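(* Fix a positive integer $k$. There is a deterministic algorithm that, given a set $Z=\{z_1,\ldots,z_n\}\subseteq\mathbb{N}$ of $n$ positive integers, targets $t_1,\ldots,t_k$ and cardinalities $c_1,\ldots,c_k$ with $\sum_i c_i\le n$, decides $k$-Subset Sum with cardinality constraints on this input in time $\tilde{O}\big(\sqrt[k+1]{n^k c^{k^2}}\; t^k\big)$, where $t=\max\{t_1,\ldots,t_k\}$ and $c=\max\{c_1,\ldots,c_k\}$.
   Context: $k$-Subset Sum with cardinality constraints: given a set $Z$ of $n$ positive integers, targets $t_1,\ldots,t_k$ and cardinalities $c_1,\ldots,c_k$, determine whether there exist pairwise disjoint subsets $Z_1,\ldots,Z_k\subseteq Z$ with $\Sigma(Z_i)=t_i$ and $|Z_i|=c_i$ for $i=1,\ldots,k$, where $\Sigma(X)=\sum_{x\in X}x$. The notation $\tilde{O}(\cdot)$ suppresses polylogarithmic factors.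
   Formalization: The time bound is Õ of the maximum of the input's bit length and the stated bound, since the stated bound alone fails when Z has many elements above t (k=t=c=1 gives √n) or when t=0 or c=0; time is logarithmic-cost RAM time. *)

theory Defs
  imports Complex_Main "HOL-Library.Disjoint_Sets"
begin

text \<open>
  The machine is the random access machine with a sequential, read-only input tape under the
  logarithmic cost criterion (Aho, Hopcroft, Ullman, The Design and Analysis of Computer
  Algorithms, Chapter 1), over natural numbers and with structured control instead of jumps.
  Every instruction is charged the bit lengths of the addresses and values it inspects.
  The lengths of register names written in the program are bounded by a constant of the program
  and are not charged.
\<close>

datatype arith_op = Plus | Minus | Times | Divide

datatype program =
    Const nat nat                \<comment> \<open>\<open>Const r v\<close>: \<open>r := v\<close>\<close>
  | Arith arith_op nat nat nat   \<comment> \<open>\<open>Arith f r p q\<close>: \<open>r := f p q\<close>\<close>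
  | Load nat nat                 \<comment> \<open>\<open>Load r p\<close>: \<open>r := mem[p]\<close>\<close>
  | Store nat nat                \<comment> \<open>\<open>Store p q\<close>: \<open>mem[p] := q\<close>\<close>
  | Read nat                     \<comment> \<open>next number of the input tape\<close>
  | Skip
  | Seq program program
  | Cond nat program program     \<comment> \<open>tests for being nonzero\<close>
  | While nat program

fun arith :: "arith_op \<Rightarrow> nat \<Rightarrow> nat \<Rightarrow> nat" where
  "arith Plus a b = a + b"
| "arith Minus a b = a - b"
| "arith Times a b = a * b"
| "arith Divide a b = a div b"

definition bit_len :: "nat \<Rightarrow> nat" where
  "bit_len v = (if v = 0 then 1 else nat \<lfloor>log 2 (real v)\<rfloor> + 1)"

type_synonym config = "(nat \<Rightarrow> nat) \<times> nat list"

text \<open>\<open>exec P s \<tau> s'\<close>: started in \<open>s\<close>, \<open>P\<close> terminates in \<open>s'\<close> at total cost \<open>\<tau>\<close>.\<close>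

inductive exec :: "program \<Rightarrow> config \<Rightarrow> nat \<Rightarrow> config \<Rightarrow> bool" where
  Const: "exec (Const r v) (m, xs) (bit_len v) (m(r := v), xs)"
| Arith: "exec (Arith f r p q) (m, xs) (bit_len (m p) + bit_len (m q))
            (m(r := arith f (m p) (m q)), xs)"
| Load: "exec (Load r p) (m, xs) (bit_len (m p) + bit_len (m (m p))) (m(r := m (m p)), xs)"
| Store: "exec (Store p q) (m, xs) (bit_len (m p) + bit_len (m q)) (m(m p := m q), xs)"
| Read: "exec (Read r) (m, x # xs) (bit_len x) (m(r := x), xs)"
| Read_end: "exec (Read r) (m, []) 1 (m(r := 0), [])"
| Skip: "exec Skip s 1 s"
| Seq: "exec P s \<tau> s' \<Longrightarrow> exec Q s' \<tau>' s'' \<Longrightarrow> exec (Seq P Q) s (\<tau> + \<tau>') s''"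
| Cond_true: "fst s r \<noteq> 0 \<Longrightarrow> exec P s \<tau> s' \<Longrightarrow> exec (Cond r P Q) s (bit_len (fst s r) + \<tau>) s'"
| Cond_false: "fst s r = 0 \<Longrightarrow> exec Q s \<tau> s' \<Longrightarrow> exec (Cond r P Q) s (bit_len (fst s r) + \<tau>) s'"
| While_false: "fst s r = 0 \<Longrightarrow> exec (While r P) s (bit_len (fst s r)) s"
| While_true: "fst s r \<noteq> 0 \<Longrightarrow> exec P s \<tau> s' \<Longrightarrow> exec (While r P) s' \<tau>' s'' \<Longrightarrow>
    exec (While r P) s (bit_len (fst s r) + \<tau> + \<tau>') s''"

inductive_cases ConstE: "exec (Const r v) s \<tau> s'"
inductive_cases ArithE: "exec (Arith f r p q) s \<tau> s'"
inductive_cases LoadE: "exec (Load r p) s \<tau> s'"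
inductive_cases StoreE: "exec (Store p q) s \<tau> s'"
inductive_cases ReadE: "exec (Read r) s \<tau> s'"
inductive_cases SkipE: "exec Skip s \<tau> s'"
inductive_cases SeqE: "exec (Seq P Q) s \<tau> s'"
inductive_cases CondE: "exec (Cond r P Q) s \<tau> s'"
inductive_cases WhileE: "exec (While r P) s \<tau> s'"

lemma exec_deterministic:
  "exec P s \<tau> s' \<Longrightarrow> exec P s \<sigma> t' \<Longrightarrow> \<sigma> = \<tau> \<and> t' = s'"
proof (induction arbitrary: \<sigma> t' rule: exec.induct)
  case (Seq P s \<tau> s' Q \<tau>' s'')
  from Seq.prems obtain \<rho> u \<rho>' where
    "exec P s \<rho> u" "exec Q u \<rho>' t'" "\<sigma> = \<rho> + \<rho>'"
    by (auto elim: SeqE)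
  with Seq.IH show ?case by blast
next
  case (Cond_true s r P \<tau> s' Q)
  from Cond_true.prems Cond_true.hyps(1) obtain \<rho> where
    "exec P s \<rho> t'" "\<sigma> = bit_len (fst s r) + \<rho>"
    by (auto elim: CondE)
  with Cond_true.IH show ?case by blast
next
  case (Cond_false s r Q \<tau> s' P)
  from Cond_false.prems Cond_false.hyps(1) obtain \<rho> where
    "exec Q s \<rho> t'" "\<sigma> = bit_len (fst s r) + \<rho>"
    by (auto elim: CondE)
  with Cond_false.IH show ?case by blast
next
  case (While_true s r P \<tau> s' \<tau>' s'')
  from While_true.prems While_true.hyps(1) obtain \<rho> u \<rho>' where
    "exec P s \<rho> u" "exec (While r P) u \<rho>' t'" "\<sigma> = bit_len (fst s r) + \<rho> + \<rho>'"
    by (auto elim: WhileE)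
  with While_true.IH show ?case by blast
next
  case (While_false s r P)
  then show ?case by (auto elim: WhileE)
qed (auto elim: ConstE ArithE LoadE StoreE ReadE SkipE)

definition decides_in_time ::
    "program \<Rightarrow> 'a set \<Rightarrow> ('a \<Rightarrow> nat list) \<Rightarrow> ('a \<Rightarrow> bool) \<Rightarrow> ('a \<Rightarrow> real) \<Rightarrow> bool" where
  "decides_in_time P A enc Q T \<longleftrightarrow>
     (\<forall>x\<in>A. \<exists>\<tau> m xs. exec P ((\<lambda>_. 0), enc x) \<tau> (m, xs) \<and> real \<tau> \<le> T x \<and>
        m 0 = (if Q x then 1 else 0))"

text \<open>\<open>g = O(f polylog f)\<close>, uniformly on \<open>A\<close>. The summand \<open>2\<close> only keeps the logarithm
  at least \<open>1\<close>.\<close>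

definition soft_O :: "'a set \<Rightarrow> ('a \<Rightarrow> real) \<Rightarrow> ('a \<Rightarrow> real) set" where
  "soft_O A f = {g. \<exists>(C::real) (d::nat). \<forall>x\<in>A. \<bar>g x\<bar> \<le> C * f x * log 2 (2 + f x) ^ d}"

text \<open>An input is \<open>(zs, ts, cs)\<close>, where \<open>zs\<close> lists the set \<open>Z\<close> without repetition in an
  arbitrary order.\<close>

type_synonym kss_input = "nat list \<times> nat list \<times> nat list"

definition kss_inputs :: "nat \<Rightarrow> kss_input set" where
  "kss_inputs k = {(zs, ts, cs). distinct zs \<and> (\<forall>z\<in>set zs. 0 < z) \<and>
     length ts = k \<and> length cs = k \<and> sum_list cs \<le> length zs}"

definition k_subset_sum_card :: "nat \<Rightarrow> kss_input \<Rightarrow> bool" where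
  "k_subset_sum_card k = (\<lambda>(zs, ts, cs). \<exists>X :: nat \<Rightarrow> nat set.
     (\<forall>i<k. X i \<subseteq> set zs \<and> \<Sum>(X i) = ts ! i \<and> card (X i) = cs ! i) \<and>
     disjoint_family_on X {..<k})"

definition kss_encode :: "kss_input \<Rightarrow> nat list" where
  "kss_encode = (\<lambda>(zs, ts, cs). length zs # ts @ cs @ zs)"

definition kss_input_size :: "kss_input \<Rightarrow> nat" where
  "kss_input_size x = sum_list (map bit_len (kss_encode x))"

definition kss_bound :: "nat \<Rightarrow> kss_input \<Rightarrow> real" where
  "kss_bound k = (\<lambda>(zs, ts, cs).
     let n = real (length zs); t = real (Max (set ts)); c = real (Max (set cs))
     in root (k + 1) (n ^ k * c ^ k\<^sup>2) * t ^ k)"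

text \<open>
  A running time includes the time for reading the input, which need not be below \<open>kss_bound\<close>
  if \<open>Z\<close> has elements exceeding every target: for \<open>k = t = c = 1\<close> the bound is \<open>sqrt n\<close>,
  while the question \<open>1 \<in> Z\<close> requires looking at all of \<open>Z\<close>. Hence the maximum below. Without such
  elements the input size is absorbed by the soft-O; see \<open>soft_O_kss_time\<close>.
\<close>

definition kss_time :: "nat \<Rightarrow> kss_input \<Rightarrow> real" where
  "kss_time k x = max (real (kss_input_size x)) (kss_bound k x)"

definition kss_core_inputs :: "nat \<Rightarrow> kss_input set" where
  "kss_core_inputs k = {(zs, ts, cs) \<in> kss_inputs k.
     (\<exists>c\<in>set cs. 0 < c) \<and> (\<forall>z\<in>set zs. z \<le> Max (set ts))}"

lemma kss_bound_ge:
  assumes "0 < k" "(zs, ts, cs) \<in> kss_core_inputs k"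
  shows "real (Max (set ts)) \<le> kss_bound k (zs, ts, cs)"
    and "length zs \<le> Max (set ts)" and "0 < length zs"
proof -
  define n t c where d: "n = length zs" "t = Max (set ts)" "c = Max (set cs)"
  from assms have A: "distinct zs" "\<forall>z\<in>set zs. 0 < z" "\<forall>z\<in>set zs. z \<le> t"
      "length cs = k" "sum_list cs \<le> n" "\<exists>c\<in>set cs. 0 < c"
    by (auto simp: kss_core_inputs_def kss_inputs_def d)
  then obtain c' where c': "c' \<in> set cs" "0 < c'" by blast
  then have c1: "1 \<le> c" unfolding d using Max_ge[OF finite_set c'(1)] by linarith
  have n1: "1 \<le> n" using c' A(5) member_le_sum_list[of c' cs] by linarith
  then show "0 < length zs" unfolding d by linarith
  have "n = card (set zs)" using A(1) by (simp add: d distinct_card)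
  also have "\<dots> \<le> card {1..t}" using A(2,3) by (intro card_mono) (auto simp: Suc_le_eq)
  finally have nt: "n \<le> t" by simp
  then show "length zs \<le> Max (set ts)" by (simp add: d)
  have "1 * 1 \<le> real n ^ k * real c ^ k\<^sup>2"
    using n1 c1 by (intro mult_mono one_le_power) auto
  then have r: "1 \<le> root (k + 1) (real n ^ k * real c ^ k\<^sup>2)" by simp
  have "real t \<le> real t ^ k" using n1 nt assms(1) by (intro self_le_power) auto
  also have "\<dots> \<le> root (k + 1) (real n ^ k * real c ^ k\<^sup>2) * real t ^ k"
    using mult_right_mono[OF r, of "real t ^ k"] by simp
  finally show "real (Max (set ts)) \<le> kss_bound k (zs, ts, cs)"
    by (simp add: kss_bound_def d Let_def)
qed

lemma kss_input_size_le:
  assumes "0 < k" "x \<in> kss_core_inputs k"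
  shows "real (kss_input_size x) \<le> 4 * (real k + 1) * kss_bound k x * log 2 (2 + kss_bound k x)"
    and "1 \<le> kss_bound k x"
proof -
  obtain zs ts cs where x: "x = (zs, ts, cs)" by (cases x)
  define B where "B = kss_bound k x"
  note ge = kss_bound_ge[OF assms(1), of zs ts cs, folded x B_def, OF assms(2)]
  from assms have A: "length ts = k" "length cs = k" "sum_list cs \<le> length zs"
     "\<forall>z\<in>set zs. z \<le> Max (set ts)"
    by (auto simp: kss_core_inputs_def kss_inputs_def x)
  have B1: "1 \<le> B" using ge by linarith
  then show "1 \<le> kss_bound k x" by (simp add: B_def)
  have L1: "1 \<le> log 2 (2 + B)" using B1 by simp
  have bl: "real (bit_len v) \<le> 2 * log 2 (2 + B)" if "real v \<le> B" for v
  proof (cases "v = 0")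
    case True then show ?thesis using L1 by (simp add: bit_len_def)
  next
    case False
    then have l0: "0 \<le> log 2 (real v)" by simp
    have "real (bit_len v) \<le> log 2 (real v) + 1"
      using False l0 by (simp add: bit_len_def)
    also have "log 2 (real v) \<le> log 2 (2 + B)" using False that by simp
    finally show ?thesis using L1 by linarith
  qed
  have v: "real v \<le> B" if "v \<in> set (kss_encode x)" for v
  proof -
    have "v \<le> Max (set ts)" 
      using that A ge(2) member_le_sum_list[of v cs] by (auto simp: kss_encode_def x)
    then show ?thesis using ge(1) by linarith
  qed
  have "real (kss_input_size x) = (\<Sum>v\<leftarrow>kss_encode x. real (bit_len v))"
  proof -
    have "real (sum_list (map bit_len ys)) = (\<Sum>v\<leftarrow>ys. real (bit_len v))" for ys
      by (induction ys) simp_all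
    then show ?thesis by (simp add: kss_input_size_def)
  qed
  also have "\<dots> \<le> (\<Sum>v\<leftarrow>kss_encode x. 2 * log 2 (2 + B))"
    by (intro sum_list_mono bl v)
  also have "\<dots> = real (2 * k + 1 + length zs) * (2 * log 2 (2 + B))"
    using A by (simp add: sum_list_triv kss_encode_def x algebra_simps)
  also have "\<dots> \<le> (2 * (real k + 1) * B) * (2 * log 2 (2 + B))"
  proof (rule mult_right_mono)
    have "real (length zs) \<le> B" using ge by linarith
    moreover have "real (2 * k + 1) * 1 \<le> real (2 * k + 1) * B" using B1 by (intro mult_left_mono) auto
    ultimately show "real (2 * k + 1 + length zs) \<le> 2 * (real k + 1) * B" by (simp add: algebra_simps)
  qed (use L1 in simp)
  also have "\<dots> = 4 * (real k + 1) * B * log 2 (2 + B)" by (simp add: algebra_simps)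
  finally show "real (kss_input_size x) \<le> 4 * (real k + 1) * kss_bound k x * log 2 (2 + kss_bound k x)"
    by (simp only: B_def)
qed

lemma soft_O_kss_time:
  assumes "0 < k" "T \<in> soft_O (kss_inputs k) (kss_time k)"
  shows "T \<in> soft_O (kss_core_inputs k) (kss_bound k)"
proof -
  from assms(2) obtain C d where C: "\<And>x. x \<in> kss_inputs k \<Longrightarrow>
      \<bar>T x\<bar> \<le> C * kss_time k x * log 2 (2 + kss_time k x) ^ d"
    by (auto simp: soft_O_def)
  define K where "K = 4 * (real k + 1)"
  define E where "E = \<bar>C\<bar> * K * (log 2 K + 3) ^ d"
  have K1: "4 \<le> K" by (simp add: K_def)
  have "\<bar>T x\<bar> \<le> E * kss_bound k x * log 2 (2 + kss_bound k x) ^ (d + 1)"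
    if x: "x \<in> kss_core_inputs k" for x
  proof -
    define B L M where d: "B = kss_bound k x" "L = log 2 (2 + B)" "M = kss_time k x"
    have B1: "1 \<le> B" using kss_input_size_le(2)[OF assms(1) x] by (simp add: d)
    have L1: "1 \<le> L" using B1 by (simp add: d)
    have s: "real (kss_input_size x) \<le> K * B * L"
      using kss_input_size_le(1)[OF assms(1) x] by (simp add: d K_def)
    have "1 * B * 1 \<le> K * B * L" using K1 B1 L1 by (intro mult_mono) auto
    with s have M: "M \<le> K * B * L" unfolding d(3) kss_time_def by (simp add: d)
    have M1: "1 \<le> M" using B1 by (simp add: d kss_time_def)
    have LB: "L \<le> 2 * (2 + B)"
    proof -
      have "ln (1 / 2) \<le> 1 / 2 - (1 :: real)" by (rule ln_le_minus_one) simp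
      then have ln2: "1 / 2 \<le> ln (2 :: real)" by (simp add: ln_div)
      have "ln (2 + B) \<le> 2 + B" using ln_le_minus_one[of "2 + B"] B1 by simp
      also have "\<dots> \<le> 2 * (2 + B) * ln 2"
      proof -
        have "2 * (2 + B) * (1 / 2) \<le> 2 * (2 + B) * ln 2"
          using B1 by (intro mult_left_mono ln2) auto
        then show ?thesis by simp
      qed
      finally show ?thesis by (simp add: d log_def divide_le_eq)
    qed
    have "2 + M \<le> 2 * K * (2 + B) * (2 + B)"
    proof -
      have "M \<le> K * B * (2 * (2 + B))"
        using M mult_left_mono[OF LB, of "K * B"] K1 B1 by (auto intro: order_trans)
      moreover have "2 \<le> 4 * K * (2 + B)"
      proof -
        have "4 * 4 * 1 \<le> 4 * K * (2 + B)" using K1 B1 by (intro mult_mono) auto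
        then show ?thesis by simp
      qed
      ultimately show ?thesis by (simp add: algebra_simps)
    qed
    then have "log 2 (2 + M) \<le> log 2 (2 * K * (2 + B) * (2 + B))"
      using M1 K1 B1 by simp
    also have "\<dots> = log 2 K + 1 + 2 * L" using K1 B1 by (simp add: log_mult d)
    also have "\<dots> \<le> (log 2 K + 3) * L"
    proof -
      have "log 2 K * 1 \<le> log 2 K * L" using K1 L1 by (intro mult_left_mono) auto
      then show ?thesis using L1 by (simp add: algebra_simps)
    qed
    finally have lM: "log 2 (2 + M) \<le> (log 2 K + 3) * L" .
    have l0: "0 \<le> log 2 (2 + M)" using M1 by simp
    have "\<bar>T x\<bar> \<le> C * M * log 2 (2 + M) ^ d"
      using C[of x] x by (auto simp: kss_core_inputs_def d)
    also have "\<dots> \<le> \<bar>C\<bar> * M * log 2 (2 + M) ^ d"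
      using M1 l0 by (intro mult_right_mono) auto
    also have "\<dots> \<le> \<bar>C\<bar> * (K * B * L) * ((log 2 K + 3) * L) ^ d"
      using M M1 l0 lM K1 B1 L1 by (intro mult_mono power_mono mult_left_mono) auto
    also have "\<dots> = E * B * L ^ (d + 1)" by (simp add: E_def power_mult_distrib)
    finally show ?thesis by (simp add: d)
  qed
  then show ?thesis unfolding soft_O_def by blast
qed

end

theory Submission
  imports Defs
begin

text \<open>
  For a set \<open>Y\<close> of items, record all tuples of cardinalities and sums of \<open>k\<close> disjoint subsets that stay
  below the bounds \<open>c\<close> and \<open>t\<close>. A tuple is coded as one number in a mixed radix, and a set of codes as the
  number whose digits in a large base \<open>\<beta>\<close> are its characteristic function. The radices leave room
  for one addition, so the table of a disjoint union is the product of the two numbers, truncated to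
  the admissible codes. Since the machine multiplies and divides at cost linear in the bit lengths,
  this Kronecker substitution replaces the fast Fourier transform; truncation has to inspect
  the digits, which are obtained by divide and conquer.

  The items are split into \<open>l\<close> residue classes modulo \<open>l\<close>. In the class of \<open>r\<close> write an item as \<open>r + l * y\<close>
  with \<open>y \<le> t div l\<close>: the sums of the \<open>y\<close> are \<open>l\<close> times smaller, and cardinality \<open>j\<close> and sum \<open>s\<close> of the \<open>y\<close>
  determine the original sum \<open>l * s + r * j\<close>. Within a class, tables are merged pairwise along a
  binary tree; because the last cardinality is the most significant digit of a code, a table for
  \<open>m\<close> items has only about \<open>m * (t / l) ^ k * c ^ (k - 1)\<close> digits. The tables of the classes are then
  multiplied one after the other with \<open>(t * c) ^ k\<close> digits each. If \<open>l\<close> is least with \<open>n \<le> l\<^sup>2 * c\<close>, both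
  phases take time about \<open>l * (t * c) ^ k\<close>, and \<open>l \<le> 2 * sqrt (n / c)\<close> is at most
  \<open>2 * (n / c) powr (k / (k + 1))\<close>.
\<close>

section \<open>Bit lengths\<close>

text \<open>The cost criterion is the obstacle: each operation is charged the lengths of its
  operands, so a time bound needs a length bound on every intermediate value. Two scales are kept
  apart. Counters, codes and addresses stay below a number \<open>U\<close>, polynomial in
  \<open>t\<close>, \<open>c\<close> and the number of items; its length gives
  \<open>\<kappa>\<close>, which is logarithmic in the claimed bound. A table with \<open>h\<close>
  digits is a number of length at most \<open>h * \<kappa>\<close>, and only the few operations on
  whole tables are charged at such a larger scale \<open>\<mu>\<close>. Hence the time is a count of
  digits times a power of \<open>\<kappa>\<close>: one factor for a digit, one for the levels of
  splitting or packing a number, one for the levels of merging a class. Items are counted only if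
  they do not exceed \<open>t\<close>, since larger ones lie in no solution. So their number, and
  with it the number \<open>l\<close> of classes, is at most \<open>t\<close>; this is used to bound
  the recoded sums. The large numerical constants in the time bounds are generous roundings.\<close>

lemma bit_len_pos [simp]: "0 < bit_len v"
  by (simp add: bit_len_def)

text \<open>Replaces logarithms by powers of two in most later estimates of lengths.
  \<open>b = 0\<close> must be excluded: the number 0 is below \<open>2 ^ 0\<close> but has length
  1.\<close>

lemma bit_len_le_iff:
  assumes "0 < b"
  shows "bit_len v \<le> b \<longleftrightarrow> v < 2 ^ b"
proof (cases "v = 0")
  case True
  then show ?thesis using assms by (simp add: bit_len_def)
next
  case False
  then have l0: "0 \<le> log 2 (real v)" by simp
  have "bit_len v \<le> b \<longleftrightarrow> \<lfloor>log 2 (real v)\<rfloor> < int b"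
    using False l0 zero_le_floor[of "log 2 (real v)"] by (simp add: bit_len_def del: zero_le_floor) linarith
  also have "\<dots> \<longleftrightarrow> log 2 (real v) < real b" by (simp add: floor_less_iff)
  also have "\<dots> \<longleftrightarrow> real v < 2 powr real b" using False by (simp add: log_less_iff)
  also have "\<dots> \<longleftrightarrow> real v < real (2 ^ b)" by (simp add: powr_realpow)
  also have "\<dots> \<longleftrightarrow> v < 2 ^ b" by (simp only: of_nat_less_iff)
  finally show ?thesis .
qed

lemma less_two_power_bit_len: "v < 2 ^ bit_len v"
  using bit_len_le_iff[of "bit_len v" v] by simp

lemma bit_len_mono: "a \<le> b \<Longrightarrow> bit_len a \<le> bit_len b"
  using bit_len_le_iff[of "bit_len b" a] less_two_power_bit_len[of b] by simp

lemma bit_len_mult: "bit_len (a * b) \<le> bit_len a + bit_len b"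
proof -
  have "a * b < 2 ^ bit_len a * 2 ^ bit_len b"
    by (intro mult_strict_mono less_two_power_bit_len) auto
  then show ?thesis by (simp add: bit_len_le_iff power_add)
qed

text \<open>Converts digit counts into charges: applied to the base of the tables, it bounds the
  length of a whole table by its number of digits times the length of the base.\<close>

lemma bit_len_less_power:
  assumes "v < b ^ a" "0 < a"
  shows "bit_len v \<le> a * bit_len b"
proof -
  have "b ^ a \<le> (2 ^ bit_len b) ^ a"
    using less_two_power_bit_len[of b] by (intro power_mono) auto
  also have "\<dots> = 2 ^ (a * bit_len b)" by (metis power_mult mult.commute)
  finally have "v < 2 ^ (a * bit_len b)" using assms(1) by linarith
  moreover have "0 < a * bit_len b" using assms(2) by simp
  ultimately show ?thesis by (subst bit_len_le_iff)
qed

lemma bit_len_le_self: "0 < v \<Longrightarrow> bit_len v \<le> v"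
  by (simp add: bit_len_le_iff)

section \<open>Registers and arrays\<close>

text \<open>
  \<open>TM\<close> and \<open>CM\<close> hold the largest target and cardinality, \<open>NP\<close> the number of items not exceeding \<open>TM\<close>,
  \<open>LL\<close> the number of residue classes, \<open>R\<close> the current class, \<open>SM\<close> the bound on sums within a class, \<open>B\<close> the
  base \<open>\<beta>\<close>, \<open>G\<close> the table of the classes treated so far, and \<open>Z\<close> the argument and result of
  truncation and packing. The arrays hold the targets, the cardinalities, the set of items, the
  tables of a class, the powers \<open>\<beta> ^ 2 ^ q\<close>, unpacked digits, and digits to be packed.
  Only the register \<open>Ans\<close> has a prescribed address.
\<close>

datatype var = Ans | NN | TM | CM | NP | LL | SM | RC | B | G | R | NR | YV | ST | II | Z
  | PS | PL | PR | PT | RS | RT | Q | N | S | I | P | E | X | Y | M | J | BAD | SS | CC | S2 | MX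

datatype arr = Tgt | Crd | Pres | Tab | Pow | Fld | Out

primrec var_num :: "var \<Rightarrow> nat" where
  "var_num Ans = 0" | "var_num NN = 1" | "var_num TM = 2" | "var_num CM = 3" | "var_num NP = 4"
| "var_num LL = 5" | "var_num SM = 6" | "var_num RC = 7" | "var_num B = 8" | "var_num G = 9"
| "var_num R = 10" | "var_num NR = 11" | "var_num YV = 12" | "var_num ST = 13" | "var_num II = 14"
| "var_num Z = 15" | "var_num PS = 16" | "var_num PL = 17" | "var_num PR = 18" | "var_num PT = 19"
| "var_num RS = 20" | "var_num RT = 21" | "var_num Q = 22" | "var_num N = 23" | "var_num S = 24"
| "var_num I = 25" | "var_num P = 26" | "var_num E = 27" | "var_num X = 28" | "var_num Y = 29"
| "var_num M = 30" | "var_num J = 31" | "var_num BAD = 32" | "var_num SS = 33" | "var_num CC = 34"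
| "var_num S2 = 35" | "var_num MX = 36"

primrec arr_num :: "arr \<Rightarrow> nat" where
  "arr_num Tgt = 0" | "arr_num Crd = 1" | "arr_num Pres = 2" | "arr_num Tab = 3"
| "arr_num Pow = 4" | "arr_num Fld = 5" | "arr_num Out = 6"

text \<open>Residues modulo 3 separate variables, scratch cells and array cells. The stride 24 is a
  multiple of 3 beyond the largest of the seven offsets 2, 5, ..., 20, so an array cell is reached
  by one multiplication and one addition, and the arrays are unbounded.
  \<open>var_num Ans = 0\<close> puts the answer into cell 0.\<close>

definition var_reg :: "var \<Rightarrow> nat" where "var_reg x = 3 * var_num x"
definition tmp_reg :: "nat \<Rightarrow> nat" where "tmp_reg d = 3 * d + 1"
definition addr :: "arr \<Rightarrow> nat \<Rightarrow> nat" where "addr a i = i * 24 + (3 * arr_num a + 2)"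

lemma var_num_inj: "var_num x = var_num y \<longleftrightarrow> x = y"
  by (cases x; simp; cases y; simp)

lemma var_reg_simps [simp]:
  "var_reg x = var_reg y \<longleftrightarrow> x = y" "tmp_reg i = tmp_reg j \<longleftrightarrow> i = j"
  "var_reg x \<noteq> tmp_reg j" "tmp_reg j \<noteq> var_reg x"
  by (simp_all add: var_reg_def tmp_reg_def var_num_inj) presburger+

lemma addr_neq [simp]:
  "addr a i \<noteq> var_reg x" "addr a i \<noteq> tmp_reg j" "var_reg x \<noteq> addr a i" "tmp_reg j \<noteq> addr a i"
  by (simp_all add: addr_def var_reg_def tmp_reg_def) presburger+

lemma addr_eq_iff [simp]: "addr a i = addr b j \<longleftrightarrow> a = b \<and> i = j"
proof
  assume *: "addr a i = addr b j"
  have lt: "arr_num a < 7" "arr_num b < 7" by (cases a; simp) (cases b; simp)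
  have "i = j \<and> arr_num a = arr_num b"
    using * lt by (cases i j rule: linorder_cases) (auto simp: addr_def)
  moreover have "arr_num a = arr_num b \<Longrightarrow> a = b" by (cases a; simp; cases b; simp)
  ultimately show "a = b \<and> i = j" by simp
qed simp

datatype expr = C nat | V var | A arr expr | Op arith_op expr expr

abbreviation plus_expr (infixl "\<oplus>" 65) where "a \<oplus> b \<equiv> Op Plus a b"
abbreviation minus_expr (infixl "\<ominus>" 65) where "a \<ominus> b \<equiv> Op Minus a b"
abbreviation times_expr (infixl "\<otimes>" 70) where "a \<otimes> b \<equiv> Op Times a b"
abbreviation div_expr (infixl "\<oslash>" 70) where "a \<oslash> b \<equiv> Op Divide a b"

type_synonym vars = "var \<Rightarrow> nat"
type_synonym arrs = "arr \<Rightarrow> nat \<Rightarrow> nat"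

primrec ev :: "expr \<Rightarrow> vars \<Rightarrow> arrs \<Rightarrow> nat" where
  "ev (C v) \<rho> \<alpha> = v"
| "ev (V x) \<rho> \<alpha> = \<rho> x"
| "ev (A a e) \<rho> \<alpha> = \<alpha> a (ev e \<rho> \<alpha>)"
| "ev (Op f d e) \<rho> \<alpha> = arith f (ev d \<rho> \<alpha>) (ev e \<rho> \<alpha>)"

definition short :: "nat \<Rightarrow> nat \<Rightarrow> bool" where "short \<kappa> v \<longleftrightarrow> bit_len v \<le> \<kappa>"

text \<open>An array cell \<open>i\<close> resides at an address below \<open>32 * (i + 1)\<close>, which
  costs at most 5 more bits than \<open>i + 1\<close>.\<close>

primrec ebd :: "nat \<Rightarrow> expr \<Rightarrow> vars \<Rightarrow> arrs \<Rightarrow> bool" where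
  "ebd \<kappa> (C v) \<rho> \<alpha> \<longleftrightarrow> short \<kappa> v"
| "ebd \<kappa> (V x) \<rho> \<alpha> \<longleftrightarrow> short \<kappa> (\<rho> x)"
| "ebd \<kappa> (A a e) \<rho> \<alpha> \<longleftrightarrow>
     ebd \<kappa> e \<rho> \<alpha> \<and> short (\<kappa> - 5) (ev e \<rho> \<alpha>) \<and> short \<kappa> (\<alpha> a (ev e \<rho> \<alpha>))"
| "ebd \<kappa> (Op f d e) \<rho> \<alpha> \<longleftrightarrow>
     ebd \<kappa> d \<rho> \<alpha> \<and> ebd \<kappa> e \<rho> \<alpha> \<and> short \<kappa> (arith f (ev d \<rho> \<alpha>) (ev e \<rho> \<alpha>))"

text \<open>Upper bound on the evaluation cost in units of \<open>\<kappa>\<close>. A variable takes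
  3 units because copying goes through an addition; an array access takes 6 units to form the
  address and 2 for the load.\<close>

primrec esize :: "expr \<Rightarrow> nat" where
  "esize (C v) = 1"
| "esize (V x) = 3"
| "esize (A a e) = esize e + 9"
| "esize (Op f d e) = esize d + esize e + 2"

definition to_addr :: "nat \<Rightarrow> arr \<Rightarrow> program" where
  "to_addr d a =
     Seq (Const (tmp_reg (d + 1)) 24)
    (Seq (Arith Times (tmp_reg d) (tmp_reg d) (tmp_reg (d + 1)))
    (Seq (Const (tmp_reg (d + 1)) (3 * arr_num a + 2))
         (Arith Plus (tmp_reg d) (tmp_reg d) (tmp_reg (d + 1)))))"

text \<open>The machine has no move instruction, hence an addition to 0. Source and target must
  differ, since the target is cleared first.\<close>

definition copy :: "nat \<Rightarrow> nat \<Rightarrow> program" where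
  "copy r p = Seq (Const r 0) (Arith Plus r p r)"

text \<open>\<open>d\<close> acts as a stack pointer fixed at compile time: the result goes to
  scratch cell \<open>d\<close>, and while a second operand is evaluated at depth
  \<open>d + 1\<close> the first one waits in cell \<open>d\<close>.\<close>

primrec comp_expr :: "nat \<Rightarrow> expr \<Rightarrow> program" where
  "comp_expr d (C v) = Const (tmp_reg d) v"
| "comp_expr d (V x) = copy (tmp_reg d) (var_reg x)"
| "comp_expr d (A a e) =
     Seq (comp_expr d e) (Seq (to_addr d a) (Load (tmp_reg d) (tmp_reg d)))"
| "comp_expr d (Op f e1 e2) =
     Seq (comp_expr d e1) (Seq (comp_expr (Suc d) e2)
       (Arith f (tmp_reg d) (tmp_reg d) (tmp_reg (Suc d))))"

definition rep :: "(nat \<Rightarrow> nat) \<Rightarrow> vars \<Rightarrow> arrs \<Rightarrow> bool" where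
  "rep m \<rho> \<alpha> \<longleftrightarrow> (\<forall>x. m (var_reg x) = \<rho> x) \<and> (\<forall>a i. m (addr a i) = \<alpha> a i)"

lemma rep_tmp [simp]: "rep (m(tmp_reg d := v)) \<rho> \<alpha> \<longleftrightarrow> rep m \<rho> \<alpha>"
  by (simp add: rep_def)

lemma rep_var: "rep m \<rho> \<alpha> \<Longrightarrow> rep (m(var_reg x := v)) (\<rho>(x := v)) \<alpha>"
  by (simp add: rep_def)

lemma rep_arr: "rep m \<rho> \<alpha> \<Longrightarrow> rep (m(addr a i := v)) \<rho> (\<alpha>(a := (\<alpha> a)(i := v)))"
  by (auto simp: rep_def)

lemma short_mono: "short \<kappa> v \<Longrightarrow> \<kappa> \<le> \<mu> \<Longrightarrow> short \<mu> v"
  by (simp add: short_def)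

lemma short_le: "short \<kappa> v \<Longrightarrow> u \<le> v \<Longrightarrow> short \<kappa> u"
  unfolding short_def using bit_len_mono le_trans by blast

lemma ebd_short: "ebd \<kappa> e \<rho> \<alpha> \<Longrightarrow> short \<kappa> (ev e \<rho> \<alpha>)"
  by (cases e) auto

lemma bit_len_addr:
  assumes "short (\<kappa> - 5) i" "6 \<le> \<kappa>"
  shows "bit_len (i * 24) \<le> \<kappa>" "bit_len (addr a i) \<le> \<kappa>"
proof -
  have "i < 2 ^ (\<kappa> - 5)" using assms by (simp add: short_def bit_len_le_iff)
  then have "i + 1 \<le> 2 ^ (\<kappa> - 5)" by simp
  then have "(i + 1) * 2 ^ 5 \<le> 2 ^ (\<kappa> - 5) * 2 ^ 5" by (rule mult_right_mono) simp
  also have "\<dots> = 2 ^ (\<kappa> - 5 + 5)" by (simp only: power_add)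
  finally have *: "(i + 1) * 32 \<le> 2 ^ \<kappa>" using assms(2) by simp
  have "arr_num a < 7" by (cases a) simp_all
  then have "addr a i < (i + 1) * 32" by (simp add: addr_def)
  with * show "bit_len (addr a i) \<le> \<kappa>" using assms(2) by (simp add: bit_len_le_iff)
  have "i * 24 < (i + 1) * 32" by simp
  with * have "i * 24 < 2 ^ \<kappa>" by linarith
  then show "bit_len (i * 24) \<le> \<kappa>" using assms(2) by (simp add: bit_len_le_iff)
qed

lemma bit_len_0 [simp]: "bit_len 0 = 1"
  by (simp add: bit_len_def)

lemma bit_len_offset: "bit_len 24 \<le> 5" "bit_len (3 * arr_num a + 2) \<le> 5"
  by (cases a; simp add: bit_len_le_iff)+

lemma exec_eq: "exec c s t u \<Longrightarrow> t = t' \<Longrightarrow> u = u' \<Longrightarrow> exec c s t' u'"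
  by simp

lemma exec_to_addr:
  assumes "6 \<le> \<kappa>" "short (\<kappa> - 5) (m (tmp_reg d))"
  shows "\<exists>t. exec (to_addr d a) (m, xs) t
     (m(tmp_reg (Suc d) := 3 * arr_num a + 2, tmp_reg d := addr a (m (tmp_reg d))), xs) \<and> t \<le> 6 * \<kappa>"
proof -
  define i where "i = m (tmp_reg d)"
  define k where "k = 3 * arr_num a + 2"
  have "exec (to_addr d a) (m, xs)
     (bit_len 24 + ((bit_len i + bit_len 24) + (bit_len k + (bit_len (i * 24) + bit_len k))))
     (m(tmp_reg (Suc d) := k, tmp_reg d := addr a i), xs)"
    unfolding to_addr_def i_def k_def
    by (rule exec_eq, (rule exec.Seq exec.Const exec.Arith)+) (simp_all add: addr_def fun_eq_iff)
  moreover have "bit_len 24 + ((bit_len i + bit_len 24) + (bit_len k + (bit_len (i * 24) + bit_len k)))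
    \<le> 6 * \<kappa>"
  proof -
    have "bit_len i \<le> \<kappa> - 5" using assms(2) by (simp add: short_def i_def)
    moreover have "bit_len (i * 24) \<le> \<kappa>" using bit_len_addr(1)[OF assms(2,1)] by (simp add: i_def)
    moreover have "bit_len k \<le> 5" using bit_len_offset(2) by (simp add: k_def)
    moreover have "bit_len 24 \<le> 5" by (rule bit_len_offset)
    ultimately show ?thesis using assms(1) by linarith
  qed
  ultimately show ?thesis unfolding i_def k_def by (intro exI conjI)
qed

lemma exec_copy:
  assumes "r \<noteq> p"
  shows "exec (copy r p) (m, xs) (2 + bit_len (m p)) (m(r := m p), xs)"
  unfolding copy_def
  by (rule exec_eq, (rule exec.Seq exec.Const exec.Arith)+) (use assms in \<open>simp_all add: fun_eq_iff\<close>)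

text \<open>The clause on the cells below \<open>d\<close> carries the induction: the first operand
  survives the evaluation of the second. The charge is uniform because \<open>ebd\<close> keeps all
  intermediate values at length at most \<open>\<kappa>\<close>.\<close>

lemma exec_comp_expr:
  assumes "6 \<le> \<kappa>" "rep m \<rho> \<alpha>" "ebd \<kappa> e \<rho> \<alpha>"
  shows "\<exists>t m'. exec (comp_expr d e) (m, xs) t (m', xs) \<and> t \<le> esize e * \<kappa> \<and> rep m' \<rho> \<alpha> \<and>
    m' (tmp_reg d) = ev e \<rho> \<alpha> \<and> (\<forall>j<d. m' (tmp_reg j) = m (tmp_reg j))"
  using assms(2-)
proof (induction e arbitrary: d m)
  case (C v)
  have "exec (comp_expr d (C v)) (m, xs) (bit_len v) (m(tmp_reg d := v), xs)"
    by (simp add: exec.Const)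
  moreover have "bit_len v \<le> esize (C v) * \<kappa>" using C by (simp add: short_def)
  moreover have "rep (m(tmp_reg d := v)) \<rho> \<alpha>" using C(1) by simp
  moreover have "(m(tmp_reg d := v)) (tmp_reg d) = ev (C v) \<rho> \<alpha>"
    "\<forall>j<d. (m(tmp_reg d := v)) (tmp_reg j) = m (tmp_reg j)" by simp_all
  ultimately show ?case by blast
next
  case (V x)
  have "exec (comp_expr d (V x)) (m, xs) (2 + bit_len (m (var_reg x))) (m(tmp_reg d := m (var_reg x)), xs)"
    using exec_copy[of "tmp_reg d" "var_reg x" m xs] by simp
  moreover have "m (var_reg x) = \<rho> x" "bit_len (\<rho> x) \<le> \<kappa>" using V by (simp_all add: rep_def short_def)
  then have "2 + bit_len (m (var_reg x)) \<le> esize (V x) * \<kappa>"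
    "(m(tmp_reg d := m (var_reg x))) (tmp_reg d) = ev (V x) \<rho> \<alpha>"
    using assms(1) by simp_all
  moreover have "rep (m(tmp_reg d := m (var_reg x))) \<rho> \<alpha>" using V(1) by simp
  moreover have "\<forall>j<d. (m(tmp_reg d := m (var_reg x))) (tmp_reg j) = m (tmp_reg j)" by simp
  ultimately show ?case by blast
next
  case (A a e)
  have p: "ebd \<kappa> e \<rho> \<alpha>" "short (\<kappa> - 5) (ev e \<rho> \<alpha>)" "short \<kappa> (\<alpha> a (ev e \<rho> \<alpha>))"
    using A.prems(2) by simp_all
  from A.IH[OF A.prems(1) p(1), of d] obtain t m1 where 1: "exec (comp_expr d e) (m, xs) t (m1, xs)"
    "t \<le> esize e * \<kappa>" "rep m1 \<rho> \<alpha>" "m1 (tmp_reg d) = ev e \<rho> \<alpha>"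
    "\<forall>j<d. m1 (tmp_reg j) = m (tmp_reg j)"
    by blast
  let ?m2 = "m1(tmp_reg (Suc d) := 3 * arr_num a + 2, tmp_reg d := addr a (ev e \<rho> \<alpha>))"
  let ?v = "\<alpha> a (ev e \<rho> \<alpha>)"
  obtain t' where 2: "exec (to_addr d a) (m1, xs) t' (?m2, xs)" "t' \<le> 6 * \<kappa>"
    using exec_to_addr[OF assms(1), of m1 d a xs] p(2) unfolding 1(4) by blast
  have "?m2 (tmp_reg d) = addr a (ev e \<rho> \<alpha>)" "?m2 (addr a (ev e \<rho> \<alpha>)) = ?v"
    using 1(3) by (simp_all add: rep_def)
  with exec.Load[of "tmp_reg d" "tmp_reg d" ?m2 xs]
  have 3: "exec (Load (tmp_reg d) (tmp_reg d)) (?m2, xs)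
     (bit_len (addr a (ev e \<rho> \<alpha>)) + bit_len ?v) (?m2(tmp_reg d := ?v), xs)"
    by simp
  have "exec (comp_expr d (A a e)) (m, xs) (t + (t' + (bit_len (addr a (ev e \<rho> \<alpha>)) + bit_len ?v)))
      (?m2(tmp_reg d := ?v), xs)"
    using exec.Seq[OF 1(1) exec.Seq[OF 2(1) 3]] by simp
  moreover have "t + (t' + (bit_len (addr a (ev e \<rho> \<alpha>)) + bit_len ?v)) \<le> esize (A a e) * \<kappa>"
  proof -
    have "bit_len (addr a (ev e \<rho> \<alpha>)) \<le> \<kappa>" by (rule bit_len_addr(2)[OF p(2) assms(1)])
    then show ?thesis using p(3) 1(2) 2(2) by (simp add: short_def add_mult_distrib)
  qed
  moreover have "rep (?m2(tmp_reg d := ?v)) \<rho> \<alpha>" using 1(3) by simp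
  moreover have "\<forall>j<d. (?m2(tmp_reg d := ?v)) (tmp_reg j) = m (tmp_reg j)" using 1(5) by simp
  moreover have "(?m2(tmp_reg d := ?v)) (tmp_reg d) = ev (A a e) \<rho> \<alpha>" by simp
  ultimately show ?case by blast
next
  case (Op f e1 e2)
  have p: "ebd \<kappa> e1 \<rho> \<alpha>" "ebd \<kappa> e2 \<rho> \<alpha>" using Op.prems(2) by simp_all
  from Op.IH(1)[OF Op.prems(1) p(1), of d] obtain t m1 where 1:
    "exec (comp_expr d e1) (m, xs) t (m1, xs)" "t \<le> esize e1 * \<kappa>"
    "rep m1 \<rho> \<alpha>" "m1 (tmp_reg d) = ev e1 \<rho> \<alpha>" "\<forall>j<d. m1 (tmp_reg j) = m (tmp_reg j)"
    by blast
  from Op.IH(2)[OF 1(3) p(2), of "Suc d"] obtain t' m2 where 2: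
    "exec (comp_expr (Suc d) e2) (m1, xs) t' (m2, xs)"
    "t' \<le> esize e2 * \<kappa>" "rep m2 \<rho> \<alpha>" "m2 (tmp_reg (Suc d)) = ev e2 \<rho> \<alpha>"
    "\<forall>j<Suc d. m2 (tmp_reg j) = m1 (tmp_reg j)"
    by blast
  let ?v = "ev (Op f e1 e2) \<rho> \<alpha>"
  have v: "m2 (tmp_reg d) = ev e1 \<rho> \<alpha>" using 1(4) 2(5) by simp
  have 3: "exec (Arith f (tmp_reg d) (tmp_reg d) (tmp_reg (Suc d))) (m2, xs)
     (bit_len (ev e1 \<rho> \<alpha>) + bit_len (ev e2 \<rho> \<alpha>)) (m2(tmp_reg d := ?v), xs)"
    using exec.Arith[of f "tmp_reg d" "tmp_reg d" "tmp_reg (Suc d)" m2 xs] v 2(4) by simp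
  have "exec (comp_expr d (Op f e1 e2)) (m, xs) (t + (t' + (bit_len (ev e1 \<rho> \<alpha>) + bit_len (ev e2 \<rho> \<alpha>))))
      (m2(tmp_reg d := ?v), xs)"
    using exec.Seq[OF 1(1) exec.Seq[OF 2(1) 3]] by simp
  moreover have "t + (t' + (bit_len (ev e1 \<rho> \<alpha>) + bit_len (ev e2 \<rho> \<alpha>))) \<le> esize (Op f e1 e2) * \<kappa>"
    using ebd_short[OF p(1)] ebd_short[OF p(2)] 1(2) 2(2) by (simp add: short_def add_mult_distrib)
  moreover have "rep (m2(tmp_reg d := ?v)) \<rho> \<alpha>" using 2(3) by simp
  moreover have "\<forall>j<d. (m2(tmp_reg d := ?v)) (tmp_reg j) = m (tmp_reg j)" using 1(5) 2(5) by simp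
  moreover have "(m2(tmp_reg d := ?v)) (tmp_reg d) = ev (Op f e1 e2) \<rho> \<alpha>" by simp
  ultimately show ?case by blast
qed

section \<open>Commands and their compilation\<close>

datatype cmd =
    Asg var expr (infix "::=" 55)
  | Upd arr expr expr ("_\<langle>_\<rangle> ::= _" [1000, 0, 56] 55)
  | Inp var
  | Nop
  | Comp cmd cmd (infixr ";;" 50)
  | If expr cmd cmd ("IF _ THEN _ ELSE _" [0, 52, 52] 52)
  | Loop expr cmd ("WHILE _ DO _" [0, 52] 52)

text \<open>In an update the address is formed before the value, so the value is evaluated at depth
  1. The machine only tests registers, so a loop condition is evaluated before the loop and again at
  the end of each pass.\<close>

primrec comp :: "cmd \<Rightarrow> program" where
  "comp (x ::= e) = Seq (comp_expr 0 e) (copy (var_reg x) (tmp_reg 0))"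
| "comp (a\<langle>i\<rangle> ::= e) =
     Seq (comp_expr 0 i) (Seq (to_addr 0 a) (Seq (comp_expr 1 e) (Store (tmp_reg 0) (tmp_reg 1))))"
| "comp (Inp x) = Read (var_reg x)"
| "comp Nop = Skip"
| "comp (c ;; d) = Seq (comp c) (comp d)"
| "comp (IF e THEN c ELSE d) = Seq (comp_expr 0 e) (Cond (tmp_reg 0) (comp c) (comp d))"
| "comp (WHILE e DO c) =
     Seq (comp_expr 0 e) (While (tmp_reg 0) (Seq (comp c) (comp_expr 0 e)))"

text \<open>Syntactic footprints. Together with \<open>wa\<close> they supply the frame conditions,
  so that invariants mention only what a command changes.\<close>

primrec wv :: "cmd \<Rightarrow> var set" where
  "wv (x ::= e) = {x}"
| "wv (a\<langle>i\<rangle> ::= e) = {}"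
| "wv (Inp x) = {x}"
| "wv Nop = {}"
| "wv (c ;; d) = wv c \<union> wv d"
| "wv (IF e THEN c ELSE d) = wv c \<union> wv d"
| "wv (WHILE e DO c) = wv c"

primrec wa :: "cmd \<Rightarrow> arr set" where
  "wa (x ::= e) = {}"
| "wa (a\<langle>i\<rangle> ::= e) = {a}"
| "wa (Inp x) = {}"
| "wa Nop = {}"
| "wa (c ;; d) = wa c \<union> wa d"
| "wa (IF e THEN c ELSE d) = wa c \<union> wa d"
| "wa (WHILE e DO c) = wa c"

section \<open>Triples with time bounds and frames\<close>

definition same :: "'a set \<Rightarrow> ('a \<Rightarrow> 'b) \<Rightarrow> ('a \<Rightarrow> 'b) \<Rightarrow> bool" where
  "same W f g \<longleftrightarrow> (\<forall>x. x \<notin> W \<longrightarrow> g x = f x)"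

lemma same_refl [simp]: "same W f f"
  by (simp add: same_def)

lemma same_trans: "same W f g \<Longrightarrow> same W' g h \<Longrightarrow> same (W \<union> W') f h"
  by (simp add: same_def)

lemma same_mono: "same W f g \<Longrightarrow> W \<subseteq> W' \<Longrightarrow> same W' f g"
  by (auto simp: same_def)

text \<open>A total-correctness triple for one initial state, with a bound on the cost. Quantifying
  over all \<open>m\<close> that represent the state leaves the scratch cells arbitrary; the frame
  is part of the triple.\<close>

definition run :: "cmd \<Rightarrow> vars \<Rightarrow> arrs \<Rightarrow> nat list \<Rightarrow> nat \<Rightarrow>
    (vars \<Rightarrow> arrs \<Rightarrow> nat list \<Rightarrow> bool) \<Rightarrow> bool" where
  "run c \<rho> \<alpha> xs T post \<longleftrightarrow> (\<forall>m. rep m \<rho> \<alpha> \<longrightarrow> (\<exists>t m' \<rho>' \<alpha>' xs'.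
     exec (comp c) (m, xs) t (m', xs') \<and> rep m' \<rho>' \<alpha>' \<and> t \<le> T \<and>
     same (wv c) \<rho> \<rho>' \<and> same (wa c) \<alpha> \<alpha>' \<and> post \<rho>' \<alpha>' xs'))"

lemma run_conseq:
  assumes "run c \<rho> \<alpha> xs T post" "T \<le> T'"
    and "\<And>\<rho>' \<alpha>' xs'. post \<rho>' \<alpha>' xs' \<Longrightarrow> same (wv c) \<rho> \<rho>' \<Longrightarrow> same (wa c) \<alpha> \<alpha>' \<Longrightarrow> post' \<rho>' \<alpha>' xs'"
  shows "run c \<rho> \<alpha> xs T' post'"
  unfolding run_def
proof (intro allI impI)
  fix m assume "rep m \<rho> \<alpha>"
  with assms(1) obtain t m' \<rho>' \<alpha>' xs' where
    "exec (comp c) (m, xs) t (m', xs')" "rep m' \<rho>' \<alpha>'" "t \<le> T"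
    "same (wv c) \<rho> \<rho>'" "same (wa c) \<alpha> \<alpha>'" "post \<rho>' \<alpha>' xs'"
    unfolding run_def by blast
  moreover from this have "t \<le> T'" "post' \<rho>' \<alpha>' xs'" using assms(2,3) by auto
  ultimately show "\<exists>t m' \<rho>' \<alpha>' xs'.
     exec (comp c) (m, xs) t (m', xs') \<and> rep m' \<rho>' \<alpha>' \<and> t \<le> T' \<and>
     same (wv c) \<rho> \<rho>' \<and> same (wa c) \<alpha> \<alpha>' \<and> post' \<rho>' \<alpha>' xs'"
    by blast
qed

lemma run_Comp:
  assumes "run c \<rho> \<alpha> xs T1 mid"
    and "\<And>\<rho>' \<alpha>' xs'. mid \<rho>' \<alpha>' xs' \<Longrightarrow> same (wv c) \<rho> \<rho>' \<Longrightarrow> same (wa c) \<alpha> \<alpha>' \<Longrightarrow>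
      run d \<rho>' \<alpha>' xs' T2 post"
    and "T1 + T2 \<le> T"
  shows "run (c ;; d) \<rho> \<alpha> xs T post"
  unfolding run_def
proof (intro allI impI)
  fix m assume "rep m \<rho> \<alpha>"
  with assms(1) obtain t1 m1 \<rho>1 \<alpha>1 xs1 where 1:
    "exec (comp c) (m, xs) t1 (m1, xs1)" "rep m1 \<rho>1 \<alpha>1" "t1 \<le> T1"
    "same (wv c) \<rho> \<rho>1" "same (wa c) \<alpha> \<alpha>1" "mid \<rho>1 \<alpha>1 xs1"
    unfolding run_def by blast
  from assms(2)[OF 1(6,4,5)] 1(2) obtain t2 m2 \<rho>2 \<alpha>2 xs2 where 2:
    "exec (comp d) (m1, xs1) t2 (m2, xs2)" "rep m2 \<rho>2 \<alpha>2" "t2 \<le> T2"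
    "same (wv d) \<rho>1 \<rho>2" "same (wa d) \<alpha>1 \<alpha>2" "post \<rho>2 \<alpha>2 xs2"
    unfolding run_def by blast
  have "exec (comp (c ;; d)) (m, xs) (t1 + t2) (m2, xs2)"
    using 1(1) 2(1) by (auto intro: exec.Seq)
  moreover have "t1 + t2 \<le> T" using 1(3) 2(3) assms(3) by linarith
  moreover have "same (wv (c ;; d)) \<rho> \<rho>2" "same (wa (c ;; d)) \<alpha> \<alpha>2"
    using same_trans[OF 1(4) 2(4)] same_trans[OF 1(5) 2(5)] by simp_all
  ultimately show "\<exists>t m' \<rho>' \<alpha>' xs'.
     exec (comp (c ;; d)) (m, xs) t (m', xs') \<and> rep m' \<rho>' \<alpha>' \<and> t \<le> T \<and>
     same (wv (c ;; d)) \<rho> \<rho>' \<and> same (wa (c ;; d)) \<alpha> \<alpha>' \<and> post \<rho>' \<alpha>' xs'"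
    using 2(2,6) by blast
qed

lemma run_Asg:
  assumes "6 \<le> \<kappa>" "ebd \<kappa> e \<rho> \<alpha>" "post (\<rho>(x := ev e \<rho> \<alpha>)) \<alpha> xs" "(esize e + 3) * \<kappa> \<le> T"
  shows "run (x ::= e) \<rho> \<alpha> xs T post"
  unfolding run_def
proof (intro allI impI)
  fix m assume "rep m \<rho> \<alpha>"
  with assms exec_comp_expr obtain t m1 where 1: "exec (comp_expr 0 e) (m, xs) t (m1, xs)"
    "t \<le> esize e * \<kappa>" "rep m1 \<rho> \<alpha>" "m1 (tmp_reg 0) = ev e \<rho> \<alpha>"
    by blast
  have 2: "exec (copy (var_reg x) (tmp_reg 0)) (m1, xs) (2 + bit_len (ev e \<rho> \<alpha>))
      (m1(var_reg x := ev e \<rho> \<alpha>), xs)"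
    using exec_copy[of "var_reg x" "tmp_reg 0" m1 xs] 1(4) by simp
  have "bit_len (ev e \<rho> \<alpha>) \<le> \<kappa>" using ebd_short[OF assms(2)] by (simp add: short_def)
  then have "t + (2 + bit_len (ev e \<rho> \<alpha>)) \<le> T" using 1(2) assms(1,4) by (simp add: add_mult_distrib)
  moreover have "exec (comp (x ::= e)) (m, xs) (t + (2 + bit_len (ev e \<rho> \<alpha>)))
      (m1(var_reg x := ev e \<rho> \<alpha>), xs)"
    using exec.Seq[OF 1(1) 2] by simp
  ultimately show "\<exists>t m' \<rho>' \<alpha>' xs'.
     exec (comp (x ::= e)) (m, xs) t (m', xs') \<and> rep m' \<rho>' \<alpha>' \<and> t \<le> T \<and>
     same (wv (x ::= e)) \<rho> \<rho>' \<and> same (wa (x ::= e)) \<alpha> \<alpha>' \<and> post \<rho>' \<alpha>' xs'"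
    using rep_var[OF 1(3)] assms(3)
    by (intro exI conjI) (assumption, assumption, assumption, auto simp: same_def)
qed

lemma run_Upd:
  assumes "6 \<le> \<kappa>" "ebd \<kappa> i \<rho> \<alpha>" "short (\<kappa> - 5) (ev i \<rho> \<alpha>)" "ebd \<kappa> e \<rho> \<alpha>"
    and "post \<rho> (\<alpha>(a := (\<alpha> a)(ev i \<rho> \<alpha> := ev e \<rho> \<alpha>))) xs"
    and "(esize i + esize e + 8) * \<kappa> \<le> T"
  shows "run (a\<langle>i\<rangle> ::= e) \<rho> \<alpha> xs T post"
  unfolding run_def
proof (intro allI impI)
  fix m assume "rep m \<rho> \<alpha>"
  with assms exec_comp_expr obtain t m1 where 1: "exec (comp_expr 0 i) (m, xs) t (m1, xs)"
    "t \<le> esize i * \<kappa>" "rep m1 \<rho> \<alpha>" "m1 (tmp_reg 0) = ev i \<rho> \<alpha>"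
    by blast
  let ?ad = "addr a (ev i \<rho> \<alpha>)"
  let ?m2 = "m1(tmp_reg (Suc 0) := 3 * arr_num a + 2, tmp_reg 0 := ?ad)"
  obtain t2 where 2: "exec (to_addr 0 a) (m1, xs) t2 (?m2, xs)" "t2 \<le> 6 * \<kappa>"
    using exec_to_addr[of \<kappa> m1 0 a xs] assms(1,3) 1(4) by auto
  have "rep ?m2 \<rho> \<alpha>" using 1(3) by simp
  from exec_comp_expr[OF assms(1) this assms(4), of 1 xs] obtain t3 m3 where 3:
    "exec (comp_expr 1 e) (?m2, xs) t3 (m3, xs)" "t3 \<le> esize e * \<kappa>" "rep m3 \<rho> \<alpha>"
    "m3 (tmp_reg 1) = ev e \<rho> \<alpha>" "m3 (tmp_reg 0) = ?ad"
    by (auto simp del: fun_upd_apply) (auto simp: )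
  have 4: "exec (Store (tmp_reg 0) (tmp_reg 1)) (m3, xs) (bit_len ?ad + bit_len (ev e \<rho> \<alpha>))
      (m3(?ad := ev e \<rho> \<alpha>), xs)"
    by (rule exec_eq, rule exec.Store) (use 3 in auto)
  let ?t = "t + (t2 + (t3 + (bit_len ?ad + bit_len (ev e \<rho> \<alpha>))))"
  have "bit_len (ev e \<rho> \<alpha>) \<le> \<kappa>" using ebd_short[OF assms(4)] by (simp add: short_def)
  moreover have "bit_len ?ad \<le> \<kappa>" by (rule bit_len_addr(2)[OF assms(3,1)])
  ultimately have "?t \<le> T" using 1(2) 2(2) 3(2) assms(6) by (simp add: add_mult_distrib)
  moreover have "exec (comp (a\<langle>i\<rangle> ::= e)) (m, xs) ?t (m3(?ad := ev e \<rho> \<alpha>), xs)"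
    using exec.Seq[OF 1(1) exec.Seq[OF 2(1) exec.Seq[OF 3(1) 4]]] by simp
  ultimately show "\<exists>t m' \<rho>' \<alpha>' xs'.
     exec (comp (a\<langle>i\<rangle> ::= e)) (m, xs) t (m', xs') \<and> rep m' \<rho>' \<alpha>' \<and> t \<le> T \<and>
     same (wv (a\<langle>i\<rangle> ::= e)) \<rho> \<rho>' \<and> same (wa (a\<langle>i\<rangle> ::= e)) \<alpha> \<alpha>' \<and> post \<rho>' \<alpha>' xs'"
    using rep_arr[OF 3(3)] assms(5)
    by (intro exI conjI) (assumption, assumption, assumption, auto simp: same_def)
qed

lemma run_Nop: "post \<rho> \<alpha> xs \<Longrightarrow> 1 \<le> T \<Longrightarrow> run Nop \<rho> \<alpha> xs T post"
  unfolding run_def by (fastforce intro: exec.Skip)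

text \<open>No scale \<open>\<kappa>\<close> appears here: a number on the tape may exceed any scale
  fixed in advance, and reading is charged its own length.\<close>

lemma run_Inp:
  assumes "post (\<rho>(x := v)) \<alpha> xs" "bit_len v \<le> T"
  shows "run (Inp x) \<rho> \<alpha> (v # xs) T post"
  unfolding run_def
proof (intro allI impI)
  fix m assume "rep m \<rho> \<alpha>"
  then show "\<exists>t m' \<rho>' \<alpha>' xs'.
     exec (comp (Inp x)) (m, v # xs) t (m', xs') \<and> rep m' \<rho>' \<alpha>' \<and> t \<le> T \<and>
     same (wv (Inp x)) \<rho> \<rho>' \<and> same (wa (Inp x)) \<alpha> \<alpha>' \<and> post \<rho>' \<alpha>' xs'"
    using assms
    by (intro exI conjI) (simp, rule exec.Read, erule rep_var, auto simp: same_def)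
qed

lemma run_If:
  assumes "6 \<le> \<kappa>" "ebd \<kappa> e \<rho> \<alpha>"
    and "ev e \<rho> \<alpha> \<noteq> 0 \<Longrightarrow> run c \<rho> \<alpha> xs T1 post" "ev e \<rho> \<alpha> = 0 \<Longrightarrow> run d \<rho> \<alpha> xs T1 post"
    and "(esize e + 1) * \<kappa> + T1 \<le> T"
  shows "run (IF e THEN c ELSE d) \<rho> \<alpha> xs T post"
  unfolding run_def
proof (intro allI impI)
  fix m assume "rep m \<rho> \<alpha>"
  with assms exec_comp_expr obtain t m1 where 1: "exec (comp_expr 0 e) (m, xs) t (m1, xs)"
    "t \<le> esize e * \<kappa>" "rep m1 \<rho> \<alpha>" "m1 (tmp_reg 0) = ev e \<rho> \<alpha>"
    by blast
  define b where "b = (if ev e \<rho> \<alpha> = 0 then d else c)"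
  have "run b \<rho> \<alpha> xs T1 post" using assms(3,4) by (simp add: b_def)
  with 1(3) obtain t2 m2 \<rho>2 \<alpha>2 xs2 where 2:
    "exec (comp b) (m1, xs) t2 (m2, xs2)" "rep m2 \<rho>2 \<alpha>2" "t2 \<le> T1"
    "same (wv b) \<rho> \<rho>2" "same (wa b) \<alpha> \<alpha>2" "post \<rho>2 \<alpha>2 xs2"
    unfolding run_def by blast
  have "exec (Cond (tmp_reg 0) (comp c) (comp d)) (m1, xs) (bit_len (ev e \<rho> \<alpha>) + t2) (m2, xs2)"
    using exec.Cond_true[of "(m1, xs)" "tmp_reg 0"] exec.Cond_false[of "(m1, xs)" "tmp_reg 0"] 2(1) 1(4)
    by (cases "ev e \<rho> \<alpha> = 0") (auto simp: b_def)
  from exec.Seq[OF 1(1) this]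
  have "exec (comp (IF e THEN c ELSE d)) (m, xs) (t + (bit_len (ev e \<rho> \<alpha>) + t2)) (m2, xs2)" by simp
  moreover have "bit_len (ev e \<rho> \<alpha>) \<le> \<kappa>" using ebd_short[OF assms(2)] by (simp add: short_def)
  then have "t + (bit_len (ev e \<rho> \<alpha>) + t2) \<le> T" using 1(2) 2(3) assms(5) by simp
  moreover have "same (wv (IF e THEN c ELSE d)) \<rho> \<rho>2" "same (wa (IF e THEN c ELSE d)) \<alpha> \<alpha>2"
    using same_mono[OF 2(4)] same_mono[OF 2(5)] by (auto simp: b_def split: if_splits)
  ultimately show "\<exists>t m' \<rho>' \<alpha>' xs'.
     exec (comp (IF e THEN c ELSE d)) (m, xs) t (m', xs') \<and> rep m' \<rho>' \<alpha>' \<and> t \<le> T \<and>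
     same (wv (IF e THEN c ELSE d)) \<rho> \<rho>' \<and> same (wa (IF e THEN c ELSE d)) \<alpha> \<alpha>' \<and> post \<rho>' \<alpha>' xs'"
    using 2(2,6) by blast
qed

text \<open>The number of passes is fixed in advance, but each pass may have its own cost
  \<open>\<tau> i\<close>. This later charges less for candidates that are absent, and sums the work
  of residue classes of different sizes. The condition is evaluated \<open>n + 1\<close>
  times.\<close>

lemma run_Loop:
  assumes "6 \<le> \<kappa>" "Inv 0 \<rho> \<alpha> xs"
    and step: "\<And>i \<rho>' \<alpha>' xs'. i < n \<Longrightarrow> Inv i \<rho>' \<alpha>' xs' \<Longrightarrow> same (wv c) \<rho> \<rho>' \<Longrightarrow>
      same (wa c) \<alpha> \<alpha>' \<Longrightarrow>
      ebd \<kappa> e \<rho>' \<alpha>' \<and> ev e \<rho>' \<alpha>' \<noteq> 0 \<and> run c \<rho>' \<alpha>' xs' (\<tau> i) (Inv (Suc i))"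
    and final: "\<And>\<rho>' \<alpha>' xs'. Inv n \<rho>' \<alpha>' xs' \<Longrightarrow> same (wv c) \<rho> \<rho>' \<Longrightarrow> same (wa c) \<alpha> \<alpha>' \<Longrightarrow>
      ebd \<kappa> e \<rho>' \<alpha>' \<and> ev e \<rho>' \<alpha>' = 0 \<and> post \<rho>' \<alpha>' xs'"
    and T: "(\<Sum>i<n. \<tau> i) + (n + 1) * ((esize e + 1) * \<kappa>) \<le> T"
  shows "run (WHILE e DO c) \<rho> \<alpha> xs T post"
proof -
  let ?ce = "comp_expr 0 e"
  let ?k = "(esize e + 1) * \<kappa>"
  let ?w = "While (tmp_reg 0) (Seq (comp c) ?ce)"
  have main: "\<exists>t m' \<rho>'' \<alpha>'' xs''. exec (Seq ?ce ?w) (m, xs') t (m', xs'') \<and> rep m' \<rho>'' \<alpha>'' \<and>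
      t \<le> (\<Sum>j=i..<n. \<tau> j) + (n - i + 1) * ?k \<and>
      same (wv c) \<rho> \<rho>'' \<and> same (wa c) \<alpha> \<alpha>'' \<and> post \<rho>'' \<alpha>'' xs''"
    if "i \<le> n" "Inv i \<rho>' \<alpha>' xs'" "same (wv c) \<rho> \<rho>'" "same (wa c) \<alpha> \<alpha>'" "rep m \<rho>' \<alpha>'"
    for i \<rho>' \<alpha>' xs' m
    using that
  proof (induction "n - i" arbitrary: i \<rho>' \<alpha>' xs' m)
    case 0
    then have i: "i = n" by simp
    have b: "ebd \<kappa> e \<rho>' \<alpha>'" "ev e \<rho>' \<alpha>' = 0" "post \<rho>' \<alpha>' xs'"
      using final 0 i by blast+
    from exec_comp_expr[OF assms(1) 0(6) b(1)] obtain t m1 where 1: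
      "exec ?ce (m, xs') t (m1, xs')" "t \<le> esize e * \<kappa>" "rep m1 \<rho>' \<alpha>'" "m1 (tmp_reg 0) = 0"
      using b(2) by metis
    have "exec ?w (m1, xs') 1 (m1, xs')"
      using exec.While_false[of "(m1, xs')" "tmp_reg 0"] 1(4) by simp
    from exec.Seq[OF 1(1) this] show ?case
      using 1 0 b(3) i assms(1) by (intro exI conjI) (assumption, assumption, auto)
  next
    case (Suc d)
    then have i: "i < n" by simp
    have b: "ebd \<kappa> e \<rho>' \<alpha>'" "ev e \<rho>' \<alpha>' \<noteq> 0" "run c \<rho>' \<alpha>' xs' (\<tau> i) (Inv (Suc i))"
      using step[OF i Suc(4,5,6)] by blast+
    from exec_comp_expr[OF assms(1) Suc(7) b(1)] obtain t m1 where 1: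
      "exec ?ce (m, xs') t (m1, xs')" "t \<le> esize e * \<kappa>" "rep m1 \<rho>' \<alpha>'" "m1 (tmp_reg 0) = ev e \<rho>' \<alpha>'"
      by metis
    from b(3) 1(3) obtain t2 m2 \<rho>2 \<alpha>2 xs2 where 2:
      "exec (comp c) (m1, xs') t2 (m2, xs2)" "rep m2 \<rho>2 \<alpha>2" "t2 \<le> \<tau> i"
      "same (wv c) \<rho>' \<rho>2" "same (wa c) \<alpha>' \<alpha>2" "Inv (Suc i) \<rho>2 \<alpha>2 xs2"
      unfolding run_def by blast
    have s: "same (wv c) \<rho> \<rho>2" "same (wa c) \<alpha> \<alpha>2"
      using same_trans[OF Suc(5) 2(4)] same_trans[OF Suc(6) 2(5)] by simp_all
    have "d = n - Suc i" "Suc i \<le> n" using Suc(2) by simp_all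
    from Suc(1)[OF this 2(6) s 2(2)] obtain t3 m3 \<rho>3 \<alpha>3 xs3 where 3:
      "exec (Seq ?ce ?w) (m2, xs2) t3 (m3, xs3)" "rep m3 \<rho>3 \<alpha>3"
      "t3 \<le> (\<Sum>j=Suc i..<n. \<tau> j) + (n - Suc i + 1) * ?k"
      "same (wv c) \<rho> \<rho>3" "same (wa c) \<alpha> \<alpha>3" "post \<rho>3 \<alpha>3 xs3"
      by blast
    \<comment> \<open>The induction hypothesis speaks of condition and loop in sequence. The
      condition is split off, because the compiled loop evaluates it as the end of the preceding
      pass.\<close>
    from 3(1) obtain t4 u t5 where 4: "exec ?ce (m2, xs2) t4 u" "exec ?w u t5 (m3, xs3)" "t3 = t4 + t5"
      by (auto elim: SeqE)
    have "exec ?w (m1, xs') (bit_len (ev e \<rho>' \<alpha>') + (t2 + t4) + t5) (m3, xs3)"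
      using exec.While_true[of "(m1, xs')" "tmp_reg 0", OF _ exec.Seq[OF 2(1) 4(1)] 4(2)] 1(4) b(2) by simp
    from exec.Seq[OF 1(1) this]
    have "exec (Seq ?ce ?w) (m, xs') (t + (bit_len (ev e \<rho>' \<alpha>') + (t2 + t4) + t5)) (m3, xs3)" .
    moreover have "t + (bit_len (ev e \<rho>' \<alpha>') + (t2 + t4) + t5) \<le> (\<Sum>j=i..<n. \<tau> j) + (n - i + 1) * ?k"
    proof -
      have "bit_len (ev e \<rho>' \<alpha>') \<le> \<kappa>" using ebd_short[OF b(1)] by (simp add: short_def)
      moreover have "(\<Sum>j=i..<n. \<tau> j) = \<tau> i + (\<Sum>j=Suc i..<n. \<tau> j)"
        using i by (simp add: sum.atLeast_Suc_lessThan)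
      moreover have "(n - i + 1) * ?k = ?k + (n - Suc i + 1) * ?k"
        using i by (simp add: Suc_diff_Suc[symmetric])
      ultimately show ?thesis using 1(2) 2(3) 3(3) 4(3) by simp
    qed
    ultimately show ?case using 3 by blast
  qed
  show ?thesis
    unfolding run_def
  proof (intro allI impI)
    fix m assume "rep m \<rho> \<alpha>"
    from main[OF _ assms(2) same_refl same_refl this] T
    show "\<exists>t m' \<rho>' \<alpha>' xs'.
       exec (comp (WHILE e DO c)) (m, xs) t (m', xs') \<and> rep m' \<rho>' \<alpha>' \<and> t \<le> T \<and>
       same (wv (WHILE e DO c)) \<rho> \<rho>' \<and> same (wa (WHILE e DO c)) \<alpha> \<alpha>' \<and> post \<rho>' \<alpha>' xs'"
      by (simp add: atLeast0LessThan) (meson le_trans)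
  qed
qed

text \<open>Weakest preconditions of straight-line code, so that simplification alone executes it.
  Input and loops get \<open>False\<close>: they are treated by their own rules.\<close>

primrec wpc :: "nat \<Rightarrow> cmd \<Rightarrow> vars \<Rightarrow> arrs \<Rightarrow> (vars \<Rightarrow> arrs \<Rightarrow> bool) \<Rightarrow> bool" where
  "wpc \<kappa> (x ::= e) \<rho> \<alpha> post \<longleftrightarrow> ebd \<kappa> e \<rho> \<alpha> \<and> post (\<rho>(x := ev e \<rho> \<alpha>)) \<alpha>"
| "wpc \<kappa> (a\<langle>i\<rangle> ::= e) \<rho> \<alpha> post \<longleftrightarrow> ebd \<kappa> i \<rho> \<alpha> \<and> short (\<kappa> - 5) (ev i \<rho> \<alpha>) \<and> ebd \<kappa> e \<rho> \<alpha> \<and>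
     post \<rho> (\<alpha>(a := (\<alpha> a)(ev i \<rho> \<alpha> := ev e \<rho> \<alpha>)))"
| "wpc \<kappa> (Inp x) \<rho> \<alpha> post \<longleftrightarrow> False"
| "wpc \<kappa> Nop \<rho> \<alpha> post \<longleftrightarrow> post \<rho> \<alpha>"
| "wpc \<kappa> (c ;; d) \<rho> \<alpha> post \<longleftrightarrow> wpc \<kappa> c \<rho> \<alpha> (\<lambda>\<rho>' \<alpha>'. wpc \<kappa> d \<rho>' \<alpha>' post)"
| "wpc \<kappa> (IF e THEN c ELSE d) \<rho> \<alpha> post \<longleftrightarrow> ebd \<kappa> e \<rho> \<alpha> \<and>
     (if ev e \<rho> \<alpha> \<noteq> 0 then wpc \<kappa> c \<rho> \<alpha> post else wpc \<kappa> d \<rho> \<alpha> post)"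
| "wpc \<kappa> (WHILE e DO c) \<rho> \<alpha> post \<longleftrightarrow> False"

primrec csize :: "cmd \<Rightarrow> nat" where
  "csize (x ::= e) = esize e + 3"
| "csize (a\<langle>i\<rangle> ::= e) = esize i + esize e + 8"
| "csize (Inp x) = 0"
| "csize Nop = 1"
| "csize (c ;; d) = csize c + csize d"
| "csize (IF e THEN c ELSE d) = esize e + 1 + max (csize c) (csize d)"
| "csize (WHILE e DO c) = 0"

text \<open>One scale serves a whole block. Blocks that touch entire tables are therefore kept short
  and run at a larger scale, without spoiling the charge of the rest.\<close>

lemma run_flat:
  assumes "6 \<le> \<kappa>" "wpc \<kappa> c \<rho> \<alpha> (\<lambda>\<rho>' \<alpha>'. post \<rho>' \<alpha>' xs)" "csize c * \<kappa> \<le> T"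
  shows "run c \<rho> \<alpha> xs T post"
  using assms(2,3)
proof (induction c arbitrary: \<rho> \<alpha> T post)
  case (Comp c d)
  have "run c \<rho> \<alpha> xs (csize c * \<kappa>)
    (\<lambda>\<rho>' \<alpha>' xs'. wpc \<kappa> d \<rho>' \<alpha>' (\<lambda>\<rho>' \<alpha>'. post \<rho>' \<alpha>' xs) \<and> xs' = xs)"
    using Comp.prems(1) by (intro Comp.IH(1)) simp_all
  then show ?case
  proof (rule run_Comp)
    show "csize c * \<kappa> + csize d * \<kappa> \<le> T" using Comp.prems(2) by (simp add: add_mult_distrib)
    fix \<rho>' \<alpha>' xs'
    assume "wpc \<kappa> d \<rho>' \<alpha>' (\<lambda>\<rho>' \<alpha>'. post \<rho>' \<alpha>' xs) \<and> xs' = xs"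
    then show "run d \<rho>' \<alpha>' xs' (csize d * \<kappa>) post" using Comp.IH(2) by blast
  qed
next
  case (If e c d)
  show ?case
  proof (rule run_If[OF assms(1)])
    show "ebd \<kappa> e \<rho> \<alpha>" using If.prems(1) by simp
    show "(esize e + 1) * \<kappa> + max (csize c) (csize d) * \<kappa> \<le> T"
      using If.prems(2) by (simp add: add_mult_distrib)
    have m: "csize c * \<kappa> \<le> max (csize c) (csize d) * \<kappa>" "csize d * \<kappa> \<le> max (csize c) (csize d) * \<kappa>"
      by (rule mult_right_mono; simp)+
    show "run c \<rho> \<alpha> xs (max (csize c) (csize d) * \<kappa>) post" if "ev e \<rho> \<alpha> \<noteq> 0"
      using If.prems(1) that by (intro If.IH(1) m) simp
    show "run d \<rho> \<alpha> xs (max (csize c) (csize d) * \<kappa>) post" if "ev e \<rho> \<alpha> = 0"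
      using If.prems(1) that by (intro If.IH(2) m) simp
  qed
next
  case (Asg x e)
  have "ebd \<kappa> e \<rho> \<alpha>" "post (\<rho>(x := ev e \<rho> \<alpha>)) \<alpha> xs" using Asg(1) by (simp_all only: wpc.simps)
  moreover have "(esize e + 3) * \<kappa> \<le> T" using Asg(2) by (simp only: csize.simps)
  ultimately show ?case by - (rule run_Asg[OF assms(1)], assumption+)
next
  case (Upd a i e)
  have "ebd \<kappa> i \<rho> \<alpha>" "short (\<kappa> - 5) (ev i \<rho> \<alpha>)" "ebd \<kappa> e \<rho> \<alpha>"
    "post \<rho> (\<alpha>(a := (\<alpha> a)(ev i \<rho> \<alpha> := ev e \<rho> \<alpha>))) xs" using Upd(1) by (simp_all only: wpc.simps)
  moreover have "(esize i + esize e + 8) * \<kappa> \<le> T" using Upd(2) by (simp only: csize.simps)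
  ultimately show ?case by - (rule run_Upd[OF assms(1)], assumption+)
next
  case Nop
  then show ?case using assms(1) by (intro run_Nop) simp_all
next
  case (Inp x)
  from Inp(1) show ?case by (simp only: wpc.simps)
next
  case (Loop e c)
  from Loop(2) show ?case by (simp only: wpc.simps)
qed

text \<open>Glues a flat block to code containing loops; the remainder is free to use scales other
  than the \<open>\<kappa>\<close> of the block.\<close>

lemma run_prefix:
  assumes "6 \<le> \<kappa>" "wpc \<kappa> c \<rho> \<alpha> (\<lambda>\<rho>' \<alpha>'. run d \<rho>' \<alpha>' xs T' post)" "csize c * \<kappa> + T' \<le> T"
  shows "run (c ;; d) \<rho> \<alpha> xs T post"
proof (rule run_Comp)
  show "run c \<rho> \<alpha> xs (csize c * \<kappa>) (\<lambda>\<rho>' \<alpha>' xs'. run d \<rho>' \<alpha>' xs T' post \<and> xs' = xs)"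
    using assms(2) by (intro run_flat[OF assms(1)]) simp_all
qed (use assms(3) in auto)

section \<open>Packing and unpacking the digits of a number\<close>

text \<open>One bound \<open>U\<close> discharges the length conditions of all small values, both as
  contents and as array indices, which lose 5 bits. The last form is the second with 5 spelled by
  successors, so that either shape is matched.\<close>

lemma short_bound:
  assumes "short (\<kappa> - 5) U" "\<kappa> \<le> \<mu>"
  shows "v \<le> U \<Longrightarrow> short \<mu> v" and "v \<le> U \<Longrightarrow> short (\<mu> - 5) v"
    and "v \<le> U \<Longrightarrow> short (\<mu> - Suc (Suc (Suc (Suc (Suc 0))))) v"
proof -
  show *: "short (\<mu> - 5) v" if "v \<le> U"
    using assms(2) by (intro short_le[OF short_mono[OF assms(1)] that]) simp
  then show "v \<le> U \<Longrightarrow> short (\<mu> - Suc (Suc (Suc (Suc (Suc 0))))) v" by (simp add: numeral_eq_Suc)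
  show "short \<mu> v" if "v \<le> U"
    using *[OF that] by (rule short_mono) simp
qed

lemma short_power:
  assumes "short (\<kappa> - 5) U" "\<beta> \<le> U" "v < \<beta> ^ a" "0 < a" "a * \<kappa> \<le> \<mu>"
  shows "short \<mu> v"
proof -
  have "bit_len \<beta> \<le> \<kappa>" using short_bound(1)[OF assms(1) order_refl assms(2)] by (simp add: short_def)
  then have "a * bit_len \<beta> \<le> a * \<kappa>" by simp
  with bit_len_less_power[OF assms(3,4)] assms(5) show ?thesis unfolding short_def by linarith
qed

lemma sum_lessThan_add: "(\<Sum>i<m + n. h i) = (\<Sum>i<m. h i) + (\<Sum>i<n. h (m + i))"
  for h :: "nat \<Rightarrow> 'a::comm_monoid_add"
  by (induction n) (simp_all add: add.assoc)

definition block :: "(nat \<Rightarrow> nat) \<Rightarrow> nat \<Rightarrow> nat \<Rightarrow> nat \<Rightarrow> nat" where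
  "block f \<beta> s i = (\<Sum>j<s. f (i + j) * \<beta> ^ j)"

lemma block_1: "block f \<beta> (Suc 0) i = f i"
  by (simp add: block_def)

lemma block_double: "block f \<beta> (2 * s) i = block f \<beta> s i + \<beta> ^ s * block f \<beta> s (i + s)"
  unfolding block_def mult_2 sum_lessThan_add by (simp add: sum_distrib_left power_add ac_simps)

lemma block_less:
  assumes "\<And>i. f i < \<beta>"
  shows "block f \<beta> s i < \<beta> ^ s"
proof (induction s)
  case (Suc s)
  have "block f \<beta> (Suc s) i = block f \<beta> s i + f (i + s) * \<beta> ^ s" by (simp add: block_def)
  also have "\<dots> < \<beta> ^ s + f (i + s) * \<beta> ^ s" using Suc by simp
  also have "\<dots> = (f (i + s) + 1) * \<beta> ^ s" by simp
  also have "\<dots> \<le> \<beta> * \<beta> ^ s" using assms[of "i + s"] by (intro mult_right_mono) auto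
  finally show ?case by simp
qed (simp add: block_def)

lemma block_eq_0: "\<forall>i>n. f i = 0 \<Longrightarrow> n < i \<Longrightarrow> block f \<beta> s i = 0"
  by (simp add: block_def)

text \<open>Cells that do not start a block hold 0, so after the last level only cell 0 can be
  nonzero, and clearing it restores an empty array.\<close>

definition level :: "(nat \<Rightarrow> nat) \<Rightarrow> nat \<Rightarrow> nat \<Rightarrow> nat \<Rightarrow> nat" where
  "level f \<beta> s i = (if s dvd i then block f \<beta> s i else 0)"

text \<open>The state of the array after \<open>a\<close> merges of neighbouring blocks of length \<open>s\<close>.\<close>

definition levels :: "(nat \<Rightarrow> nat) \<Rightarrow> nat \<Rightarrow> nat \<Rightarrow> nat \<Rightarrow> nat \<Rightarrow> nat" where
  "levels f \<beta> s a i = (if i < 2 * s * a then level f \<beta> (2 * s) i else level f \<beta> s i)"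

lemma level_1: "level f \<beta> (Suc 0) = f"
  by (simp add: level_def block_1 fun_eq_iff)

lemma levels_0: "levels f \<beta> s 0 = level f \<beta> s"
  by (simp add: levels_def fun_eq_iff)

lemma not_dvd_between: "(s::nat) * a < i \<Longrightarrow> i < s * Suc a \<Longrightarrow> \<not> s dvd i"
  by (metis dvd_def less_Suc_eq_le mult_less_cancel1 not_less)

lemma levels_Suc:
  assumes "0 < s"
  shows "(levels f \<beta> s a)(2 * s * a := levels f \<beta> s a (2 * s * a) + \<beta> ^ s * levels f \<beta> s a (2 * s * a + s),
    2 * s * a + s := 0) = levels f \<beta> s (Suc a)"
proof
  fix i
  consider "i < 2 * s * a" | "i = 2 * s * a" | "2 * s * a < i" "i < 2 * s * a + s" | "i = 2 * s * a + s"
    | "2 * s * a + s < i" "i < 2 * s * Suc a" | "2 * s * Suc a \<le> i"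
    by (simp only: mult_Suc_right) linarith
  then show "((levels f \<beta> s a)(2 * s * a := levels f \<beta> s a (2 * s * a) + \<beta> ^ s * levels f \<beta> s a (2 * s * a
    + s),
    2 * s * a + s := 0)) i = levels f \<beta> s (Suc a) i"
  proof cases
    case 1
    then show ?thesis by (simp add: levels_def)
  next
    case 2
    then show ?thesis using assms by (simp add: levels_def level_def block_double)
  next
    case 3
    then have "\<not> s dvd i" using not_dvd_between[of s "2 * a" i] by (simp add: ac_simps)
    moreover from this have "\<not> 2 * s dvd i" by (metis dvd_mult_right)
    ultimately show ?thesis using 3 by (simp add: levels_def level_def)
  next
    case 4
    have "\<not> 2 * s dvd i" using not_dvd_between[of "2 * s" a i] 4 assms by simp
    then show ?thesis using 4 assms by (simp add: levels_def level_def)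
  next
    case 5
    then have "\<not> s dvd i" using not_dvd_between[of s "2 * a + 1" i] by (simp add: algebra_simps)
    moreover from this have "\<not> 2 * s dvd i" by (metis dvd_mult_right)
    ultimately show ?thesis using 5 by (simp add: levels_def level_def)
  next
    case 6
    then show ?thesis using assms by (simp add: levels_def)
  qed
qed

text \<open>The pass stops at the first pair whose right half begins beyond \<open>n\<close>. That
  half is zero, so the remaining left half already equals the doubled block.\<close>

lemma levels_final:
  assumes "0 < s" "\<forall>i>n. f i = 0" "n < 2 * s * a + s"
  shows "levels f \<beta> s a = level f \<beta> (2 * s)"
proof
  fix i
  show "levels f \<beta> s a i = level f \<beta> (2 * s) i"
  proof (cases "i < 2 * s * a")
    case True
    then show ?thesis by (simp add: levels_def)
  next
    case False
    show ?thesis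
    proof (cases "i = 2 * s * a")
      case True
      then show ?thesis using block_eq_0[OF assms(2), of "i + s"] assms(3)
        by (simp add: levels_def level_def block_double)
    next
      case ne: False
      show ?thesis
      proof (cases "s dvd i")
        case True
        then have "2 * s * a + s \<le> i"
          using not_dvd_between[of s "2 * a" i] False ne
            by (simp add: ac_simps) (metis linorder_neqE_nat not_less)
        then have "n < i" using assms(3) by linarith
        then show ?thesis using block_eq_0[OF assms(2), of i] False by (simp add: levels_def level_def)
      next
        case nd: False
        moreover from this have "\<not> 2 * s dvd i" by (metis dvd_mult_right)
        ultimately show ?thesis using False by (simp add: levels_def level_def)
      qed
    qed
  qed
qed

lemma level_less:
  assumes "\<And>i. f i < \<beta>"
  shows "level f \<beta> s i < \<beta> ^ s"
  using block_less[of f \<beta> s i, OF assms] by (simp add: level_def) (metis assms gr_zeroI not_less0)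

section \<open>Packing digits into one number by doubling block lengths\<close>

definition pack_inner :: cmd where
  "pack_inner =
     (Out\<langle>V I\<rangle> ::= A Out (V I) \<oplus> V P \<otimes> A Out (V I \<oplus> V S) ;;
      Out\<langle>V I \<oplus> V S\<rangle> ::= C 0 ;;
      I ::= V I \<oplus> V S \<otimes> C 2)"

text \<open>Truncated subtraction serves as comparison:
  \<open>V MX \<oplus> C 1 \<ominus> V S\<close> is nonzero exactly if the block length does not
  exceed \<open>MX\<close>. Horner's scheme would pay the length of the growing number at every
  digit, which is quadratic in total.\<close>

definition pack :: cmd where
  "pack =
     (S ::= C 1 ;; P ::= V B ;;
      WHILE V MX \<oplus> C 1 \<ominus> V S DO
       (I ::= C 0 ;;
        WHILE V MX \<oplus> C 1 \<ominus> (V I \<oplus> V S) DO pack_inner ;;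
        S ::= V S \<otimes> C 2 ;; P ::= V P \<otimes> V P) ;;
      Z ::= A Out (C 0) ;; Out\<langle>C 0\<rangle> ::= C 0)"

lemma wv_pack_inner [simp]: "wv pack_inner = {I}" "wa pack_inner = {Out}"
  by (auto simp: pack_inner_def)

lemma wv_pack [simp]: "wv pack = {S, P, I, Z}" "wa pack = {Out}"
  by (auto simp: pack_def)

text \<open>The quotient counts the pairs whose right half starts at or below \<open>n\<close>. The
  same count governs the merging of tables.\<close>

lemma less_merge_count_iff:
  assumes "0 < s"
  shows "a < (n + s) div (2 * s) \<longleftrightarrow> 2 * s * a + s \<le> (n::nat)"
proof -
  have "a < (n + s) div (2 * s) \<longleftrightarrow> Suc a \<le> (n + s) div (2 * s)" by auto
  also have "\<dots> \<longleftrightarrow> Suc a * (2 * s) \<le> n + s" using assms by (simp add: less_eq_div_iff_mult_less_eq)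
  also have "\<dots> \<longleftrightarrow> 2 * s * a + s \<le> n" by (simp add: algebra_simps)
  finally show ?thesis .
qed

text \<open>There are about \<open>n / (2 * s)\<close> merges on numbers of \<open>2 * s\<close>
  digits: the block length cancels, and every level costs about \<open>n\<close> digits.
  \<open>\<mu>\<close> is the scale of one merged block.\<close>

lemma run_pack_inner:
  assumes "6 \<le> \<kappa>" "short (\<kappa> - 5) U" "4 * n + 4 \<le> U" "2 \<le> \<beta>" "\<beta> \<le> U"
    and f: "\<And>i. f i < \<beta>" and f0: "\<forall>i>n. f i = 0"
    and s: "0 < s" "s \<le> n"
    and \<rho>: "\<rho> MX = n" "\<rho> S = s" "\<rho> P = \<beta> ^ s" "\<rho> I = 0" "\<alpha> Out = level f \<beta> s"
  shows "run (WHILE V MX \<oplus> C 1 \<ominus> (V I \<oplus> V S) DO pack_inner) \<rho> \<alpha> xs (300 * n * \<kappa>)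
    (\<lambda>\<rho>' \<alpha>' xs'. \<alpha>' Out = level f \<beta> (2 * s) \<and> xs' = xs)"
proof -
  define d where "d = (n + s) div (2 * s)"
  have d: "a < d \<longleftrightarrow> 2 * s * a + s \<le> n" for a unfolding d_def by (rule less_merge_count_iff[OF s(1)])
  define \<mu> where "\<mu> = 2 * s * \<kappa>"
  have \<mu>: "\<kappa> \<le> \<mu>" "6 \<le> \<mu>" using s(1) assms(1) mult_le_mono1[of 1 "2 * s" \<kappa>] unfolding \<mu>_def by linarith+
  note sU = short_bound[OF assms(2) \<mu>(1)]
  have sB: "v < \<beta> ^ (2 * s) \<Longrightarrow> short \<mu> v" for v
    using short_power[OF assms(2,5), of v "2 * s" \<mu>] s by (simp add: \<mu>_def)
  show ?thesis
  proof (rule run_Loop[OF assms(1), where n = d and \<tau> = "\<lambda>_. 80 * \<mu>" and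
      Inv = "\<lambda>a \<rho>' \<alpha>' xs'. \<rho>' I = 2 * s * a \<and> \<alpha>' Out = levels f \<beta> s a \<and> xs' = xs"])
    show "\<rho> I = 2 * s * 0 \<and> \<alpha> Out = levels f \<beta> s 0 \<and> xs = xs" using \<rho> by (simp add: levels_0)
  next
    fix a \<rho>' \<alpha>' xs'
    assume a: "a < d" and I: "\<rho>' I = 2 * s * a \<and> \<alpha>' Out = levels f \<beta> s a \<and> xs' = xs"
      and "same (wv pack_inner) \<rho> \<rho>'" "same (wa pack_inner) \<alpha> \<alpha>'"
    then have r: "\<rho>' MX = n" "\<rho>' S = s" "\<rho>' P = \<beta> ^ s" "\<rho>' I = 2 * s * a" "\<alpha>' Out = levels f \<beta> s a"
      using \<rho> by (simp_all add: same_def)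
    have le: "2 * s * a + s \<le> n" using a d by simp
    note bds = short_bound[OF assms(2) order_refl]
    have v1: "levels f \<beta> s a (2 * s * a) < \<beta> ^ s" "levels f \<beta> s a (2 * s * a + s) < \<beta> ^ s"
      using level_less[OF f] by (simp_all add: levels_def)
    have pw: "\<beta> ^ (2 * s) = \<beta> ^ s * \<beta> ^ s" by (simp add: power_add mult_2)
    have b1: "1 \<le> \<beta> ^ s" using assms(4) by simp
    have v2: "\<beta> ^ s * levels f \<beta> s a (2 * s * a + s) + levels f \<beta> s a (2 * s * a) < \<beta> ^ (2 * s)"
    proof -
      have "\<beta> ^ s * (levels f \<beta> s a (2 * s * a + s) + 1) \<le> \<beta> ^ s * \<beta> ^ s" using v1(2)
        by (intro mult_left_mono) auto
      then show ?thesis using v1(1) by (simp add: pw)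
    qed
    have b2: "\<beta> ^ s < \<beta> ^ (2 * s)" using s(1) assms(4) by (intro power_strict_increasing) auto
    have sh: "short \<mu> (\<beta> ^ s * levels f \<beta> s a (2 * s * a + s) + levels f \<beta> s a (2 * s * a))"
      "short \<mu> (levels f \<beta> s a (2 * s * a) + \<beta> ^ s * levels f \<beta> s a (2 * s * a + s))"
      "short \<mu> (\<beta> ^ s * levels f \<beta> s a (2 * s * a + s))" "short \<mu> (levels f \<beta> s a (2 * s * a))"
      "short \<mu> (levels f \<beta> s a (2 * s * a + s))" "short \<mu> (\<beta> ^ s)"
      using v1 v2 b2 by (auto intro!: sB simp: add.commute)
    have "run pack_inner \<rho>' \<alpha>' xs' (80 * \<mu>)
       (\<lambda>\<rho>' \<alpha>' xs'. \<rho>' I = 2 * s * Suc a \<and> \<alpha>' Out = levels f \<beta> s (Suc a) \<and> xs' = xs)"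
      using r I s assms(3) le sh levels_Suc[OF s(1), of f \<beta> a]
      by (intro run_flat[OF \<mu>(2)]) (simp_all add: pack_inner_def sU)
    moreover have "ebd \<kappa> (V MX \<oplus> C 1 \<ominus> (V I \<oplus> V S)) \<rho>' \<alpha>'" "ev (V MX \<oplus> C 1 \<ominus> (V I \<oplus> V S)) \<rho>' \<alpha>' \<noteq> 0"
      using r le assms(3) by (simp_all add: bds)
    ultimately show "ebd \<kappa> (V MX \<oplus> C 1 \<ominus> (V I \<oplus> V S)) \<rho>' \<alpha>' \<and> ev (V MX \<oplus> C 1 \<ominus> (V I \<oplus> V S)) \<rho>' \<alpha>' \<noteq> 0 \<and>
      run pack_inner \<rho>' \<alpha>' xs' (80 * \<mu>)
       (\<lambda>\<rho>' \<alpha>' xs'. \<rho>' I = 2 * s * Suc a \<and> \<alpha>' Out = levels f \<beta> s (Suc a) \<and> xs' = xs)" by blast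
  next
    fix \<rho>' \<alpha>' xs'
    assume I: "\<rho>' I = 2 * s * d \<and> \<alpha>' Out = levels f \<beta> s d \<and> xs' = xs"
      and "same (wv pack_inner) \<rho> \<rho>'" "same (wa pack_inner) \<alpha> \<alpha>'"
    then have r: "\<rho>' MX = n" "\<rho>' S = s" "\<rho>' I = 2 * s * d"
      using \<rho> by (simp_all add: same_def)
    have gt: "n < 2 * s * d + s" using d[of d] by simp
    have le: "2 * s * d \<le> n + s" unfolding d_def by simp
    note bds = short_bound[OF assms(2) order_refl]
    show "ebd \<kappa> (V MX \<oplus> C 1 \<ominus> (V I \<oplus> V S)) \<rho>' \<alpha>' \<and> ev (V MX \<oplus> C 1 \<ominus> (V I \<oplus> V S)) \<rho>' \<alpha>' = 0 \<and>
       \<alpha>' Out = level f \<beta> (2 * s) \<and> xs' = xs"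
      using I r gt le assms(3) s levels_final[OF s(1) f0 gt] by (simp add: bds)
  next
    have "d * (2 * s) \<le> n + s" unfolding d_def by simp
    then have d2: "2 * (d * s) \<le> 2 * n" using s by simp
    have "d \<le> d * s" using s by simp
    then have d1: "d \<le> n" using d2 by linarith
    have "(\<Sum>i<d. 80 * \<mu>) + (d + 1) * ((esize (V MX \<oplus> C 1 \<ominus> (V I \<oplus> V S)) + 1) * \<kappa>)
      = 160 * (d * s) * \<kappa> + 17 * (d * \<kappa>) + 17 * \<kappa>"
      by (simp add: \<mu>_def algebra_simps)
    also have "\<dots> \<le> 160 * n * \<kappa> + 17 * (n * \<kappa>) + 17 * (n * \<kappa>)"
      using d1 d2 s by (intro add_mono mult_mono) auto
    also have "\<dots> \<le> 300 * n * \<kappa>" by (simp add: algebra_simps)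
    finally show "(\<Sum>i<d. 80 * \<mu>) + (d + 1) * ((esize (V MX \<oplus> C 1 \<ominus> (V I \<oplus> V S)) + 1) * \<kappa>)
      \<le> 300 * n * \<kappa>" .
  qed
qed

lemma less_bit_len_iff: "0 < n \<Longrightarrow> q < bit_len n \<longleftrightarrow> 2 ^ q \<le> n"
  using bit_len_le_iff[of q n] by (cases "q = 0") (simp_all, linarith)

text \<open>At most \<open>\<kappa>\<close> levels of about \<open>n\<close> digits each, hence the
  square of \<open>\<kappa>\<close>. Leaving \<open>Out\<close> zero makes the array ready for the
  next call without a cleaning pass.\<close>

lemma run_pack:
  assumes "6 \<le> \<kappa>" "short (\<kappa> - 5) U" "4 * n + 4 \<le> U" "2 \<le> \<beta>" "\<beta> \<le> U"
    and f: "\<And>i. f i < \<beta>" and f0: "\<forall>i>n. f i = 0"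
    and \<rho>: "\<rho> MX = n" "\<rho> B = \<beta>" "\<alpha> Out = f"
  shows "run pack \<rho> \<alpha> xs (1000 * (n + 1) * \<kappa>\<^sup>2)
    (\<lambda>\<rho>' \<alpha>' xs'. \<rho>' Z = (\<Sum>i\<le>n. f i * \<beta> ^ i) \<and> \<alpha>' Out = (\<lambda>_. 0) \<and> xs' = xs)"
proof -
  \<comment> \<open>\<open>bit_len 0\<close> is 1, but with \<open>n = 0\<close> there is no level
    at all.\<close>
  define d where "d = (if n = 0 then 0 else bit_len n)"
  have d: "q < d \<longleftrightarrow> 2 ^ q \<le> n" for q
    by (simp add: d_def less_bit_len_iff)
  have dn: "n < 2 ^ d" using d[of d] by simp
  have d\<kappa>: "d \<le> \<kappa>"
    using short_bound(1)[OF assms(2) order_refl, of n] assms(3) by (simp add: d_def short_def)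
  have d2: "2 ^ d \<le> 2 * (n + 1)"
  proof (cases d)
    case (Suc q)
    then have "2 ^ q \<le> n" using d[of q] by simp
    then show ?thesis using Suc by simp
  qed simp
  note sU = short_bound[OF assms(2) order_refl]
  let ?Inv = "\<lambda>q \<rho>' \<alpha>' xs'. \<rho>' S = 2 ^ q \<and> \<rho>' P = \<beta> ^ (2 ^ q) \<and> \<alpha>' Out = level f \<beta> (2 ^ q) \<and> xs' = xs"
  have step: "run (I ::= C 0 ;; WHILE V MX \<oplus> C 1 \<ominus> (V I \<oplus> V S) DO pack_inner ;;
      S ::= V S \<otimes> C 2 ;; P ::= V P \<otimes> V P) \<rho>' \<alpha>' xs' (400 * n * \<kappa>) (?Inv (Suc q))"
    if q: "q < d" and I: "?Inv q \<rho>' \<alpha>' xs'" and r: "\<rho>' MX = n" for q \<rho>' \<alpha>' xs'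
  proof -
    define s :: nat where "s = 2 ^ q"
    have s: "0 < s" "s \<le> n" using q d by (simp_all add: s_def)
    have inner: "run (WHILE V MX \<oplus> C 1 \<ominus> (V I \<oplus> V S) DO pack_inner) (\<rho>'(I := 0)) \<alpha>' xs' (300 * n * \<kappa>)
        (\<lambda>\<rho>' \<alpha>' xs'. \<alpha>' Out = level f \<beta> (2 * s) \<and> xs' = xs)"
      using run_pack_inner[OF assms(1-5) f f0 s, of "\<rho>'(I := 0)" \<alpha>' xs'] I r by (simp add: s_def)
    \<comment> \<open>Squaring \<open>P\<close> produces \<open>\<beta> ^ (2 * s)\<close> itself, a
      number of \<open>2 * s + 1\<close> digits; \<open>3 * s\<close> digits suffice because
      \<open>0 < s\<close>.\<close>
    have \<mu>: "6 \<le> 3 * s * \<kappa>" using s(1) assms(1) mult_le_mono1[of 1 "3 * s" \<kappa>] by linarith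
    have pw: "\<beta> ^ s * \<beta> ^ s = \<beta> ^ (2 * s)" by (simp add: power_add mult_2)
    have b2: "\<beta> ^ s < \<beta> ^ (3 * s)" "\<beta> ^ (2 * s) < \<beta> ^ (3 * s)"
      using s(1) assms(4) by (intro power_strict_increasing; simp)+
    have b: "short (3 * s * \<kappa>) (\<beta> ^ s)" "short (3 * s * \<kappa>) (\<beta> ^ (2 * s))"
      by (rule short_power[OF assms(2,5) b2(1)] short_power[OF assms(2,5) b2(2)]; use s(1) in simp)+
    have sn: "s * \<kappa> \<le> n * \<kappa>" using s(2) by simp
    have fin: "run (S ::= V S \<otimes> C 2 ;; P ::= V P \<otimes> V P) \<rho>'' \<alpha>'' xs'' (10 * \<kappa> + 33 * (n * \<kappa>)) (?Inv (Suc q))"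
      if "\<rho>'' S = s" "\<rho>'' P = \<beta> ^ s" "\<alpha>'' Out = level f \<beta> (2 * s) \<and> xs'' = xs" for \<rho>'' \<alpha>'' xs''
    proof (rule run_prefix[OF assms(1)])
      have "run (P ::= V P \<otimes> V P) (\<rho>''(S := 2 * s)) \<alpha>'' xs'' (33 * (n * \<kappa>)) (?Inv (Suc q))"
        using that b pw sn by (intro run_flat[OF \<mu>]) (simp_all add: s_def)
      then show "wpc \<kappa> (S ::= V S \<otimes> C 2) \<rho>'' \<alpha>'' (\<lambda>\<rho> \<alpha>. run (P ::= V P \<otimes> V P) \<rho> \<alpha> xs'' (33 * (n * \<kappa>)) (?Inv
        (Suc q)))"
        using that s assms(3) by (simp add: sU mult.commute)
    qed simp
    have "run (WHILE V MX \<oplus> C 1 \<ominus> (V I \<oplus> V S) DO pack_inner ;;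
      S ::= V S \<otimes> C 2 ;;
        P ::= V P \<otimes> V P) (\<rho>'(I := 0)) \<alpha>' xs' (300 * n * \<kappa> + (10 * \<kappa> + 33 * (n * \<kappa>))) (?Inv (Suc q))"
      by (rule run_Comp[OF inner fin order_refl]) (use I in \<open>auto simp: same_def s_def\<close>)
    then show ?thesis
      using s mult_le_mono1[of 1 n \<kappa>]
      by (intro run_prefix[OF assms(1), where T' = "300 * n * \<kappa> + (10 * \<kappa> + 33 * (n * \<kappa>))"])
        (simp_all add: sU)
  qed
  let ?loop = "WHILE V MX \<oplus> C 1 \<ominus> V S DO
       (I ::= C 0 ;;
        WHILE V MX \<oplus> C 1 \<ominus> (V I \<oplus> V S) DO pack_inner ;;
        S ::= V S \<otimes> C 2 ;; P ::= V P \<otimes> V P)"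
  have loop: "run ?loop \<rho>' \<alpha>' xs (400 * n * \<kappa>\<^sup>2 + 13 * (\<kappa> + 1) * \<kappa>) (?Inv d)"
    if r: "\<rho>' MX = n" "\<rho>' S = 1" "\<rho>' P = \<beta>" "\<alpha>' Out = f" for \<rho>' \<alpha>'
  proof (rule run_Loop[OF assms(1), where n = d and \<tau> = "\<lambda>_. 400 * n * \<kappa>" and Inv = ?Inv])
    show "?Inv 0 \<rho>' \<alpha>' xs" using r by (simp add: level_1)
  next
    fix q \<rho>'' \<alpha>'' xs''
    assume q: "q < d" and I: "?Inv q \<rho>'' \<alpha>'' xs''"
      and "same (wv (I ::= C 0 ;; WHILE V MX \<oplus> C 1 \<ominus> (V I \<oplus> V S) DO pack_inner ;;
        S ::= V S \<otimes> C 2 ;; P ::= V P \<otimes> V P)) \<rho>' \<rho>''"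
    then have mx: "\<rho>'' MX = n" using r by (simp add: same_def)
    moreover have "2 ^ q \<le> n" using q d by simp
    ultimately have "ebd \<kappa> (V MX \<oplus> C 1 \<ominus> V S) \<rho>'' \<alpha>''" "ev (V MX \<oplus> C 1 \<ominus> V S) \<rho>'' \<alpha>'' \<noteq> 0"
      using I assms(3) by (simp_all add: sU)
    moreover note step[of q \<rho>'' \<alpha>'' xs'', OF q _ mx]
    ultimately show "ebd \<kappa> (V MX \<oplus> C 1 \<ominus> V S) \<rho>'' \<alpha>'' \<and>
       ev (V MX \<oplus> C 1 \<ominus> V S) \<rho>'' \<alpha>'' \<noteq> 0 \<and>
       run (I ::= C 0 ;; WHILE V MX \<oplus> C 1 \<ominus> (V I \<oplus> V S) DO pack_inner ;;
        S ::= V S \<otimes> C 2 ;; P ::= V P \<otimes> V P) \<rho>'' \<alpha>'' xs'' (400 * n * \<kappa>) (?Inv (Suc q))" using I by blast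
  next
    fix \<rho>'' \<alpha>'' xs''
    assume I: "?Inv d \<rho>'' \<alpha>'' xs''"
      and "same (wv (I ::= C 0 ;; WHILE V MX \<oplus> C 1 \<ominus> (V I \<oplus> V S) DO pack_inner ;;
        S ::= V S \<otimes> C 2 ;; P ::= V P \<otimes> V P)) \<rho>' \<rho>''"
    then have mx: "\<rho>'' MX = n" using r by (simp add: same_def)
    with I dn d2 assms(3) show "ebd \<kappa> (V MX \<oplus> C 1 \<ominus> V S) \<rho>'' \<alpha>'' \<and>
       ev (V MX \<oplus> C 1 \<ominus> V S) \<rho>'' \<alpha>'' = 0 \<and> ?Inv d \<rho>'' \<alpha>'' xs''"
      by (simp add: sU)
  next
    have "(\<Sum>i<d. 400 * n * \<kappa>) + (d + 1) * ((esize (V MX \<oplus> C 1 \<ominus> V S) + 1) * \<kappa>)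
      = d * (400 * n * \<kappa>) + 12 * (d + 1) * \<kappa>" by (simp add: algebra_simps)
    also have "\<dots> \<le> \<kappa> * (400 * n * \<kappa>) + 13 * (\<kappa> + 1) * \<kappa>"
      using d\<kappa> by (intro add_mono mult_mono) auto
    finally show "(\<Sum>i<d. 400 * n * \<kappa>) + (d + 1) * ((esize (V MX \<oplus> C 1 \<ominus> V S) + 1) * \<kappa>)
      \<le> 400 * n * \<kappa>\<^sup>2 + 13 * (\<kappa> + 1) * \<kappa>" by (simp add: power2_eq_square ac_simps)
  qed
  have fin: "run (Z ::= A Out (C 0) ;; Out\<langle>C 0\<rangle> ::= C 0) \<rho>' \<alpha>' xs' (50 * ((2 * n + 2) * \<kappa>))
     (\<lambda>\<rho>' \<alpha>' xs'. \<rho>' Z = (\<Sum>i\<le>n. f i * \<beta> ^ i) \<and> \<alpha>' Out = (\<lambda>_. 0) \<and> xs' = xs)"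
    if I: "?Inv d \<rho>' \<alpha>' xs'" for \<rho>' \<alpha>' xs'
  proof -
    define \<mu> where "\<mu> = (2 * n + 2) * \<kappa>"
    have \<mu>: "\<kappa> \<le> \<mu>" by (simp add: \<mu>_def)
    then have \<mu>6: "6 \<le> \<mu>" using assms(1) by linarith
    have "(\<Sum>i<2 ^ d. f i * \<beta> ^ i) = (\<Sum>i\<le>n. f i * \<beta> ^ i)"
      using dn f0 by (intro sum.mono_neutral_right) auto
    then have z: "level f \<beta> (2 ^ d) 0 = (\<Sum>i\<le>n. f i * \<beta> ^ i)" by (simp add: level_def block_def)
    have "short \<mu> (level f \<beta> (2 ^ d) 0)"
    proof (rule short_power[OF assms(2,5) level_less[of f \<beta> "2 ^ d" 0, OF f]])
      show "2 ^ d * \<kappa> \<le> \<mu>" unfolding \<mu>_def using d2 by (intro mult_right_mono) auto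
    qed simp
    moreover have "(level f \<beta> (2 ^ d))(0 := 0) = (\<lambda>_. 0)"
    proof
      fix i
      have "level f \<beta> (2 ^ d) i = 0" if "0 < i"
      proof (cases "2 ^ d dvd i")
        case True
        then have "n < i" using that dn dvd_imp_le[of "2 ^ d" i] by linarith
        then show ?thesis using block_eq_0[OF f0] by (simp add: level_def)
      qed (simp add: level_def)
      then show "((level f \<beta> (2 ^ d))(0 := 0)) i = 0" by simp
    qed
    ultimately show ?thesis
      unfolding \<mu>_def[symmetric] using I z
        by (intro run_flat[OF \<mu>6]) (simp_all add: short_bound[OF assms(2) \<mu>])
  qed
  have main: "run (?loop ;; Z ::= A Out (C 0) ;; Out\<langle>C 0\<rangle> ::= C 0) (\<rho>(S := 1, P := \<beta>)) \<alpha> xs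
     (400 * n * \<kappa>\<^sup>2 + 13 * (\<kappa> + 1) * \<kappa> + 50 * ((2 * n + 2) * \<kappa>))
     (\<lambda>\<rho>' \<alpha>' xs'. \<rho>' Z = (\<Sum>i\<le>n. f i * \<beta> ^ i) \<and> \<alpha>' Out = (\<lambda>_. 0) \<and> xs' = xs)"
    by (rule run_Comp[OF loop fin order_refl]) (use \<rho> in auto)
  have T: "csize (S ::= C 1) * \<kappa> + (csize (P ::= V B) * \<kappa> +
     (400 * n * \<kappa>\<^sup>2 + 13 * (\<kappa> + 1) * \<kappa> + 50 * ((2 * n + 2) * \<kappa>))) \<le> 1000 * (n + 1) * \<kappa>\<^sup>2"
  proof -
    have 1: "\<kappa> \<le> \<kappa> * \<kappa>" using assms(1) by simp
    then have 2: "n * \<kappa> \<le> \<kappa> * (\<kappa> * n)" by simp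
    show ?thesis by (simp add: distrib_left distrib_right power2_eq_square) (use 1 2 in linarith)
  qed
  show ?thesis
    unfolding pack_def
  proof (rule run_prefix[OF assms(1) _ T])
    show "wpc \<kappa> (S ::= C 1) \<rho> \<alpha> (\<lambda>\<rho>' \<alpha>'. run (P ::= V B ;; ?loop ;; Z ::= A Out (C 0) ;;
      Out\<langle>C 0\<rangle> ::= C 0) \<rho>' \<alpha>' xs
      (csize (P ::= V B) * \<kappa> + (400 * n * \<kappa>\<^sup>2 + 13 * (\<kappa> + 1) * \<kappa> + 50 * ((2 * n + 2) * \<kappa>)))
      (\<lambda>\<rho>' \<alpha>' xs'. \<rho>' Z = (\<Sum>i\<le>n. f i * \<beta> ^ i) \<and> \<alpha>' Out = (\<lambda>_. 0) \<and> xs' = xs))"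
      using main \<rho> assms(3,5) run_prefix[OF assms(1) _ order_refl, where c = "P ::= V B" and \<rho> = "\<rho>(S := 1)"
        and \<alpha> = \<alpha>]
      by (simp add: sU del: csize.simps)
  qed
qed

section \<open>Unpacking a number by repeated halving\<close>

definition unpack_inner :: cmd where
  "unpack_inner =
     (Fld\<langle>V I \<oplus> V S\<rangle> ::= A Fld (V I) \<oslash> A Pow (V Q) ;;
      Fld\<langle>V I\<rangle> ::= A Fld (V I) \<ominus> A Fld (V I \<oplus> V S) \<otimes> A Pow (V Q) ;;
      I ::= V I \<oplus> V S \<otimes> C 2)"

definition unpack_powers :: cmd where
  "unpack_powers =
     (Pow\<langle>V Q \<oplus> C 1\<rangle> ::= A Pow (V Q) \<otimes> A Pow (V Q) ;; Q ::= V Q \<oplus> C 1 ;; N ::= V N \<otimes> C 2)"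

definition unpack_split :: cmd where
  "unpack_split =
     (Q ::= V Q \<ominus> C 1 ;; S ::= V S \<oslash> C 2 ;; I ::= C 0 ;; WHILE V N \<ominus> V I DO unpack_inner)"

text \<open>Dividing off one digit at a time would again be quadratic. The powers are computed
  upwards by squaring and used downwards, hence stored. \<open>Fld\<close> is never cleared: entries
  from \<open>N\<close> on may be stale, and callers inspect only those below
  \<open>N\<close>.\<close>

definition unpack :: cmd where
  "unpack =
     (Pow\<langle>C 0\<rangle> ::= V B ;; Q ::= C 0 ;; N ::= C 1 ;;
      WHILE V Z \<oplus> C 1 \<ominus> A Pow (V Q) DO unpack_powers ;;
      Fld\<langle>C 0\<rangle> ::= V Z ;; S ::= V N ;;
      WHILE V Q DO unpack_split)"

lemma wv_unpack [simp]:
  "wv unpack_inner = {I}" "wa unpack_inner = {Fld}" "wv unpack_powers = {Q, N}" "wa unpack_powers = {Pow}"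
  "wv unpack_split = {Q, S, I}" "wa unpack_split = {Fld}"
  "wv unpack = {Q, N, S, I}" "wa unpack = {Pow, Fld}"
  by (auto simp: unpack_inner_def unpack_powers_def unpack_split_def unpack_def)

definition field :: "nat \<Rightarrow> nat \<Rightarrow> nat \<Rightarrow> nat \<Rightarrow> nat" where
  "field \<beta> z s i = z div \<beta> ^ i mod \<beta> ^ s"

text \<open>The machine divides but has no remainder, so the lower half is recovered by multiplying
  the upper half back and subtracting.\<close>

lemma field_split:
  assumes "0 < \<beta>"
  shows "field \<beta> z (2 * s) i div \<beta> ^ s = field \<beta> z s (i + s)"
    and "field \<beta> z (2 * s) i - field \<beta> z s (i + s) * \<beta> ^ s = field \<beta> z s i"
proof -
  have "field \<beta> z (2 * s) i = \<beta> ^ s * field \<beta> z s (i + s) + field \<beta> z s i"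
    by (simp add: field_def mult_2 power_add mod_mult2_eq div_mult2_eq)
  moreover have "field \<beta> z s i < \<beta> ^ s" using assms by (simp add: field_def)
  ultimately show "field \<beta> z (2 * s) i div \<beta> ^ s = field \<beta> z s (i + s)"
    "field \<beta> z (2 * s) i - field \<beta> z s (i + s) * \<beta> ^ s = field \<beta> z s i"
    using assms by simp_all
qed

text \<open>In the invariant, blocks have length \<open>s\<close> to the left of
  \<open>2 * s * a\<close> and \<open>2 * s\<close> to the right. Cells that start no block are
  unconstrained, which tolerates stale contents.\<close>

lemma run_unpack_inner:
  assumes "6 \<le> \<kappa>" "short (\<kappa> - 5) U" "2 * (2 * s * c) + 1 \<le> U" "2 \<le> \<beta>" "\<beta> \<le> U" "q \<le> U"
    and s: "0 < s" "0 < c"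
    and \<rho>: "\<rho> N = 2 * s * c" "\<rho> S = s" "\<rho> Q = q" "\<rho> I = 0" "\<alpha> Pow q = \<beta> ^ s"
      "\<And>j. j < 2 * s * c \<Longrightarrow> 2 * s dvd j \<Longrightarrow> \<alpha> Fld j = field \<beta> z (2 * s) j"
  shows "run (WHILE V N \<ominus> V I DO unpack_inner) \<rho> \<alpha> xs (150 * (2 * s * c) * \<kappa>)
    (\<lambda>\<rho>' \<alpha>' xs'. (\<forall>j<2 * s * c. s dvd j \<longrightarrow> \<alpha>' Fld j = field \<beta> z s j) \<and> xs' = xs)"
proof -
  define \<mu> where "\<mu> = 2 * s * \<kappa>"
  have \<mu>: "\<kappa> \<le> \<mu>" "6 \<le> \<mu>" using s(1) assms(1) mult_le_mono1[of 1 "2 * s" \<kappa>] unfolding \<mu>_def by linarith+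
  note sU = short_bound[OF assms(2) \<mu>(1)]
  note bds = short_bound[OF assms(2) order_refl]
  have sB: "v < \<beta> ^ (2 * s) \<Longrightarrow> short \<mu> v" for v
    using short_power[OF assms(2,5), of v "2 * s" \<mu>] s by (simp add: \<mu>_def)
  let ?Inv = "\<lambda>a \<rho>' \<alpha>' xs'. \<rho>' I = 2 * s * a \<and> xs' = xs \<and>
      (\<forall>j<2 * s * a. s dvd j \<longrightarrow> \<alpha>' Fld j = field \<beta> z s j) \<and>
      (\<forall>j<2 * s * c. 2 * s * a \<le> j \<longrightarrow> 2 * s dvd j \<longrightarrow> \<alpha>' Fld j = field \<beta> z (2 * s) j)"
  show ?thesis
  proof (rule run_Loop[OF assms(1), where n = c and \<tau> = "\<lambda>_. 120 * \<mu>" and Inv = ?Inv])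
    show "?Inv 0 \<rho> \<alpha> xs" using \<rho> by simp
  next
    fix a \<rho>' \<alpha>' xs'
    assume a: "a < c" and I: "?Inv a \<rho>' \<alpha>' xs'"
      and "same (wv unpack_inner) \<rho> \<rho>'" "same (wa unpack_inner) \<alpha> \<alpha>'"
    then have r: "\<rho>' N = 2 * s * c" "\<rho>' S = s" "\<rho>' Q = q" "\<rho>' I = 2 * s * a" "\<alpha>' Pow q = \<beta> ^ s"
      using \<rho> by (simp_all add: same_def)
    have "2 * s * Suc a \<le> 2 * s * c" using a by (intro mult_left_mono) auto
    then have le: "2 * s * a + 2 * s \<le> 2 * s * c" by simp
    then have lt: "2 * s * a < 2 * s * c" using s by linarith
    let ?w = "\<alpha>' Fld (2 * s * a)"
    have w: "?w = field \<beta> z (2 * s) (2 * s * a)" using I lt by simp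
    have b0: "0 < \<beta>" using assms(4) by simp
    note fs = field_split[OF b0, of z s "2 * s * a", folded w]
    have wb: "?w < \<beta> ^ (2 * s)" using b0 by (simp add: w field_def)
    have pb: "\<beta> ^ s < \<beta> ^ (2 * s)" using s assms(4) by (intro power_strict_increasing) auto
    have sh: "short \<mu> ?w" "short \<mu> (\<beta> ^ s)" "short \<mu> (?w div \<beta> ^ s)" "short \<mu> (?w div \<beta> ^ s * \<beta> ^ s)"
      "short \<mu> (?w - ?w div \<beta> ^ s * \<beta> ^ s)"
      by (rule sB; use wb pb in \<open>auto
        intro: le_less_trans[OF div_le_dividend] le_less_trans[OF div_times_less_eq_dividend]
          le_less_trans[OF diff_le_self]\<close>)+
    define F where "F = (\<alpha>' Fld)(2 * s * a + s := ?w div \<beta> ^ s, 2 * s * a := ?w - ?w div \<beta> ^ s * \<beta> ^ s)"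
    have F1: "F j = field \<beta> z s j" if "j < 2 * s * Suc a" "s dvd j" for j
    proof -
      consider "j < 2 * s * a" | "j = 2 * s * a" | "2 * s * a < j" "j < 2 * s * a + s" | "j = 2 * s * a + s"
        | "2 * s * a + s < j" by linarith
      then show ?thesis
      proof cases
        case 1
        then show ?thesis using I that by (simp add: F_def)
      next
        case 2
        then show ?thesis using s fs by (simp add: F_def)
      next
        case 3
        then show ?thesis using that not_dvd_between[of s "2 * a" j] by (simp add: ac_simps)
      next
        case 4
        then show ?thesis using s fs by (simp add: F_def)
      next
        case 5
        then show ?thesis using that not_dvd_between[of s "2 * a + 1" j] by (simp add: algebra_simps)
      qed
    qed
    have F2: "F j = field \<beta> z (2 * s) j" if "j < 2 * s * c" "2 * s * Suc a \<le> j" "2 * s dvd j" for j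
      using I that s by (simp add: F_def)
    have "run unpack_inner \<rho>' \<alpha>' xs' (120 * \<mu>) (\<lambda>\<rho>' \<alpha>' xs'. \<rho>' I = 2 * s * Suc a \<and> xs' = xs \<and> \<alpha>' Fld = F)"
      using r I s assms(3,6) le lt sh
      by (intro run_flat[OF \<mu>(2)]) (simp_all add: unpack_inner_def sU F_def)
    then have "run unpack_inner \<rho>' \<alpha>' xs' (120 * \<mu>) (?Inv (Suc a))"
      by (rule run_conseq) (use F1 F2 in auto)
    moreover have "ebd \<kappa> (V N \<ominus> V I) \<rho>' \<alpha>'" "ev (V N \<ominus> V I) \<rho>' \<alpha>' \<noteq> 0"
      using r le lt assms(3) by (simp_all add: bds)
    ultimately show "ebd \<kappa> (V N \<ominus> V I) \<rho>' \<alpha>' \<and> ev (V N \<ominus> V I) \<rho>' \<alpha>' \<noteq> 0 \<and>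
      run unpack_inner \<rho>' \<alpha>' xs' (120 * \<mu>) (?Inv (Suc a))" by blast
  next
    fix \<rho>' \<alpha>' xs'
    assume "?Inv c \<rho>' \<alpha>' xs'" and "same (wv unpack_inner) \<rho> \<rho>'" "same (wa unpack_inner) \<alpha> \<alpha>'"
    then show "ebd \<kappa> (V N \<ominus> V I) \<rho>' \<alpha>' \<and> ev (V N \<ominus> V I) \<rho>' \<alpha>' = 0 \<and>
      (\<forall>j<2 * s * c. s dvd j \<longrightarrow> \<alpha>' Fld j = field \<beta> z s j) \<and> xs' = xs"
      using \<rho> assms(3) by (simp add: same_def bds)
  next
    have "c * \<kappa> \<le> s * c * \<kappa>" "1 * \<kappa> \<le> s * c * \<kappa>" using s by (auto intro!: mult_le_mono1)
    moreover have "(\<Sum>i<c. 120 * \<mu>) + (c + 1) * ((esize (V N \<ominus> V I) + 1) * \<kappa>) =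
      240 * (s * c * \<kappa>) + 9 * (c * \<kappa>) + 9 * (1 * \<kappa>)" by (simp add: \<mu>_def algebra_simps)
    moreover have "150 * (2 * s * c) * \<kappa> = 300 * (s * c * \<kappa>)" by simp
    ultimately show "(\<Sum>i<c. 120 * \<mu>) + (c + 1) * ((esize (V N \<ominus> V I) + 1) * \<kappa>) \<le> 150 * (2 * s * c) * \<kappa>"
      by linarith
  qed
qed

text \<open>\<open>n\<close> is known to the proof only. The program squares until the power exceeds
  \<open>Z\<close>; by minimality of \<open>d\<close> the previous exponent is below
  \<open>n\<close>, so the number \<open>2 ^ d\<close> of digits overshoots by at most a factor
  2.\<close>

lemma run_unpack:
  assumes "6 \<le> \<kappa>" "short (\<kappa> - 5) U" "4 * n + 4 \<le> U" "2 \<le> \<beta>" "\<beta> \<le> U" "0 < n"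
    and z: "z < \<beta> ^ n"
    and \<rho>: "\<rho> Z = z" "\<rho> B = \<beta>"
  shows "run unpack \<rho> \<alpha> xs (2000 * n * \<kappa>\<^sup>2)
    (\<lambda>\<rho>' \<alpha>' xs'. \<rho>' N \<le> 2 * n \<and> z < \<beta> ^ \<rho>' N \<and> (\<forall>i<\<rho>' N. \<alpha>' Fld i = z div \<beta> ^ i mod \<beta>) \<and> xs' = xs)"
proof -
  note sU = short_bound[OF assms(2) order_refl]
  define d where "d = (LEAST q. z < \<beta> ^ (2 ^ q))"
  have "z < \<beta> ^ (2 ^ n)"
  proof -
    have "\<beta> ^ n \<le> \<beta> ^ (2 ^ n)" using assms(4) by (intro power_increasing) (auto intro: less_imp_le)
    then show ?thesis using z by linarith
  qed
  then have zd: "z < \<beta> ^ (2 ^ d)" unfolding d_def by (rule LeastI)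
  have dle: "\<beta> ^ (2 ^ q) \<le> z" if "q < d" for q
    using not_less_Least[of q "\<lambda>q. z < \<beta> ^ (2 ^ q)"] that by (simp add: d_def)
  have dn: "2 ^ q < n" if "q < d" for q
  proof -
    have "\<beta> ^ (2 ^ q) < \<beta> ^ n" using dle[OF that] z by linarith
    then show ?thesis using assms(4) by (simp add: power_strict_increasing_iff)
  qed
  have d2: "2 ^ d \<le> 2 * n"
    using dn[of "d - 1"] assms(6) by (cases d) auto
  have dn': "d \<le> n"
  proof (cases d)
    case (Suc q)
    then show ?thesis using dn[of q] less_exp[of q] by linarith
  qed simp
  have d\<kappa>: "d \<le> \<kappa>"
  proof (cases d)
    case (Suc q)
    then have "q < bit_len n" using dn[of q] less_bit_len_iff[of n q] assms(6) by simp
    moreover have "bit_len n \<le> \<kappa> - 5" using sU(2)[of n] assms(3) by (simp add: short_def)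
    ultimately show ?thesis using Suc by simp
  qed simp
  define \<mu> where "\<mu> = 2 * n * \<kappa>"
  have \<mu>: "\<kappa> \<le> \<mu>" "6 \<le> \<mu>" using assms(1,6) mult_le_mono1[of 1 "2 * n" \<kappa>] unfolding \<mu>_def by linarith+
  note mU = short_bound[OF assms(2) \<mu>(1)]
  have mB: "v < \<beta> ^ (2 * n) \<Longrightarrow> short \<mu> v" for v
    using short_power[OF assms(2,5), of v "2 * n" \<mu>] assms(6) by (simp add: \<mu>_def)
  have nn: "\<beta> ^ n < \<beta> ^ (2 * n)" using assms(4,6) by (intro power_strict_increasing) auto
  have mz: "short \<mu> z" "short \<mu> (Suc z)" using z nn by (auto intro!: mB)
  have mp: "short \<mu> (\<beta> ^ (2 ^ q))" if "q \<le> d" for q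
  proof (cases q)
    case 0
    then show ?thesis using mU(1)[OF assms(5)] by simp
  next
    case (Suc p)
    then have "2 ^ q < 2 * n" using dn[of p] that by simp
    then show ?thesis using assms(4) by (intro mB power_strict_increasing) auto
  qed
  let ?l1 = "WHILE V Z \<oplus> C 1 \<ominus> A Pow (V Q) DO unpack_powers"
  let ?I1 = "\<lambda>q \<rho>' \<alpha>' xs'. \<rho>' Q = q \<and> \<rho>' N = 2 ^ q \<and> (\<forall>p\<le>q. \<alpha>' Pow p = \<beta> ^ (2 ^ p)) \<and> xs' = xs"
  have l1: "run ?l1 \<rho>' \<alpha>' xs ((\<kappa> + 1) * (100 * \<mu>)) (?I1 d)"
    if r: "\<rho>' Z = z" "\<rho>' Q = 0" "\<rho>' N = 1" "\<alpha>' Pow 0 = \<beta>" for \<rho>' \<alpha>'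
  proof (rule run_Loop[OF \<mu>(2), where n = d and \<tau> = "\<lambda>_. 70 * \<mu>" and Inv = ?I1])
    show "?I1 0 \<rho>' \<alpha>' xs" using r by simp
  next
    fix q \<rho>'' \<alpha>'' xs''
    assume q: "q < d" and I: "?I1 q \<rho>'' \<alpha>'' xs''" and "same (wv unpack_powers) \<rho>' \<rho>''"
    then have r': "\<rho>'' Z = z" "\<rho>'' Q = q" "\<rho>'' N = 2 ^ q" "\<alpha>'' Pow q = \<beta> ^ 2 ^ q" using r
      by (simp_all add: same_def)
    have p: "short \<mu> (\<beta> ^ 2 ^ q)" "short \<mu> (\<beta> ^ 2 ^ q * \<beta> ^ 2 ^ q)"
      using mp[of q] mp[of "Suc q"] q by (simp_all add: power_add mult_2)
    have "Suc q \<le> U" "q \<le> U" "2 * 2 ^ q \<le> U" "2 ^ q \<le> U" using dn[OF q] dn' q assms(3) by linarith+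
    then have "run unpack_powers \<rho>'' \<alpha>'' xs'' (70 * \<mu>) (?I1 (Suc q))"
      using r' p I assms(3)
      by (intro run_flat[OF \<mu>(2)])
         (simp_all add: unpack_powers_def mU le_Suc_eq all_conj_distrib power_add mult_2 mult.commute)
    moreover have "ebd \<mu> (V Z \<oplus> C 1 \<ominus> A Pow (V Q)) \<rho>'' \<alpha>''" "ev (V Z \<oplus> C 1 \<ominus> A Pow (V Q)) \<rho>'' \<alpha>'' \<noteq> 0"
      using r' p mz dle[OF q] \<open>q \<le> U\<close> assms(3) short_le[OF mz(2), of "Suc z - \<beta> ^ 2 ^ q"]
        by (simp_all add: mU)
    ultimately show "ebd \<mu> (V Z \<oplus> C 1 \<ominus> A Pow (V Q)) \<rho>'' \<alpha>'' \<and>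
       ev (V Z \<oplus> C 1 \<ominus> A Pow (V Q)) \<rho>'' \<alpha>'' \<noteq> 0 \<and>
       run unpack_powers \<rho>'' \<alpha>'' xs'' (70 * \<mu>) (?I1 (Suc q))" by blast
  next
    fix \<rho>'' \<alpha>'' xs''
    assume I: "?I1 d \<rho>'' \<alpha>'' xs''" and "same (wv unpack_powers) \<rho>' \<rho>''"
    then have r': "\<rho>'' Z = z" "\<rho>'' Q = d" "\<alpha>'' Pow d = \<beta> ^ 2 ^ d" using r by (simp_all add: same_def)
    then have "ebd \<mu> (V Z \<oplus> C 1 \<ominus> A Pow (V Q)) \<rho>'' \<alpha>''" "ev (V Z \<oplus> C 1 \<ominus> A Pow (V Q)) \<rho>'' \<alpha>'' = 0"
      using mp[of d] mz zd dn' assms(3) by (simp_all add: mU)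
    then show "ebd \<mu> (V Z \<oplus> C 1 \<ominus> A Pow (V Q)) \<rho>'' \<alpha>'' \<and>
       ev (V Z \<oplus> C 1 \<ominus> A Pow (V Q)) \<rho>'' \<alpha>'' = 0 \<and> ?I1 d \<rho>'' \<alpha>'' xs''" using I by blast
  next
    have "(\<Sum>i<d. 70 * \<mu>) + (d + 1) * ((esize (V Z \<oplus> C 1 \<ominus> A Pow (V Q)) + 1) * \<mu>) \<le> (d + 1) * (100 * \<mu>)"
      by (simp add: algebra_simps)
    also have "\<dots> \<le> (\<kappa> + 1) * (100 * \<mu>)" using d\<kappa> by (intro mult_right_mono) auto
    finally show "(\<Sum>i<d. 70 * \<mu>) + (d + 1) * ((esize (V Z \<oplus> C 1 \<ominus> A Pow (V Q)) + 1) * \<mu>)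
       \<le> (\<kappa> + 1) * (100 * \<mu>)" .
  qed
  let ?I2 = "\<lambda>i \<rho>' \<alpha>' xs'. \<rho>' Q = d - i \<and> \<rho>' S = 2 ^ (d - i) \<and>
     (\<forall>j<2 ^ d. 2 ^ (d - i) dvd j \<longrightarrow> \<alpha>' Fld j = field \<beta> z (2 ^ (d - i)) j) \<and> xs' = xs"
  have l2: "run (WHILE V Q DO unpack_split) \<rho>' \<alpha>' xs ((\<kappa> + 1) * (400 * n * \<kappa>)) (?I2 d)"
    if r: "?I2 0 \<rho>' \<alpha>' xs" "\<rho>' N = 2 ^ d" "\<forall>p\<le>d. \<alpha>' Pow p = \<beta> ^ (2 ^ p)" for \<rho>' \<alpha>'
  proof (rule run_Loop[OF assms(1), where n = d and \<tau> = "\<lambda>_. 330 * n * \<kappa>" and Inv = ?I2])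
    show "?I2 0 \<rho>' \<alpha>' xs" by (rule r(1))
  next
    fix i \<rho>'' \<alpha>'' xs''
    assume i: "i < d" and I: "?I2 i \<rho>'' \<alpha>'' xs''" and "same (wv unpack_split) \<rho>' \<rho>''"
      "same (wa unpack_split) \<alpha>' \<alpha>''"
    define q where "q = d - Suc i"
    have q: "d - i = Suc q" "q < d" using i by (simp_all add: q_def)
    define s :: nat where "s = 2 ^ q"
    define c :: nat where "c = 2 ^ i"
    have sc: "2 ^ d = 2 * s * c" using i by (simp add: s_def c_def q_def flip: power_Suc power_add)
    have s: "0 < s" "0 < c" by (simp_all add: s_def c_def)
    have r': "\<rho>'' N = 2 * s * c" "\<rho>'' Q = Suc q" "\<rho>'' S = 2 * s" "\<alpha>'' Pow q = \<beta> ^ s"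
      using r I q \<open>same (wv unpack_split) \<rho>' \<rho>''\<close> \<open>same (wa unpack_split) \<alpha>' \<alpha>''\<close>
        by (simp_all add: same_def sc s_def)
    have le: "2 * (2 * s * c) + 1 \<le> U" using d2 assms(3) unfolding sc by linarith
    have qU: "Suc q \<le> U" "2 * s \<le> U"
    proof -
      show "Suc q \<le> U" using q(2) dn' assms(3) by linarith
      have "2 * s * 1 \<le> 2 * s * c" using s by (intro mult_left_mono) auto
      then show "2 * s \<le> U" using le by linarith
    qed
    have "run (WHILE V N \<ominus> V I DO unpack_inner) (\<rho>''(Q := q, S := s, I := 0)) \<alpha>'' xs'' (150 * (2 * s * c) * \<kappa>)
      (\<lambda>\<rho>' \<alpha>' xs'. (\<forall>j<2 * s * c. s dvd j \<longrightarrow> \<alpha>' Fld j = field \<beta> z s j) \<and> xs' = xs'')"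
      using run_unpack_inner[OF assms(1,2) le assms(4,5) _ s, of q "\<rho>''(Q := q, S := s, I := 0)" \<alpha>'' z xs'']
        r' qU I q sc by (simp add: s_def)
    then have inn: "run (WHILE V N \<ominus> V I DO unpack_inner) (\<rho>''(Q := q, S := s, I := 0)) \<alpha>'' xs'' (300 * n * \<kappa>)
      (?I2 (Suc i))"
    proof (rule run_conseq)
      show "150 * (2 * s * c) * \<kappa> \<le> 300 * n * \<kappa>" using d2 by (simp add: sc)
    qed (use I in \<open>simp add: same_def sc flip: q_def s_def\<close>)
    have a3: "run (I ::= C 0 ;; WHILE V N \<ominus> V I DO unpack_inner) (\<rho>''(Q := q, S := s)) \<alpha>'' xs''
      (csize (I ::= C 0) * \<kappa> + 300 * n * \<kappa>) (?I2 (Suc i))"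
      by (rule run_prefix[OF assms(1) _ order_refl]) (use inn in \<open>simp add: sU\<close>)
    have a2: "run (S ::= V S \<oslash> C 2 ;; I ::= C 0 ;; WHILE V N \<ominus> V I DO unpack_inner) (\<rho>''(Q := q)) \<alpha>'' xs''
      (csize (S ::= V S \<oslash> C 2) * \<kappa> + (csize (I ::= C 0) * \<kappa> + 300 * n * \<kappa>)) (?I2 (Suc i))"
      by (rule run_prefix[OF assms(1) _ order_refl]) (use a3 r' qU assms(3) in \<open>simp add: sU\<close>)
    have "run unpack_split \<rho>'' \<alpha>'' xs'' (330 * n * \<kappa>) (?I2 (Suc i))"
      unfolding unpack_split_def
    proof (rule run_prefix[OF assms(1)])
      show "wpc \<kappa> (Q ::= V Q \<ominus> C 1) \<rho>'' \<alpha>'' (\<lambda>\<rho> \<alpha>. run (S ::= V S \<oslash> C 2 ;; I ::= C 0 ;;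
        WHILE V N \<ominus> V I DO unpack_inner)
         \<rho> \<alpha> xs'' (csize (S ::= V S \<oslash> C 2) * \<kappa> + (csize (I ::= C 0) * \<kappa> + 300 * n * \<kappa>)) (?I2 (Suc i)))"
        using a2 r' qU assms(3) by (simp add: sU)
      show "csize (Q ::= V Q \<ominus> C 1) * \<kappa> + (csize (S ::= V S \<oslash> C 2) * \<kappa> + (csize (I ::= C 0) * \<kappa>
        + 300 * n * \<kappa>)) \<le> 330 * n * \<kappa>"
        using assms(6) mult_le_mono1[of 1 n \<kappa>] by simp
    qed
    then show "ebd \<kappa> (V Q) \<rho>'' \<alpha>'' \<and> ev (V Q) \<rho>'' \<alpha>'' \<noteq> 0 \<and>
       run unpack_split \<rho>'' \<alpha>'' xs'' (330 * n * \<kappa>) (?I2 (Suc i))"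
      using r' qU by (simp add: sU)
  next
    fix \<rho>'' \<alpha>'' xs''
    assume "?I2 d \<rho>'' \<alpha>'' xs''"
    then show "ebd \<kappa> (V Q) \<rho>'' \<alpha>'' \<and> ev (V Q) \<rho>'' \<alpha>'' = 0 \<and> ?I2 d \<rho>'' \<alpha>'' xs''" by (simp add: sU)
  next
    have "\<kappa> \<le> n * \<kappa>" using assms(6) by simp
    then have "(d + 1) * (4 * \<kappa>) \<le> (d + 1) * (4 * (n * \<kappa>))" by (intro mult_left_mono) auto
    moreover have "(\<Sum>i<d. 330 * n * \<kappa>) + (d + 1) * ((esize (V Q) + 1) * \<kappa>) = d * (330 * n * \<kappa>) + (d
      + 1) * (4 * \<kappa>)"
      by simp
    ultimately have "(\<Sum>i<d. 330 * n * \<kappa>) + (d + 1) * ((esize (V Q) + 1) * \<kappa>) \<le> d * (330 * n * \<kappa>) + (d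
      + 1) * (4 * (n * \<kappa>))"
      by linarith
    also have "\<dots> \<le> (d + 1) * (400 * n * \<kappa>)" by (simp add: algebra_simps)
    also have "\<dots> \<le> (\<kappa> + 1) * (400 * n * \<kappa>)" using d\<kappa> by (intro mult_right_mono) auto
    finally show "(\<Sum>i<d. 330 * n * \<kappa>) + (d + 1) * ((esize (V Q) + 1) * \<kappa>) \<le> (\<kappa> + 1) * (400 * n * \<kappa>)" .
  qed
  let ?post = "\<lambda>\<rho>' \<alpha>' xs'. \<rho>' N \<le> 2 * n \<and> z < \<beta> ^ \<rho>' N \<and> (\<forall>i<\<rho>' N. \<alpha>' Fld i = z div \<beta> ^ i mod \<beta>) \<and> xs' = xs"
  let ?T2 = "(\<kappa> + 1) * (400 * n * \<kappa>)"
  have tail: "run (Fld\<langle>C 0\<rangle> ::= V Z ;; S ::= V N ;; WHILE V Q DO unpack_split) \<rho>' \<alpha>' xs'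
     (12 * \<mu> + (6 * \<kappa> + ?T2)) ?post"
    if I: "?I1 d \<rho>' \<alpha>' xs'" and r: "\<rho>' Z = z" for \<rho>' \<alpha>' xs'
  proof -
    let ?a = "\<alpha>'(Fld := (\<alpha>' Fld)(0 := z))"
    have "?I2 0 (\<rho>'(S := 2 ^ d)) ?a xs"
    proof -
      have "j = 0" if "j < 2 ^ d" "2 ^ d dvd j" for j :: nat
        using that by (meson dvd_imp_le gr0I not_less)
      then show ?thesis using I zd by (auto simp: field_def)
    qed
    then have "run (WHILE V Q DO unpack_split) (\<rho>'(S := 2 ^ d)) ?a xs ?T2 (?I2 d)"
      by (rule l2) (use I in auto)
    \<comment> \<open>\<open>back_subst\<close> only exchanges the tape \<open>xs\<close> for the
      equal tape \<open>xs'\<close>.\<close>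
    then have "run (WHILE V Q DO unpack_split) (\<rho>'(S := 2 ^ d)) ?a xs' ?T2 ?post"
      by (rule back_subst[of "\<lambda>u. run _ _ _ u _ _", OF run_conseq[OF _ order_refl]])
         (use I d2 zd in \<open>simp_all add: same_def field_def\<close>)
    then have "run (S ::= V N ;; WHILE V Q DO unpack_split) \<rho>' ?a xs' (6 * \<kappa> + ?T2) ?post"
      using I d2 assms(3) by (intro run_prefix[OF assms(1), where T' = ?T2]) (simp_all add: sU)
    then show ?thesis
      using I r mz by (intro run_prefix[OF \<mu>(2), where T' = "6 * \<kappa> + ?T2"]) (simp_all add: mU)
  qed
  let ?T1 = "(\<kappa> + 1) * (100 * \<mu>)"
  have main: "run (?l1 ;; Fld\<langle>C 0\<rangle> ::= V Z ;; S ::= V N ;; WHILE V Q DO unpack_split)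
     (\<rho>(Q := 0, N := 1)) (\<alpha>(Pow := (\<alpha> Pow)(0 := \<beta>))) xs (?T1 + (12 * \<mu> + (6 * \<kappa> + ?T2))) ?post"
    by (rule run_Comp[OF l1 tail order_refl]) (use \<rho> in \<open>simp_all add: same_def\<close>)
  have m2: "run (N ::= C 1 ;; ?l1 ;; Fld\<langle>C 0\<rangle> ::= V Z ;; S ::= V N ;; WHILE V Q DO unpack_split)
     (\<rho>(Q := 0)) (\<alpha>(Pow := (\<alpha> Pow)(0 := \<beta>))) xs (4 * \<kappa> + (?T1 + (12 * \<mu> + (6 * \<kappa> + ?T2)))) ?post"
    using main assms(3) by (intro run_prefix[OF assms(1), where T' = "?T1 + (12 * \<mu> + (6 * \<kappa>
      + ?T2))"]) (simp_all add: sU)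
  have m1: "run (Q ::= C 0 ;; N ::= C 1 ;; ?l1 ;; Fld\<langle>C 0\<rangle> ::= V Z ;; S ::= V N ;; WHILE V Q DO unpack_split)
     \<rho> (\<alpha>(Pow := (\<alpha> Pow)(0 := \<beta>))) xs (4 * \<kappa> + (4 * \<kappa> + (?T1 + (12 * \<mu> + (6 * \<kappa> + ?T2))))) ?post"
    using m2 assms(3) by (intro run_prefix[OF assms(1), where T' = "4 * \<kappa> + (?T1 + (12 * \<mu> + (6 * \<kappa>
      + ?T2)))"]) (simp_all add: sU)
  show ?thesis
    unfolding unpack_def
  proof (rule run_prefix[OF assms(1), where T' = "4 * \<kappa> + (4 * \<kappa> + (?T1 + (12 * \<mu> + (6 * \<kappa> + ?T2))))"])
    show "wpc \<kappa> (Pow\<langle>C 0\<rangle> ::= V B) \<rho> \<alpha> (\<lambda>\<rho> \<alpha>. run (Q ::= C 0 ;; N ::= C 1 ;; ?l1 ;;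
       Fld\<langle>C 0\<rangle> ::= V Z ;; S ::= V N ;; WHILE V Q DO unpack_split) \<rho> \<alpha> xs
       (4 * \<kappa> + (4 * \<kappa> + (?T1 + (12 * \<mu> + (6 * \<kappa> + ?T2))))) ?post)"
      using m1 \<rho> assms(3,5) by (simp add: sU)
    have 1: "n * \<kappa> \<le> n * (\<kappa> * \<kappa>)" "\<kappa> \<le> n * \<kappa>" using assms(1,6) by simp_all
    have 2: "csize (Pow\<langle>C 0\<rangle> ::= V B) * \<kappa> + (4 * \<kappa> + (4 * \<kappa> + (?T1 + (12 * \<mu> + (6 * \<kappa> + ?T2))))) =
        26 * \<kappa> + 624 * (n * \<kappa>) + 600 * (n * (\<kappa> * \<kappa>))"
      by (simp add: \<mu>_def algebra_simps)
    have "2000 * n * \<kappa>\<^sup>2 = 2000 * (n * (\<kappa> * \<kappa>))" by (simp add: power2_eq_square)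
    with 1 2 show "csize (Pow\<langle>C 0\<rangle> ::= V B) * \<kappa> + (4 * \<kappa> + (4 * \<kappa> + (?T1 + (12 * \<mu> + (6 * \<kappa> + ?T2)))))
      \<le> 2000 * n * \<kappa>\<^sup>2"
      by linarith
  qed
qed

section \<open>Truncation of tables\<close>

text \<open>Position \<open>i\<close> in radix \<open>Rs * Rc\<close> describes the
  \<open>i\<close>-th subset: the sum is its low part, in radix \<open>Rs\<close>, the cardinality
  its high part. This order is what makes the last cardinality lead the code.\<close>

definition sdig :: "nat \<Rightarrow> nat \<Rightarrow> nat \<Rightarrow> nat \<Rightarrow> nat" where
  "sdig Rs Rc e i = e div (Rs * Rc) ^ i mod Rs"

definition cdig :: "nat \<Rightarrow> nat \<Rightarrow> nat \<Rightarrow> nat \<Rightarrow> nat" where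
  "cdig Rs Rc e i = e div (Rs * Rc) ^ i div Rs mod Rc"

definition code :: "nat \<Rightarrow> nat \<Rightarrow> nat \<Rightarrow> (nat \<Rightarrow> nat) \<Rightarrow> (nat \<Rightarrow> nat) \<Rightarrow> nat" where
  "code Rs Rc k j s = (\<Sum>i<k. (Rs * Rc) ^ i * (Rs * j i + s i))"

definition decode_step :: cmd where
  "decode_step =
     (SS ::= V X \<ominus> V X \<oslash> V RS \<otimes> V RS ;;
      X ::= V X \<oslash> V RS ;;
      CC ::= V X \<ominus> V X \<oslash> V RC \<otimes> V RC ;;
      X ::= V X \<oslash> V RC ;;
      S2 ::= V PL \<otimes> V SS \<oplus> V PR \<otimes> V CC ;;
      BAD ::= V BAD \<oplus> (V SS \<ominus> V PS) \<oplus> (V CC \<ominus> V CM) \<oplus> (V S2 \<ominus> V PT) ;;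
      Y ::= V Y \<oplus> V M \<otimes> (V RT \<otimes> V CC \<oplus> V S2) ;;
      M ::= V M \<otimes> (V RT \<otimes> V RC) ;;
      J ::= V J \<oplus> C 1)"

definition decode :: "nat \<Rightarrow> cmd" where
  "decode k =
     ((X ::= V E ;; Y ::= C 0 ;; M ::= C 1 ;; BAD ::= C 0 ;; J ::= C 0) ;;
      WHILE C k \<ominus> V J DO decode_step)"

definition clip_step :: "nat \<Rightarrow> cmd" where
  "clip_step k =
     (IF A Fld (V E)
      THEN (decode k ;;
        IF V BAD THEN Nop ELSE (Out\<langle>V Y\<rangle> ::= C 1 ;; IF V Y \<ominus> V MX THEN MX ::= V Y ELSE Nop))
      ELSE Nop ;;
      E ::= V E \<oplus> C 1)"

text \<open>The same routine truncates products (coefficients 1 and 0, equal layouts) and changes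
  the sums of a class. A nonzero coefficient of any size is reset to the digit 1. \<open>MX\<close>
  tracks the largest accepted code, so that packing pays only for the digits of the result.\<close>

definition clip :: "nat \<Rightarrow> cmd" where
  "clip k = (unpack ;; (MX ::= C 0 ;; E ::= C 0) ;; WHILE V N \<ominus> V E DO clip_step k ;; pack)"

lemma wv_clip [simp]:
  "wv decode_step = {SS, X, CC, S2, BAD, Y, M, J}" "wa decode_step = {}"
  "wv (decode k) = {SS, X, CC, S2, BAD, Y, M, J}" "wa (decode k) = {}"
  "wv (clip_step k) = {SS, X, CC, S2, BAD, Y, M, J, MX, E}" "wa (clip_step k) = {Out}"
  "wv (clip k) = {Q, N, S, I, SS, X, CC, S2, BAD, Y, M, J, MX, E, P, Z}" "wa (clip k) = {Pow, Fld, Out}"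
  by (auto simp: decode_step_def decode_def clip_step_def clip_def)

text \<open>The registers hold the input layout \<open>(Rs, Rc)\<close>, the output layout \<open>(Rt, Rc)\<close>, the bounds \<open>b\<close>,
  \<open>c\<close>, \<open>b'\<close>, and the coefficients of the change of sums \<open>s \<mapsto> l * s + r * j\<close>.\<close>

definition layout :: "vars \<Rightarrow> nat \<Rightarrow> nat \<Rightarrow> nat \<Rightarrow> nat \<Rightarrow> nat \<Rightarrow> nat \<Rightarrow> nat \<Rightarrow> nat \<Rightarrow> bool" where
  "layout \<rho> Rs Rc Rt l r b c b' \<longleftrightarrow> \<rho> RS = Rs \<and> \<rho> RC = Rc \<and> \<rho> RT = Rt \<and> \<rho> PL = l \<and> \<rho> PR = r \<and>
     \<rho> PS = b \<and> \<rho> CM = c \<and> \<rho> PT = b'"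

definition fits :: "nat \<Rightarrow> nat \<Rightarrow> nat \<Rightarrow> nat \<Rightarrow> nat \<Rightarrow> nat \<Rightarrow> nat \<Rightarrow> nat \<Rightarrow> nat \<Rightarrow> bool" where
  "fits k Rs Rc l r b c b' e \<longleftrightarrow> (\<forall>i<k. sdig Rs Rc e i \<le> b \<and> cdig Rs Rc e i \<le> c \<and>
     l * sdig Rs Rc e i + r * cdig Rs Rc e i \<le> b')"

definition recode :: "nat \<Rightarrow> nat \<Rightarrow> nat \<Rightarrow> nat \<Rightarrow> nat \<Rightarrow> nat \<Rightarrow> nat \<Rightarrow> nat" where
  "recode k Rs Rc Rt l r e = code Rt Rc k (cdig Rs Rc e) (\<lambda>i. l * sdig Rs Rc e i + r * cdig Rs Rc e i)"

lemma recode_Suc: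
  "recode (Suc i) Rs Rc Rt l r e = recode i Rs Rc Rt l r e +
     (Rt * Rc) ^ i * (Rt * cdig Rs Rc e i + (l * sdig Rs Rc e i + r * cdig Rs Rc e i))"
  by (simp add: recode_def code_def)

lemma fits_Suc:
  "fits (Suc i) Rs Rc l r b c b' e \<longleftrightarrow> fits i Rs Rc l r b c b' e \<and> sdig Rs Rc e i \<le> b \<and> cdig Rs Rc e i \<le> c \<and>
     l * sdig Rs Rc e i + r * cdig Rs Rc e i \<le> b'"
  by (auto simp: fits_def less_Suc_eq)

text \<open>Bounds whatever is formed from one digit. The digits are not assumed admissible, since
  rejected codes are recoded too; this is why \<open>l * Rs + r * Rc\<close> enters with full
  radices.\<close>

definition wide :: "nat \<Rightarrow> nat \<Rightarrow> nat \<Rightarrow> nat \<Rightarrow> nat \<Rightarrow> nat \<Rightarrow> bool" where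
  "wide W Rs Rc Rt l r \<longleftrightarrow> 0 < Rs \<and> 0 < Rc \<and> 0 < Rt \<and> 2 \<le> W \<and> Rs * Rc \<le> W \<and> Rt * Rc \<le> W \<and> l * Rs + r * Rc \<le> W"

lemma wideD:
  assumes "wide W Rs Rc Rt l r"
  shows "Rs \<le> W" "Rc \<le> W" "Rt \<le> W" "l \<le> W" "r \<le> W"
proof -
  have "Rs * 1 \<le> Rs * Rc" "1 * Rc \<le> Rs * Rc" "Rt * 1 \<le> Rt * Rc" "l * 1 \<le> l * Rs" "r * 1 \<le> r * Rc"
    using assms unfolding wide_def by (intro mult_le_mono; simp)+
  then show "Rs \<le> W" "Rc \<le> W" "Rt \<le> W" "l \<le> W" "r \<le> W"
    using assms unfolding wide_def by linarith+
qed

lemma wide_digits: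
  assumes "wide W Rs Rc Rt l r"
  shows "sdig Rs Rc e i \<le> W" "cdig Rs Rc e i \<le> W"
    "l * sdig Rs Rc e i + r * cdig Rs Rc e i \<le> W" "Rt * cdig Rs Rc e i \<le> W"
proof -
  have p: "0 < Rs" "0 < Rc" and b: "l * Rs + r * Rc \<le> W" "Rt * Rc \<le> W" using assms by (simp_all add: wide_def)
  have d: "sdig Rs Rc e i < Rs" "cdig Rs Rc e i < Rc" using p by (simp_all add: sdig_def cdig_def)
  then show "sdig Rs Rc e i \<le> W" "cdig Rs Rc e i \<le> W" using wideD[OF assms] by linarith+
  have "l * sdig Rs Rc e i \<le> l * Rs" "r * cdig Rs Rc e i \<le> r * Rc" "Rt * cdig Rs Rc e i \<le> Rt * Rc"
    using d by simp_all
  then show "l * sdig Rs Rc e i + r * cdig Rs Rc e i \<le> W" "Rt * cdig Rs Rc e i \<le> W" using b by linarith+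
qed

text \<open>A rejected code may overflow the output layout, so its radices give no bound. Each new
  term is at most \<open>2 * W ^ Suc i\<close>; adding it to the sum so far doubles this value, and
  \<open>2 \<le> W\<close> absorbs the doubling.\<close>

lemma recode_le:
  assumes "wide W Rs Rc Rt l r"
  shows "recode i Rs Rc Rt l r e \<le> 2 * W ^ Suc i"
proof (induction i)
  case (Suc i)
  have W: "2 \<le> W" "Rt * Rc \<le> W" using assms by (simp_all add: wide_def)
  have "(Rt * Rc) ^ i * (Rt * cdig Rs Rc e i + (l * sdig Rs Rc e i + r * cdig Rs Rc e i)) \<le> W ^ i * (W + W)"
    using wide_digits[OF assms, of e i] W by (intro mult_le_mono power_mono add_mono) auto
  also have "W ^ i * (W + W) = 2 * W ^ Suc i" by (simp add: mult_2 algebra_simps)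
  finally have "recode (Suc i) Rs Rc Rt l r e \<le> 2 * (2 * W ^ Suc i)" using Suc unfolding recode_Suc
    by linarith
  also have "\<dots> \<le> 2 * (W * W ^ Suc i)" using W by (intro mult_left_mono mult_right_mono) auto
  finally show ?case by simp
qed (simp add: recode_def code_def)

lemma run_decode:
  assumes "6 \<le> \<kappa>" "short (\<kappa> - 5) U" "3 * W ^ Suc k \<le> U" "e \<le> U" and wide: "wide W Rs Rc Rt l r"
    and \<rho>: "layout \<rho> Rs Rc Rt l r b c b'" "\<rho> E = e" "b \<le> U" "c \<le> U" "b' \<le> U"
  shows "run (decode k) \<rho> \<alpha> xs ((300 * k + 50) * \<kappa>)
    (\<lambda>\<rho>' \<alpha>' xs'. \<rho>' Y = recode k Rs Rc Rt l r e \<and> (\<rho>' BAD = 0 \<longleftrightarrow> fits k Rs Rc l r b c b' e) \<and> \<rho>' BAD \<le> U \<and>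
       \<alpha>' = \<alpha> \<and> xs' = xs)"
proof -
  note sU = short_bound[OF assms(2) order_refl]
  have W: "2 \<le> W" "Rs * Rc \<le> W" "Rt * Rc \<le> W" and pos: "0 < Rs" "0 < Rc" using wide
    by (simp_all add: wide_def)
  have kW: "i \<le> W ^ i" for i :: nat
    using less_exp[of i] power_mono[OF W(1), of i] by linarith
  have mono: "W ^ i \<le> W ^ k" if "i \<le> k" for i using W(1) that by (intro power_increasing) auto
  \<comment> \<open>\<open>BAD\<close> gains at most three excesses of size \<open>W\<close> per
    digit, and the factor \<open>i\<close> is covered by \<open>W ^ i\<close>.\<close>
  have bad: "3 * W * i \<le> U" if "i \<le> k" for i
  proof -
    have "W * i \<le> W * W ^ k" using kW[of i] mono[OF that] by (intro mult_le_mono2) linarith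
    then show ?thesis using assms(3) unfolding power_Suc mult.assoc by linarith
  qed
  have WU: "W \<le> U" "1 \<le> U"
  proof -
    have "W * 1 \<le> W * W ^ k" using W(1) by (intro mult_le_mono2) simp
    then show "W \<le> U" using assms(3) unfolding power_Suc by linarith
    then show "1 \<le> U" using W(1) by linarith
  qed
  let ?Inv = "\<lambda>i \<rho>' \<alpha>' xs'. \<rho>' J = i \<and> \<rho>' X = e div (Rs * Rc) ^ i \<and> \<rho>' Y = recode i Rs Rc Rt l r e \<and>
      \<rho>' M = (Rt * Rc) ^ i \<and> (\<rho>' BAD = 0 \<longleftrightarrow> fits i Rs Rc l r b c b' e) \<and> \<rho>' BAD \<le> 3 * W * i \<and> \<alpha>' = \<alpha> \<and>
        xs' = xs"
  let ?post = "\<lambda>\<rho>' \<alpha>' xs'. \<rho>' Y = recode k Rs Rc Rt l r e \<and> (\<rho>' BAD = 0 \<longleftrightarrow> fits k Rs Rc l r b c b' e) \<and>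
      \<rho>' BAD \<le> U \<and> \<alpha>' = \<alpha> \<and> xs' = xs"
  let ?\<rho> = "\<rho>(X := e, Y := 0, M := 1, BAD := 0, J := 0)"
  have loop: "run (WHILE C k \<ominus> V J DO decode_step) ?\<rho> \<alpha> xs (300 * k * \<kappa> + 10 * \<kappa>) ?post"
  proof (rule run_Loop[OF assms(1), where n = k and \<tau> = "\<lambda>_. 250 * \<kappa>" and Inv = ?Inv])
    show "?Inv 0 ?\<rho> \<alpha> xs" by (simp add: recode_def code_def fits_def)
  next
    fix i \<rho>' \<alpha>' xs'
    assume i: "i < k" and I: "?Inv i \<rho>' \<alpha>' xs'" and "same (wv decode_step) ?\<rho> \<rho>'"
    then have r: "\<rho>' RS = Rs" "\<rho>' RC = Rc" "\<rho>' RT = Rt" "\<rho>' PL = l" "\<rho>' PR = r" "\<rho>' PS = b" "\<rho>' CM = c"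
      "\<rho>' PT = b'"
      using \<rho>(1) by (simp_all add: same_def layout_def)
    define x where "x = e div (Rs * Rc) ^ i"
    define ss where "ss = sdig Rs Rc e i"
    define cc where "cc = cdig Rs Rc e i"
    define M' where "M' = (Rt * Rc) ^ i"
    define y where "y = recode i Rs Rc Rt l r e"
    define bd where "bd = \<rho>' BAD"
    have x: "x mod Rs = ss" "x div Rs mod Rc = cc" by (simp_all add: x_def ss_def cc_def sdig_def cdig_def)
    have x': "x - x div Rs * Rs = ss" "x div Rs - x div Rs div Rc * Rc = cc"
      using x by (simp_all add: minus_div_mult_eq_mod)
    have xU: "x \<le> U" unfolding x_def using div_le_dividend assms(4) by (rule le_trans)
    have xU': "x div Rs \<le> U" "x div Rs * Rs \<le> U" "x div Rs div Rc \<le> U" "x div Rs div Rc * Rc \<le> U"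
      using xU div_le_dividend div_times_less_eq_dividend by (meson le_trans)+
    note wd = wideD[OF wide]
    note dg = wide_digits[OF wide, of e i, folded ss_def cc_def]
    have dg': "l * ss \<le> W" "r * cc \<le> W" using dg(3) by linarith+
    have Wi: "W ^ Suc i \<le> W ^ k" using i by (intro mono) simp
    have Wk: "W ^ k \<le> W ^ Suc k" using W(1) by simp
    have M'W: "M' \<le> W ^ i" unfolding M'_def using W(3) by (rule power_mono) simp
    have M'1: "M' * (Rt * Rc) \<le> W ^ i * W" using M'W W(3) by (rule mult_le_mono)
    have M'2: "M' * (Rt * cc + (l * ss + r * cc)) \<le> W ^ i * (W + W)"
      using M'W dg by (intro mult_le_mono add_mono) auto
    have y2: "y + M' * (Rt * cc + (l * ss + r * cc)) \<le> 2 * W ^ Suc (Suc i)"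
      using recode_le[OF wide, of "Suc i" e] by (simp add: recode_Suc y_def M'_def ss_def cc_def)
    have yy: "y \<le> 2 * W ^ Suc i" unfolding y_def by (rule recode_le[OF wide])
    have W2: "W ^ Suc (Suc i) \<le> W ^ Suc k" using W(1) i by (intro power_increasing) auto
    have Ub: "M' \<le> U" "M' * (Rt * Rc) \<le> U" "M' * (Rt * cc + (l * ss + r * cc)) \<le> U"
      "y + M' * (Rt * cc + (l * ss + r * cc)) \<le> U" "y \<le> U"
    proof -
      define a b d z where abdz: "a = W ^ Suc i" "b = W ^ k" "d = W ^ Suc (Suc i)" "z = W ^ Suc k"
      have "M' \<le> b" using M'W mono[of i] i by (simp add: abdz)
      moreover have "M' * (Rt * Rc) \<le> a" using M'1 by (simp add: abdz mult.commute)
      moreover have "M' * (Rt * cc + (l * ss + r * cc)) \<le> 2 * a"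
      proof -
        have "W ^ i * (W + W) = 2 * a" by (simp add: abdz algebra_simps)
        then show ?thesis using M'2 by (simp only:)
      qed
      moreover have "y + M' * (Rt * cc + (l * ss + r * cc)) \<le> 2 * d" "y \<le> 2 * a" "a \<le> b" "b \<le> z" "d \<le> z"
        "3 * z \<le> U"
        using y2 yy Wi Wk W2 assms(3) unfolding abdz by simp_all
      ultimately show "M' \<le> U" "M' * (Rt * Rc) \<le> U" "M' * (Rt * cc + (l * ss + r * cc)) \<le> U"
        "y + M' * (Rt * cc + (l * ss + r * cc)) \<le> U" "y \<le> U"
        by linarith+
    qed
    have Ub2: "Rt * cc \<le> U" "l * ss + r * cc \<le> U" "l * ss \<le> U" "r * cc \<le> U" "ss \<le> U" "cc \<le> U"
      "Rs \<le> U" "Rc \<le> U" "Rt \<le> U" "l \<le> U" "r \<le> U" "Rt * Rc \<le> U"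
      using dg dg' wd W WU by linarith+
    have bdl: "bd \<le> 3 * W * i" using I by (simp add: bd_def)
    have b1: "bd + (ss - b) + (cc - c) + (l * ss + r * cc - b') \<le> 3 * W * Suc i"
      using bdl dg by simp
    have b1U: "3 * W * Suc i \<le> U" using i by (intro bad) simp
    have Ub3: "bd \<le> U" "bd + (ss - b) \<le> U" "bd + (ss - b) + (cc - c) \<le> U"
      "bd + (ss - b) + (cc - c) + (l * ss + r * cc - b') \<le> U" "ss - b \<le> U" "cc - c \<le> U"
        "l * ss + r * cc - b' \<le> U"
      using b1 b1U by linarith+
    have tot: "Rt * cc + (l * ss + r * cc) \<le> U"
    proof -
      have "Rt * cc + (l * ss + r * cc) \<le> 2 * W ^ 1" using dg by simp
      also have "\<dots> \<le> 2 * W ^ Suc k" using W(1) by (intro mult_left_mono power_increasing) auto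
      finally show ?thesis using assms(3) by linarith
    qed
    have kU: "Suc i \<le> U" "k \<le> U" using kW[of k] Wk assms(3) i by linarith+
    have iS: "short \<kappa> i" "short \<kappa> (Suc 0)" by (rule sU(1); use kU WU in linarith)+
    have nx: "x div Rs div Rc = e div (Rs * Rc) ^ Suc i"
      by (simp add: x_def div_mult2_eq[symmetric] mult.commute mult.assoc)
    have nb: "bd + (ss - b) + (cc - c) + (l * ss + r * cc - b') = 0 \<longleftrightarrow> fits (Suc i) Rs Rc l r b c b' e"
      using I by (auto simp: fits_Suc bd_def ss_def cc_def)
    have "run decode_step \<rho>' \<alpha>' xs' (250 * \<kappa>)
      (\<lambda>\<rho>'' \<alpha>'' xs''. \<rho>'' J = Suc i \<and> \<rho>'' X = x div Rs div Rc \<and>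
        \<rho>'' Y = y + M' * (Rt * cc + (l * ss + r * cc)) \<and>
        \<rho>'' M = M' * (Rt * Rc) \<and> \<rho>'' BAD = bd + (ss - b) + (cc - c) + (l * ss + r * cc - b') \<and> \<alpha>'' = \<alpha> \<and>
          xs'' = xs)"
    proof (rule run_flat[OF assms(1)])
      have eq: "\<rho>' J = i" "\<rho>' X = x" "\<rho>' Y = y" "\<rho>' M = M'" "\<rho>' BAD = bd" "\<alpha>' = \<alpha>" "xs' = xs"
        using I by (simp_all add: x_def y_def M'_def bd_def)
      show "wpc \<kappa> decode_step \<rho>' \<alpha>' (\<lambda>\<rho>'' \<alpha>''. \<rho>'' J = Suc i \<and> \<rho>'' X = x div Rs div Rc \<and>
        \<rho>'' Y = y + M' * (Rt * cc + (l * ss + r * cc)) \<and>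
        \<rho>'' M = M' * (Rt * Rc) \<and> \<rho>'' BAD = bd + (ss - b) + (cc - c) + (l * ss + r * cc - b') \<and> \<alpha>'' = \<alpha> \<and>
          xs' = xs)"
        unfolding decode_step_def
        by (simp add: iS eq r x x' sU Ub Ub2 Ub3 xU xU' \<rho>(3-5) tot kU WU
          del: add_mult_distrib add_mult_distrib2 diff_diff_left)
    qed (simp add: decode_step_def)
    then have "run decode_step \<rho>' \<alpha>' xs' (250 * \<kappa>) (?Inv (Suc i))"
      by (rule run_conseq[OF _ order_refl])
         (use b1 nx nb in \<open>simp add: recode_Suc y_def M'_def ss_def cc_def mult.commute\<close>)
    moreover have "ebd \<kappa> (C k \<ominus> V J) \<rho>' \<alpha>'" "ev (C k \<ominus> V J) \<rho>' \<alpha>' \<noteq> 0"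
      using I i kU by (simp_all add: sU)
    ultimately show "ebd \<kappa> (C k \<ominus> V J) \<rho>' \<alpha>' \<and> ev (C k \<ominus> V J) \<rho>' \<alpha>' \<noteq> 0 \<and>
       run decode_step \<rho>' \<alpha>' xs' (250 * \<kappa>) (?Inv (Suc i))" by blast
  next
    fix \<rho>' \<alpha>' xs'
    assume "?Inv k \<rho>' \<alpha>' xs'"
    moreover have "k \<le> U"
    proof -
      have "W ^ k \<le> W ^ Suc k" using W(1) by simp
      then show ?thesis using kW[of k] assms(3) by linarith
    qed
    ultimately show "ebd \<kappa> (C k \<ominus> V J) \<rho>' \<alpha>' \<and> ev (C k \<ominus> V J) \<rho>' \<alpha>' = 0 \<and> ?post \<rho>' \<alpha>' xs'"
      using bad[of k] by (simp add: sU)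
  next
    show "(\<Sum>i<k. 250 * \<kappa>) + (k + 1) * ((esize (C k \<ominus> V J) + 1) * \<kappa>) \<le> 300 * k * \<kappa> + 10 * \<kappa>"
      by (simp add: algebra_simps)
  qed
  show ?thesis
    unfolding decode_def
  proof (rule run_prefix[OF assms(1), where T' = "300 * k * \<kappa> + 10 * \<kappa>"])
    show "wpc \<kappa> (X ::= V E ;; Y ::= C 0 ;; M ::= C 1 ;; BAD ::= C 0 ;; J ::= C 0) \<rho> \<alpha>
       (\<lambda>\<rho> \<alpha>. run (WHILE C k \<ominus> V J DO decode_step) \<rho> \<alpha> xs (300 * k * \<kappa> + 10 * \<kappa>) ?post)"
      using loop \<rho>(2) assms(4) WU by (simp add: sU)
  qed (simp add: algebra_simps)
qed

definition ind :: "nat set \<Rightarrow> nat \<Rightarrow> nat" where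
  "ind H i = (if i \<in> H then 1 else 0)"

definition bits :: "nat \<Rightarrow> nat set \<Rightarrow> nat" where
  "bits \<beta> H = (\<Sum>y\<in>H. \<beta> ^ y)"

lemma sum_ind: "\<forall>y\<in>H. y \<le> n \<Longrightarrow> (\<Sum>i\<le>n. ind H i * \<beta> ^ i) = bits \<beta> H"
  unfolding bits_def by (rule sum.mono_neutral_cong_right) (auto simp: ind_def)

lemma run_clip_step:
  assumes "6 \<le> \<kappa>" "short (\<kappa> - 5) U" "3 * W ^ Suc k \<le> U" "Suc e \<le> U" and wide: "wide W Rs Rc Rt l r"
    and \<rho>: "layout \<rho> Rs Rc Rt l r b c b'" "b \<le> U" "c \<le> U" "b' \<le> U"
    and st: "\<rho> E = e" "\<alpha> Fld e \<le> U" "\<alpha> Out = ind H" "\<rho> MX = n" "n \<le> U"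
  shows "run (clip_step k) \<rho> \<alpha> xs ((300 * k + 200) * \<kappa>)
    (\<lambda>\<rho>' \<alpha>' xs'. \<rho>' E = Suc e \<and> xs' = xs \<and>
      (if \<alpha> Fld e \<noteq> 0 \<and> fits k Rs Rc l r b c b' e
       then \<alpha>' Out = ind (insert (recode k Rs Rc Rt l r e) H) \<and> \<rho>' MX = max n (recode k Rs Rc Rt l r e)
       else \<alpha>' Out = ind H \<and> \<rho>' MX = n))"
proof -
  note sU = short_bound[OF assms(2) order_refl]
  let ?y = "recode k Rs Rc Rt l r e"
  have yU: "?y \<le> U" using recode_le[OF wide, of k e] assms(3) by linarith
  let ?mid = "\<lambda>\<rho>' \<alpha>' xs'. \<rho>' E = e \<and> xs' = xs \<and>
      (if \<alpha> Fld e \<noteq> 0 \<and> fits k Rs Rc l r b c b' e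
       then \<alpha>' Out = ind (insert ?y H) \<and> \<rho>' MX = max n ?y else \<alpha>' Out = ind H \<and> \<rho>' MX = n)"
  let ?out = "Out\<langle>V Y\<rangle> ::= C 1 ;; IF V Y \<ominus> V MX THEN MX ::= V Y ELSE Nop"
  have eU: "e \<le> U" "1 \<le> U" using assms(4) by simp_all
  have ins: "(ind H)(?y := Suc 0) = ind (insert ?y H)" by (auto simp: ind_def)
  have inner: "run (decode k ;; IF V BAD THEN Nop ELSE (?out)) \<rho> \<alpha> xs ((300 * k + 50) * \<kappa> + 60 * \<kappa>) ?mid"
    if nz: "\<alpha> Fld e \<noteq> 0"
  proof (rule run_Comp[OF run_decode[OF assms(1-3) eU(1) wide \<rho>(1) st(1) \<rho>(2-4)] _ order_refl])
    fix \<rho>' \<alpha>' xs'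
    assume D: "\<rho>' Y = ?y \<and> (\<rho>' BAD = 0 \<longleftrightarrow> fits k Rs Rc l r b c b' e) \<and> \<rho>' BAD \<le> U \<and> \<alpha>' = \<alpha> \<and> xs' = xs"
      and "same (wv (decode k)) \<rho> \<rho>'"
    then have r: "\<rho>' E = e" "\<rho>' MX = n" using st by (simp_all add: same_def)
    show "run (IF V BAD THEN Nop ELSE (?out)) \<rho>' \<alpha>' xs' (60 * \<kappa>) ?mid"
    proof (rule run_flat[OF assms(1)])
      show "wpc \<kappa> (IF V BAD THEN Nop ELSE (?out)) \<rho>' \<alpha>' (\<lambda>\<rho> \<alpha>. ?mid \<rho> \<alpha> xs')"
        using D r nz st yU eU ins by (cases "?y \<le> n") (simp_all add: sU max_def)
    qed simp
  qed
  have "run (IF A Fld (V E) THEN (decode k ;; IF V BAD THEN Nop ELSE (?out)) ELSE Nop) \<rho> \<alpha> xs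
      (15 * \<kappa> + ((300 * k + 50) * \<kappa> + 60 * \<kappa>)) ?mid"
  proof (rule run_If[OF assms(1)])
    show "ebd \<kappa> (A Fld (V E)) \<rho> \<alpha>" using st eU by (simp add: sU)
    show "run (decode k ;; IF V BAD THEN Nop ELSE (?out)) \<rho> \<alpha> xs ((300 * k + 50) * \<kappa> + 60 * \<kappa>) ?mid"
      if "ev (A Fld (V E)) \<rho> \<alpha> \<noteq> 0" using that st by (intro inner) simp
    show "run Nop \<rho> \<alpha> xs ((300 * k + 50) * \<kappa> + 60 * \<kappa>) ?mid" if "ev (A Fld (V E)) \<rho> \<alpha> = 0"
      using that st assms(1) by (intro run_Nop) simp_all
  qed simp
  then show ?thesis
    unfolding clip_step_def
  proof (rule run_Comp)
    fix \<rho>' \<alpha>' xs'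
    assume "?mid \<rho>' \<alpha>' xs'"
    then show "run (E ::= V E \<oplus> C 1) \<rho>' \<alpha>' xs' (10 * \<kappa>) (\<lambda>\<rho>' \<alpha>' xs'. \<rho>' E = Suc e \<and> xs' = xs \<and>
      (if \<alpha> Fld e \<noteq> 0 \<and> fits k Rs Rc l r b c b' e
       then \<alpha>' Out = ind (insert ?y H) \<and> \<rho>' MX = max n ?y else \<alpha>' Out = ind H \<and> \<rho>' MX = n))"
      using eU assms(4) by (intro run_flat[OF assms(1)]) (simp_all add: sU split: if_splits)
  qed (simp add: algebra_simps)
qed

definition kept :: "nat \<Rightarrow> nat \<Rightarrow> nat \<Rightarrow> nat \<Rightarrow> nat \<Rightarrow> nat \<Rightarrow> nat \<Rightarrow> nat \<Rightarrow> nat \<Rightarrow> nat \<Rightarrow> nat \<Rightarrow> nat \<Rightarrow> nat set" where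
  "kept k \<beta> Rs Rc Rt l r b c b' z m = recode k Rs Rc Rt l r `
     {e. e < m \<and> z div \<beta> ^ e mod \<beta> \<noteq> 0 \<and> fits k Rs Rc l r b c b' e}"

lemma kept_Suc:
  "kept k \<beta> Rs Rc Rt l r b c b' z (Suc m) =
     (if z div \<beta> ^ m mod \<beta> \<noteq> 0 \<and> fits k Rs Rc l r b c b' m
      then insert (recode k Rs Rc Rt l r m) (kept k \<beta> Rs Rc Rt l r b c b' z m)
      else kept k \<beta> Rs Rc Rt l r b c b' z m)"
  by (auto simp: kept_def less_Suc_eq)

lemma kept_eq:
  assumes "z < \<beta> ^ m" "0 < \<beta>"
  shows "kept k \<beta> Rs Rc Rt l r b c b' z m = recode k Rs Rc Rt l r `
     {e. z div \<beta> ^ e mod \<beta> \<noteq> 0 \<and> fits k Rs Rc l r b c b' e}"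
proof -
  have "e < m" if "z div \<beta> ^ e mod \<beta> \<noteq> 0" for e
  proof (rule ccontr)
    assume "\<not> e < m"
    then have "\<beta> ^ m \<le> \<beta> ^ e" using assms(2) by (intro power_increasing) auto
    with assms(1) that show False by simp
  qed
  then show ?thesis by (auto simp: kept_def)
qed

text \<open>Unpacking and inspection are linear in the digits \<open>n\<close> of the argument,
  packing in the bound \<open>n'\<close> on accepted codes only. As accepted codes obey their own
  bound, the extra digits of a product do not inflate later tables.\<close>

lemma run_clip:
  assumes "6 \<le> \<kappa>" "short (\<kappa> - 5) U" "3 * W ^ Suc k \<le> U" "4 * n + 4 \<le> U" "4 * n' + 4 \<le> U" "2 \<le> \<beta>" "\<beta> \<le> U"
    "0 < n"
    and wide: "wide W Rs Rc Rt l r"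
    and \<rho>: "layout \<rho> Rs Rc Rt l r b c b'" "b \<le> U" "c \<le> U" "b' \<le> U"
    and st: "\<rho> Z = z" "z < \<beta> ^ n" "\<rho> B = \<beta>" "\<alpha> Out = (\<lambda>_. 0)"
    and n': "\<And>e. fits k Rs Rc l r b c b' e \<Longrightarrow> z div \<beta> ^ e mod \<beta> \<noteq> 0 \<Longrightarrow> recode k Rs Rc Rt l r e \<le> n'"
  shows "run (clip k) \<rho> \<alpha> xs (5000 * (k + 1) * (n + n' + 1) * \<kappa>\<^sup>2)
    (\<lambda>\<rho>' \<alpha>' xs'. \<rho>' Z = bits \<beta> (recode k Rs Rc Rt l r ` {e. z div \<beta> ^ e mod \<beta> \<noteq> 0 \<and>
      fits k Rs Rc l r b c b' e}) \<and>
       \<alpha>' Out = (\<lambda>_. 0) \<and> xs' = xs)"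
proof -
  note sU = short_bound[OF assms(2) order_refl]
  let ?K = "kept k \<beta> Rs Rc Rt l r b c b' z"
  let ?H = "recode k Rs Rc Rt l r ` {e. z div \<beta> ^ e mod \<beta> \<noteq> 0 \<and> fits k Rs Rc l r b c b' e}"
  let ?post = "\<lambda>\<rho>' \<alpha>' xs'. \<rho>' Z = bits \<beta> ?H \<and> \<alpha>' Out = (\<lambda>_. 0) \<and> xs' = xs"
  let ?loop = "WHILE V N \<ominus> V E DO clip_step k"
  let ?T1 = "2 * n * ((300 * k + 200) * \<kappa>) + (2 * n + 1) * (9 * \<kappa>)"
  let ?T2 = "1000 * (n' + 1) * \<kappa>\<^sup>2"
  have rest: "run (?loop ;; pack) (\<rho>'(MX := 0, E := 0)) \<alpha>' xs (?T1 + ?T2) ?post"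
    if r: "\<rho>' N \<le> 2 * n" "z < \<beta> ^ \<rho>' N" "\<forall>i<\<rho>' N. \<alpha>' Fld i = z div \<beta> ^ i mod \<beta>" "\<alpha>' Out = (\<lambda>_. 0)"
      and lay: "layout \<rho>' Rs Rc Rt l r b c b'" "\<rho>' B = \<beta>" for \<rho>' \<alpha>'
  proof -
    define m where "m = \<rho>' N"
    have m: "m \<le> 2 * n" using r(1) by (simp add: m_def)
    let ?Inv = "\<lambda>e \<rho>' \<alpha>' xs'. \<rho>' E = e \<and> \<alpha>' Out = ind (?K e) \<and> (\<forall>y\<in>?K e. y \<le> \<rho>' MX) \<and> \<rho>' MX \<le> n' \<and> xs' = xs"
    have K: "?K m = ?H" unfolding m_def using r(2) assms(6) by (intro kept_eq) auto
    show ?thesis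
    proof (rule run_Comp[OF run_Loop[OF assms(1), where n = m and \<tau> = "\<lambda>_. (300 * k + 200) * \<kappa>"
          and Inv = ?Inv and post = "?Inv m"], where ?T2.0 = ?T2])
      show "?Inv 0 (\<rho>'(MX := 0, E := 0)) \<alpha>' xs" using r(4) by (simp add: kept_def ind_def fun_eq_iff)
    next
      fix e \<rho>'' \<alpha>'' xs''
      assume e: "e < m" and I: "?Inv e \<rho>'' \<alpha>'' xs''"
        and s: "same (wv (clip_step k)) (\<rho>'(MX := 0, E := 0)) \<rho>''" "same (wa (clip_step k)) \<alpha>' \<alpha>''"
      have lay'': "layout \<rho>'' Rs Rc Rt l r b c b'" using s(1) lay(1) by (simp add: same_def layout_def)
      have N: "\<rho>'' N = m" using s(1) by (simp add: same_def m_def)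
      have f: "\<alpha>'' Fld e = z div \<beta> ^ e mod \<beta>" using s(2) r(3) e by (simp add: same_def m_def)
      have "z div \<beta> ^ e mod \<beta> < \<beta>" using assms(6) by simp
      then have fU: "\<alpha>'' Fld e \<le> U" using assms(7) f by linarith
      have eU: "Suc e \<le> U" "m \<le> U" using e m assms(4) by linarith+
      have "run (clip_step k) \<rho>'' \<alpha>'' xs'' ((300 * k + 200) * \<kappa>) (?Inv (Suc e))"
      proof (rule run_conseq[OF run_clip_step[OF assms(1-3) eU(1) wide lay'' \<rho>(2-4), where H = "?K e"
        and n = "\<rho>'' MX"] order_refl])
        show "\<rho>'' MX \<le> U" using I assms(5) by linarith
        fix \<rho>3 \<alpha>3 xs3
        assume P: "\<rho>3 E = Suc e \<and> xs3 = xs'' \<and> (if \<alpha>'' Fld e \<noteq> 0 \<and> fits k Rs Rc l r b c b' e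
          then \<alpha>3 Out = ind (insert (recode k Rs Rc Rt l r e) (?K e)) \<and>
            \<rho>3 MX = max (\<rho>'' MX) (recode k Rs Rc Rt l r e)
          else \<alpha>3 Out = ind (?K e) \<and> \<rho>3 MX = \<rho>'' MX)"
        show "?Inv (Suc e) \<rho>3 \<alpha>3 xs3"
        proof (cases "z div \<beta> ^ e mod \<beta> \<noteq> 0 \<and> fits k Rs Rc l r b c b' e")
          case True
          then show ?thesis using P I n' f by (auto simp: kept_Suc)
        next
          case False
          then show ?thesis using P I f by (auto simp: kept_Suc split: if_splits)
        qed
      qed (use I fU in auto)
      moreover have "ebd \<kappa> (V N \<ominus> V E) \<rho>'' \<alpha>''" "ev (V N \<ominus> V E) \<rho>'' \<alpha>'' \<noteq> 0"
        using N I e eU by (simp_all add: sU)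
      ultimately show "ebd \<kappa> (V N \<ominus> V E) \<rho>'' \<alpha>'' \<and> ev (V N \<ominus> V E) \<rho>'' \<alpha>'' \<noteq> 0 \<and>
        run (clip_step k) \<rho>'' \<alpha>'' xs'' ((300 * k + 200) * \<kappa>) (?Inv (Suc e))" by blast
    next
      fix \<rho>'' \<alpha>'' xs''
      assume I: "?Inv m \<rho>'' \<alpha>'' xs''" and s: "same (wv (clip_step k)) (\<rho>'(MX := 0, E := 0)) \<rho>''"
      have "\<rho>'' N = m" using s(1) by (simp add: same_def m_def)
      then have "ebd \<kappa> (V N \<ominus> V E) \<rho>'' \<alpha>''" "ev (V N \<ominus> V E) \<rho>'' \<alpha>'' = 0"
        using I m assms(4) by (simp_all add: sU)
      with I show "ebd \<kappa> (V N \<ominus> V E) \<rho>'' \<alpha>'' \<and> ev (V N \<ominus> V E) \<rho>'' \<alpha>'' = 0 \<and> ?Inv m \<rho>'' \<alpha>'' xs''" by blast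
    next
      show "(\<Sum>i<m. (300 * k + 200) * \<kappa>) + (m + 1) * ((esize (V N \<ominus> V E) + 1) * \<kappa>) \<le> ?T1"
        using m by (intro add_mono mult_mono) auto
    next
      fix \<rho>'' \<alpha>'' xs''
      assume I: "?Inv m \<rho>'' \<alpha>'' xs''" and s: "same (wv ?loop) (\<rho>'(MX := 0, E := 0)) \<rho>''"
      have "4 * \<rho>'' MX + 4 \<le> U" using I assms(5) by linarith
      moreover have "\<rho>'' B = \<beta>" using s lay(2) by (simp add: same_def)
      ultimately have "run pack \<rho>'' \<alpha>'' xs'' (1000 * (\<rho>'' MX + 1) * \<kappa>\<^sup>2)
        (\<lambda>\<rho>' \<alpha>' xs'. \<rho>' Z = (\<Sum>i\<le>\<rho>'' MX. ind (?K m) i * \<beta> ^ i) \<and> \<alpha>' Out = (\<lambda>_. 0) \<and> xs' = xs'')"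
        using I assms(6) by (intro run_pack[OF assms(1,2) _ assms(6,7)]) (auto simp: ind_def)
      then show "run pack \<rho>'' \<alpha>'' xs'' ?T2 ?post"
      proof (rule run_conseq)
        show "1000 * (\<rho>'' MX + 1) * \<kappa>\<^sup>2 \<le> ?T2" using I by (intro mult_right_mono mult_left_mono) auto
      qed (use I sum_ind[of "?K m" "\<rho>'' MX" \<beta>] K in auto)
    qed simp
  qed
  show ?thesis
    unfolding clip_def
  proof (rule run_Comp[OF run_unpack[OF assms(1,2,4,6,7,8) st(2,1,3)]])
    fix \<rho>' \<alpha>' xs'
    assume U: "\<rho>' N \<le> 2 * n \<and> z < \<beta> ^ \<rho>' N \<and> (\<forall>i<\<rho>' N. \<alpha>' Fld i = z div \<beta> ^ i mod \<beta>) \<and> xs' = xs"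
      and s: "same (wv unpack) \<rho> \<rho>'" "same (wa unpack) \<alpha> \<alpha>'"
    show "run ((MX ::= C 0 ;; E ::= C 0) ;; ?loop ;; pack) \<rho>' \<alpha>' xs' (8 * \<kappa> + (?T1 + ?T2)) ?post"
    proof (rule run_prefix[OF assms(1), where T' = "?T1 + ?T2"])
      have "run (?loop ;; pack) (\<rho>'(MX := 0, E := 0)) \<alpha>' xs (?T1 + ?T2) ?post"
        by (rule rest) (use U s st \<rho> in \<open>simp_all add: same_def layout_def\<close>)
      then show "wpc \<kappa> (MX ::= C 0 ;; E ::= C 0) \<rho>' \<alpha>' (\<lambda>\<rho> \<alpha>. run (?loop ;; pack) \<rho> \<alpha> xs' (?T1 + ?T2) ?post)"
        using U by (simp add: sU)
    qed simp
  next
    define a where "a = \<kappa>\<^sup>2"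
    have a: "\<kappa> \<le> a" using assms(1) by (simp add: a_def power2_eq_square)
    have "?T1 = n * (600 * k + 418) * \<kappa> + 9 * \<kappa>" by (simp add: algebra_simps)
    also have "\<dots> \<le> n * (600 * k + 418) * a + 9 * a" using a by (intro add_mono mult_left_mono) auto
    finally have "2000 * n * a + (8 * \<kappa> + (?T1 + 1000 * (n' + 1) * a)) \<le>
        2000 * n * a + (8 * a + (n * (600 * k + 418) * a + 9 * a + 1000 * (n' + 1) * a))"
      using a by linarith
    also have "\<dots> = (2000 * n + 8 + n * (600 * k + 418) + 9 + 1000 * (n' + 1)) * a"
      by (simp add: algebra_simps)
    also have "\<dots> \<le> (5000 * (k + 1) * (n + n' + 1)) * a"
      by (intro mult_right_mono) (simp_all add: algebra_simps)
    finally show "2000 * n * \<kappa>\<^sup>2 + (8 * \<kappa> + (?T1 + ?T2)) \<le> 5000 * (k + 1) * (n + n' + 1) * \<kappa>\<^sup>2"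
      by (simp add: a_def)
  qed
qed

section \<open>Codes of solutions\<close>

text \<open>Uniqueness of the expansion in base \<open>\<beta>\<close>: the part below position
  \<open>e\<close> is less than \<open>\<beta> ^ e\<close> and disappears in the division, and after
  it the part above \<open>e\<close> is a multiple of \<open>\<beta>\<close>.\<close>

lemma digits_sum:
  assumes "\<And>i. g i < \<beta>"
  shows "(\<Sum>i<n. g i * \<beta> ^ i) div \<beta> ^ e mod \<beta> = (if e < n then g e else (0::nat))"
proof -
  have b: "block g \<beta> s i < \<beta> ^ s" for s i by (rule block_less[OF assms])
  have \<beta>: "0 < \<beta>" using assms[of 0] by simp
  have S: "(\<Sum>i<n. g i * \<beta> ^ i) = block g \<beta> n 0" by (simp add: block_def)
  show ?thesis
  proof (cases "e < n")
    case False
    then have "\<beta> ^ n \<le> \<beta> ^ e" using \<beta> by (intro power_increasing) auto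
    then show ?thesis using b[of n 0] False by (simp add: S)
  next
    case True
    define m where "m = n - Suc e"
    have n: "n = e + Suc m" using True by (simp add: m_def)
    have "block g \<beta> n 0 = block g \<beta> e 0 + (\<Sum>i<Suc m. g (e + i) * \<beta> ^ (e + i))"
      unfolding block_def n by (simp add: sum_lessThan_add del: sum.lessThan_Suc add_Suc_right)
    also have "(\<Sum>i<Suc m. g (e + i) * \<beta> ^ (e + i)) = \<beta> ^ e * (g e + \<beta> * (\<Sum>i<m. g (e + Suc i) * \<beta> ^ i))"
      by (simp add: sum.lessThan_Suc_shift sum_distrib_left power_add algebra_simps del: sum.lessThan_Suc)
    finally have "block g \<beta> n 0 div \<beta> ^ e = g e + \<beta> * (\<Sum>i<m. g (e + Suc i) * \<beta> ^ i)"
      using b[of e 0] \<beta> by simp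
    then show ?thesis using assms[of e] True by (simp add: S)
  qed
qed

lemma bits_less:
  assumes "D \<subseteq> {..<n}" "2 \<le> \<beta>"
  shows "bits \<beta> D < \<beta> ^ n"
proof -
  have "bits \<beta> D = (\<Sum>i<n. ind D i * \<beta> ^ i)"
    unfolding bits_def using assms(1) by (intro sum.mono_neutral_cong_left) (auto simp: ind_def)
  also have "\<dots> = block (ind D) \<beta> n 0" by (simp add: block_def)
  also have "\<dots> < \<beta> ^ n" using assms(2) by (intro block_less) (simp add: ind_def)
  finally show ?thesis .
qed

text \<open>A coefficient of the product counts pairs, so it does not overflow into the next digit.\<close>

lemma bits_mult_digit:
  assumes "D \<subseteq> {..<n}" "D' \<subseteq> {..<n'}" "n < \<beta>"
  shows "bits \<beta> D * bits \<beta> D' div \<beta> ^ e mod \<beta> \<noteq> 0 \<longleftrightarrow> (\<exists>a\<in>D. \<exists>b\<in>D'. e = a + b)"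
proof -
  have fin: "finite D" "finite D'" using assms finite_subset finite_lessThan by blast+
  define g where "g e = card {a \<in> D. e - a \<in> D' \<and> a \<le> e}" for e
  have gA: "g e \<le> n" for e
  proof -
    have "g e \<le> card {..<n}" unfolding g_def using assms(1) by (intro card_mono) auto
    then show ?thesis by simp
  qed
  have "bits \<beta> D * bits \<beta> D' = (\<Sum>(a, b)\<in>D \<times> D'. \<beta> ^ (a + b))"
    by (simp add: bits_def sum_product sum.cartesian_product power_add)
  also have "\<dots> = (\<Sum>e<n + n'. \<Sum>p\<in>{p\<in>D \<times> D'. fst p + snd p = e}. \<beta> ^ e)"
  proof -
    have "(\<Sum>p\<in>D \<times> D'. \<beta> ^ (fst p + snd p)) =
      (\<Sum>e<n + n'. \<Sum>p\<in>{p\<in>D \<times> D'. fst p + snd p = e}. \<beta> ^ (fst p + snd p))"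
      using fin assms by (intro sum.group[symmetric]) (auto, fastforce)
    then show ?thesis by (simp add: case_prod_unfold)
  qed
  also have "\<dots> = (\<Sum>e<n + n'. g e * \<beta> ^ e)"
  proof (rule sum.cong[OF refl])
    fix e
    have "bij_betw fst {p\<in>D \<times> D'. fst p + snd p = e} {a \<in> D. e - a \<in> D' \<and> a \<le> e}"
      by (rule bij_betwI[where g = "\<lambda>a. (a, e - a)"]) auto
    from bij_betw_same_card[OF this] show "(\<Sum>p\<in>{p\<in>D \<times> D'. fst p + snd p = e}. \<beta> ^ e) = g e * \<beta> ^ e"
      by (simp add: g_def)
  qed
  finally have "bits \<beta> D * bits \<beta> D' div \<beta> ^ e mod \<beta> = (if e < n + n' then g e else 0)"
    using digits_sum[of g \<beta> "n + n'" e, OF le_less_trans[OF gA assms(3)]] by simp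
  moreover have "g e \<noteq> 0 \<longleftrightarrow> (\<exists>a\<in>D. \<exists>b\<in>D'. e = a + b)"
  proof -
    have "g e \<noteq> 0 \<longleftrightarrow> {a \<in> D. e - a \<in> D' \<and> a \<le> e} \<noteq> {}" using fin by (simp add: g_def)
    also have "\<dots> \<longleftrightarrow> (\<exists>a\<in>D. \<exists>b\<in>D'. e = a + b)" by force
    finally show ?thesis .
  qed
  moreover have "e < n + n'" if "\<exists>a\<in>D. \<exists>b\<in>D'. e = a + b" using that assms by fastforce
  ultimately show ?thesis by auto
qed

text \<open>The table of \<open>{0}\<close> is the number 1, so this is a product with one trivial
  factor.\<close>

lemma bits_digit:
  assumes "D \<subseteq> {..<n}" "n < \<beta>"
  shows "bits \<beta> D div \<beta> ^ e mod \<beta> \<noteq> 0 \<longleftrightarrow> e \<in> D"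
  using bits_mult_digit[OF assms(1) _ assms(2), of "{0}" 1 e] by (simp add: bits_def)

section \<open>Arithmetic of codes\<close>

lemma code_Suc: "code Rs Rc (Suc k) j s = code Rs Rc k j s + (Rs * Rc) ^ k * (Rs * j k + s k)"
  by (simp add: code_def)

lemma code_add: "code Rs Rc k (\<lambda>i. j i + j' i) (\<lambda>i. s i + s' i) = code Rs Rc k j s + code Rs Rc k j' s'"
  by (simp add: code_def algebra_simps sum.distrib)

lemma code_cong: "(\<And>i. i < k \<Longrightarrow> j i = j' i \<and> s i = s' i) \<Longrightarrow> code Rs Rc k j s = code Rs Rc k j' s'"
  by (simp add: code_def)

lemma code_less:
  assumes "\<And>i. i < k \<Longrightarrow> j i < Rc \<and> s i < Rs"
  shows "code Rs Rc k j s < (Rs * Rc) ^ k"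
  using assms
proof (induction k)
  case (Suc k)
  have "Rs * (j k + 1) \<le> Rs * Rc" using Suc.prems[of k] by (intro mult_le_mono2) simp
  then have "Rs * j k + s k + 1 \<le> Rs * Rc" using Suc.prems[of k] by simp
  then have "(Rs * Rc) ^ k * (Rs * j k + s k + 1) \<le> (Rs * Rc) ^ k * (Rs * Rc)" by (rule mult_le_mono2)
  moreover have "code Rs Rc k j s < (Rs * Rc) ^ k" using Suc by simp
  ultimately show ?case by (simp add: code_Suc mult.commute)
qed (simp add: code_def)

lemma digits_code:
  assumes "\<And>i. i < k \<Longrightarrow> j i < Rc \<and> s i < Rs" "i < k"
  shows "sdig Rs Rc (code Rs Rc k j s) i = s i" "cdig Rs Rc (code Rs Rc k j s) i = j i"
proof -
  let ?D = "Rs * Rc"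
  have "code Rs Rc k j s div ?D ^ i mod ?D = Rs * j i + s i"
  proof -
    define g where "g i = (if i < k then Rs * j i + s i else 0)" for i
    have "0 < ?D" using assms(1)[OF assms(2)] by simp
    moreover have "Rs * j i + s i < ?D" if "i < k" for i
    proof -
      have "Rs * (j i + 1) \<le> Rs * Rc" using assms(1)[OF that] by (intro mult_le_mono2) simp
      then show ?thesis using assms(1)[OF that] by simp
    qed
    ultimately have "g i < ?D" for i by (simp add: g_def)
    from digits_sum[of g ?D k i, OF this] assms(2)
    have "(\<Sum>i<k. g i * ?D ^ i) div ?D ^ i mod ?D = Rs * j i + s i" by (simp add: g_def)
    moreover have "(\<Sum>i<k. g i * ?D ^ i) = code Rs Rc k j s"
      unfolding code_def by (rule sum.cong) (simp_all add: g_def)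
    ultimately show ?thesis by simp
  qed
  note d = this
  \<comment> \<open>Sum and cardinality depend only on the digit in radix \<open>Rs * Rc\<close>, so
    the quotient may first be reduced to that digit.\<close>
  have m: "x mod Rs = x mod ?D mod Rs" "x div Rs mod Rc = x mod ?D div Rs" if "0 < Rs" for x
    using that by (simp_all add: mod_mult2_eq)
  have Rs: "0 < Rs" "s i < Rs" using assms(1)[OF assms(2)] by auto
  show "sdig Rs Rc (code Rs Rc k j s) i = s i" "cdig Rs Rc (code Rs Rc k j s) i = j i"
    using Rs by (simp_all add: sdig_def cdig_def m d)
qed

lemma recode_code:
  assumes "\<And>i. i < k \<Longrightarrow> j i < Rc \<and> s i < Rs"
  shows "recode k Rs Rc Rt l r (code Rs Rc k j s) = code Rt Rc k j (\<lambda>i. l * s i + r * j i)"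
    and "fits k Rs Rc l r b c b' (code Rs Rc k j s) \<longleftrightarrow> (\<forall>i<k. s i \<le> b \<and> j i \<le> c \<and> l * s i + r * j i \<le> b')"
  using digits_code[of k j Rc s Rs, OF assms] by (auto simp: recode_def fits_def intro!: code_cong)

text \<open>A family of \<open>k\<close> disjoint subsets of \<open>F\<close> is a colouring \<open>f\<close>; elements whose colour is not
  below \<open>k\<close> are unused.\<close>

definition cnt :: "nat set \<Rightarrow> (nat \<Rightarrow> nat) \<Rightarrow> nat \<Rightarrow> nat" where
  "cnt F f i = card {y\<in>F. f y = i}"

definition tot :: "nat set \<Rightarrow> (nat \<Rightarrow> nat) \<Rightarrow> nat \<Rightarrow> nat" where
  "tot F f i = \<Sum>{y\<in>F. f y = i}"

definition sols :: "nat \<Rightarrow> nat \<Rightarrow> nat \<Rightarrow> nat set \<Rightarrow> nat set" where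
  "sols k c b F = {code (2 * b + 1) (2 * c + 1) k (cnt F f) (tot F f) | f. \<forall>i<k. cnt F f i \<le> c \<and>
    tot F f i \<le> b}"

lemma cnt_union:
  assumes "finite F" "finite F'" "F \<inter> F' = {}"
  shows "cnt (F \<union> F') f i = cnt F f i + cnt F' f i" "tot (F \<union> F') f i = tot F f i + tot F' f i"
proof -
  have "{y \<in> F \<union> F'. f y = i} = {y\<in>F. f y = i} \<union> {y\<in>F'. f y = i}" by auto
  moreover have "{y\<in>F. f y = i} \<inter> {y\<in>F'. f y = i} = {}" using assms(3) by auto
  ultimately show "cnt (F \<union> F') f i = cnt F f i + cnt F' f i" "tot (F \<union> F') f i = tot F f i + tot F' f i"
    using assms(1,2) by (simp_all add: cnt_def tot_def card_Un_disjoint sum.union_disjoint)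
qed

lemma cnt_cong: "(\<And>y. y \<in> F \<Longrightarrow> f y = g y) \<Longrightarrow> cnt F f = cnt F g \<and> tot F f = tot F g"
  by (auto simp: cnt_def tot_def fun_eq_iff intro!: arg_cong[of _ _ card] arg_cong[of _ _ Sum])

text \<open>Colourings of disjoint sets glue together and restrict back, with counts and sums adding
  up. The digits of a sum of two admissible codes stay below \<open>2 * c + 1\<close> and
  \<open>2 * b + 1\<close>, so no carry falsifies the test \<open>fits\<close>; on admissible codes
  \<open>recode\<close> is the identity here.\<close>

lemma sols_union:
  fixes b c :: nat
  assumes "finite F" "finite F'" "F \<inter> F' = {}"
  defines "Rs \<equiv> 2 * b + 1" and "Rc \<equiv> 2 * c + 1"
  shows "recode k Rs Rc Rs 1 0 ` {e. (\<exists>a\<in>sols k c b F. \<exists>a'\<in>sols k c b F'. e = a + a') \<and>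
    fits k Rs Rc 1 0 b c b e} =
    sols k c b (F \<union> F')" (is "?L = _")
proof (intro equalityI subsetI)
  fix x assume "x \<in> ?L"
  then obtain f g where fg: "\<forall>i<k. cnt F f i \<le> c \<and> tot F f i \<le> b" "\<forall>i<k. cnt F' g i \<le> c \<and> tot F' g i \<le> b"
    and e: "fits k Rs Rc 1 0 b c b (code Rs Rc k (cnt F f) (tot F f) + code Rs Rc k (cnt F' g) (tot F' g))"
    "x = recode k Rs Rc Rs 1 0 (code Rs Rc k (cnt F f) (tot F f) + code Rs Rc k (cnt F' g) (tot F' g))"
    unfolding sols_def Rs_def Rc_def by blast
  define h where "h y = (if y \<in> F then f y else g y)" for y
  have h: "cnt F h = cnt F f" "tot F h = tot F f" "cnt F' h = cnt F' g" "tot F' h = tot F' g"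
  proof -
    have "h y = f y" if "y \<in> F" for y using that by (simp add: h_def)
    moreover have "h y = g y" if "y \<in> F'" for y using that assms(3) by (auto simp: h_def)
    ultimately show "cnt F h = cnt F f" "tot F h = tot F f" "cnt F' h = cnt F' g" "tot F' h = tot F' g"
      using cnt_cong[of F h f] cnt_cong[of F' h g] by blast+
  qed
  have u: "cnt (F \<union> F') h = (\<lambda>i. cnt F f i + cnt F' g i)" "tot (F \<union> F') h = (\<lambda>i. tot F f i + tot F' g i)"
    using cnt_union[OF assms(1-3), of h] h by auto
  have eq: "code Rs Rc k (cnt F f) (tot F f) + code Rs Rc k (cnt F' g) (tot F' g) =
      code Rs Rc k (cnt (F \<union> F') h) (tot (F \<union> F') h)" by (simp only: u code_add)
  have bd: "cnt (F \<union> F') h i < Rc \<and> tot (F \<union> F') h i < Rs" if "i < k" for i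
    using fg that by (auto simp: u Rs_def Rc_def add_mono less_Suc_eq_le mult_2)
  have "x = code Rs Rc k (cnt (F \<union> F') h) (tot (F \<union> F') h)"
    using e(2) recode_code(1)[of k "cnt (F \<union> F') h" Rc "tot (F \<union> F') h" Rs Rs 1 0, OF bd] by (simp add: eq)
  moreover have "\<forall>i<k. cnt (F \<union> F') h i \<le> c \<and> tot (F \<union> F') h i \<le> b"
    using e(1) recode_code(2)[of k "cnt (F \<union> F') h" Rc "tot (F \<union> F') h" Rs 1 0 b c b, OF bd] by (simp add: eq)
  ultimately show "x \<in> sols k c b (F \<union> F')" unfolding sols_def Rs_def Rc_def by blast
next
  fix x assume "x \<in> sols k c b (F \<union> F')"
  then obtain f where f: "\<forall>i<k. cnt (F \<union> F') f i \<le> c \<and> tot (F \<union> F') f i \<le> b"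
    "x = code Rs Rc k (cnt (F \<union> F') f) (tot (F \<union> F') f)" unfolding sols_def Rs_def Rc_def by blast
  note u = cnt_union[OF assms(1-3), of f]
  have x: "x = code Rs Rc k (cnt F f) (tot F f) + code Rs Rc k (cnt F' f) (tot F' f)"
    unfolding f(2) code_add[symmetric] by (rule code_cong) (simp add: u)
  have "\<forall>i<k. cnt F f i \<le> c \<and> tot F f i \<le> b" "\<forall>i<k. cnt F' f i \<le> c \<and> tot F' f i \<le> b"
    using f(1) unfolding u by (meson add_leD1 add_leD2)+
  then have s: "code Rs Rc k (cnt F f) (tot F f) \<in> sols k c b F"
    "code Rs Rc k (cnt F' f) (tot F' f) \<in> sols k c b F'"
    unfolding sols_def Rs_def Rc_def by blast+
  have bd: "cnt (F \<union> F') f i < Rc \<and> tot (F \<union> F') f i < Rs" if "i < k" for i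
    using f(1) that by (auto simp: Rs_def Rc_def less_Suc_eq_le intro: order.trans)
  have "fits k Rs Rc 1 0 b c b x" "recode k Rs Rc Rs 1 0 x = x"
    using f recode_code[of k "cnt (F \<union> F') f" Rc "tot (F \<union> F') f" Rs, OF bd] by simp_all
  then show "x \<in> ?L" using s x by (intro image_eqI[of _ _ x]) auto
qed

text \<open>Colourings are transported along an injection under which a set of size \<open>j\<close>
  and sum \<open>s\<close> gets the sum \<open>l * s + r * j\<close>. The bound \<open>b\<close>
  loses nothing: an image sum of at most \<open>t\<close> forces
  \<open>s \<le> t div l\<close>.\<close>

lemma sols_affine:
  fixes b c t :: nat
  assumes "finite F" "0 < l" "t div l \<le> b"
  defines "Rs \<equiv> 2 * b + 1" and "Rc \<equiv> 2 * c + 1" and "Rt \<equiv> 2 * t + 1"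
  shows "recode k Rs Rc Rt l r ` {e \<in> sols k c b F. fits k Rs Rc l r b c t e} = sols k c t ((\<lambda>y. r
    + l * y) ` F)"
    (is "?L = _")
proof -
  let ?h = "\<lambda>y. r + l * y"
  have inj: "inj_on ?h D" for D using assms(2) by (simp add: inj_on_def)
  have aff: "cnt (?h ` F) f i = cnt F (f \<circ> ?h) i"
    "tot (?h ` F) f i = l * tot F (f \<circ> ?h) i + r * cnt F (f \<circ> ?h) i" for f i
  proof -
    have e: "{y \<in> ?h ` F. f y = i} = ?h ` {y\<in>F. (f \<circ> ?h) y = i}" by auto
    show "cnt (?h ` F) f i = cnt F (f \<circ> ?h) i" unfolding cnt_def e by (rule card_image[OF inj])
    have "\<Sum>(?h ` {y\<in>F. (f \<circ> ?h) y = i}) = (\<Sum>y\<in>{y\<in>F. (f \<circ> ?h) y = i}. r + l * y)"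
      by (subst sum.reindex[OF inj]) simp
    then show "tot (?h ` F) f i = l * tot F (f \<circ> ?h) i + r * cnt F (f \<circ> ?h) i"
      unfolding tot_def cnt_def e by (simp add: sum.distrib sum_distrib_left)
  qed
  have lt: "j i < Rc \<and> s i < Rs" if "\<forall>i<k. j i \<le> c \<and> s i \<le> b" "i < k" for j s i
    using that by (auto simp: Rs_def Rc_def less_Suc_eq_le intro: order.trans)
  show ?thesis
  proof (intro equalityI subsetI)
    fix x assume "x \<in> ?L"
    then obtain f where f: "\<forall>i<k. cnt F f i \<le> c \<and> tot F f i \<le> b"
      "fits k Rs Rc l r b c t (code Rs Rc k (cnt F f) (tot F f))"
      "x = recode k Rs Rc Rt l r (code Rs Rc k (cnt F f) (tot F f))"
      unfolding sols_def Rs_def Rc_def by blast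
    \<comment> \<open>The affine map is inverted on its image, which carries the colouring
      over.\<close>
    define g where "g z = f ((z - r) div l)" for z
    have g: "g \<circ> ?h = f" using assms(2) by (auto simp: g_def fun_eq_iff)
    have rc: "recode k Rs Rc Rt l r (code Rs Rc k (cnt F f) (tot F f)) =
        code Rt Rc k (cnt F f) (\<lambda>i. l * tot F f i + r * cnt F f i)"
      "fits k Rs Rc l r b c t (code Rs Rc k (cnt F f) (tot F f)) \<longleftrightarrow>
        (\<forall>i<k. tot F f i \<le> b \<and> cnt F f i \<le> c \<and> l * tot F f i + r * cnt F f i \<le> t)"
      using lt[OF f(1)] by (intro recode_code; blast)+
    have "x = code Rt Rc k (cnt (?h ` F) g) (tot (?h ` F) g)"
      unfolding f(3) rc(1) by (rule code_cong) (simp add: aff g)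
    moreover have "\<forall>i<k. cnt (?h ` F) g i \<le> c \<and> tot (?h ` F) g i \<le> t" using f(2) by (simp add: rc(2) aff g)
    ultimately show "x \<in> sols k c t (?h ` F)" unfolding sols_def Rt_def Rc_def by blast
  next
    fix x assume "x \<in> sols k c t (?h ` F)"
    then obtain g where g: "\<forall>i<k. cnt (?h ` F) g i \<le> c \<and> tot (?h ` F) g i \<le> t"
      "x = code Rt Rc k (cnt (?h ` F) g) (tot (?h ` F) g)" unfolding sols_def Rt_def Rc_def by blast
    define f where "f = g \<circ> ?h"
    have le: "\<forall>i<k. cnt F f i \<le> c \<and> l * tot F f i + r * cnt F f i \<le> t" using g(1) by (simp add: aff f_def)
    have "tot F f i \<le> b" if "i < k" for i
    proof -
      have "l * tot F f i \<le> t" using le that by (meson add_leD1)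
      then have "tot F f i \<le> t div l" using assms(2) by (simp add: less_eq_div_iff_mult_less_eq mult.commute)
      then show ?thesis using assms(3) by simp
    qed
    then have f: "\<forall>i<k. cnt F f i \<le> c \<and> tot F f i \<le> b" using le by simp
    have rc: "recode k Rs Rc Rt l r (code Rs Rc k (cnt F f) (tot F f)) =
        code Rt Rc k (cnt F f) (\<lambda>i. l * tot F f i + r * cnt F f i)"
      "fits k Rs Rc l r b c t (code Rs Rc k (cnt F f) (tot F f)) \<longleftrightarrow>
        (\<forall>i<k. tot F f i \<le> b \<and> cnt F f i \<le> c \<and> l * tot F f i + r * cnt F f i \<le> t)"
      using lt[OF f] by (intro recode_code; blast)+
    have "x = recode k Rs Rc Rt l r (code Rs Rc k (cnt F f) (tot F f))"
      unfolding rc(1) g(2) by (rule code_cong) (simp add: aff f_def)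
    moreover have "fits k Rs Rc l r b c t (code Rs Rc k (cnt F f) (tot F f))" using f le by (simp add: rc(2))
    moreover have "code Rs Rc k (cnt F f) (tot F f) \<in> sols k c b F" using f unfolding sols_def Rs_def Rc_def
      by blast
    ultimately show "x \<in> ?L" by blast
  qed
qed

lemma sols_empty: "sols k c b {} = {0}"
proof -
  have "code Rs Rc k (cnt {} f) (tot {} f) = 0" for Rs Rc f by (simp add: code_def cnt_def tot_def)
  then show ?thesis by (auto simp: sols_def cnt_def tot_def)
qed

lemma sols_singleton:
  fixes b c :: nat
  assumes "1 \<le> c" "y \<le> b"
  defines "Rs \<equiv> 2 * b + 1" and "Rc \<equiv> 2 * c + 1"
  shows "sols k c b {y} = insert 0 ((\<lambda>i. (Rs * Rc) ^ i * (Rs + y)) ` {..<k})"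
proof -
  have ct: "cnt {y} f i = (if f y = i then 1 else 0)" "tot {y} f i = (if f y = i then y else 0)" for f i
  proof -
    have "{z \<in> {y}. f z = i} = (if f y = i then {y} else {})" by auto
    then show "cnt {y} f i = (if f y = i then 1 else 0)" "tot {y} f i = (if f y = i then y else 0)"
      by (simp_all add: cnt_def tot_def)
  qed
  have cd: "code Rs Rc k (cnt {y} f) (tot {y} f) = (if f y < k then (Rs * Rc) ^ f y * (Rs + y) else 0)" for f
  proof -
    have "code Rs Rc k (cnt {y} f) (tot {y} f) = (\<Sum>i<k. if i = f y then (Rs * Rc) ^ i * (Rs + y) else 0)"
      unfolding code_def by (intro sum.cong) (auto simp: ct)
    then show ?thesis by (simp add: sum.delta)
  qed
  have "sols k c b {y} = {code Rs Rc k (cnt {y} f) (tot {y} f) | f. True}"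
    using assms(1,2) unfolding sols_def Rs_def Rc_def by (auto simp: ct)
  also have "\<dots> = insert 0 ((\<lambda>i. (Rs * Rc) ^ i * (Rs + y)) ` {..<k})" (is "?D = ?D'")
  proof (intro equalityI subsetI)
    fix x assume "x \<in> ?D'"
    then consider "x = 0" | i where "i < k" "x = (Rs * Rc) ^ i * (Rs + y)" by auto
    then show "x \<in> ?D"
    proof cases
      case 1
      then have "x = code Rs Rc k (cnt {y} (\<lambda>_. k)) (tot {y} (\<lambda>_. k))" unfolding cd by simp
      then show ?thesis by blast
    next
      case 2
      then have "x = code Rs Rc k (cnt {y} (\<lambda>_. i)) (tot {y} (\<lambda>_. i))" unfolding cd by simp
      then show ?thesis by blast
    qed
  qed (auto simp: cd)
  finally show ?thesis .
qed

lemma sols_less: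
  "sols k c b F \<subseteq> {..<((2 * b + 1) * (2 * c + 1)) ^ k}"
proof
  fix x assume "x \<in> sols k c b F"
  then obtain f where f: "\<forall>i<k. cnt F f i \<le> c \<and> tot F f i \<le> b"
    "x = code (2 * b + 1) (2 * c + 1) k (cnt F f) (tot F f)"
    unfolding sols_def by blast
  have "cnt F f i < 2 * c + 1 \<and> tot F f i < 2 * b + 1" if "i < k" for i
    using f(1)[rule_format, OF that] by linarith
  then show "x \<in> {..<((2 * b + 1) * (2 * c + 1)) ^ k}" unfolding f(2) lessThan_iff by (rule code_less)
qed

text \<open>The last cardinality is the most significant digit, so few items give small codes.\<close>

lemma sols_less_card:
  fixes b c :: nat
  assumes "0 < k" "finite F" "card F \<le> m"
  defines "Rs \<equiv> 2 * b + 1" and "Rc \<equiv> 2 * c + 1"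
  shows "sols k c b F \<subseteq> {..<(m + 1) * (Rs * (Rs * Rc) ^ (k - 1))}"
proof
  fix x assume "x \<in> sols k c b F"
  then obtain f where f: "\<forall>i<k. cnt F f i \<le> c \<and> tot F f i \<le> b" "x = code Rs Rc k (cnt F f) (tot F f)"
    unfolding sols_def Rs_def Rc_def by blast
  obtain k' where k: "k = Suc k'" using assms(1) gr0_conv_Suc by blast
  have "code Rs Rc k' (cnt F f) (tot F f) < (Rs * Rc) ^ k'"
  proof (rule code_less)
    fix i assume "i < k'"
    then have "cnt F f i \<le> c \<and> tot F f i \<le> b" using f(1) k by simp
    then show "cnt F f i < Rc \<and> tot F f i < Rs" unfolding Rs_def Rc_def by linarith
  qed
  moreover have "cnt F f k' \<le> m"
    using card_mono[OF assms(2), of "{y\<in>F. f y = k'}"] assms(3) by (simp add: cnt_def)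
  then have "Rs * cnt F f k' + tot F f k' + 1 \<le> Rs * m + Rs"
    using f(1) by (intro order.trans[OF _ add_mono[OF mult_le_mono2[of _ m Rs] order_refl]]) (auto
      simp: Rs_def k)
  then have "(Rs * Rc) ^ k' * (Rs * cnt F f k' + tot F f k' + 1) \<le> (Rs * Rc) ^ k' * (Rs * m + Rs)"
    by (rule mult_le_mono2)
  ultimately have "x < (Rs * Rc) ^ k' * (Rs * m + Rs)" by (simp add: f(2) k code_Suc)
  then show "x \<in> {..<(m + 1) * (Rs * (Rs * Rc) ^ (k - 1))}" by (simp add: k algebra_simps)
qed

lemma k_subset_sum_card_iff:
  assumes "distinct zs" "length ts = k" "length cs = k"
    and t: "\<forall>x\<in>set ts. x \<le> t" and c: "\<forall>x\<in>set cs. x \<le> c"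
  shows "k_subset_sum_card k (zs, ts, cs) \<longleftrightarrow>
    code (2 * t + 1) (2 * c + 1) k ((!) cs) ((!) ts) \<in> sols k c t {z\<in>set zs. z \<le> t}"
proof -
  let ?F = "{z\<in>set zs. z \<le> t}"
  let ?code = "code (2 * t + 1) (2 * c + 1) k"
  have ti: "ts ! i \<le> t" "cs ! i \<le> c" if "i < k" for i using that assms by simp_all
  show ?thesis
  proof
    assume "k_subset_sum_card k (zs, ts, cs)"
    then obtain K where K: "\<And>i. i < k \<Longrightarrow> K i \<subseteq> set zs \<and> \<Sum>(K i) = ts ! i \<and> card (K i) = cs ! i"
      and dis: "disjoint_family_on K {..<k}" unfolding k_subset_sum_card_def by auto
    \<comment> \<open>Colour \<open>k\<close> marks the elements outside all sets; disjointness
      makes the chosen index the only possible one.\<close>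
    define f where "f z = (if \<exists>i<k. z \<in> K i then SOME i. i < k \<and> z \<in> K i else k)" for z
    have f: "f z = i" if "i < k" "z \<in> K i" for i z
    proof -
      have "(SOME i. i < k \<and> z \<in> K i) < k \<and> z \<in> K (SOME i. i < k \<and> z \<in> K i)"
        using that by (intro someI[where P = "\<lambda>i. i < k \<and> z \<in> K i"]) auto
      then have "f z < k \<and> z \<in> K (f z)" using that by (auto simp: f_def)
      then show ?thesis using dis that by (auto simp: disjoint_family_on_def)
    qed
    have Xf: "{z\<in>?F. f z = i} = K i" if i: "i < k" for i
    proof (intro equalityI subsetI)
      fix z assume "z \<in> K i"
      moreover have "finite (K i)" using K[OF i] finite_subset by blast
      then have "z \<le> \<Sum>(K i)" using \<open>z \<in> K i\<close> member_le_sum[of z "K i" "\<lambda>x. x"] by simp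
      ultimately show "z \<in> {z\<in>?F. f z = i}" using K[OF i] f[OF i] ti[OF i] by auto
    next
      fix z assume z: "z \<in> {z\<in>?F. f z = i}"
      then have "\<exists>i<k. z \<in> K i" using i by (auto simp: f_def split: if_splits)
      then show "z \<in> K i" using f z by blast
    qed
    have "cnt ?F f i = cs ! i" "tot ?F f i = ts ! i" if "i < k" for i
      unfolding cnt_def tot_def Xf[OF that] using K[OF that] by simp_all
    then have "\<forall>i<k. cnt ?F f i \<le> c \<and> tot ?F f i \<le> t" "?code ((!) cs) ((!) ts) = ?code (cnt ?F f) (tot ?F f)"
      using ti by (auto intro!: code_cong)
    then show "?code ((!) cs) ((!) ts) \<in> sols k c t ?F" unfolding sols_def by blast
  next
    assume "?code ((!) cs) ((!) ts) \<in> sols k c t ?F"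
    then obtain f where f: "\<forall>i<k. cnt ?F f i \<le> c \<and> tot ?F f i \<le> t"
      "?code ((!) cs) ((!) ts) = ?code (cnt ?F f) (tot ?F f)" unfolding sols_def by blast
    have b: "cs ! i < 2 * c + 1 \<and> ts ! i < 2 * t + 1" "cnt ?F f i < 2 * c + 1 \<and> tot ?F f i < 2 * t + 1"
      if "i < k" for i
      using f(1)[rule_format, OF that] ti[OF that] by linarith+
    have "cs ! i = cnt ?F f i \<and> ts ! i = tot ?F f i" if "i < k" for i
      using digits_code[of k "(!) cs" "2 * c + 1" "(!) ts" "2 * t + 1" i, OF b(1) that]
        digits_code[of k "cnt ?F f" "2 * c + 1" "tot ?F f" "2 * t + 1" i, OF b(2) that] f(2) by simp
    then have "\<forall>i<k. {z\<in>?F. f z = i} \<subseteq> set zs \<and> \<Sum>{z\<in>?F. f z = i} = ts ! i \<and> card {z\<in>?F. f z = i} = cs ! i"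
      by (auto simp: cnt_def tot_def)
    moreover have "disjoint_family_on (\<lambda>i. {z\<in>?F. f z = i}) {..<k}" unfolding disjoint_family_on_def by blast
    ultimately show "k_subset_sum_card k (zs, ts, cs)" unfolding k_subset_sum_card_def prod.case
      by (intro exI[of _ "\<lambda>i. {z\<in>?F. f z = i}"] conjI)
  qed
qed

section \<open>The algorithm\<close>

definition leaf_step :: cmd where
  "leaf_step =
     (Y ::= V M \<otimes> (V RS \<oplus> V YV) ;; Out\<langle>V Y\<rangle> ::= C 1 ;; M ::= V M \<otimes> (V RS \<otimes> V RC) ;; J ::= V J \<oplus> C 1)"

text \<open>The \<open>k + 1\<close> codes of a single item are written directly. They appear in
  increasing order, so after the loop \<open>Y\<close> is the largest one and bounds the
  packing.\<close>

definition leaf :: "nat \<Rightarrow> cmd" where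
  "leaf k =
     ((Out\<langle>C 0\<rangle> ::= C 1 ;; M ::= C 1 ;; J ::= C 0) ;; WHILE C k \<ominus> V J DO leaf_step ;; MX ::= V Y ;; pack)"

definition gather_step :: "nat \<Rightarrow> cmd" where
  "gather_step k =
     (IF A Pres (V R \<oplus> V LL \<otimes> V YV) THEN (leaf k ;; Tab\<langle>V NR\<rangle> ::= V Z ;; NR ::= V NR \<oplus> C 1) ELSE Nop ;;
      YV ::= V YV \<oplus> C 1)"

definition merge_step :: "nat \<Rightarrow> cmd" where
  "merge_step k =
     (Z ::= A Tab (V II) \<otimes> A Tab (V II \<oplus> V ST) ;; clip k ;; Tab\<langle>V II\<rangle> ::= V Z ;; II ::= V II \<oplus> V ST \<otimes> C 2)"

definition merge_level :: "nat \<Rightarrow> cmd" where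
  "merge_level k = (II ::= C 0 ;; WHILE V NR \<ominus> (V II \<oplus> V ST) DO merge_step k ;; ST ::= V ST \<otimes> C 2)"

text \<open>The first truncation replaces sums of quotients by sums of the items themselves, bounded
  by \<open>TM\<close>. Only then does the table share its layout with \<open>G\<close>, so that the
  product is meaningful; the second truncation cleans the product.\<close>

definition absorb :: "nat \<Rightarrow> cmd" where
  "absorb k =
     (Z ::= A Tab (C 0) ;; (PL ::= V LL ;; PR ::= V R ;; PT ::= V TM ;; RT ::= V TM \<otimes> C 2 \<oplus> C 1) ;; clip k ;;
      Z ::= V G \<otimes> V Z ;; (PS ::= V TM ;; PL ::= C 1 ;; PR ::= C 0 ;; RS ::= V RT) ;; clip k ;;
      G ::= V Z ;; R ::= V R \<oplus> C 1)"

text \<open>Cell 0 of \<open>Tab\<close> starts with the table of the empty set, the number 1, and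
  items follow from cell 1 on. So the tree has a root even for a class without items.\<close>

definition residue_class :: "nat \<Rightarrow> cmd" where
  "residue_class k =
     ((PS ::= V SM ;; PL ::= C 1 ;; PR ::= C 0 ;; PT ::= V SM ;; RS ::= V SM \<otimes> C 2 \<oplus> C 1 ;; RT ::= V RS ;;
       Tab\<langle>C 0\<rangle> ::= C 1 ;; NR ::= C 1 ;; YV ::= C 0) ;;
      WHILE V SM \<oplus> C 1 \<ominus> V YV DO gather_step k ;;
      ST ::= C 1 ;;
      WHILE V NR \<ominus> V ST DO merge_level k ;;
      absorb k)"

lemma wv_class [simp]:
  "wv leaf_step = {Y, M, J}" "wa leaf_step = {Out}"
  "wv (leaf k) = {Y, M, J, MX, S, P, I, Z}" "wa (leaf k) = {Out}"
  "wv (gather_step k) = {Y, M, J, MX, S, P, I, Z, NR, YV}" "wa (gather_step k) = {Out, Tab}"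
  "wv (merge_step k) = {Q, N, S, I, SS, X, CC, S2, BAD, Y, M, J, MX, E, P, Z, II}"
  "wa (merge_step k) = {Pow, Fld, Out, Tab}"
  "wv (merge_level k) = {Q, N, S, I, SS, X, CC, S2, BAD, Y, M, J, MX, E, P, Z, II, ST}"
  "wa (merge_level k) = {Pow, Fld, Out, Tab}"
  "wv (absorb k) = {Q, N, S, I, SS, X, CC, S2, BAD, Y, M, J, MX, E, P, Z, PL, PR, PT, RT, PS, RS, G, R}"
  "wa (absorb k) = {Pow, Fld, Out}"
  "wv (residue_class k) = {Q, N, S, I, SS, X, CC, S2, BAD, Y, M, J, MX, E, P, Z, PL, PR, PT, RT, PS, RS, G, R,
     NR, YV, II, ST}"
  "wa (residue_class k) = {Pow, Fld, Out, Tab}"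
  by (auto simp: leaf_step_def leaf_def gather_step_def merge_step_def merge_level_def absorb_def
    residue_class_def)

text \<open>Items above \<open>TM\<close> are dropped at once: they occur in no solution, and used
  as an index into \<open>Pres\<close> such an item could exceed the scale
  \<open>\<kappa>\<close>.\<close>

definition collect_step :: cmd where
  "collect_step =
     (Inp X ;;
      IF V X \<ominus> V TM THEN Nop ELSE (Pres\<langle>V X\<rangle> ::= C 1 ;; NP ::= V NP \<oplus> C 1) ;;
      NN ::= V NN \<ominus> C 1)"

definition power_step :: cmd where
  "power_step = (B ::= V B \<otimes> ((V TM \<otimes> C 2 \<oplus> C 1) \<otimes> V RC) ;; J ::= V J \<oplus> C 1)"

text \<open>A linear search for the number of classes is cheap enough, since each class takes at
  least one step anyway. \<open>B\<close> becomes one more than the range of codes in the final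
  layout.\<close>

definition prepare :: "nat \<Rightarrow> cmd" where
  "prepare k =
     (LL ::= C 1 ;;
      WHILE V NP \<ominus> V LL \<otimes> V LL \<otimes> V CM DO LL ::= V LL \<oplus> C 1 ;;
      (SM ::= V TM \<oslash> V LL ;; RC ::= V CM \<otimes> C 2 \<oplus> C 1 ;; G ::= C 1 ;; B ::= C 1 ;; J ::= C 0 ;; R ::= C 0) ;;
      WHILE C k \<ominus> V J DO power_step ;;
      B ::= V B \<oplus> C 1)"

definition target_step :: cmd where
  "target_step =
     (X ::= V X \<oplus> V M \<otimes> (V RT \<otimes> A Crd (V J) \<oplus> A Tgt (V J)) ;; M ::= V M \<otimes> (V RT \<otimes> V RC) ;;
      J ::= V J \<oplus> C 1)"

definition answer :: "nat \<Rightarrow> cmd" where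
  "answer k =
     (Z ::= V G ;; unpack ;;
      (X ::= C 0 ;; M ::= C 1 ;; J ::= C 0 ;; RT ::= V TM \<otimes> C 2 \<oplus> C 1) ;;
      WHILE C k \<ominus> V J DO target_step ;;
      IF V N \<ominus> V X THEN (IF A Fld (V X) THEN Ans ::= C 1 ELSE Ans ::= C 0) ELSE Ans ::= C 0)"

definition solve :: "nat \<Rightarrow> cmd" where
  "solve k =
     (NP ::= C 0 ;; WHILE V NN DO collect_step ;; prepare k ;; WHILE V LL \<ominus> V R DO residue_class k ;;
       answer k)"

lemma wv_solve [simp]:
  "wv collect_step = {X, NP, NN}" "wa collect_step = {Pres}"
  "wv power_step = {B, J}" "wa power_step = {}"
  "wv (prepare k) = {LL, SM, RC, G, B, J, R}" "wa (prepare k) = {}"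
  "wv target_step = {X, M, J}" "wa target_step = {}"
  by (auto simp: collect_step_def power_step_def prepare_def target_step_def)

definition read_step :: "arr \<Rightarrow> var \<Rightarrow> cmd" where
  "read_step a x =
     (Inp X ;; a\<langle>V J\<rangle> ::= V X ;; IF V X \<ominus> V x THEN x ::= V X ELSE Nop ;; J ::= V J \<oplus> C 1)"

definition read_numbers :: "nat \<Rightarrow> arr \<Rightarrow> var \<Rightarrow> cmd" where
  "read_numbers k a x = ((x ::= C 0 ;; J ::= C 0) ;; WHILE C k \<ominus> V J DO read_step a x)"

text \<open>The main algorithm needs positive \<open>TM\<close> and \<open>CM\<close>. If one of
  them is 0, positivity of the items leaves only empty sets as solutions, so the answer is yes
  exactly if both are 0.\<close>

definition kss_cmd :: "nat \<Rightarrow> cmd" where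
  "kss_cmd k =
     (Inp NN ;; read_numbers k Tgt TM ;; read_numbers k Crd CM ;;
      IF V TM \<otimes> V CM THEN solve k ELSE (IF V TM \<oplus> V CM THEN Ans ::= C 0 ELSE Ans ::= C 1))"

lemma wv_read [simp]:
  "wv (read_step a x) = {X, x, J}" "wa (read_step a x) = {a}"
  "wv (read_numbers k a x) = {X, x, J}" "wa (read_numbers k a x) = {a}"
  by (auto simp: read_step_def read_numbers_def)

section \<open>Reading the items that can occur in a solution\<close>

lemma run_collect:
  assumes "6 \<le> \<kappa>" "short (\<kappa> - 5) U" "length zs \<le> U" "t < U" and dist: "distinct zs"
    and \<rho>: "\<rho> NN = length zs" "\<rho> TM = t" "\<rho> NP = 0" "\<alpha> Pres = (\<lambda>_. 0)"
  shows "run (WHILE V NN DO collect_step) \<rho> \<alpha> zs (100 * (length zs + 1) * \<kappa> + 100 * (\<Sum>z\<leftarrow>zs. bit_len z))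
    (\<lambda>\<rho>' \<alpha>' xs'. \<rho>' NP = card {z\<in>set zs. z \<le> t} \<and> \<alpha>' Pres = ind {z\<in>set zs. z \<le> t} \<and> xs' = [])"
proof -
  let ?n = "length zs"
  let ?S = "\<lambda>i. {z\<in>set (take i zs). z \<le> t}"
  let ?Inv = "\<lambda>i \<rho>' \<alpha>' xs'. \<rho>' NN = ?n - i \<and> \<rho>' NP = card (?S i) \<and> \<alpha>' Pres = ind (?S i) \<and> xs' = drop i zs"
  note sU = short_bound[OF assms(2) order_refl]
  show ?thesis
  proof (rule run_Loop[OF assms(1), where n = ?n and Inv = ?Inv and \<tau> = "\<lambda>i. 60 * \<kappa> + 61 * bit_len (zs ! i)"])
    show "?Inv 0 \<rho> \<alpha> zs" using \<rho> by (simp add: ind_def fun_eq_iff)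
  next
    fix i \<rho>' \<alpha>' xs'
    assume i: "i < ?n" and I: "?Inv i \<rho>' \<alpha>' xs'" and sm: "same (wv collect_step) \<rho> \<rho>'"
    define z where "z = zs ! i"
    \<comment> \<open>An item may be longer than \<open>\<kappa>\<close>, so each pass has its own
      scale. Summed over the passes this charges the total length of the items rather than a
      multiple of the longest one.\<close>
    define \<mu> where "\<mu> = \<kappa> + bit_len z"
    have mu: "\<kappa> \<le> \<mu>" "6 \<le> \<mu>" using assms(1) by (simp_all add: \<mu>_def)
    note mU = short_bound[OF assms(2) mu(1)]
    have xs: "xs' = z # drop (Suc i) zs" using I i by (simp add: z_def Cons_nth_drop_Suc)
    have r: "\<rho>' TM = t" "\<rho>' NN = ?n - i" "\<rho>' NP = card (?S i)" "\<alpha>' Pres = ind (?S i)" using sm \<rho> I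
      by (simp_all add: same_def)
    have tk: "take (Suc i) zs = take i zs @ [z]" using i by (simp add: take_Suc_conv_app_nth z_def)
    have zn: "z \<notin> set (take i zs)"
    proof -
      have "distinct (take (Suc i) zs)" using dist by (rule distinct_take)
      then show ?thesis by (simp add: tk)
    qed
    have S: "?S (Suc i) = (if z \<le> t then insert z (?S i) else ?S i)" by (auto simp: tk)
    have cd: "card (?S (Suc i)) = (if z \<le> t then Suc (card (?S i)) else card (?S i))" unfolding S using zn
      by simp
    have "card (?S (Suc i)) \<le> card (set (take (Suc i) zs))" by (intro card_mono) auto
    also have "\<dots> \<le> ?n" using card_length[of "take (Suc i) zs"] by simp
    finally have cU: "card (?S (Suc i)) \<le> U" using assms(3) by linarith
    have nU: "?n - i \<le> U" "?n - Suc i \<le> U" "t \<le> U" "Suc 0 \<le> U" using assms(3,4) by simp_all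
    have sz: "short \<mu> z" "short \<mu> (z - t)" by (simp_all add: short_def \<mu>_def trans_le_add2 bit_len_mono)
    have "run (IF V X \<ominus> V TM THEN Nop ELSE (Pres\<langle>V X\<rangle> ::= C 1 ;; NP ::= V NP \<oplus> C 1) ;; NN ::= V NN \<ominus> C 1)
       (\<rho>'(X := z)) \<alpha>' (drop (Suc i) zs) (60 * \<mu>) (?Inv (Suc i))"
    proof (cases "z \<le> t")
      case True
      then have "z \<le> U" using nU by linarith
      moreover have "(ind (?S i))(z := Suc 0) = ind (?S (Suc i))" using True unfolding S
        by (auto simp: ind_def)
      ultimately show ?thesis
        using True r sz nU cU cd by (intro run_flat[OF mu(2)]) (simp_all add: mU)
    next
      case False
      then show ?thesis
        using r sz nU cU cd by (intro run_flat[OF mu(2)]) (simp_all add: mU S)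
    qed
    then have "run collect_step \<rho>' \<alpha>' xs' (60 * \<kappa> + 61 * bit_len z) (?Inv (Suc i))"
      unfolding collect_step_def xs
      by (intro run_Comp[OF run_Inp[where post = "\<lambda>\<rho>'' \<alpha>'' xs''. \<rho>'' = \<rho>'(X := z) \<and> \<alpha>'' = \<alpha>' \<and>
        xs'' = drop (Suc i) zs" and T = "bit_len z"]])
         (auto simp: \<mu>_def)
    moreover have "ebd \<kappa> (V NN) \<rho>' \<alpha>'" "ev (V NN) \<rho>' \<alpha>' \<noteq> 0" using r i nU by (simp_all add: sU)
    ultimately show "ebd \<kappa> (V NN) \<rho>' \<alpha>' \<and> ev (V NN) \<rho>' \<alpha>' \<noteq> 0 \<and>
      run collect_step \<rho>' \<alpha>' xs' (60 * \<kappa> + 61 * bit_len (zs ! i)) (?Inv (Suc i))" unfolding z_def by blast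
  next
    fix \<rho>' \<alpha>' xs'
    assume "?Inv ?n \<rho>' \<alpha>' xs'"
    then show "ebd \<kappa> (V NN) \<rho>' \<alpha>' \<and> ev (V NN) \<rho>' \<alpha>' = 0 \<and>
      \<rho>' NP = card {z\<in>set zs. z \<le> t} \<and> \<alpha>' Pres = ind {z\<in>set zs. z \<le> t} \<and> xs' = []" by (simp add: sU)
  next
    have "(\<Sum>i<?n. bit_len (zs ! i)) = (\<Sum>z\<leftarrow>zs. bit_len z)"
      by (simp add: sum_list_sum_nth atLeast0LessThan)
    then have "(\<Sum>i<?n. 60 * \<kappa> + 61 * bit_len (zs ! i)) = ?n * (60 * \<kappa>) + 61 * (\<Sum>z\<leftarrow>zs. bit_len z)"
      by (simp add: sum.distrib flip: sum_distrib_left)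
    then show "(\<Sum>i<?n. 60 * \<kappa> + 61 * bit_len (zs ! i)) + (?n + 1) * ((esize (V NN) + 1) * \<kappa>)
       \<le> 100 * (?n + 1) * \<kappa> + 100 * (\<Sum>z\<leftarrow>zs. bit_len z)"
      by (simp add: algebra_simps)
  qed
qed

lemma sum_filter_upt: "(\<Sum>i<n. if pr i then a else 0) = length (filter pr [0..<n]) * (a::nat)"
  by (induction n) auto

text \<open>\<open>l\<close> is the number of residue classes, \<open>H\<close> the place value of the last cardinality in the codes of
  a class, and \<open>L\<close> a strict bound on all codes.\<close>


locale kss_params =
  fixes k t c l \<kappa> U :: nat
  assumes pos: "0 < k" "0 < t" "0 < c" "0 < l" "l \<le> t"
    and \<kappa>: "6 \<le> \<kappa>" and U: "short (\<kappa> - 5) U" and WU: "20 * (9 * t * c) ^ (k + 2) \<le> U"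
begin

definition b :: nat where "b = t div l"
definition Rs :: nat where "Rs = 2 * b + 1"
definition Rc :: nat where "Rc = 2 * c + 1"
definition Rt :: nat where "Rt = 2 * t + 1"
text \<open>The 9 comes from \<open>2 * t + 1 \<le> 3 * t\<close> and
  \<open>2 * c + 1 \<le> 3 * c\<close>, applied to the radix \<open>Rt * Rc\<close>.\<close>

definition W :: nat where "W = 9 * t * c"
definition L :: nat where "L = (Rt * Rc) ^ k"
definition H :: nat where "H = Rs * (Rs * Rc) ^ (k - 1)"
text \<open>A coefficient of a product of two tables counts at most \<open>L\<close> pairs, so a
  base of \<open>L + 1\<close> avoids carries.\<close>

definition \<beta> :: nat where "\<beta> = L + 1"

section \<open>Bounds on radices, codes and register contents\<close>

lemma b_le: "b \<le> t" by (simp add: b_def)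

lemma W_ge: "9 * t \<le> W" "9 * c \<le> W" "9 \<le> W"
proof -
  have "9 * t * 1 \<le> 9 * t * c" "9 * 1 * c \<le> 9 * t * c" using pos by (intro mult_le_mono; simp)+
  then show "9 * t \<le> W" "9 * c \<le> W" by (simp_all add: W_def)
  then show "9 \<le> W" using pos by linarith
qed

lemma RtRc: "Rt * Rc \<le> W"
proof -
  have "Rt * Rc \<le> (3 * t) * (3 * c)" using pos by (intro mult_le_mono) (simp_all add: Rt_def Rc_def)
  then show ?thesis by (simp add: W_def)
qed

lemma RsRc: "Rs * Rc \<le> Rt * Rc"
  using b_le by (intro mult_le_mono1) (simp add: Rs_def Rt_def)

lemma RsRc': "Rs * Rc \<le> W" using RsRc RtRc by (rule le_trans)

lemma R_pos [simp]: "0 < Rs" "0 < Rc" "0 < Rt" "Suc 0 \<le> Rs" "Suc 0 \<le> Rc" "Suc 0 \<le> Rt"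
  by (simp_all add: Rs_def Rc_def Rt_def)

lemma wide_merge: "wide W Rs Rc Rs 1 0"
proof -
  have "Rs \<le> W" using W_ge b_le pos unfolding Rs_def by linarith
  then show ?thesis using W_ge RsRc' by (simp add: wide_def)
qed

lemma wide_final: "wide W Rt Rc Rt 1 0"
proof -
  have "Rt \<le> W" using W_ge pos unfolding Rt_def by linarith
  then show ?thesis using W_ge RtRc by (simp add: wide_def)
qed

text \<open>\<open>l * b \<le> t\<close> and \<open>l \<le> t\<close> bound \<open>l * Rs\<close> by
  \<open>3 * t\<close>, and \<open>r < l \<le> t\<close> bounds \<open>r * Rc\<close> by
  \<open>3 * t * c\<close>; both together stay within \<open>W\<close>.\<close>

lemma wide_remap: "r < l \<Longrightarrow> wide W Rs Rc Rt l r"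
proof -
  assume r: "r < l"
  have "l * b \<le> t" by (simp add: b_def)
  then have 1: "l * Rs \<le> 3 * t" using pos by (simp add: Rs_def)
  have "r * Rc \<le> t * (3 * c)" using r pos by (intro mult_le_mono) (simp_all add: Rc_def)
  moreover have "3 * t * 1 \<le> 3 * t * c" using pos by (intro mult_le_mono) simp_all
  ultimately have "l * Rs + r * Rc \<le> W" using 1 unfolding W_def by linarith
  then show ?thesis using W_ge RsRc' RtRc by (simp add: wide_def)
qed

lemma L_le: "L \<le> W ^ k" unfolding L_def by (intro power_mono RtRc) simp

lemma LU: "20 * (W * (W * W ^ k)) \<le> U" using WU by (simp add: W_def mult.assoc mult.left_commute)

text \<open>The second bound is for the tables of a class: up to \<open>t + 1\<close> items with
  \<open>H \<le> W ^ k\<close> digits per item.\<close>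

lemma W_power_U: "20 * (W * W ^ k) \<le> U" "180 * (t * W ^ k) \<le> U" "3 * W ^ Suc k \<le> U" "20 * W ^ k \<le> U"
  "20 * W \<le> U"
proof -
  have p: "0 < W ^ k" using W_ge by simp
  have "1 * (W * W ^ k) \<le> W * (W * W ^ k)" using W_ge by (intro mult_le_mono) auto
  then show 1: "20 * (W * W ^ k) \<le> U" using LU by linarith
  have "9 * t * W ^ k \<le> W * W ^ k" using W_ge by (intro mult_le_mono) auto
  moreover have "180 * (t * W ^ k) = 20 * (9 * t * W ^ k)" by simp
  ultimately show "180 * (t * W ^ k) \<le> U" using 1 by linarith
  show "3 * W ^ Suc k \<le> U" using 1 by simp
  have "1 * W ^ k \<le> W * W ^ k" using W_ge by (intro mult_le_mono) auto
  then show "20 * W ^ k \<le> U" using 1 by linarith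
  have "W * 1 \<le> W * W ^ k" using p by (intro mult_le_mono) auto
  then show "20 * W \<le> U" using 1 by linarith
qed

lemma W_k_ge: "1 \<le> W ^ k" "W \<le> W ^ k"
  using W_ge pos self_le_power[of W k] by auto

lemma small_le_U: "v \<le> 20 * W \<Longrightarrow> v \<le> U"
  using W_power_U by linarith

lemma kU: "k \<le> W ^ k" "k \<le> U"
proof -
  have "k < 2 ^ k" by (rule less_exp)
  also have "\<dots> \<le> W ^ k" using W_ge by (intro power_mono) auto
  finally show "k \<le> W ^ k" by simp
  then show "k \<le> U" using W_power_U by linarith
qed

lemma H_le: "H \<le> (Rs * Rc) ^ k" "H \<le> L" "0 < H" "(Rs * Rc) ^ k \<le> L"
proof -
  have "Rs * (Rs * Rc) ^ (k - 1) \<le> Rs * Rc * (Rs * Rc) ^ (k - 1)" by (intro mult_le_mono1) simp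
  also have "\<dots> = (Rs * Rc) ^ k" using pos(1) by (simp flip: power_Suc)
  finally show 1: "H \<le> (Rs * Rc) ^ k" unfolding H_def .
  show 2: "(Rs * Rc) ^ k \<le> L" unfolding L_def by (intro power_mono RsRc) simp
  show "H \<le> L" using 1 2 by (rule le_trans)
  show "0 < H" by (simp add: H_def)
qed

lemma L_pos: "0 < L" "Rt \<le> L"
proof -
  have "Rt * 1 \<le> Rt * Rc" by (intro mult_le_mono) auto
  also have "\<dots> \<le> L" unfolding L_def using pos(1) by (intro self_le_power) auto
  finally show "Rt \<le> L" by simp
  then show "0 < L" using R_pos(3) by linarith
qed

lemma \<beta>: "2 \<le> \<beta>" "\<beta> \<le> U" "L < \<beta>"
  using L_le W_power_U(4) W_k_ge L_pos by (simp_all add: \<beta>_def)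

lemmas sU = short_bound[OF U order_refl]

lemma sols_bounds:
  "sols k c b F \<subseteq> {..<L}" "sols k c t F \<subseteq> {..<L}"
  using sols_less[of k c b F] sols_less[of k c t F] H_le(4) by (auto simp: L_def Rs_def Rc_def Rt_def)

lemma sols_class_bound:
  "finite F \<Longrightarrow> card F \<le> m \<Longrightarrow> sols k c b F \<subseteq> {..<(m + 1) * H}"
  using sols_less_card[of k F m c b] pos by (simp add: H_def Rs_def Rc_def)

text \<open>As \<open>y \<le> b\<close>, the largest code \<open>D ^ (k - 1) * (Rs + y)\<close> is
  at most \<open>2 * H\<close>, so a leaf costs about one item's share of the digits of a class
  table.\<close>

lemma run_leaf:
  assumes y: "y \<le> b"
    and \<rho>: "\<rho> RS = Rs" "\<rho> RC = Rc" "\<rho> YV = y" "\<rho> B = \<beta>" "\<alpha> Out = (\<lambda>_. 0)"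
  shows "run (leaf k) \<rho> \<alpha> xs (4000 * (k + 1) * H * \<kappa>\<^sup>2)
    (\<lambda>\<rho>' \<alpha>' xs'. \<rho>' Z = bits \<beta> (sols k c b {y}) \<and> \<alpha>' Out = (\<lambda>_. 0) \<and> xs' = xs)"
proof -
  define D where "D = Rs * Rc"
  have D: "1 \<le> D" "D \<le> W" using RsRc' by (simp_all add: D_def Suc_le_eq)
  let ?S = "\<lambda>i. insert 0 ((\<lambda>i. D ^ i * (Rs + y)) ` {..<i})"
  \<comment> \<open>\<open>Y\<close> has a known value only after the first pass;
    \<open>0 < k\<close> guarantees that there is one.\<close>
  let ?Inv = "\<lambda>i \<rho>' \<alpha>' xs'. \<rho>' J = i \<and> \<rho>' M = D ^ i \<and> \<alpha>' Out = ind (?S i) \<and> (0 < i \<longrightarrow>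
    \<rho>' Y = D ^ (i - 1) * (Rs + y)) \<and> xs' = xs"
  let ?\<rho> = "\<rho>(M := 1, J := 0)" and ?\<alpha> = "\<alpha>(Out := ind {0})"
  have yR: "Rs + y \<le> 2 * Rs" "Rs + y \<le> 2 * W" "Rs \<le> W" "y \<le> W" "Rc \<le> W"
    using y wideD[OF wide_merge] W_ge by (simp_all add: Rs_def)
  let ?post = "\<lambda>\<rho>' \<alpha>' xs'. \<rho>' Z = bits \<beta> (sols k c b {y}) \<and> \<alpha>' Out = (\<lambda>_. 0) \<and> xs' = xs"
  have loop: "run (WHILE C k \<ominus> V J DO leaf_step) ?\<rho> ?\<alpha> xs (k * (80 * \<kappa>) + (k + 1) * (7 * \<kappa>)) (?Inv k)"
  proof (rule run_Loop[OF \<kappa>, where n = k and \<tau> = "\<lambda>_. 80 * \<kappa>" and Inv = ?Inv])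
    show "?Inv 0 ?\<rho> ?\<alpha> xs" by simp
  next
    fix i \<rho>' \<alpha>' xs'
    assume i: "i < k" and I: "?Inv i \<rho>' \<alpha>' xs'" and "same (wv leaf_step) ?\<rho> \<rho>'"
    then have r: "\<rho>' RS = Rs" "\<rho>' RC = Rc" "\<rho>' YV = y" "\<rho>' J = i" "\<rho>' M = D ^ i" "\<alpha>' Out = ind (?S i)"
      "xs' = xs"
      using \<rho> by (simp_all add: same_def)
    have Di: "D ^ i \<le> W ^ k"
    proof -
      have "D ^ i \<le> D ^ k" using D i by (intro power_increasing) auto
      also have "\<dots> \<le> W ^ k" using D by (intro power_mono) auto
      finally show ?thesis .
    qed
    have m: "D ^ i * (Rs + y) \<le> W ^ k * (2 * W)" "D ^ i * D \<le> W ^ k * W"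
      using Di yR D by (intro mult_le_mono; simp)+
    have mU: "D ^ i * (Rs + y) \<le> U" "D ^ i * (Rs * Rc) \<le> U" "D ^ i \<le> U" "Rs * Rc \<le> U" "Rs + y \<le> U" "Rs \<le> U"
      "y \<le> U"
      "Rc \<le> U" "Suc i \<le> U" "i \<le> U" "1 \<le> U" "Suc 0 \<le> U"
    proof -
      have "W ^ k * (2 * W) = 2 * (W * W ^ k)" "W ^ k * W = W * W ^ k" by simp_all
      then show "D ^ i * (Rs + y) \<le> U" "D ^ i * (Rs * Rc) \<le> U" using m W_power_U(1) unfolding D_def
        by linarith+
      show "D ^ i \<le> U" "Rs * Rc \<le> U" "Rs + y \<le> U" "Rs \<le> U" "y \<le> U" "Rc \<le> U" "Suc i \<le> U" "i \<le> U" "1 \<le> U"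
        "Suc 0 \<le> U"
        using Di W_power_U D yR i kU unfolding D_def by linarith+
    qed
    have "ind (insert (D ^ i * (Rs + y)) (?S i)) = ind (?S (Suc i))"
      by (simp add: lessThan_Suc insert_commute)
    moreover have "(ind (?S i))(D ^ i * (Rs + y) := 1) = ind (insert (D ^ i * (Rs + y)) (?S i))"
      by (auto simp: ind_def)
    ultimately have out: "(ind (?S i))(D ^ i * (Rs + y) := 1) = ind (?S (Suc i))" by simp
    have "run leaf_step \<rho>' \<alpha>' xs' (80 * \<kappa>) (\<lambda>\<rho>' \<alpha>' xs'. \<rho>' J = Suc i \<and> \<rho>' M = D ^ i * (Rs * Rc) \<and>
      \<alpha>' Out = (ind (?S i))(D ^ i * (Rs + y) := 1) \<and> \<rho>' Y = D ^ i * (Rs + y) \<and> xs' = xs)"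
      unfolding leaf_step_def
      by (rule run_flat[OF \<kappa>]) (simp_all add: r sU mU del: add_mult_distrib2)
    then have "run leaf_step \<rho>' \<alpha>' xs' (80 * \<kappa>) (?Inv (Suc i))"
      by (rule run_conseq[OF _ order_refl]) (use out in \<open>auto simp: D_def mult.commute\<close>)
    moreover have "ebd \<kappa> (C k \<ominus> V J) \<rho>' \<alpha>'" "ev (C k \<ominus> V J) \<rho>' \<alpha>' \<noteq> 0"
      using r i kU mU by (simp_all add: sU)
    ultimately show "ebd \<kappa> (C k \<ominus> V J) \<rho>' \<alpha>' \<and> ev (C k \<ominus> V J) \<rho>' \<alpha>' \<noteq> 0 \<and>
      run leaf_step \<rho>' \<alpha>' xs' (80 * \<kappa>) (?Inv (Suc i))" by blast
  next
    fix \<rho>' \<alpha>' xs'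
    assume "?Inv k \<rho>' \<alpha>' xs'"
    then show "ebd \<kappa> (C k \<ominus> V J) \<rho>' \<alpha>' \<and> ev (C k \<ominus> V J) \<rho>' \<alpha>' = 0 \<and> ?Inv k \<rho>' \<alpha>' xs'"
      using kU by (simp add: sU)
  next
    show "(\<Sum>i<k. 80 * \<kappa>) + (k + 1) * ((esize (C k \<ominus> V J) + 1) * \<kappa>) \<le> k * (80 * \<kappa>) + (k + 1) * (7 * \<kappa>)" by simp
  qed
  define x where "x = D ^ (k - 1) * (Rs + y)"
  have sk: "?S k = sols k c b {y}"
    using sols_singleton[of c y b k] y pos by (simp add: D_def Rs_def Rc_def)
  have xH: "x \<le> 2 * H"
  proof -
    have "x \<le> D ^ (k - 1) * (2 * Rs)" unfolding x_def using yR by (intro mult_le_mono2) auto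
    then show ?thesis by (simp add: H_def D_def ac_simps)
  qed
  have xU: "4 * x + 4 \<le> U" using xH H_le(2) L_le W_power_U(4) W_k_ge by linarith
  have le: "e \<le> x" if "e \<in> ?S k" for e
  proof -
    have "D ^ i * (Rs + y) \<le> x" if "i < k" for i
      unfolding x_def using D that by (intro mult_le_mono1 power_increasing) auto
    then show ?thesis using that by auto
  qed
  have fin: "run (MX ::= V Y ;; pack) \<rho>' \<alpha>' xs' (6 * \<kappa> + 1000 * (x + 1) * \<kappa>\<^sup>2) ?post"
    if I: "?Inv k \<rho>' \<alpha>' xs'" and B: "\<rho>' B = \<beta>" for \<rho>' \<alpha>' xs'
  proof (rule run_prefix[OF \<kappa>, where T' = "1000 * (x + 1) * \<kappa>\<^sup>2"])
    have Y: "\<rho>' Y = x" using I pos by (simp add: x_def)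
    have "run pack (\<rho>'(MX := x)) \<alpha>' xs' (1000 * (x + 1) * \<kappa>\<^sup>2)
      (\<lambda>\<rho>' \<alpha>' xs'. \<rho>' Z = (\<Sum>i\<le>x. ind (?S k) i * \<beta> ^ i) \<and> \<alpha>' Out = (\<lambda>_. 0) \<and> xs' = xs)"
    proof (rule run_conseq[OF run_pack[OF \<kappa> U xU \<beta>(1,2), where f = "ind (?S k)"] order_refl])
      show "ind (?S k) i < \<beta>" for i using \<beta>(1) by (simp add: ind_def)
      show "\<forall>i>x. ind (?S k) i = 0"
      proof (intro allI impI)
        fix i assume "x < i"
        then have "i \<notin> ?S k" using le[of i] not_le by blast
        then show "ind (?S k) i = 0" unfolding ind_def by (rule if_not_P)
      qed
    qed (use I B in auto)
    moreover have "(\<Sum>i\<le>x. ind (?S k) i * \<beta> ^ i) = bits \<beta> (sols k c b {y})" unfolding sk[symmetric]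
      using le by (intro sum_ind) blast
    ultimately have "run pack (\<rho>'(MX := x)) \<alpha>' xs' (1000 * (x + 1) * \<kappa>\<^sup>2) ?post" by simp
    then show "wpc \<kappa> (MX ::= V Y) \<rho>' \<alpha>' (\<lambda>\<rho>' \<alpha>'. run pack \<rho>' \<alpha>' xs' (1000 * (x + 1) * \<kappa>\<^sup>2) ?post)"
      using Y xU by (simp add: sU)
  qed simp
  have main: "run (WHILE C k \<ominus> V J DO leaf_step ;; MX ::= V Y ;; pack) ?\<rho> ?\<alpha> xs
     (k * (80 * \<kappa>) + (k + 1) * (7 * \<kappa>) + (6 * \<kappa> + 1000 * (x + 1) * \<kappa>\<^sup>2)) ?post"
    by (rule run_Comp[OF loop fin order_refl]) (use \<rho> in \<open>simp_all add: same_def\<close>)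
  show ?thesis
    unfolding leaf_def
  proof (rule run_prefix[OF \<kappa>, where T' = "k * (80 * \<kappa>) + (k + 1) * (7 * \<kappa>) + (6 * \<kappa> + 1000 * (x
    + 1) * \<kappa>\<^sup>2)"])
    have "(\<lambda>_. 0)(0 := Suc 0) = ind {0}" by (auto simp: ind_def)
    then show "wpc \<kappa> (Out\<langle>C 0\<rangle> ::= C 1 ;; M ::= C 1 ;;
      J ::= C 0) \<rho> \<alpha> (\<lambda>\<rho> \<alpha>. run (WHILE C k \<ominus> V J DO leaf_step ;; MX ::= V Y ;; pack)
      \<rho> \<alpha> xs (k * (80 * \<kappa>) + (k + 1) * (7 * \<kappa>) + (6 * \<kappa> + 1000 * (x + 1) * \<kappa>\<^sup>2)) ?post)"
      using main \<rho> small_le_U[of "Suc 0"] W_ge by (simp add: sU)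
    define a where "a = \<kappa>\<^sup>2"
    have a: "\<kappa> \<le> a" using \<kappa> by (simp add: a_def power2_eq_square)
    have "csize (Out\<langle>C 0\<rangle> ::= C 1 ;; M ::= C 1 ;; J ::= C 0) * \<kappa> +
      (k * (80 * \<kappa>) + (k + 1) * (7 * \<kappa>) + (6 * \<kappa> + 1000 * (x + 1) * a)) = (87 * k + 31) * \<kappa> + 1000 * (x
        + 1) * a"
      by (simp add: algebra_simps)
    also have "\<dots> \<le> (87 * k + 31) * a + 1000 * (2 * H + 1) * a" using a xH
      by (intro add_mono mult_le_mono) auto
    also have "\<dots> = (87 * k + 1031 + 2000 * H) * a" by (simp add: algebra_simps)
    also have "\<dots> \<le> (4000 * (k + 1) * H) * a"
    proof (rule mult_le_mono1)
      have "k * 1 \<le> k * H" using H_le(3) by (intro mult_le_mono2) simp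
      then have "87 * k + 1031 + 2000 * H \<le> 4000 * (k * H) + 4000 * H" using H_le(3) by linarith
      then show "87 * k + 1031 + 2000 * H \<le> 4000 * (k + 1) * H" by (simp add: algebra_simps)
    qed
    finally show "csize (Out\<langle>C 0\<rangle> ::= C 1 ;; M ::= C 1 ;; J ::= C 0) * \<kappa> +
      (k * (80 * \<kappa>) + (k + 1) * (7 * \<kappa>) + (6 * \<kappa> + 1000 * (x + 1) * \<kappa>\<^sup>2)) \<le> 4000 * (k + 1) * H * \<kappa>\<^sup>2"
      by (simp add: a_def)
  qed
qed

lemma \<kappa>_sq: "\<kappa> \<le> \<kappa>\<^sup>2" "1 \<le> \<kappa>\<^sup>2"
  using \<kappa> by (simp_all add: power2_eq_square Suc_le_eq)

lemma short_bits:
  assumes "D \<subseteq> {..<n}" "0 < n" "n * \<kappa> \<le> \<mu>"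
  shows "short \<mu> (bits \<beta> D)"
  using short_power[OF U \<beta>(2) bits_less[OF assms(1) \<beta>(1)] assms(2,3)] .

lemma sols_class_bound':
  assumes "finite F" "card F \<le> m" "(m + 1) * H \<le> h"
  shows "sols k c b F \<subseteq> {..<h}"
  using sols_class_bound[OF assms(1,2)] assms(3) by (meson lessThan_subset_iff subset_trans)

text \<open>Every candidate \<open>y \<le> b\<close> is tested, but only a present one pays for a
  leaf. The cost of a pass depends on \<open>y\<close> accordingly, and \<open>items\<close> counts
  the expensive passes.\<close>

lemma run_gather:
  assumes r: "r < l" and Zs: "Zs \<subseteq> {..t}"
    and \<rho>: "\<rho> RS = Rs" "\<rho> RC = Rc" "\<rho> B = \<beta>" "\<rho> LL = l" "\<rho> R = r" "\<rho> SM = b" "\<rho> NR = 1" "\<rho> YV = 0"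
      "\<alpha> Out = (\<lambda>_. 0)" "\<alpha> Pres = ind Zs" "\<alpha> Tab 0 = 1"
  defines "items \<equiv> filter (\<lambda>y. r + l * y \<in> Zs) [0..<b + 1]"
  shows "run (WHILE V SM \<oplus> C 1 \<ominus> V YV DO gather_step k) \<rho> \<alpha> xs
      ((b + 2) * (60 * \<kappa>) + length items * (5000 * (k + 1) * H * \<kappa>\<^sup>2))
    (\<lambda>\<rho>' \<alpha>' xs'. \<rho>' NR = Suc (length items) \<and> \<alpha>' Out = (\<lambda>_. 0) \<and> \<alpha>' Tab 0 = 1 \<and>
      (\<forall>i<length items. \<alpha>' Tab (Suc i) = bits \<beta> (sols k c b {items ! i})) \<and> xs' = xs)"
proof -
  define T where "T = 5000 * (k + 1) * H * \<kappa>\<^sup>2"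
  let ?p = "\<lambda>y. r + l * y \<in> Zs"
  let ?it = "\<lambda>y. filter ?p [0..<y]"
  let ?Inv = "\<lambda>y \<rho>' \<alpha>' xs'. \<rho>' YV = y \<and> \<rho>' NR = Suc (length (?it y)) \<and> \<alpha>' Out = (\<lambda>_. 0) \<and> \<alpha>' Tab 0 = 1 \<and>
      (\<forall>i<length (?it y). \<alpha>' Tab (Suc i) = bits \<beta> (sols k c b {?it y ! i})) \<and> xs' = xs"
  have len: "length (?it y) \<le> y" for y using length_filter_le[of ?p "[0..<y]"] by simp
  have lb: "l * b \<le> t" by (simp add: b_def)
  have tU: "20 * t + 20 \<le> U" using W_power_U(5) W_ge pos by linarith
  show ?thesis
  proof (rule run_Loop[OF \<kappa>, where n = "b + 1" and Inv = ?Inv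
        and \<tau> = "\<lambda>y. 40 * \<kappa> + (if ?p y then T else 0)"])
    show "?Inv 0 \<rho> \<alpha> xs" using \<rho> by simp
  next
    fix y \<rho>' \<alpha>' xs'
    assume y: "y < b + 1" and I: "?Inv y \<rho>' \<alpha>' xs'"
      and s: "same (wv (gather_step k)) \<rho> \<rho>'" "same (wa (gather_step k)) \<alpha> \<alpha>'"
    then have r': "\<rho>' RS = Rs" "\<rho>' RC = Rc" "\<rho>' B = \<beta>" "\<rho>' LL = l" "\<rho>' R = r" "\<rho>' SM = b" "\<alpha>' Pres = ind Zs"
      using \<rho> by (simp_all add: same_def)
    have yb: "y \<le> b" using y by simp
    have ly: "l * y \<le> t" using mult_le_mono2[OF yb, of l] lb by linarith
    have idx: "r + l * y \<le> U" "l * y \<le> U" "l \<le> U" "r \<le> U" "y \<le> U" "Suc y \<le> U" "b \<le> U" "Suc b \<le> U"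
      "Suc (Suc y) \<le> U"
      "Suc (length (?it y)) \<le> U" "Suc (Suc (length (?it y))) \<le> U" "Suc 0 \<le> U" "0 \<le> U"
      using ly r pos yb b_le tU len[of y] by linarith+
    have it: "?it (Suc y) = (if ?p y then ?it y @ [y] else ?it y)" by simp
    let ?mid = "\<lambda>\<rho>' \<alpha>' xs'. \<rho>' YV = y \<and> \<rho>' NR = Suc (length (?it (Suc y))) \<and> \<alpha>' Out = (\<lambda>_. 0) \<and> \<alpha>' Tab 0 = 1 \<and>
      (\<forall>i<length (?it (Suc y)). \<alpha>' Tab (Suc i) = bits \<beta> (sols k c b {?it (Suc y) ! i})) \<and> xs' = xs"
    have mid: "run (IF A Pres (V R \<oplus> V LL \<otimes> V YV) THEN (leaf k ;; Tab\<langle>V NR\<rangle> ::= V Z ;;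
      NR ::= V NR \<oplus> C 1) ELSE Nop)
       \<rho>' \<alpha>' xs' (30 * \<kappa> + (if ?p y then T else 0)) ?mid"
    proof (cases "?p y")
      case False
      have "run Nop \<rho>' \<alpha>' xs' \<kappa> ?mid" using I False \<kappa> by (intro run_Nop) simp_all
      then show ?thesis
        using False I r' idx
        by (intro run_If[OF \<kappa>, where ?T1.0 = \<kappa>]) (simp_all add: sU ind_def)
    next
      case True
      define x where "x = bits \<beta> (sols k c b {y})"
      have mu: "\<kappa> \<le> 2 * H * \<kappa>" "6 \<le> 2 * H * \<kappa>"
      proof -
        show "\<kappa> \<le> 2 * H * \<kappa>" using H_le(3) by simp
        then show "6 \<le> 2 * H * \<kappa>" using \<kappa> by linarith
      qed
      have sx: "short (2 * H * \<kappa>) x"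
        using sols_class_bound'[of "{y}" 1 "2 * H"] H_le(3) unfolding x_def
          by (intro short_bits[of _ "2 * H"]) simp_all
      note mU = short_bound[OF U mu(1)]
      have st: "run (Tab\<langle>V NR\<rangle> ::= V Z ;; NR ::= V NR \<oplus> C 1) \<rho>2 \<alpha>2 xs2 (30 * (2 * H * \<kappa>)) ?mid"
        if "\<rho>2 Z = x \<and> \<alpha>2 Out = (\<lambda>_. 0) \<and> xs2 = xs'" "same (wv (leaf k)) \<rho>' \<rho>2" "same (wa (leaf k)) \<alpha>' \<alpha>2"
          for \<rho>2 \<alpha>2 xs2
      proof -
        have e: "\<rho>2 Z = x" "\<alpha>2 Out = (\<lambda>_. 0)" "xs2 = xs" "\<rho>2 YV = y" "\<rho>2 NR = Suc (length (?it y))"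
          "\<alpha>2 Tab = \<alpha>' Tab"
          using that I by (simp_all add: same_def)
        have "run (Tab\<langle>V NR\<rangle> ::= V Z ;; NR ::= V NR \<oplus> C 1) \<rho>2 \<alpha>2 xs2 (30 * (2 * H * \<kappa>))
          (\<lambda>\<rho>3 \<alpha>3 xs3. \<rho>3 YV = y \<and> \<rho>3 NR = Suc (Suc (length (?it y))) \<and> \<alpha>3 Out = (\<lambda>_. 0) \<and>
            \<alpha>3 Tab = (\<alpha>' Tab)(Suc (length (?it y)) := x) \<and> xs3 = xs)"
          by (rule run_flat[OF mu(2)]) (simp_all add: e mU idx sx)
        then show ?thesis
          by (rule run_conseq[OF _ order_refl]) (use I True in \<open>auto simp: x_def nth_append less_Suc_eq\<close>)
      qed
      have "run (leaf k ;; Tab\<langle>V NR\<rangle> ::= V Z ;; NR ::= V NR \<oplus> C 1) \<rho>' \<alpha>' xs' T ?mid"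
      proof (rule run_Comp[OF run_leaf[OF yb] st])
        have a: "H * \<kappa> \<le> H * \<kappa>\<^sup>2" "60 * (H * \<kappa>\<^sup>2) \<le> 1000 * (k + 1) * H * \<kappa>\<^sup>2"
          using \<kappa>_sq(1) by simp_all
        have "30 * (2 * H * \<kappa>) = 60 * (H * \<kappa>)" by simp
        moreover have "T = 4000 * (k + 1) * H * \<kappa>\<^sup>2 + 1000 * (k + 1) * H * \<kappa>\<^sup>2"
          by (simp add: T_def algebra_simps)
        ultimately show "4000 * (k + 1) * H * \<kappa>\<^sup>2 + 30 * (2 * H * \<kappa>) \<le> T" using a by linarith
      qed (use I r' in \<open>simp_all add: x_def\<close>)
      then show ?thesis
        using True I r' idx by (intro run_If[OF \<kappa>, where ?T1.0 = T]) (simp_all add: sU ind_def)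
    qed
    have "run (gather_step k) \<rho>' \<alpha>' xs' (40 * \<kappa> + (if ?p y then T else 0)) (?Inv (Suc y))"
      unfolding gather_step_def
    proof (rule run_Comp[OF mid])
      fix \<rho>2 \<alpha>2 xs2 assume "?mid \<rho>2 \<alpha>2 xs2"
      then show "run (YV ::= V YV \<oplus> C 1) \<rho>2 \<alpha>2 xs2 (9 * \<kappa>) (?Inv (Suc y))"
        using idx by (intro run_flat[OF \<kappa>]) (simp_all add: sU)
    qed simp
    moreover have "ebd \<kappa> (V SM \<oplus> C 1 \<ominus> V YV) \<rho>' \<alpha>'" "ev (V SM \<oplus> C 1 \<ominus> V YV) \<rho>' \<alpha>' \<noteq> 0"
      using r' I yb idx by (simp_all add: sU)
    ultimately show "ebd \<kappa> (V SM \<oplus> C 1 \<ominus> V YV) \<rho>' \<alpha>' \<and> ev (V SM \<oplus> C 1 \<ominus> V YV) \<rho>' \<alpha>' \<noteq> 0 \<and>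
      run (gather_step k) \<rho>' \<alpha>' xs' (40 * \<kappa> + (if ?p y then T else 0)) (?Inv (Suc y))" by blast
  next
    fix \<rho>' \<alpha>' xs'
    assume I: "?Inv (b + 1) \<rho>' \<alpha>' xs'" and s: "same (wv (gather_step k)) \<rho> \<rho>'"
    then have "\<rho>' SM = b" using \<rho> by (simp add: same_def)
    then have "ebd \<kappa> (V SM \<oplus> C 1 \<ominus> V YV) \<rho>' \<alpha>'" "ev (V SM \<oplus> C 1 \<ominus> V YV) \<rho>' \<alpha>' = 0"
      using I b_le tU by (simp_all add: sU)
    then show "ebd \<kappa> (V SM \<oplus> C 1 \<ominus> V YV) \<rho>' \<alpha>' \<and> ev (V SM \<oplus> C 1 \<ominus> V YV) \<rho>' \<alpha>' = 0 \<and>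
      \<rho>' NR = Suc (length items) \<and> \<alpha>' Out = (\<lambda>_. 0) \<and> \<alpha>' Tab 0 = 1 \<and>
      (\<forall>i<length items. \<alpha>' Tab (Suc i) = bits \<beta> (sols k c b {items ! i})) \<and> xs' = xs"
      using I unfolding items_def by blast
  next
    have "(\<Sum>y<b + 1. 40 * \<kappa> + (if ?p y then T else 0)) = (b + 1) * (40 * \<kappa>) + length items * T"
      unfolding sum.distrib sum_filter_upt items_def by simp
    then show "(\<Sum>y<b + 1. 40 * \<kappa> + (if ?p y then T else 0)) + (b + 1 + 1) * ((esize (V SM \<oplus> C 1 \<ominus> V YV)
      + 1) * \<kappa>)
       \<le> (b + 2) * (60 * \<kappa>) + length items * (5000 * (k + 1) * H * \<kappa>\<^sup>2)"
      by (simp add: T_def)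
  qed
qed

section \<open>Merging the tables of a residue class along a binary tree\<close>

definition merging :: "vars \<Rightarrow> bool" where
  "merging \<rho> \<longleftrightarrow> layout \<rho> Rs Rc Rs 1 0 b c b \<and> \<rho> B = \<beta>"

definition un :: "(nat \<Rightarrow> nat set) \<Rightarrow> nat \<Rightarrow> nat \<Rightarrow> nat set" where
  "un F s i = (\<Union>j\<in>{i..<i + s}. F j)"

lemma un_double: "un F (2 * s) i = un F s i \<union> un F s (i + s)"
proof -
  have "{i..<i + 2 * s} = {i..<i + s} \<union> {i + s..<i + s + s}" by auto
  then show ?thesis by (simp add: un_def)
qed

text \<open>Few items have small codes: at most \<open>s\<close> items need no more than
  \<open>2 * s * H\<close> digits, so the product needs \<open>4 * s * H\<close>, and the union of
  at most \<open>2 * s\<close> items again only \<open>3 * s * H\<close>. A merge is thus linear in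
  \<open>s * H\<close>.\<close>

lemma run_clip_merge:
  assumes F: "finite F" "card F \<le> s" and F': "finite F'" "card F' \<le> s" and dis: "F \<inter> F' = {}"
    and s: "0 < s" "s \<le> t + 1"
    and \<rho>: "merging \<rho>" "\<rho> Z = bits \<beta> (sols k c b F) * bits \<beta> (sols k c b F')" "\<alpha> Out = (\<lambda>_. 0)"
  shows "run (clip k) \<rho> \<alpha> xs (40000 * (k + 1) * s * H * \<kappa>\<^sup>2)
     (\<lambda>\<rho>' \<alpha>' xs'. \<rho>' Z = bits \<beta> (sols k c b (F \<union> F')) \<and> \<alpha>' Out = (\<lambda>_. 0) \<and> xs' = xs)"
proof -
  let ?z = "bits \<beta> (sols k c b F) * bits \<beta> (sols k c b F')"
  have H1: "H \<le> s * H" using s by simp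
  have sH: "(s + 1) * H \<le> 2 * (s * H)" "(2 * s + 1) * H \<le> 3 * (s * H)" using H1 by simp_all
  have sub: "sols k c b F \<subseteq> {..<2 * (s * H)}" "sols k c b F' \<subseteq> {..<2 * (s * H)}"
    by (rule sols_class_bound'[OF F sH(1)] sols_class_bound'[OF F' sH(1)])+
  have "card (F \<union> F') \<le> 2 * s" using card_Un_le[of F F'] F F' by linarith
  then have sub': "sols k c b (F \<union> F') \<subseteq> {..<3 * (s * H)}"
    using F F' by (intro sols_class_bound'[OF _ _ sH(2)]) simp_all
  have sU': "4 * (4 * (s * H)) + 4 \<le> U" "4 * (3 * (s * H)) + 4 \<le> U"
  proof -
    have "s * H \<le> (2 * t) * W ^ k" using s pos H_le(2) L_le by (intro mult_le_mono) auto
    moreover have "1 \<le> t * W ^ k" using pos W_k_ge by simp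
    ultimately show "4 * (4 * (s * H)) + 4 \<le> U" "4 * (3 * (s * H)) + 4 \<le> U" using W_power_U(2) by linarith+
  qed
  have z: "?z < \<beta> ^ (4 * (s * H))"
  proof -
    have "?z < \<beta> ^ (2 * (s * H)) * \<beta> ^ (2 * (s * H))"
      using bits_less[OF sub(1) \<beta>(1)] bits_less[OF sub(2) \<beta>(1)] \<beta>(1) by (intro mult_strict_mono) simp_all
    then show ?thesis by (simp flip: power_add)
  qed
  have dig: "?z div \<beta> ^ e mod \<beta> \<noteq> 0 \<longleftrightarrow> (\<exists>a\<in>sols k c b F. \<exists>a'\<in>sols k c b F'. e = a + a')" for e
    by (rule bits_mult_digit[OF sols_bounds(1) sols_bounds(1) \<beta>(3)])
  have res: "recode k Rs Rc Rs 1 0 ` {e. ?z div \<beta> ^ e mod \<beta> \<noteq> 0 \<and>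
    fits k Rs Rc 1 0 b c b e} = sols k c b (F \<union> F')"
    using sols_union[OF F(1) F'(1) dis, where k = k and b = b and c = c] unfolding dig Rs_def Rc_def by simp
  have bU: "b \<le> U" "c \<le> U" using b_le W_power_U(5) W_ge by linarith+
  have lay: "layout \<rho> Rs Rc Rs 1 0 b c b" "\<rho> B = \<beta>" using \<rho>(1) by (simp_all add: merging_def)
  have "run (clip k) \<rho> \<alpha> xs (5000 * (k + 1) * (4 * (s * H) + 3 * (s * H) + 1) * \<kappa>\<^sup>2)
    (\<lambda>\<rho>' \<alpha>' xs'. \<rho>' Z = bits \<beta> (recode k Rs Rc Rs 1 0 ` {e. ?z div \<beta> ^ e mod \<beta> \<noteq> 0 \<and>
      fits k Rs Rc 1 0 b c b e}) \<and>
       \<alpha>' Out = (\<lambda>_. 0) \<and> xs' = xs)"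
  proof (rule run_clip[where \<rho> = \<rho> and \<alpha> = \<alpha> and z = ?z and k
    = k, OF \<kappa> U W_power_U(3) sU' \<beta>(1,2) _ wide_merge lay(1) bU bU(1) \<rho>(2) z lay(2) \<rho>(3)])
    show "0 < 4 * (s * H)" using s H_le(3) by simp
    \<comment> \<open>Accepted codes are solutions for the union, hence below the bound for
      \<open>2 * s\<close> items.\<close>
    fix e assume "fits k Rs Rc 1 0 b c b e" "?z div \<beta> ^ e mod \<beta> \<noteq> 0"
    then have "recode k Rs Rc Rs 1 0 e \<in> sols k c b (F \<union> F')" unfolding res[symmetric] by blast
    then show "recode k Rs Rc Rs 1 0 e \<le> 3 * (s * H)" using sub' by fastforce
  qed
  then show ?thesis
    unfolding res
  proof (rule run_conseq)
    have "4 * (s * H) + 3 * (s * H) + 1 \<le> 8 * (s * H)" using s H_le(3) by (simp add: Suc_le_eq)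
    then have "5000 * (k + 1) * (4 * (s * H) + 3 * (s * H) + 1) * \<kappa>\<^sup>2 \<le> 5000 * (k + 1) * (8 * (s * H)) * \<kappa>\<^sup>2"
      by (intro mult_le_mono1 mult_le_mono2)
    also have "\<dots> = 40000 * (k + 1) * s * H * \<kappa>\<^sup>2" by (simp add: algebra_simps)
    finally show "5000 * (k + 1) * (4 * (s * H) + 3 * (s * H) + 1) * \<kappa>\<^sup>2 \<le> 40000 * (k + 1) * s * H * \<kappa>\<^sup>2" .
  qed
qed

lemma run_merge_step:
  assumes F: "finite F" "card F \<le> s" and F': "finite F'" "card F' \<le> s" and dis: "F \<inter> F' = {}"
    and s: "0 < s" "s \<le> t + 1" "i + s \<le> t + 1"
    and \<rho>: "merging \<rho>" "\<rho> II = i" "\<rho> ST = s" "\<alpha> Out = (\<lambda>_. 0)"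
      "\<alpha> Tab i = bits \<beta> (sols k c b F)" "\<alpha> Tab (i + s) = bits \<beta> (sols k c b F')"
  shows "run (merge_step k) \<rho> \<alpha> xs (50000 * (k + 1) * s * H * \<kappa>\<^sup>2)
     (\<lambda>\<rho>' \<alpha>' xs'. \<rho>' II = i + 2 * s \<and> \<alpha>' Tab = (\<alpha> Tab)(i := bits \<beta> (sols k c b (F \<union> F'))) \<and>
       \<alpha>' Out = (\<lambda>_. 0) \<and> xs' = xs)"
proof -
  define x y where xy: "x = bits \<beta> (sols k c b F)" "y = bits \<beta> (sols k c b F')"
  define w where "w = bits \<beta> (sols k c b (F \<union> F'))"
  define h where "h = s * H"
  have H1: "H \<le> h" using s by (simp add: h_def)
  have h0: "0 < h" using H1 H_le(3) by linarith
  have sH: "(s + 1) * H \<le> 2 * h" "(2 * s + 1) * H \<le> 3 * h" using H1 by (simp_all add: h_def)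
  define \<mu> where "\<mu> = 4 * h * \<kappa>"
  have mu: "\<kappa> \<le> \<mu>" using h0 by (simp add: \<mu>_def)
  then have mu6: "6 \<le> \<mu>" using \<kappa> by linarith
  note mU = short_bound[OF U mu]
  have sub: "sols k c b F \<subseteq> {..<2 * h}" "sols k c b F' \<subseteq> {..<2 * h}"
    by (rule sols_class_bound'[OF F sH(1)] sols_class_bound'[OF F' sH(1)])+
  have "card (F \<union> F') \<le> 2 * s" using card_Un_le[of F F'] F F' by linarith
  then have sub': "sols k c b (F \<union> F') \<subseteq> {..<3 * h}"
    using F F' by (intro sols_class_bound'[OF _ _ sH(2)]) simp_all
  have sh: "short \<mu> x" "short \<mu> y" "short \<mu> w"
    unfolding xy w_def using h0
    by (auto intro!: short_bits[OF sub(1)] short_bits[OF sub(2)] short_bits[OF sub'] simp: \<mu>_def)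
  have "x * y < \<beta> ^ (2 * h) * \<beta> ^ (2 * h)"
    unfolding xy using bits_less[OF sub(1) \<beta>(1)] bits_less[OF sub(2) \<beta>(1)] \<beta>(1)
      by (intro mult_strict_mono) simp_all
  then have "short \<mu> (x * y)"
    using short_power[OF U \<beta>(2), of "x * y" "4 * h" \<mu>] h0 by (simp add: \<mu>_def flip: power_add)
  note sh = sh this
  have iU: "i \<le> U" "s \<le> U" "i + s \<le> U" "2 * s \<le> U" "s * 2 \<le> U" "i + 2 * s \<le> U" "i + s * 2 \<le> U" "2 \<le> U"
    using s W_power_U(5) W_ge pos by linarith+
  let ?post = "\<lambda>\<rho>' \<alpha>' xs'. \<rho>' II = i + 2 * s \<and> \<alpha>' Tab = (\<alpha> Tab)(i := w) \<and> \<alpha>' Out = (\<lambda>_. 0) \<and> xs' = xs"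
  have tail: "run (Tab\<langle>V II\<rangle> ::= V Z ;; II ::= V II \<oplus> V ST \<otimes> C 2) \<rho>' \<alpha>' xs' (30 * \<mu>) ?post"
    if "\<rho>' Z = w \<and> \<alpha>' Out = (\<lambda>_. 0) \<and> xs' = xs" "same (wv (clip k)) (\<rho>(Z := x * y)) \<rho>'"
      "same (wa (clip k)) \<alpha> \<alpha>'"
    for \<rho>' \<alpha>' xs'
  proof -
    have "\<rho>' II = i" "\<rho>' ST = s" "\<rho>' Z = w" "\<alpha>' Tab = \<alpha> Tab" "\<alpha>' Out = (\<lambda>_. 0)" "xs' = xs"
      using that \<rho> by (simp_all add: same_def)
    then show ?thesis using iU sh by (intro run_flat[OF mu6]) (simp_all add: mU)
  qed
  have main: "run (clip k ;; Tab\<langle>V II\<rangle> ::= V Z ;; II ::= V II \<oplus> V ST \<otimes> C 2) (\<rho>(Z := x * y)) \<alpha> xs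
      (40000 * (k + 1) * s * H * \<kappa>\<^sup>2 + 30 * \<mu>) ?post"
  proof (rule run_Comp[OF run_clip_merge[OF F F' dis s(1,2)] _ order_refl])
    show "merging (\<rho>(Z := x * y))" using \<rho>(1) by (simp add: merging_def layout_def)
  qed (use tail \<rho> in \<open>auto simp: xy w_def\<close>)
  show ?thesis
    unfolding merge_step_def w_def[symmetric]
  proof (rule run_prefix[OF mu6, where T' = "40000 * (k + 1) * s * H * \<kappa>\<^sup>2 + 30 * \<mu>"])
    show "wpc \<mu> (Z ::= A Tab (V II) \<otimes> A Tab (V II \<oplus> V ST)) \<rho> \<alpha> (\<lambda>\<rho>' \<alpha>'. run (clip k ;; Tab\<langle>V II\<rangle> ::= V Z ;;
       II ::= V II \<oplus> V ST \<otimes> C 2) \<rho>' \<alpha>' xs (40000 * (k + 1) * s * H * \<kappa>\<^sup>2 + 30 * \<mu>) ?post)"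
      using main \<rho> iU sh by (simp add: mU xy)
    define q where "q = (k + 1) * (h * \<kappa>\<^sup>2)"
    have "h * \<kappa> \<le> h * \<kappa>\<^sup>2" using \<kappa>_sq(1) by simp
    also have "\<dots> \<le> q" by (simp add: q_def)
    finally have "h * \<kappa> \<le> q" .
    moreover have "40000 * (k + 1) * s * H * \<kappa>\<^sup>2 = 40000 * q" "50000 * (k + 1) * s * H * \<kappa>\<^sup>2 = 50000 * q"
      by (simp_all add: h_def q_def algebra_simps)
    moreover have "csize (Z ::= A Tab (V II) \<otimes> A Tab (V II \<oplus> V ST)) * \<mu> = 136 * (h * \<kappa>)"
      "30 * \<mu> = 120 * (h * \<kappa>)"
      by (simp_all add: \<mu>_def)
    ultimately show "csize (Z ::= A Tab (V II) \<otimes> A Tab (V II \<oplus> V ST)) * \<mu> + (40000 * (k + 1) * s * H * \<kappa>\<^sup>2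
      + 30 * \<mu>)
      \<le> 50000 * (k + 1) * s * H * \<kappa>\<^sup>2"
      by linarith
  qed
qed

text \<open>At most one item per leaf makes a block of \<open>s\<close> leaves hold at most
  \<open>s\<close> items, and the number of items is what controls the digits of a table.\<close>

definition blocks :: "(nat \<Rightarrow> nat set) \<Rightarrow> nat \<Rightarrow> bool" where
  "blocks F n \<longleftrightarrow> (\<forall>i. finite (F i) \<and> card (F i) \<le> 1) \<and> (\<forall>i j. i \<noteq> j \<longrightarrow> F i \<inter> F j = {}) \<and> (\<forall>i>n. F i = {})"

lemma blocks_un:
  assumes "blocks F n"
  shows "finite (un F s i)" "card (un F s i) \<le> s" "un F s i \<inter> un F s (i + s) = {}" "n < i \<Longrightarrow> un F s i = {}"
proof -
  show "finite (un F s i)" using assms by (simp add: un_def blocks_def)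
  have "card (un F s i) \<le> (\<Sum>j\<in>{i..<i + s}. card (F j))" unfolding un_def by (rule card_UN_le) simp
  also have "\<dots> \<le> (\<Sum>j\<in>{i..<i + s}. 1)" using assms by (intro sum_mono) (simp add: blocks_def)
  finally show "card (un F s i) \<le> s" by simp
  have "F j \<inter> F j' = {}" if "j < i + s" "i + s \<le> j'" for j j'
    using assms that unfolding blocks_def by (metis not_less)
  then show "un F s i \<inter> un F s (i + s) = {}" unfolding un_def by fastforce
  show "n < i \<Longrightarrow> un F s i = {}" using assms by (auto simp: un_def blocks_def)
qed

text \<open>A level has \<open>d\<close> merges with \<open>d * s \<le> n\<close>, so its cost does
  not depend on \<open>s\<close>. A block without a partner stays in place: the partner would lie
  beyond \<open>n\<close> and be empty, so its table already is that of the doubled block.\<close>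

lemma run_merge_level:
  assumes F: "blocks F n" and n: "n \<le> t + 1" and s: "0 < s" "s \<le> n"
    and \<rho>: "merging \<rho>" "\<rho> NR = Suc n" "\<rho> ST = s" "\<alpha> Out = (\<lambda>_. 0)"
      "\<forall>i\<le>n. s dvd i \<longrightarrow> \<alpha> Tab i = bits \<beta> (sols k c b (un F s i))"
  shows "run (merge_level k) \<rho> \<alpha> xs (60000 * (k + 1) * n * H * \<kappa>\<^sup>2)
    (\<lambda>\<rho>' \<alpha>' xs'. \<rho>' ST = 2 * s \<and> \<alpha>' Out = (\<lambda>_. 0) \<and>
       (\<forall>i\<le>n. 2 * s dvd i \<longrightarrow> \<alpha>' Tab i = bits \<beta> (sols k c b (un F (2 * s) i))) \<and> xs' = xs)"
proof -
  define d where "d = (n + s) div (2 * s)"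
  have d: "a < d \<longleftrightarrow> 2 * s * a + s \<le> n" for a unfolding d_def by (rule less_merge_count_iff[OF s(1)])
  have nU: "4 * n + 4 \<le> U" using n W_power_U(5) W_ge pos by linarith
  let ?T = "50000 * (k + 1) * s * H * \<kappa>\<^sup>2"
  let ?x = "\<lambda>s i. bits \<beta> (sols k c b (un F s i))"
  let ?Inv = "\<lambda>a \<rho>' \<alpha>' xs'. \<rho>' II = 2 * s * a \<and> \<alpha>' Out = (\<lambda>_. 0) \<and> xs' = xs \<and>
     (\<forall>i\<le>n. i < 2 * s * a \<longrightarrow> 2 * s dvd i \<longrightarrow> \<alpha>' Tab i = ?x (2 * s) i) \<and>
     (\<forall>i\<le>n. 2 * s * a \<le> i \<longrightarrow> s dvd i \<longrightarrow> \<alpha>' Tab i = ?x s i)"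
  let ?post = "\<lambda>\<rho>' \<alpha>' xs'. \<alpha>' Out = (\<lambda>_. 0) \<and> (\<forall>i\<le>n. 2 * s dvd i \<longrightarrow> \<alpha>' Tab i = ?x (2 * s) i) \<and> xs' = xs"
  let ?e = "V NR \<ominus> (V II \<oplus> V ST)"
  have loop: "run (WHILE ?e DO merge_step k) (\<rho>(II := 0)) \<alpha> xs (d * ?T + (d + 1) * (14 * \<kappa>)) ?post"
  proof (rule run_Loop[OF \<kappa>, where n = d and \<tau> = "\<lambda>_. ?T" and Inv = ?Inv])
    show "?Inv 0 (\<rho>(II := 0)) \<alpha> xs" using \<rho> by simp
  next
    fix a \<rho>' \<alpha>' xs'
    assume a: "a < d" and I: "?Inv a \<rho>' \<alpha>' xs'"
      and sm: "same (wv (merge_step k)) (\<rho>(II := 0)) \<rho>'" "same (wa (merge_step k)) \<alpha> \<alpha>'"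
    have le: "2 * s * a + s \<le> n" using a d by simp
    have r: "\<rho>' NR = Suc n" "\<rho>' ST = s" "merging \<rho>'" "\<rho>' II = 2 * s * a" "\<alpha>' Out = (\<lambda>_. 0)"
      using \<rho> sm(1) I by (simp_all add: same_def merging_def layout_def)
    have tab: "\<alpha>' Tab (2 * s * a) = ?x s (2 * s * a)" "\<alpha>' Tab (2 * s * a + s) = ?x s (2 * s * a + s)"
      using I le by simp_all
    note u = blocks_un[OF F, of s "2 * s * a"] blocks_un(1,2)[OF F, of s "2 * s * a + s"]
    have "run (merge_step k) \<rho>' \<alpha>' xs' ?T (\<lambda>\<rho>'' \<alpha>'' xs''. \<rho>'' II = 2 * s * a + 2 * s \<and>
       \<alpha>'' Tab = (\<alpha>' Tab)(2 * s * a := bits \<beta> (sols k c b (un F s (2 * s * a) \<union> un F s (2 * s * a + s)))) \<and>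
       \<alpha>'' Out = (\<lambda>_. 0) \<and> xs'' = xs')"
      by (rule run_merge_step[OF u(1,2,5,6,3) s(1)]) (use s n le r tab in simp_all)
    then have "run (merge_step k) \<rho>' \<alpha>' xs' ?T (?Inv (Suc a))"
    proof (rule run_conseq[OF _ order_refl])
      fix \<rho>'' \<alpha>'' xs''
      assume Q: "\<rho>'' II = 2 * s * a + 2 * s \<and>
       \<alpha>'' Tab = (\<alpha>' Tab)(2 * s * a := bits \<beta> (sols k c b (un F s (2 * s * a) \<union> un F s (2 * s * a + s)))) \<and>
       \<alpha>'' Out = (\<lambda>_. 0) \<and> xs'' = xs'"
      have 1: "\<alpha>'' Tab i = ?x (2 * s) i" if "i \<le> n" "i < 2 * s * Suc a" "2 * s dvd i" for i
      proof (cases "i < 2 * s * a")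
        case True
        then show ?thesis using I Q that by simp
      next
        case False
        then have "i = 2 * s * a" using not_dvd_between[of "2 * s" a i] that by (meson linorder_neqE_nat)
        then show ?thesis using Q by (simp add: un_double)
      qed
      have 2: "\<alpha>'' Tab i = ?x s i" if "i \<le> n" "2 * s * Suc a \<le> i" "s dvd i" for i
        using I Q that s by simp
      show "?Inv (Suc a) \<rho>'' \<alpha>'' xs''" using Q I 1 2 by simp
    qed
    moreover have "ebd \<kappa> ?e \<rho>' \<alpha>'" "ev ?e \<rho>' \<alpha>' \<noteq> 0"
      using r le nU s by (simp_all add: sU)
    ultimately show "ebd \<kappa> ?e \<rho>' \<alpha>' \<and> ev ?e \<rho>' \<alpha>' \<noteq> 0 \<and> run (merge_step k) \<rho>' \<alpha>' xs' ?T (?Inv (Suc a))"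
      by blast
  next
    fix \<rho>' \<alpha>' xs'
    assume I: "?Inv d \<rho>' \<alpha>' xs'" and sm: "same (wv (merge_step k)) (\<rho>(II := 0)) \<rho>'"
    have r: "\<rho>' NR = Suc n" "\<rho>' ST = s" "\<rho>' II = 2 * s * d" using \<rho> sm I by (simp_all add: same_def)
    have gt: "n < 2 * s * d + s" using d[of d] by simp
    have le: "2 * s * d \<le> n + s" unfolding d_def by simp
    have "ebd \<kappa> ?e \<rho>' \<alpha>'" "ev ?e \<rho>' \<alpha>' = 0" using r gt le nU s by (simp_all add: sU)
    moreover have "\<alpha>' Tab i = ?x (2 * s) i" if i: "i \<le> n" "2 * s dvd i" for i
    proof (cases "i < 2 * s * d")
      case True
      then show ?thesis using I i by simp
    next
      case False
      then have "n < i + s" using gt by linarith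
      then have "un F (2 * s) i = un F s i" using blocks_un(4)[OF F, of "i + s" s] by (simp add: un_double)
      moreover have "s dvd i" using i(2) by (rule dvd_mult_right)
      ultimately show ?thesis using I i False by simp
    qed
    ultimately show "ebd \<kappa> ?e \<rho>' \<alpha>' \<and> ev ?e \<rho>' \<alpha>' = 0 \<and> ?post \<rho>' \<alpha>' xs'" using I by blast
  qed simp
  have fin: "run (ST ::= V ST \<otimes> C 2) \<rho>' \<alpha>' xs' (10 * \<kappa>) (\<lambda>\<rho>' \<alpha>' xs'. \<rho>' ST = 2 * s \<and> \<alpha>' Out = (\<lambda>_. 0) \<and>
       (\<forall>i\<le>n. 2 * s dvd i \<longrightarrow> \<alpha>' Tab i = ?x (2 * s) i) \<and> xs' = xs)"
    if "?post \<rho>' \<alpha>' xs'" "\<rho>' ST = s" for \<rho>' \<alpha>' xs'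
    using that nU s by (intro run_flat[OF \<kappa>]) (simp_all add: sU)
  have main: "run (WHILE ?e DO merge_step k ;; ST ::= V ST \<otimes> C 2) (\<rho>(II := 0)) \<alpha> xs
     (d * ?T + (d + 1) * (14 * \<kappa>) + 10 * \<kappa>) (\<lambda>\<rho>' \<alpha>' xs'. \<rho>' ST = 2 * s \<and> \<alpha>' Out = (\<lambda>_. 0) \<and>
       (\<forall>i\<le>n. 2 * s dvd i \<longrightarrow> \<alpha>' Tab i = ?x (2 * s) i) \<and> xs' = xs)"
    by (rule run_Comp[OF loop fin order_refl]) (use \<rho> in \<open>simp_all add: same_def\<close>)
  show ?thesis
    unfolding merge_level_def
  proof (rule run_prefix[OF \<kappa>, where T' = "d * ?T + (d + 1) * (14 * \<kappa>) + 10 * \<kappa>"])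
    show "wpc \<kappa> (II ::= C 0) \<rho> \<alpha> (\<lambda>\<rho>' \<alpha>'. run (WHILE ?e DO merge_step k ;; ST ::= V ST \<otimes> C 2) \<rho>' \<alpha>' xs
      (d * ?T + (d + 1) * (14 * \<kappa>) + 10 * \<kappa>) (\<lambda>\<rho>' \<alpha>' xs'. \<rho>' ST = 2 * s \<and> \<alpha>' Out = (\<lambda>_. 0) \<and>
       (\<forall>i\<le>n. 2 * s dvd i \<longrightarrow> \<alpha>' Tab i = ?x (2 * s) i) \<and> xs' = xs))"
      using main by (simp add: sU)
    have "d * (2 * s) \<le> n + s" unfolding d_def by simp
    then have ds: "d * s \<le> n" using s by simp
    have "d * 1 \<le> d * s" using s by (intro mult_le_mono2) simp
    then have dn: "d \<le> n" using ds by linarith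
    define a where "a = \<kappa>\<^sup>2"
    define w where "w = (k + 1) * (H * a)"
    have aw: "a \<le> w" "\<kappa> \<le> a"
      using \<kappa>_sq(1) H_le(3) by (simp_all add: w_def a_def Suc_le_eq trans_le_add1)
    have t: "d * ?T = 50000 * (d * s * w)" by (simp add: w_def a_def algebra_simps)
    have "d * s * w \<le> n * w" using ds by (rule mult_le_mono1)
    moreover have "(d + 1) * (14 * \<kappa>) \<le> (2 * n) * (14 * w)" using dn aw s by (intro mult_le_mono) auto
    then have "(d + 1) * (14 * \<kappa>) \<le> 28 * (n * w)" by simp
    moreover have "1 * \<kappa> \<le> n * w" using aw s by (intro mult_le_mono) auto
    then have "\<kappa> \<le> n * w" by simp
    moreover have "60000 * (k + 1) * n * H * \<kappa>\<^sup>2 = 60000 * (n * w)" by (simp add: w_def a_def algebra_simps)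
    moreover have "csize (II ::= C 0) * \<kappa> = 4 * \<kappa>" by simp
    ultimately show "csize (II ::= C 0) * \<kappa> + (d * ?T + (d + 1) * (14 * \<kappa>) + 10 * \<kappa>) \<le> 60000 * (k
      + 1) * n * H * \<kappa>\<^sup>2"
      unfolding t by linarith
  qed
qed

text \<open>After \<open>d\<close> levels the block at 0 covers all leaves, as
  \<open>n < 2 ^ d\<close>; and \<open>d \<le> \<kappa>\<close> contributes the third factor
  \<open>\<kappa>\<close>.\<close>

lemma run_merge:
  assumes F: "blocks F n" and n: "n \<le> t + 1"
    and \<rho>: "merging \<rho>" "\<rho> NR = Suc n" "\<rho> ST = 1" "\<alpha> Out = (\<lambda>_. 0)"
      "\<forall>i\<le>n. \<alpha> Tab i = bits \<beta> (sols k c b (F i))"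
  shows "run (WHILE V NR \<ominus> V ST DO merge_level k) \<rho> \<alpha> xs (\<kappa> * (60000 * (k + 1) * n * H * \<kappa>\<^sup>2) + (\<kappa>
    + 1) * (10 * \<kappa>))
    (\<lambda>\<rho>' \<alpha>' xs'. \<alpha>' Out = (\<lambda>_. 0) \<and> \<alpha>' Tab 0 = bits \<beta> (sols k c b (\<Union>i\<le>n. F i)) \<and> xs' = xs)"
proof -
  define d where "d = (if n = 0 then 0 else bit_len n)"
  have d: "q < d \<longleftrightarrow> 2 ^ q \<le> n" for q by (simp add: d_def less_bit_len_iff)
  have dn: "n < 2 ^ d" using d[of d] by simp
  have nU: "4 * n + 4 \<le> U" using n W_power_U(5) W_ge pos by linarith
  have d\<kappa>: "d \<le> \<kappa>" using sU(1)[of n] nU by (simp add: d_def short_def)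
  have d2: "2 ^ d \<le> 2 * (n + 1)"
  proof (cases d)
    case (Suc q)
    then show ?thesis using d[of q] by simp
  qed simp
  let ?T = "60000 * (k + 1) * n * H * \<kappa>\<^sup>2"
  let ?Inv = "\<lambda>q \<rho>' \<alpha>' xs'. \<rho>' ST = 2 ^ q \<and> \<alpha>' Out = (\<lambda>_. 0) \<and>
     (\<forall>i\<le>n. 2 ^ q dvd i \<longrightarrow> \<alpha>' Tab i = bits \<beta> (sols k c b (un F (2 ^ q) i))) \<and> xs' = xs"
  show ?thesis
  proof (rule run_Loop[OF \<kappa>, where n = d and \<tau> = "\<lambda>_. ?T" and Inv = ?Inv])
    show "?Inv 0 \<rho> \<alpha> xs" using \<rho> by (simp add: un_def)
  next
    fix q \<rho>' \<alpha>' xs'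
    assume q: "q < d" and I: "?Inv q \<rho>' \<alpha>' xs'" and sm: "same (wv (merge_level k)) \<rho> \<rho>'"
    have r: "\<rho>' NR = Suc n" "merging \<rho>'" "\<rho>' ST = 2 ^ q"
      using \<rho> sm I by (simp_all add: same_def merging_def layout_def)
    have qn: "2 ^ q \<le> n" using q d by simp
    have "run (merge_level k) \<rho>' \<alpha>' xs' ?T (?Inv (Suc q))"
      by (rule run_conseq[OF run_merge_level[OF F n _ qn r(2,1,3)] order_refl]) (use I in simp_all)
    moreover have "ebd \<kappa> (V NR \<ominus> V ST) \<rho>' \<alpha>'" "ev (V NR \<ominus> V ST) \<rho>' \<alpha>' \<noteq> 0"
      using r qn nU by (simp_all add: sU)
    ultimately show "ebd \<kappa> (V NR \<ominus> V ST) \<rho>' \<alpha>' \<and> ev (V NR \<ominus> V ST) \<rho>' \<alpha>' \<noteq> 0 \<and>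
      run (merge_level k) \<rho>' \<alpha>' xs' ?T (?Inv (Suc q))" by blast
  next
    fix \<rho>' \<alpha>' xs'
    assume I: "?Inv d \<rho>' \<alpha>' xs'" and sm: "same (wv (merge_level k)) \<rho> \<rho>'"
    have r: "\<rho>' NR = Suc n" "\<rho>' ST = 2 ^ d" using \<rho> sm I by (simp_all add: same_def)
    have "(\<Union>i\<in>{0..<2 ^ d}. F i) = (\<Union>i\<le>n. F i)"
    proof (intro equalityI UN_least)
      fix i show "F i \<subseteq> (\<Union>i\<le>n. F i)"
        using F by (cases "i \<le> n") (auto simp: blocks_def)
      show "F i \<subseteq> (\<Union>i\<in>{0..<2 ^ d}. F i)" if "i \<in> {..n}" using that dn by (intro UN_upper) simp
    qed
    then have "un F (2 ^ d) 0 = (\<Union>i\<le>n. F i)" by (simp add: un_def)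
    then show "ebd \<kappa> (V NR \<ominus> V ST) \<rho>' \<alpha>' \<and> ev (V NR \<ominus> V ST) \<rho>' \<alpha>' = 0 \<and> \<alpha>' Out = (\<lambda>_. 0) \<and>
      \<alpha>' Tab 0 = bits \<beta> (sols k c b (\<Union>i\<le>n. F i)) \<and> xs' = xs"
      using r I d2 dn nU by (simp add: sU)
  next
    have "(\<Sum>i<d. ?T) + (d + 1) * ((esize (V NR \<ominus> V ST) + 1) * \<kappa>) = d * ?T + (d + 1) * (9 * \<kappa>)" by simp
    also have "\<dots> \<le> \<kappa> * ?T + (\<kappa> + 1) * (10 * \<kappa>)" using d\<kappa> by (intro add_mono mult_le_mono) auto
    finally show "(\<Sum>i<d. ?T) + (d + 1) * ((esize (V NR \<ominus> V ST) + 1) * \<kappa>) \<le> \<kappa> * ?T + (\<kappa> + 1) * (10 * \<kappa>)" .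
  qed
qed

text \<open>The class table and the result have at most \<open>L\<close> digits, the product at most
  \<open>2 * L\<close>. This price is paid once per class, whatever its number of items.\<close>

lemma run_absorb:
  assumes r: "r < l" and F: "finite F" "finite K" "K \<inter> (\<lambda>y. r + l * y) ` F = {}"
    and \<rho>: "merging \<rho>" "\<rho> LL = l" "\<rho> R = r" "\<rho> TM = t" "\<rho> G = bits \<beta> (sols k c t K)" "\<alpha> Out = (\<lambda>_. 0)"
      "\<alpha> Tab 0 = bits \<beta> (sols k c b F)"
  shows "run (absorb k) \<rho> \<alpha> xs (50000 * (k + 1) * L * \<kappa>\<^sup>2)
    (\<lambda>\<rho>' \<alpha>' xs'. \<rho>' R = Suc r \<and> \<rho>' G = bits \<beta> (sols k c t (K \<union> (\<lambda>y. r + l * y) ` F)) \<and> \<alpha>' Out = (\<lambda>_. 0) \<and>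
      xs' = xs)"
proof -
  let ?F = "(\<lambda>y. r + l * y) ` F"
  define x where "x = bits \<beta> (sols k c b F)"
  define y where "y = bits \<beta> (sols k c t ?F)"
  define g where "g = bits \<beta> (sols k c t K)"
  define h where "h = bits \<beta> (sols k c t (K \<union> ?F))"
  define \<mu> where "\<mu> = 2 * L * \<kappa>"
  have mu: "\<kappa> \<le> \<mu>" using L_pos by (simp add: \<mu>_def)
  then have mu6: "6 \<le> \<mu>" using \<kappa> by linarith
  note mU = short_bound[OF U mu]
  have L2: "0 < 2 * L" "0 < L" using L_pos by simp_all
  have sh: "short \<mu> x" "short \<mu> y" "short \<mu> g" "short \<mu> h"
    unfolding x_def y_def g_def h_def using L2
    by (auto intro!: short_bits[OF sols_bounds(1)] short_bits[OF sols_bounds(2)] simp: \<mu>_def)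
  have xz: "x < \<beta> ^ L" unfolding x_def by (rule bits_less[OF sols_bounds(1) \<beta>(1)])
  have gy: "g * y < \<beta> ^ (2 * L)"
  proof -
    have "g * y < \<beta> ^ L * \<beta> ^ L" unfolding g_def y_def
      using bits_less[OF sols_bounds(2) \<beta>(1)] \<beta>(1) by (intro mult_strict_mono) simp_all
    then show ?thesis by (simp flip: power_add add: mult_2)
  qed
  then have sgy: "short \<mu> (g * y)" using short_power[OF U \<beta>(2) gy L2(1)] by (simp add: \<mu>_def)
  have LU: "4 * L + 4 \<le> U" "4 * (2 * L) + 4 \<le> U" using L_le W_power_U(4) W_k_ge(1) by linarith+
  have sm: "b \<le> U" "c \<le> U" "t \<le> U" "l \<le> U" "r \<le> U" "Suc r \<le> U" "2 * t \<le> U" "t * 2 \<le> U" "Suc (2 * t) \<le> U"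
    "Suc (t * 2) \<le> U" "2 \<le> U"
    "Suc 0 \<le> U" "0 \<le> U" "Rt \<le> U"
    using b_le W_power_U(5) W_ge pos r unfolding Rt_def by linarith+
  have res1: "recode k Rs Rc Rt l r ` {e. x div \<beta> ^ e mod \<beta> \<noteq> 0 \<and> fits k Rs Rc l r b c t e} = sols k c t ?F"
    using sols_affine[OF F(1) pos(4), of t b k c r] bits_digit[OF sols_bounds(1) \<beta>(3)]
    by (simp add: x_def b_def Rs_def Rc_def Rt_def)
  have res2: "recode k Rt Rc Rt 1 0 ` {e. g * y div \<beta> ^ e mod \<beta> \<noteq> 0 \<and>
    fits k Rt Rc 1 0 t c t e} = sols k c t (K \<union> ?F)"
    using sols_union[OF F(2) _ F(3), where k = k and b = t and c = c] F(1)
      bits_mult_digit[OF sols_bounds(2) sols_bounds(2) \<beta>(3)]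
    by (simp add: g_def y_def Rc_def Rt_def)
  let ?post = "\<lambda>\<rho>' \<alpha>' xs'. \<rho>' R = Suc r \<and> \<rho>' G = h \<and> \<alpha>' Out = (\<lambda>_. 0) \<and> xs' = xs"
  let ?T1 = "5000 * (k + 1) * (L + L + 1) * \<kappa>\<^sup>2"
  let ?T2 = "5000 * (k + 1) * (2 * L + L + 1) * \<kappa>\<^sup>2"
  let ?c4 = "G ::= V Z ;; R ::= V R \<oplus> C 1"
  let ?c3 = "(PS ::= V TM ;; PL ::= C 1 ;; PR ::= C 0 ;; RS ::= V RT) ;; clip k ;; ?c4"
  let ?c2 = "Z ::= V G \<otimes> V Z ;; ?c3"
  let ?c1 = "(PL ::= V LL ;; PR ::= V R ;; PT ::= V TM ;; RT ::= V TM \<otimes> C 2 \<oplus> C 1) ;; clip k ;; ?c2"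
  have lay: "\<rho> RS = Rs" "\<rho> RC = Rc" "\<rho> PS = b" "\<rho> CM = c" "\<rho> B = \<beta>" using \<rho>(1)
    by (simp_all add: merging_def layout_def)
  let ?\<rho>2 = "\<lambda>\<rho>'. \<rho>'(PS := t, PL := 1, PR := 0, RS := Rt)"
  have r2: "run (clip k ;; ?c4) (?\<rho>2 \<rho>') \<alpha>' xs (?T2 + 20 * \<mu>) ?post"
    if q: "\<rho>' RC = Rc" "\<rho>' RT = Rt" "\<rho>' CM = c" "\<rho>' PT = t" "\<rho>' Z = g * y" "\<rho>' B = \<beta>" "\<rho>' R = r"
      "\<alpha>' Out = (\<lambda>_. 0)" for \<rho>' \<alpha>'
  proof (rule run_Comp[OF _ _ order_refl])
    show "run (clip k) (?\<rho>2 \<rho>') \<alpha>' xs ?T2 (\<lambda>\<rho>' \<alpha>' xs'. \<rho>' Z = h \<and> \<alpha>' Out = (\<lambda>_. 0) \<and> xs' = xs)"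
      unfolding h_def res2[symmetric]
    proof (rule run_clip[where \<rho> = "?\<rho>2 \<rho>'" and \<alpha> = \<alpha>' and z = "g * y"
      and k = k, OF \<kappa> U W_power_U(3) LU(2,1) \<beta>(1,2) L2(1) wide_final _ sm(3,2,3) _ gy])
      show "layout (?\<rho>2 \<rho>') Rt Rc Rt 1 0 t c t" using q by (simp add: layout_def)
      fix e assume "fits k Rt Rc 1 0 t c t e" "g * y div \<beta> ^ e mod \<beta> \<noteq> 0"
      then have "recode k Rt Rc Rt 1 0 e \<in> sols k c t (K \<union> ?F)" unfolding res2[symmetric] by blast
      then show "recode k Rt Rc Rt 1 0 e \<le> L" using sols_bounds(2) by (meson lessThan_iff less_imp_le subsetD)
    qed (use q in simp_all)
    fix \<rho>3 :: vars and \<alpha>3 :: arrs and xs3 :: "nat list"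
    assume "\<rho>3 Z = h \<and> \<alpha>3 Out = (\<lambda>_. 0) \<and> xs3 = xs" "same (wv (clip k)) (?\<rho>2 \<rho>') \<rho>3"
    then have "\<rho>3 Z = h" "\<alpha>3 Out = (\<lambda>_. 0)" "xs3 = xs" "\<rho>3 R = r" using q by (simp_all add: same_def)
    then show "run ?c4 \<rho>3 \<alpha>3 xs3 (20 * \<mu>) ?post"
      using sm sh by (intro run_flat[OF mu6]) (simp_all add: mU)
  qed
  have r3: "run ?c2 \<rho>' \<alpha>' xs' (60 * \<mu> + ?T2) ?post"
    if q: "\<rho>' Z = y \<and> \<alpha>' Out = (\<lambda>_. 0) \<and> xs' = xs" "\<rho>' RC = Rc" "\<rho>' RT = Rt" "\<rho>' CM = c" "\<rho>' PT = t"
      "\<rho>' G = g"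
      "\<rho>' B = \<beta>" "\<rho>' R = r" "\<rho>' TM = t" for \<rho>' \<alpha>' xs'
  proof (rule run_prefix[OF mu6, where T' = "40 * \<mu> + ?T2"])
    have "run (clip k ;; ?c4) (?\<rho>2 (\<rho>'(Z := g * y))) \<alpha>' xs (?T2 + 20 * \<mu>) ?post"
      by (rule r2) (use q in simp_all)
    then have "run ?c3 (\<rho>'(Z := g * y)) \<alpha>' xs (40 * \<mu> + ?T2) ?post"
      using q sm by (intro run_prefix[OF mu6, where T' = "?T2 + 20 * \<mu>"]) (simp_all add: mU)
    then show "wpc \<mu> (Z ::= V G \<otimes> V Z) \<rho>' \<alpha>' (\<lambda>\<rho> \<alpha>. run ?c3 \<rho> \<alpha> xs' (40 * \<mu> + ?T2) ?post)"
      using q sh sgy by simp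
  qed simp
  let ?\<rho>1 = "\<rho>(Z := x, PL := l, PR := r, PT := t, RT := Suc (2 * t))"
  have r4: "run (clip k ;; ?c2) ?\<rho>1 \<alpha> xs (?T1 + (60 * \<mu> + ?T2)) ?post"
  proof (rule run_Comp[OF _ r3 order_refl])
    show "run (clip k) ?\<rho>1 \<alpha> xs ?T1 (\<lambda>\<rho>' \<alpha>' xs'. \<rho>' Z = y \<and> \<alpha>' Out = (\<lambda>_. 0) \<and> xs' = xs)"
      unfolding y_def res1[symmetric]
    proof (rule run_clip[where \<rho> = ?\<rho>1 and \<alpha> = \<alpha> and z = x and k
      = k, OF \<kappa> U W_power_U(3) LU(1,1) \<beta>(1,2) L2(2) wide_remap[OF r] _ sm(1,2,3) _ xz])
      show "layout ?\<rho>1 Rs Rc Rt l r b c t" using lay by (simp add: layout_def Rt_def)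
      fix e assume "fits k Rs Rc l r b c t e" "x div \<beta> ^ e mod \<beta> \<noteq> 0"
      then have "recode k Rs Rc Rt l r e \<in> sols k c t ?F" unfolding res1[symmetric] by blast
      then show "recode k Rs Rc Rt l r e \<le> L" using sols_bounds(2) by (meson lessThan_iff less_imp_le subsetD)
    qed (use lay \<rho> in simp_all)
  qed (use lay \<rho> in \<open>simp_all add: same_def Rt_def g_def\<close>)
  have r5: "run ?c1 (\<rho>(Z := x)) \<alpha> xs (?T1 + (100 * \<mu> + ?T2)) ?post"
    using r4 \<rho> sm by (intro run_prefix[OF mu6, where T' = "?T1 + (60 * \<mu> + ?T2)"]) (simp_all
      add: mU mult.commute)
  show ?thesis
    unfolding absorb_def h_def[symmetric]
  proof (rule run_prefix[OF mu6, where T' = "?T1 + (100 * \<mu> + ?T2)"])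
    show "wpc \<mu> (Z ::= A Tab (C 0)) \<rho> \<alpha> (\<lambda>\<rho> \<alpha>. run ?c1 \<rho> \<alpha> xs (?T1 + (100 * \<mu> + ?T2)) ?post)"
      using r5 \<rho> sh by (simp add: mU x_def)
    define w where "w = (k + 1) * \<kappa>\<^sup>2"
    have w: "\<kappa> \<le> w" using \<kappa>_sq by (simp add: w_def trans_le_add1)
    have "?T1 + ?T2 = 5000 * (5 * L + 2) * w" by (simp add: w_def algebra_simps)
    also have "\<dots> \<le> 5000 * (7 * L) * w" using L2(2) by (intro mult_le_mono1) simp
    finally have 1: "?T1 + ?T2 \<le> 35000 * (L * w)" by simp
    have 2: "\<mu> \<le> 2 * (L * w)" using w by (simp add: \<mu>_def)
    have 3: "50000 * (k + 1) * L * \<kappa>\<^sup>2 = 50000 * (L * w)" by (simp add: w_def algebra_simps)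
    show "csize (Z ::= A Tab (C 0)) * \<mu> + (?T1 + (100 * \<mu> + ?T2)) \<le> 50000 * (k + 1) * L * \<kappa>\<^sup>2"
      unfolding 3 using 1 2 by simp
  qed
qed

text \<open>The items of residue \<open>r\<close> are the numbers \<open>r + l * y\<close> with
  \<open>y = z div l\<close>, and \<open>z \<le> t\<close> gives \<open>y \<le> b\<close>. The cost
  splits into \<open>H\<close> per item and \<open>L\<close> per class, the two quantities balanced
  by the choice of \<open>l\<close>.\<close>

lemma run_residue_class:
  assumes r: "r < l" and Zs: "Zs \<subseteq> {..t}"
    and \<rho>: "\<rho> SM = b" "\<rho> TM = t" "\<rho> CM = c" "\<rho> RC = Rc" "\<rho> LL = l" "\<rho> R = r" "\<rho> B = \<beta>"
      "\<rho> G = bits \<beta> (sols k c t {z\<in>Zs. z mod l < r})" "\<alpha> Out = (\<lambda>_. 0)" "\<alpha> Pres = ind Zs"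
  shows "run (residue_class k) \<rho> \<alpha> xs (200000 * (k + 1) * (card {z\<in>Zs. z mod l = r} * H + L) * \<kappa> ^ 3)
    (\<lambda>\<rho>' \<alpha>' xs'. \<rho>' R = Suc r \<and> \<rho>' G = bits \<beta> (sols k c t {z\<in>Zs. z mod l < Suc r}) \<and> \<alpha>' Out = (\<lambda>_. 0) \<and>
      xs' = xs)"
proof -
  define items where "items = filter (\<lambda>y. r + l * y \<in> Zs) [0..<b + 1]"
  define n where "n = length items"
  define F where "F i = (if 0 < i \<and> i \<le> n then {items ! (i - 1)} else {})" for i
  have n: "n \<le> t + 1"
    using length_filter_le[of "\<lambda>y. r + l * y \<in> Zs" "[0..<b + 1]"] b_le unfolding n_def items_def by simp
  have dis: "distinct items" by (simp add: items_def)
  have blocks: "blocks F n"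
    unfolding blocks_def
  proof (intro conjI allI impI)
    show "F i \<inter> F j = {}" if "i \<noteq> j" for i j
    proof (cases "0 < i \<and> i \<le> n \<and> 0 < j \<and> j \<le> n")
      case True
      then have "i - 1 < length items" "j - 1 < length items" "i - 1 \<noteq> j - 1" using that by (auto simp: n_def)
      then have "items ! (i - 1) \<noteq> items ! (j - 1)" using dis by (simp add: nth_eq_iff_index_eq)
      then show ?thesis by (simp add: F_def)
    qed (auto simp: F_def)
  qed (simp_all add: F_def)
  have UF: "(\<Union>i\<le>n. F i) = set items"
  proof (intro equalityI subsetI)
    fix y assume "y \<in> set items"
    then obtain i where "i < n" "y = items ! i" by (metis in_set_conv_nth n_def)
    then have "y \<in> F (Suc i)" "Suc i \<le> n" by (simp_all add: F_def)
    then show "y \<in> (\<Union>i\<le>n. F i)" by blast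
  next
    fix y assume "y \<in> (\<Union>i\<le>n. F i)"
    then obtain i where "0 < i" "i \<le> n" "y = items ! (i - 1)" by (auto simp: F_def split: if_splits)
    then show "y \<in> set items" by (simp add: n_def)
  qed
  have si: "set items = {y. y \<le> b \<and> r + l * y \<in> Zs}" unfolding items_def set_filter set_upt by auto
  have img: "(\<lambda>y. r + l * y) ` set items = {z\<in>Zs. z mod l = r}"
  proof (intro equalityI subsetI)
    fix z assume z: "z \<in> {z\<in>Zs. z mod l = r}"
    then have "z = r + l * (z div l)" by (metis (mono_tags, lifting) mem_Collect_eq mod_mult_div_eq)
    moreover have "z div l \<le> b" using z Zs unfolding b_def by (intro div_le_mono) auto
    ultimately show "z \<in> (\<lambda>y. r + l * y) ` set items" using z
      by (intro image_eqI[of _ _ "z div l"]) (auto simp: si)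
  qed (use r in \<open>auto simp: si\<close>)
  have m: "card {z\<in>Zs. z mod l = r} = n"
  proof -
    have "inj_on (\<lambda>y. r + l * y) (set items)" using pos by (simp add: inj_on_def)
    then show ?thesis using card_image[of "\<lambda>y. r + l * y" "set items"] dis
      by (simp add: img distinct_card n_def)
  qed
  have un: "{z\<in>Zs. z mod l < r} \<union> (\<lambda>y. r + l * y) ` set items = {z\<in>Zs. z mod l < Suc r}"
    unfolding img by auto
  have fin: "finite {z\<in>Zs. z mod l < r}" using finite_subset[OF Zs] by simp
  have disj: "{z\<in>Zs. z mod l < r} \<inter> (\<lambda>y. r + l * y) ` set items = {}" unfolding img by auto
  let ?post = "\<lambda>\<rho>' \<alpha>' xs'. \<rho>' R = Suc r \<and> \<rho>' G = bits \<beta> (sols k c t {z\<in>Zs. z mod l < Suc r}) \<and>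
    \<alpha>' Out = (\<lambda>_. 0) \<and> xs' = xs"
  let ?T1 = "(b + 2) * (60 * \<kappa>) + n * (5000 * (k + 1) * H * \<kappa>\<^sup>2)"
  let ?T2 = "\<kappa> * (60000 * (k + 1) * n * H * \<kappa>\<^sup>2) + (\<kappa> + 1) * (10 * \<kappa>)"
  let ?T3 = "50000 * (k + 1) * L * \<kappa>\<^sup>2"
  let ?gather = "WHILE V SM \<oplus> C 1 \<ominus> V YV DO gather_step k"
  let ?merge = "WHILE V NR \<ominus> V ST DO merge_level k"
  let ?\<rho>1 = "\<rho>(PS := b, PL := 1, PR := 0, PT := b, RS := Rs, RT := Rs, NR := 1, YV := 0)"
  let ?\<alpha>1 = "\<alpha>(Tab := (\<alpha> Tab)(0 := 1))"
  have bU: "b \<le> U" "b * 2 \<le> U" "Suc (b * 2) \<le> U" "Suc 0 \<le> U" "2 \<le> U" "Rs \<le> U"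
    using b_le W_power_U(5) W_ge pos unfolding Rs_def by linarith+
  have g: "run ?gather ?\<rho>1 ?\<alpha>1 xs ?T1
    (\<lambda>\<rho>' \<alpha>' xs'. \<rho>' NR = Suc n \<and> \<alpha>' Out = (\<lambda>_. 0) \<and> \<alpha>' Tab 0 = 1 \<and>
      (\<forall>i<n. \<alpha>' Tab (Suc i) = bits \<beta> (sols k c b {items ! i})) \<and> xs' = xs)"
    using run_gather[OF r Zs, of ?\<rho>1 ?\<alpha>1 xs] \<rho> by (simp add: n_def items_def)
  have rest: "run (ST ::= C 1 ;; ?merge ;; absorb k) \<rho>' \<alpha>' xs' (4 * \<kappa> + (?T2 + ?T3)) ?post"
    if Q: "\<rho>' NR = Suc n \<and> \<alpha>' Out = (\<lambda>_. 0) \<and> \<alpha>' Tab 0 = 1 \<and>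
      (\<forall>i<n. \<alpha>' Tab (Suc i) = bits \<beta> (sols k c b {items ! i})) \<and> xs' = xs"
      and sm: "same (wv ?gather) ?\<rho>1 \<rho>'" for \<rho>' \<alpha>' xs'
  proof (rule run_prefix[OF \<kappa>, where T' = "?T2 + ?T3"])
    let ?\<rho>2 = "\<rho>'(ST := 1)"
    have mg: "merging ?\<rho>2" using sm \<rho> by (simp add: same_def merging_def layout_def)
    have r2: "\<rho>' LL = l" "\<rho>' R = r" "\<rho>' TM = t" "\<rho>' G = bits \<beta> (sols k c t {z\<in>Zs. z mod l < r})"
      using sm \<rho> by (simp_all add: same_def)
    have tab: "\<forall>i\<le>n. \<alpha>' Tab i = bits \<beta> (sols k c b (F i))"
    proof (intro allI impI)
      fix i assume "i \<le> n"
      then show "\<alpha>' Tab i = bits \<beta> (sols k c b (F i))"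
        using Q by (cases i) (simp_all add: F_def sols_empty bits_def)
    qed
    have "run (?merge ;; absorb k) ?\<rho>2 \<alpha>' xs (?T2 + ?T3) ?post"
    proof (rule run_Comp[OF run_merge[OF blocks n mg] _ order_refl])
      fix \<rho>3 :: vars and \<alpha>3 :: arrs and xs3
      assume Q3: "\<alpha>3 Out = (\<lambda>_. 0) \<and> \<alpha>3 Tab 0 = bits \<beta> (sols k c b (\<Union>i\<le>n. F i)) \<and> xs3 = xs"
        and sm3: "same (wv ?merge) ?\<rho>2 \<rho>3"
      have "merging \<rho>3" "\<rho>3 LL = l" "\<rho>3 R = r" "\<rho>3 TM = t" "\<rho>3 G = bits \<beta> (sols k c t {z\<in>Zs. z mod l < r})"
        using sm3 mg r2 by (simp_all add: same_def merging_def layout_def)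
      from run_absorb[OF r _ fin disj this, of \<alpha>3 xs3] Q3
      show "run (absorb k) \<rho>3 \<alpha>3 xs3 ?T3 ?post" unfolding un UF by simp
    qed (use Q tab in simp_all)
    then show "wpc \<kappa> (ST ::= C 1) \<rho>' \<alpha>' (\<lambda>\<rho> \<alpha>. run (?merge ;; absorb k) \<rho> \<alpha> xs' (?T2 + ?T3) ?post)"
      using Q bU by (simp add: sU)
  qed simp
  have main: "run (?gather ;; ST ::= C 1 ;; ?merge ;;
    absorb k) ?\<rho>1 ?\<alpha>1 xs (?T1 + (4 * \<kappa> + (?T2 + ?T3))) ?post"
    by (rule run_Comp[OF g rest order_refl])
  show ?thesis
    unfolding residue_class_def
  proof (rule run_prefix[OF \<kappa>, where T' = "?T1 + (4 * \<kappa> + (?T2 + ?T3))"])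
    have Rs': "Suc (b * 2) = Rs" by (simp add: Rs_def)
    let ?init = "PS ::= V SM ;; PL ::= C 1 ;; PR ::= C 0 ;; PT ::= V SM ;; RS ::= V SM \<otimes> C 2 \<oplus> C 1 ;;
      RT ::= V RS ;;
       Tab\<langle>C 0\<rangle> ::= C 1 ;; NR ::= C 1 ;; YV ::= C 0"
    show "wpc \<kappa> (?init) \<rho> \<alpha> (\<lambda>\<rho> \<alpha>. run (?gather ;; ST ::= C 1 ;; ?merge ;;
      absorb k) \<rho> \<alpha> xs (?T1 + (4 * \<kappa> + (?T2 + ?T3))) ?post)"
      using main \<rho> bU(3-) sU(1)[OF bU(1)] sU(1)[OF bU(2)] by (simp add: sU Rs')
    define w where "w = (k + 1) * \<kappa> ^ 3"
    define v where "v = n * H + L"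
    have k3: "\<kappa> ^ 3 = \<kappa> * (\<kappa> * \<kappa>)" by (simp add: power3_eq_cube)
    have w1: "1 * \<kappa> ^ 3 \<le> w" unfolding w_def by (intro mult_le_mono1) simp
    have w2: "(k + 1) * \<kappa>\<^sup>2 \<le> w" unfolding w_def k3 power2_eq_square using \<kappa> by (intro mult_le_mono2) simp
    have k2: "\<kappa> * \<kappa> \<le> w" using w1 \<kappa> unfolding k3 by (intro order.trans[OF _ w1[unfolded k3]]) simp
    have k1: "\<kappa> \<le> w" using k2 \<kappa> by (meson le_square le_trans)
    \<comment> \<open>The scan over all candidates \<open>y \<le> b\<close> is absorbed by the price
      of the class, because \<open>b \<le> t\<close> and \<open>2 * t + 1 \<le> L\<close>.\<close>
    have Lv: "L \<le> v" "n * H \<le> v" "1 \<le> v" "b + 2 \<le> v"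
      using L_pos b_le pos unfolding v_def Rt_def by simp_all
    have "(b + 2) * (60 * \<kappa>) \<le> v * (60 * w)" using Lv k1 by (intro mult_le_mono) auto
    moreover have "n * (5000 * (k + 1) * H * \<kappa>\<^sup>2) \<le> 5000 * (v * w)"
    proof -
      have "n * (5000 * (k + 1) * H * \<kappa>\<^sup>2) = 5000 * (n * H * ((k + 1) * \<kappa>\<^sup>2))" by (simp add: algebra_simps)
      also have "\<dots> \<le> 5000 * (v * w)" using Lv w2 by (intro mult_le_mono2 mult_le_mono)
      finally show ?thesis .
    qed
    moreover have "\<kappa> * (60000 * (k + 1) * n * H * \<kappa>\<^sup>2) \<le> 60000 * (v * w)"
    proof -
      have "\<kappa> * (60000 * (k + 1) * n * H * \<kappa>\<^sup>2) = 60000 * (n * H * w)"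
        by (simp add: w_def k3 power2_eq_square algebra_simps)
      also have "\<dots> \<le> 60000 * (v * w)" using Lv by (intro mult_le_mono2 mult_le_mono1)
      finally show ?thesis .
    qed
    moreover have "(\<kappa> + 1) * (10 * \<kappa>) \<le> 20 * (v * w)"
    proof -
      have "(\<kappa> + 1) * (10 * \<kappa>) = 10 * (\<kappa> * \<kappa>) + 10 * \<kappa>" by (simp add: algebra_simps)
      also have "\<dots> \<le> 20 * (1 * w)" using k1 k2 by simp
      also have "\<dots> \<le> 20 * (v * w)" using Lv by (intro mult_le_mono2 mult_le_mono1)
      finally show ?thesis .
    qed
    moreover have "?T3 \<le> 50000 * (v * w)"
    proof -
      have "?T3 = 50000 * (L * ((k + 1) * \<kappa>\<^sup>2))" by (simp add: algebra_simps)
      also have "\<dots> \<le> 50000 * (v * w)" using Lv w2 by (intro mult_le_mono2 mult_le_mono)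
      finally show ?thesis .
    qed
    moreover have "1 * \<kappa> \<le> v * w" using Lv k1 by (intro mult_le_mono)
    then have "csize (?init) * \<kappa> + 4 * \<kappa> \<le> 100 * (v * w)" by simp
    moreover have "v * (60 * w) = 60 * (v * w)" by simp
    moreover have "200000 * (k + 1) * (n * H + L) * \<kappa> ^ 3 = 200000 * (v * w)"
      by (simp add: v_def w_def algebra_simps)
    ultimately show "csize (?init) * \<kappa> + (?T1 + (4 * \<kappa> + (?T2 + ?T3))) \<le>
       200000 * (k + 1) * (card {z\<in>Zs. z mod l = r} * H + L) * \<kappa> ^ 3"
      unfolding m by linarith
  qed
qed

lemma run_prepare:
  assumes small: "\<And>i. 0 < i \<Longrightarrow> i < l \<Longrightarrow> i * i * c < n'" and big: "n' \<le> l * l * c" "n' \<le> t"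
    and \<rho>: "\<rho> NP = n'" "\<rho> TM = t" "\<rho> CM = c"
  shows "run (prepare k) \<rho> \<alpha> xs (40 * l * \<kappa> + 100 * (k + 1) * \<kappa>)
    (\<lambda>\<rho>' \<alpha>' xs'. \<rho>' LL = l \<and> \<rho>' SM = b \<and> \<rho>' RC = Rc \<and> \<rho>' G = 1 \<and> \<rho>' R = 0 \<and> \<rho>' B = \<beta> \<and> \<alpha>' = \<alpha> \<and> xs' = xs)"
proof -
  have sm: "t \<le> U" "c \<le> U" "c * 2 \<le> U" "Suc (c * 2) \<le> U" "t * 2 \<le> U" "Suc (t * 2) \<le> U" "Suc 0 \<le> U" "2 \<le> U"
    "k \<le> U" "n' \<le> U"
     "Rc \<le> U" "b \<le> U" "l \<le> U"
    using W_power_U(5) W_ge pos kU big(2) b_le unfolding Rc_def by linarith+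
  have sq: "i * i * c \<le> U" "i * i \<le> U" if "i \<le> t" for i
  proof -
    have "i * (i * c) \<le> W * W"
    proof (rule mult_le_mono)
      show "i \<le> W" using that W_ge pos by linarith
      have "i * c \<le> t * c" using that by (rule mult_le_mono1)
      also have "t * c \<le> 9 * t * c" by simp
      finally show "i * c \<le> W" unfolding W_def .
    qed
    moreover have "W * W \<le> W * (W * W ^ k)" by (rule mult_le_mono2) (use W_k_ge in simp)
    ultimately have "i * (i * c) \<le> U" using LU by linarith
    then show 1: "i * i * c \<le> U" by (simp only: mult.assoc)
    have "i * i * 1 \<le> i * i * c" using pos by (intro mult_le_mono2) simp
    then show "i * i \<le> U" using 1 by linarith
  qed
  let ?e = "V NP \<ominus> V LL \<otimes> V LL \<otimes> V CM"
  \<comment> \<open>\<open>LL\<close> starts at 1, so after \<open>i\<close> passes it is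
    \<open>Suc i\<close>, and \<open>l - 1\<close> passes reach the first value at which the
    condition fails.\<close>
  let ?Inv1 = "\<lambda>i \<rho>' \<alpha>' xs'. \<rho>' LL = Suc i \<and> \<alpha>' = \<alpha> \<and> xs' = xs"
  have l1: "run (WHILE ?e DO LL ::= V LL \<oplus> C 1) (\<rho>(LL := 1)) \<alpha> xs (l * (10 * \<kappa>)
    + l * (19 * \<kappa>)) (?Inv1 (l - 1))"
  proof (rule run_Loop[OF \<kappa>, where n = "l - 1" and Inv = ?Inv1 and \<tau> = "\<lambda>_. 10 * \<kappa>"])
    show "?Inv1 0 (\<rho>(LL := 1)) \<alpha> xs" by simp
  next
    fix i \<rho>' \<alpha>' xs'
    assume i: "i < l - 1" and I: "?Inv1 i \<rho>' \<alpha>' xs'" and s: "same (wv (LL ::= V LL \<oplus> C 1)) (\<rho>(LL := 1)) \<rho>'"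
    have r: "\<rho>' NP = n'" "\<rho>' CM = c" "\<rho>' LL = Suc i" using s I \<rho> by (simp_all add: same_def)
    have il: "Suc i < l" "Suc i \<le> t" using i pos by linarith+
    have iU: "Suc i \<le> U" "Suc (Suc i) \<le> U" using il sm pos by linarith+
    have lt: "Suc i * Suc i * c < n'" using small[of "Suc i"] il by blast
    have "run (LL ::= V LL \<oplus> C 1) \<rho>' \<alpha>' xs' (10 * \<kappa>) (?Inv1 (Suc i))"
      using r I iU sm by (intro run_flat[OF \<kappa>]) (simp_all add: sU)
    moreover have "ebd \<kappa> ?e \<rho>' \<alpha>'" "ev ?e \<rho>' \<alpha>' \<noteq> 0"
      using r iU sm sq[OF il(2)] lt by (simp_all add: sU del: mult_Suc mult_Suc_right)
    ultimately show "ebd \<kappa> ?e \<rho>' \<alpha>' \<and> ev ?e \<rho>' \<alpha>' \<noteq> 0 \<and>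
      run (LL ::= V LL \<oplus> C 1) \<rho>' \<alpha>' xs' (10 * \<kappa>) (?Inv1 (Suc i))" by blast
  next
    fix \<rho>' \<alpha>' xs'
    assume I: "?Inv1 (l - 1) \<rho>' \<alpha>' xs'" and s: "same (wv (LL ::= V LL \<oplus> C 1)) (\<rho>(LL := 1)) \<rho>'"
    have "\<rho>' NP = n'" "\<rho>' CM = c" "\<rho>' LL = l" using s I \<rho> pos by (simp_all add: same_def)
    then have "ebd \<kappa> ?e \<rho>' \<alpha>'" "ev ?e \<rho>' \<alpha>' = 0" using sm sq[OF pos(5)] big by (simp_all add: sU)
    then show "ebd \<kappa> ?e \<rho>' \<alpha>' \<and> ev ?e \<rho>' \<alpha>' = 0 \<and> ?Inv1 (l - 1) \<rho>' \<alpha>' xs'" using I by blast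
  next
    have "(l - 1) * (10 * \<kappa>) \<le> l * (10 * \<kappa>)" by (intro mult_le_mono1) simp
    then show "(\<Sum>i<l - 1. 10 * \<kappa>) + (l - 1 + 1) * ((esize ?e + 1) * \<kappa>) \<le> l * (10 * \<kappa>) + l * (19 * \<kappa>)"
      using pos by simp
  qed
  let ?post = "\<lambda>\<rho>' \<alpha>' xs'. \<rho>' LL = l \<and> \<rho>' SM = b \<and> \<rho>' RC = Rc \<and> \<rho>' G = 1 \<and> \<rho>' R = 0 \<and> \<rho>' B = \<beta> \<and> \<alpha>' = \<alpha> \<and>
    xs' = xs"
  let ?Inv2 = "\<lambda>i \<rho>' \<alpha>' xs'. \<rho>' B = (Rt * Rc) ^ i \<and> \<rho>' J = i \<and> \<alpha>' = \<alpha> \<and> xs' = xs"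
  have pL: "(Rt * Rc) ^ i \<le> U" if "i \<le> k" for i
  proof -
    have "(Rt * Rc) ^ i \<le> L" unfolding L_def using that by (intro power_increasing) (simp_all add: Suc_le_eq)
    then show ?thesis using \<beta>(2,3) by linarith
  qed
  have l2: "run (WHILE C k \<ominus> V J DO power_step) \<rho>' \<alpha> xs (k * (40 * \<kappa>) + (k + 1) * (7 * \<kappa>)) (?Inv2 k)"
    if q: "\<rho>' TM = t" "\<rho>' RC = Rc" "\<rho>' B = 1" "\<rho>' J = 0" for \<rho>'
  proof (rule run_Loop[OF \<kappa>, where n = k and Inv = ?Inv2 and \<tau> = "\<lambda>_. 40 * \<kappa>"])
    show "?Inv2 0 \<rho>' \<alpha> xs" using q by simp
  next
    fix i \<rho>'' \<alpha>'' xs''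
    assume i: "i < k" and I: "?Inv2 i \<rho>'' \<alpha>'' xs''" and s: "same (wv power_step) \<rho>' \<rho>''"
    have r: "\<rho>'' TM = t" "\<rho>'' RC = Rc" "\<rho>'' B = (Rt * Rc) ^ i" "\<rho>'' J = i" using s I q
      by (simp_all add: same_def)
    have Rt': "Suc (t * 2) = Rt" by (simp add: Rt_def)
    have pU: "(Rt * Rc) ^ Suc i \<le> U" "(Rt * Rc) ^ i \<le> U" "Rt * Rc \<le> U" "Suc i \<le> U" "i \<le> U" "Rt \<le> U"
      using pL[of "Suc i"] pL[of i] pL[of 1] i sm pos unfolding Rt_def by simp_all
    have "run power_step \<rho>'' \<alpha>'' xs'' (40 * \<kappa>) (?Inv2 (Suc i))"
      unfolding power_step_def using I
        by (intro run_flat[OF \<kappa>]) (simp_all add: r pU sm sU Rt' flip: power_Suc2 del: power_Suc)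
    moreover have "ebd \<kappa> (C k \<ominus> V J) \<rho>'' \<alpha>''" "ev (C k \<ominus> V J) \<rho>'' \<alpha>'' \<noteq> 0"
      using r i sm by (simp_all add: sU)
    ultimately show "ebd \<kappa> (C k \<ominus> V J) \<rho>'' \<alpha>'' \<and> ev (C k \<ominus> V J) \<rho>'' \<alpha>'' \<noteq> 0 \<and>
      run power_step \<rho>'' \<alpha>'' xs'' (40 * \<kappa>) (?Inv2 (Suc i))" by blast
  next
    fix \<rho>'' \<alpha>'' xs''
    assume "?Inv2 k \<rho>'' \<alpha>'' xs''"
    then show "ebd \<kappa> (C k \<ominus> V J) \<rho>'' \<alpha>'' \<and> ev (C k \<ominus> V J) \<rho>'' \<alpha>'' = 0 \<and> ?Inv2 k \<rho>'' \<alpha>'' xs''"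
      using sm by (simp add: sU)
  qed simp
  let ?init = "SM ::= V TM \<oslash> V LL ;; RC ::= V CM \<otimes> C 2 \<oplus> C 1 ;; G ::= C 1 ;; B ::= C 1 ;; J ::= C 0 ;;
    R ::= C 0"
  have fin: "run (B ::= V B \<oplus> C 1) \<rho>'' \<alpha>'' xs'' (10 * \<kappa>) ?post"
    if "?Inv2 k \<rho>'' \<alpha>'' xs''" "\<rho>'' LL = l" "\<rho>'' SM = b" "\<rho>'' RC = Rc" "\<rho>'' G = 1" "\<rho>'' R = 0" for \<rho>'' \<alpha>'' xs''
  proof -
    have "(Rt * Rc) ^ k = L" by (simp add: L_def)
    then have "\<rho>'' B = L" using that by simp
    moreover have "L \<le> U" "Suc L \<le> U" using \<beta> unfolding \<beta>_def by linarith+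
    ultimately show ?thesis using that sm by (intro run_flat[OF \<kappa>]) (simp_all add: sU \<beta>_def)
  qed
  let ?Tb = "k * (40 * \<kappa>) + (k + 1) * (7 * \<kappa>) + 10 * \<kappa>"
  have r2: "run ((?init) ;; WHILE C k \<ominus> V J DO power_step ;; B ::= V B \<oplus> C 1) \<rho>' \<alpha>' xs' (50 * \<kappa> + ?Tb) ?post"
    if q: "?Inv1 (l - 1) \<rho>' \<alpha>' xs'" "\<rho>' TM = t" "\<rho>' CM = c" for \<rho>' \<alpha>' xs'
  proof (rule run_prefix[OF \<kappa>, where T' = ?Tb])
    let ?\<rho> = "\<rho>'(SM := b, RC := Rc, G := 1, B := 1, J := 0, R := 0)"
    have "\<rho>' LL = l" using q pos by simp
    then have "run (WHILE C k \<ominus> V J DO power_step ;; B ::= V B \<oplus> C 1) ?\<rho> \<alpha> xs ?Tb ?post"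
      by (intro run_Comp[OF l2 fin order_refl]) (use q in \<open>simp_all add: same_def\<close>)
    moreover have "Suc (c * 2) = Rc" by (simp add: Rc_def)
    ultimately show "wpc \<kappa> (?init) \<rho>' \<alpha>' (\<lambda>\<rho> \<alpha>. run (WHILE C k \<ominus> V J DO power_step ;;
      B ::= V B \<oplus> C 1) \<rho> \<alpha> xs' ?Tb ?post)"
      using q \<open>\<rho>' LL = l\<close> sm by (simp add: sU flip: b_def)
  qed simp
  have r1: "run (WHILE ?e DO LL ::= V LL \<oplus> C 1 ;; (?init) ;; WHILE C k \<ominus> V J DO power_step ;; B ::= V B \<oplus> C 1)
     (\<rho>(LL := 1)) \<alpha> xs (l * (10 * \<kappa>) + l * (19 * \<kappa>) + (50 * \<kappa> + ?Tb)) ?post"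
    by (rule run_Comp[OF l1 r2 order_refl]) (use \<rho> in \<open>simp_all add: same_def\<close>)
  show ?thesis
    unfolding prepare_def
    by (rule run_prefix[OF \<kappa>, where T' = "l * (10 * \<kappa>) + l * (19 * \<kappa>) + (50 * \<kappa> + ?Tb)"])
       (use r1 sm in \<open>simp_all add: sU algebra_simps\<close>)
qed

text \<open>The code of the targets may lie beyond the \<open>N\<close> unpacked digits, where
  \<open>Fld\<close> can be stale. There the digit of the table is 0, and the guard on
  \<open>N\<close> answers no.\<close>

lemma run_answer:
  assumes len: "length ts = k" "length cs = k" and le: "\<forall>x\<in>set ts. x \<le> t" "\<forall>x\<in>set cs. x \<le> c"
    and \<rho>: "\<rho> G = bits \<beta> (sols k c t Zs)" "\<rho> TM = t" "\<rho> RC = Rc" "\<rho> B = \<beta>"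
      "\<forall>i<k. \<alpha> Tgt i = ts ! i" "\<forall>i<k. \<alpha> Crd i = cs ! i"
  shows "run (answer k) \<rho> \<alpha> xs (3000 * (k + 1) * L * \<kappa>\<^sup>2)
    (\<lambda>\<rho>' \<alpha>' xs'. \<rho>' Ans = (if code Rt Rc k ((!) cs) ((!) ts) \<in> sols k c t Zs then 1 else 0))"
proof -
  define z where "z = bits \<beta> (sols k c t Zs)"
  let ?x = "\<lambda>i. code Rt Rc i ((!) cs) ((!) ts)"
  have zL: "z < \<beta> ^ L" unfolding z_def by (rule bits_less[OF sols_bounds(2) \<beta>(1)])
  have dig: "z div \<beta> ^ e mod \<beta> \<noteq> 0 \<longleftrightarrow> e \<in> sols k c t Zs" for e
    unfolding z_def by (rule bits_digit[OF sols_bounds(2) \<beta>(3)])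
  have LU: "4 * L + 4 \<le> U" "L \<le> U" "2 * L \<le> U" using L_le W_power_U(4) W_k_ge(1) by linarith+
  have sm: "t * 2 \<le> U" "Suc (t * 2) \<le> U" "t \<le> U" "c \<le> U" "Suc 0 \<le> U" "2 \<le> U" "Rt \<le> U" "Rc \<le> U"
    using W_power_U(5) W_ge pos unfolding Rt_def Rc_def by linarith+
  let ?post = "\<lambda>\<rho>' \<alpha>' xs'. \<rho>' Ans = (if ?x k \<in> sols k c t Zs then 1 else (0::nat))"
  define \<mu> where "\<mu> = L * \<kappa>"
  have mu: "\<kappa> \<le> \<mu>" using L_pos by (simp add: \<mu>_def)
  then have mu6: "6 \<le> \<mu>" using \<kappa> by linarith
  have sz: "short \<mu> z" unfolding z_def \<mu>_def using L_pos by (intro short_bits[OF sols_bounds(2)]) auto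
  have dg: "cs ! i < Rc \<and> ts ! i < Rt" if "i < k" for i
  proof -
    have "cs ! i \<le> c" "ts ! i \<le> t" using len le that by simp_all
    then show ?thesis unfolding Rc_def Rt_def by linarith
  qed
  have pL: "(Rt * Rc) ^ i \<le> L" if "i \<le> k" for i
    unfolding L_def using that by (intro power_increasing) (simp_all add: Suc_le_eq)
  have xL: "?x i \<le> L" if "i \<le> k" for i
    using code_less[of i "(!) cs" Rc "(!) ts" Rt] dg pL[OF that] that by fastforce
  let ?Inv = "\<lambda>i \<rho>' \<alpha>' xs'. \<rho>' X = ?x i \<and> \<rho>' M = (Rt * Rc) ^ i \<and> \<rho>' J = i \<and> xs' = xs"
  let ?if = "IF V N \<ominus> V X THEN (IF A Fld (V X) THEN Ans ::= C 1 ELSE Ans ::= C 0) ELSE Ans ::= C 0"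
  have loop: "run (WHILE C k \<ominus> V J DO target_step) \<rho>' \<alpha>' xs (k * (90 * \<kappa>) + (k + 1) * (7 * \<kappa>)) (?Inv k)"
    if q: "\<rho>' X = 0" "\<rho>' M = 1" "\<rho>' J = 0" "\<rho>' RT = Rt" "\<rho>' RC = Rc" "\<forall>i<k. \<alpha>' Tgt i = ts ! i"
      "\<forall>i<k. \<alpha>' Crd i = cs ! i" for \<rho>' \<alpha>'
  proof (rule run_Loop[OF \<kappa>, where n = k and Inv = ?Inv and \<tau> = "\<lambda>_. 90 * \<kappa>"])
    show "?Inv 0 \<rho>' \<alpha>' xs" using q by (simp add: code_def)
  next
    fix i \<rho>'' \<alpha>'' xs''
    assume i: "i < k" and I: "?Inv i \<rho>'' \<alpha>'' xs''" and s: "same (wv target_step) \<rho>' \<rho>''"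
      "same (wa target_step) \<alpha>' \<alpha>''"
    have r: "\<rho>'' X = ?x i" "\<rho>'' M = (Rt * Rc) ^ i" "\<rho>'' J = i" "\<rho>'' RT = Rt" "\<rho>'' RC = Rc"
      "\<alpha>'' Tgt i = ts ! i" "\<alpha>'' Crd i = cs ! i" "xs'' = xs"
      using s I q i by (simp_all add: same_def)
    have M: "(Rt * Rc) ^ i \<le> U" "(Rt * Rc) ^ i * (Rt * Rc) \<le> U" "Rt * Rc \<le> U"
      using pL[of i] pL[of "Suc i"] pL[of 1] i LU pos by (simp_all add: mult.commute)
    have x: "?x i + (Rt * Rc) ^ i * (Rt * cs ! i + ts ! i) \<le> U" "?x i \<le> U"
      using xL[of "Suc i"] xL[of i] i LU by (simp_all add: code_Suc)
    have d: "Rt * cs ! i + ts ! i \<le> U" "Rt * cs ! i \<le> U" "cs ! i \<le> U" "ts ! i \<le> U"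
      "(Rt * Rc) ^ i * (Rt * cs ! i + ts ! i) \<le> U"
    proof -
      have "Rt * (cs ! i + 1) \<le> Rt * Rc" using dg[OF i] by (intro mult_le_mono2) simp
      then show "Rt * cs ! i + ts ! i \<le> U" "Rt * cs ! i \<le> U" using dg[OF i] M(3) by simp_all
      show "cs ! i \<le> U" "ts ! i \<le> U" using dg[OF i] sm by linarith+
      show "(Rt * Rc) ^ i * (Rt * cs ! i + ts ! i) \<le> U" using x(1) by linarith
    qed
    have iU: "i \<le> U" "Suc i \<le> U" "k \<le> U" using i kU by linarith+
    have "run target_step \<rho>'' \<alpha>'' xs'' (90 * \<kappa>) (?Inv (Suc i))"
      unfolding target_step_def
      by (intro run_flat[OF \<kappa>]) (simp_all add: r M x d sm iU sU code_Suc mult.commute[of "Rt * Rc"]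
        del: add_mult_distrib2)
    moreover have "ebd \<kappa> (C k \<ominus> V J) \<rho>'' \<alpha>''" "ev (C k \<ominus> V J) \<rho>'' \<alpha>'' \<noteq> 0" using r i iU by (simp_all add: sU)
    ultimately show "ebd \<kappa> (C k \<ominus> V J) \<rho>'' \<alpha>'' \<and> ev (C k \<ominus> V J) \<rho>'' \<alpha>'' \<noteq> 0 \<and>
      run target_step \<rho>'' \<alpha>'' xs'' (90 * \<kappa>) (?Inv (Suc i))" by blast
  next
    fix \<rho>'' \<alpha>'' xs''
    assume "?Inv k \<rho>'' \<alpha>'' xs''"
    then show "ebd \<kappa> (C k \<ominus> V J) \<rho>'' \<alpha>'' \<and> ev (C k \<ominus> V J) \<rho>'' \<alpha>'' = 0 \<and> ?Inv k \<rho>'' \<alpha>'' xs''"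
      using kU by (simp add: sU)
  qed simp
  let ?Tb = "k * (90 * \<kappa>) + (k + 1) * (7 * \<kappa>) + 40 * \<kappa>"
  let ?init = "X ::= C 0 ;; M ::= C 1 ;; J ::= C 0 ;; RT ::= V TM \<otimes> C 2 \<oplus> C 1"
  have after: "run ((?init) ;; WHILE C k \<ominus> V J DO target_step ;; ?if) \<rho>' \<alpha>' xs' (40 * \<kappa> + ?Tb) ?post"
    if u: "\<rho>' N \<le> 2 * L \<and> z < \<beta> ^ \<rho>' N \<and> (\<forall>i<\<rho>' N. \<alpha>' Fld i = z div \<beta> ^ i mod \<beta>) \<and> xs' = xs"
      and s: "same (wv unpack) (\<rho>(Z := z)) \<rho>'" "same (wa unpack) \<alpha> \<alpha>'" for \<rho>' \<alpha>' xs'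
  proof (rule run_prefix[OF \<kappa>, where T' = ?Tb])
    let ?\<rho> = "\<rho>'(X := 0, M := 1, J := 0, RT := Rt)"
    have r: "\<rho>' TM = t" "\<rho>' RC = Rc" "\<forall>i<k. \<alpha>' Tgt i = ts ! i" "\<forall>i<k. \<alpha>' Crd i = cs ! i"
      using s \<rho> by (simp_all add: same_def)
    have "run (WHILE C k \<ominus> V J DO target_step ;; ?if) ?\<rho> \<alpha>' xs ?Tb ?post"
    proof (rule run_Comp[OF loop _ order_refl])
      fix \<rho>2 :: vars and \<alpha>2 :: arrs and xs2
      assume I: "?Inv k \<rho>2 \<alpha>2 xs2" and s2: "same (wv (WHILE C k \<ominus> V J DO target_step)) ?\<rho> \<rho>2"
        "same (wa (WHILE C k \<ominus> V J DO target_step)) \<alpha>' \<alpha>2"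
      have e: "\<rho>2 X = ?x k" "\<rho>2 N = \<rho>' N" "\<alpha>2 Fld = \<alpha>' Fld" using I s2 by (simp_all add: same_def)
      have xU: "?x k \<le> U" "\<rho>' N \<le> U" using xL[of k] u LU by linarith+
      show "run (?if) \<rho>2 \<alpha>2 xs2 (40 * \<kappa>) ?post"
      proof (cases "?x k < \<rho>' N")
        case True
        then have f: "\<alpha>' Fld (?x k) = z div \<beta> ^ ?x k mod \<beta>" using u by simp
        then have "\<alpha>' Fld (?x k) \<le> U" using \<beta>(1,2) mod_less_divisor[of \<beta> "z div \<beta> ^ ?x k"] by linarith
        then show ?thesis using True e xU sm dig[of "?x k"] f by (intro run_flat[OF \<kappa>]) (simp_all add: sU)
      next
        case False
        then have "\<beta> ^ \<rho>' N \<le> \<beta> ^ ?x k" using \<beta>(1) by (intro power_increasing) auto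
        then have "z div \<beta> ^ ?x k = 0" using u by simp
        then have "?x k \<notin> sols k c t Zs" using dig[of "?x k"] by simp
        then show ?thesis using False e xU sm by (intro run_flat[OF \<kappa>]) (simp_all add: sU)
      qed
    qed (use r in simp_all)
    moreover have "Suc (t * 2) = Rt" by (simp add: Rt_def)
    ultimately show "wpc \<kappa> (?init) \<rho>' \<alpha>' (\<lambda>\<rho> \<alpha>. run (WHILE C k \<ominus> V J DO target_step ;;
      ?if) \<rho> \<alpha> xs' ?Tb ?post)"
      using u r sm by (simp add: sU)
  qed simp
  have main: "run (unpack ;; (?init) ;; WHILE C k \<ominus> V J DO target_step ;; ?if) (\<rho>(Z := z)) \<alpha> xs
      (2000 * L * \<kappa>\<^sup>2 + (40 * \<kappa> + ?Tb)) ?post"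
    by (rule run_Comp[OF run_unpack[OF \<kappa> U LU(1) \<beta>(1,2) L_pos(1) zL] after order_refl]) (use \<rho> in simp_all)
  show ?thesis
    unfolding answer_def
  proof (rule run_prefix[OF mu6, where T' = "2000 * L * \<kappa>\<^sup>2 + (40 * \<kappa> + ?Tb)"])
    show "wpc \<mu> (Z ::= V G) \<rho> \<alpha> (\<lambda>\<rho> \<alpha>. run (unpack ;; (?init) ;; WHILE C k \<ominus> V J DO target_step ;; ?if) \<rho> \<alpha> xs
      (2000 * L * \<kappa>\<^sup>2 + (40 * \<kappa> + ?Tb)) ?post)"
      using main \<rho> sz by (simp add: z_def)
    define w where "w = L * \<kappa>\<^sup>2"
    have "L * \<kappa> \<le> w" unfolding w_def using \<kappa>_sq by (intro mult_le_mono2)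
    then have 1: "\<mu> \<le> w" by (simp add: \<mu>_def)
    then have 2: "\<kappa> \<le> w" using mu by linarith
    then have 3: "k * \<kappa> \<le> k * w" by (rule mult_le_mono2)
    have "40 * \<kappa> + ?Tb = 97 * (k * \<kappa>) + 87 * \<kappa>" by (simp add: algebra_simps)
    moreover have "csize (Z ::= V G) * \<mu> = 6 * \<mu>" by simp
    moreover have "3000 * (k + 1) * L * \<kappa>\<^sup>2 = 3000 * (k * w) + 3000 * w" by (simp add: w_def algebra_simps)
    moreover have "2000 * L * \<kappa>\<^sup>2 = 2000 * w" by (simp add: w_def)
    ultimately show "csize (Z ::= V G) * \<mu> + (2000 * L * \<kappa>\<^sup>2 + (40 * \<kappa> + ?Tb)) \<le> 3000 * (k + 1) * L * \<kappa>\<^sup>2"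
      using 1 2 3 by linarith
  qed
qed

text \<open>The balance of the two phases. Since \<open>Rs\<close> is about \<open>t / l\<close>,
  one radix \<open>Rs * Rc\<close> absorbs a factor \<open>l\<close>. In \<open>H\<close> one factor
  \<open>Rc\<close> is missing, and \<open>c\<close> takes its place; so
  \<open>n' \<le> l * l * c\<close> items of \<open>H\<close> digits cost no more than
  \<open>l\<close> classes of \<open>W ^ k\<close> digits.\<close>

lemma class_cost_le:
  assumes "n' \<le> l * l * c"
  shows "n' * H \<le> l * W ^ k" "l * L \<le> l * W ^ k"
proof -
  define D where "D = Rs * Rc"
  have "l * b \<le> t" by (simp add: b_def)
  then have "l * Rs \<le> 3 * t" using pos by (simp add: Rs_def)
  then have "l * Rs * Rc \<le> (3 * t) * (3 * c)" by (rule mult_le_mono) (use pos in \<open>simp add: Rc_def\<close>)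
  then have lD: "l * D \<le> W" by (simp add: D_def W_def mult.assoc)
  have "D * 1 \<le> l * D" using pos by (simp add: Suc_le_eq)
  then have DW: "D \<le> W" using lD by linarith
  have "l * c * H \<le> l * Rc * H" by (intro mult_le_mono1 mult_le_mono2) (simp add: Rc_def)
  also have "\<dots> = l * D * D ^ (k - 1)" by (simp add: H_def D_def ac_simps)
  also have "\<dots> \<le> W * W ^ (k - 1)" using lD DW by (intro mult_le_mono power_mono) auto
  also have "\<dots> = W ^ k" using pos(1) by (simp flip: power_Suc)
  finally have 1: "l * c * H \<le> W ^ k" .
  have "n' * H \<le> l * l * c * H" using assms by (rule mult_le_mono1)
  also have "\<dots> = l * (l * c * H)" by (simp add: ac_simps)
  also have "\<dots> \<le> l * W ^ k" using 1 by (rule mult_le_mono2)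
  finally show "n' * H \<le> l * W ^ k" .
  show "l * L \<le> l * W ^ k" using L_le by (rule mult_le_mono2)
qed

lemma run_solve:
  assumes inp: "distinct zs" "\<forall>z\<in>set zs. 0 < z" "length ts = k" "length cs = k" "\<forall>x\<in>set ts. x \<le> t"
    "\<forall>x\<in>set cs. x \<le> c"
    and n: "length zs \<le> U"
    and small: "\<And>i. 0 < i \<Longrightarrow> i < l \<Longrightarrow> i * i * c < card {z\<in>set zs. z \<le> t}"
      and big: "card {z\<in>set zs. z \<le> t} \<le> l * l * c"
    and \<rho>: "\<rho> NN = length zs" "\<rho> TM = t" "\<rho> CM = c" "\<alpha> Pres = (\<lambda>_. 0)" "\<alpha> Out = (\<lambda>_. 0)"
      "\<forall>i<k. \<alpha> Tgt i = ts ! i" "\<forall>i<k. \<alpha> Crd i = cs ! i"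
  shows "run (solve k) \<rho> \<alpha> zs (1000000 * (k + 1) * (l * W ^ k + length zs + 1) * \<kappa> ^ 3
    + 100 * (\<Sum>z\<leftarrow>zs. bit_len z))
    (\<lambda>\<rho>' \<alpha>' xs'. \<rho>' Ans = (if k_subset_sum_card k (zs, ts, cs) then 1 else 0))"
proof -
  define Zs where "Zs = {z\<in>set zs. z \<le> t}"
  define n' where "n' = card Zs"
  have Zs: "Zs \<subseteq> {..t}" "finite Zs" by (auto simp: Zs_def)
  have n't: "n' \<le> t"
  proof -
    have "n' \<le> card {1..t}" unfolding n'_def Zs_def using inp(2) by (intro card_mono) (auto simp: Suc_le_eq)
    then show ?thesis by simp
  qed
  have sm: "t < U" "l \<le> U" "Suc 0 \<le> U" "0 \<le> U" using W_power_U(5) W_ge pos by linarith+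
  have ans: "k_subset_sum_card k (zs, ts, cs) \<longleftrightarrow> code Rt Rc k ((!) cs) ((!) ts) \<in> sols k c t Zs"
    unfolding Rt_def Rc_def Zs_def by (rule k_subset_sum_card_iff[OF inp(1,3,4,5,6)])
  let ?post = "\<lambda>\<rho>' \<alpha>' xs'. \<rho>' Ans = (if k_subset_sum_card k (zs, ts, cs) then 1 else (0::nat))"
  let ?T1 = "100 * (length zs + 1) * \<kappa> + 100 * (\<Sum>z\<leftarrow>zs. bit_len z)"
  let ?T2 = "40 * l * \<kappa> + 100 * (k + 1) * \<kappa>"
  let ?t = "\<lambda>r. 200000 * (k + 1) * (card {z\<in>Zs. z mod l = r} * H + L) * \<kappa> ^ 3"
  let ?T3 = "(\<Sum>r<l. ?t r) + (l + 1) * (9 * \<kappa>)"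
  let ?T4 = "3000 * (k + 1) * L * \<kappa>\<^sup>2"
  let ?classes = "WHILE V LL \<ominus> V R DO residue_class k"
  let ?Inv = "\<lambda>r \<rho>' \<alpha>' xs'. \<rho>' R = r \<and> \<rho>' G = bits \<beta> (sols k c t {z\<in>Zs. z mod l < r}) \<and> \<alpha>' Out = (\<lambda>_. 0) \<and>
    xs' = ([] :: nat list)"
  have classes: "run ?classes \<rho>' \<alpha>' [] ?T3 (?Inv l)"
    if q: "\<rho>' LL = l" "\<rho>' SM = b" "\<rho>' RC = Rc" "\<rho>' G = 1" "\<rho>' R = 0" "\<rho>' B = \<beta>" "\<rho>' TM = t" "\<rho>' CM = c"
      "\<alpha>' Pres = ind Zs" "\<alpha>' Out = (\<lambda>_. 0)" for \<rho>' \<alpha>'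
  proof (rule run_Loop[OF \<kappa>, where n = l and Inv = ?Inv and \<tau> = ?t])
    show "?Inv 0 \<rho>' \<alpha>' []" using q by (simp add: sols_empty bits_def)
  next
    fix r and \<rho>'' :: vars and \<alpha>'' :: arrs and xs'' :: "nat list"
    assume r: "r < l" and I: "?Inv r \<rho>'' \<alpha>'' xs''"
      and s: "same (wv (residue_class k)) \<rho>' \<rho>''" "same (wa (residue_class k)) \<alpha>' \<alpha>''"
    have e: "\<rho>'' SM = b" "\<rho>'' TM = t" "\<rho>'' CM = c" "\<rho>'' RC = Rc" "\<rho>'' LL = l" "\<rho>'' R = r" "\<rho>'' B = \<beta>"
      "\<alpha>'' Pres = ind Zs"
      using s I q by (simp_all add: same_def)
    have "run (residue_class k) \<rho>'' \<alpha>'' xs'' (?t r) (?Inv (Suc r))"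
      using run_residue_class[OF r Zs(1), of \<rho>'' \<alpha>'' xs''] e I by simp
    moreover have "ebd \<kappa> (V LL \<ominus> V R) \<rho>'' \<alpha>''" "ev (V LL \<ominus> V R) \<rho>'' \<alpha>'' \<noteq> 0"
      using e r sm by (simp_all add: sU)
    ultimately show "ebd \<kappa> (V LL \<ominus> V R) \<rho>'' \<alpha>'' \<and> ev (V LL \<ominus> V R) \<rho>'' \<alpha>'' \<noteq> 0 \<and>
      run (residue_class k) \<rho>'' \<alpha>'' xs'' (?t r) (?Inv (Suc r))" by blast
  next
    fix \<rho>'' :: vars and \<alpha>'' :: arrs and xs'' :: "nat list"
    assume I: "?Inv l \<rho>'' \<alpha>'' xs''" and s: "same (wv (residue_class k)) \<rho>' \<rho>''"
    have e: "\<rho>'' LL = l" "\<rho>'' R = l" using s I q by (simp_all add: same_def)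
    show "ebd \<kappa> (V LL \<ominus> V R) \<rho>'' \<alpha>'' \<and> ev (V LL \<ominus> V R) \<rho>'' \<alpha>'' = 0 \<and> ?Inv l \<rho>'' \<alpha>'' xs''"
      using e sm I by (simp add: sU)
  qed simp
  have r3: "run (?classes ;; answer k) \<rho>' \<alpha>' [] (?T3 + ?T4) ?post"
    if q: "\<rho>' LL = l" "\<rho>' SM = b" "\<rho>' RC = Rc" "\<rho>' G = 1" "\<rho>' R = 0" "\<rho>' B = \<beta>" "\<rho>' TM = t" "\<rho>' CM = c"
      "\<alpha>' Pres = ind Zs" "\<alpha>' Out = (\<lambda>_. 0)" "\<forall>i<k. \<alpha>' Tgt i = ts ! i" "\<forall>i<k. \<alpha>' Crd i = cs ! i" for \<rho>' \<alpha>'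
  proof (rule run_Comp[OF classes[OF q(1-10)] _ order_refl])
    fix \<rho>'' :: vars and \<alpha>'' :: arrs and xs'' :: "nat list"
    assume I: "?Inv l \<rho>'' \<alpha>'' xs''" and s: "same (wv ?classes) \<rho>' \<rho>''" "same (wa ?classes) \<alpha>' \<alpha>''"
    have "{z\<in>Zs. z mod l < l} = Zs" using pos by auto
    then have "\<rho>'' G = bits \<beta> (sols k c t Zs)" using I by simp
    moreover have "\<rho>'' TM = t" "\<rho>'' RC = Rc" "\<rho>'' B = \<beta>" "\<forall>i<k. \<alpha>'' Tgt i = ts ! i" "\<forall>i<k. \<alpha>'' Crd i = cs ! i"
      using s q by (simp_all add: same_def)
    ultimately show "run (answer k) \<rho>'' \<alpha>'' xs'' ?T4 ?post"
      unfolding ans by (rule run_answer[OF inp(3,4,5,6)])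
  qed
  have r2: "run (prepare k ;; ?classes ;; answer k) \<rho>' \<alpha>' [] (?T2 + (?T3 + ?T4)) ?post"
    if q: "\<rho>' NP = n'" "\<rho>' TM = t" "\<rho>' CM = c" "\<alpha>' Pres = ind Zs" "\<alpha>' Out = (\<lambda>_. 0)"
      "\<forall>i<k. \<alpha>' Tgt i = ts ! i" "\<forall>i<k. \<alpha>' Crd i = cs ! i" for \<rho>' \<alpha>'
  proof (rule run_Comp[OF run_prepare[of n' \<rho>' \<alpha>' "[]"] _ order_refl])
    show "i * i * c < n'" if "0 < i" "i < l" for i using small[OF that] by (simp add: n'_def Zs_def)
    show "n' \<le> l * l * c" using big by (simp add: n'_def Zs_def)
    fix \<rho>'' :: vars and \<alpha>'' :: arrs and xs'' :: "nat list"
    assume "\<rho>'' LL = l \<and> \<rho>'' SM = b \<and> \<rho>'' RC = Rc \<and> \<rho>'' G = 1 \<and> \<rho>'' R = 0 \<and> \<rho>'' B = \<beta> \<and> \<alpha>'' = \<alpha>' \<and> xs'' = []"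
      "same (wv (prepare k)) \<rho>' \<rho>''"
    then show "run (?classes ;; answer k) \<rho>'' \<alpha>'' xs'' (?T3 + ?T4) ?post"
      using r3[of \<rho>'' \<alpha>''] q by (simp add: same_def)
  qed (use q n't in simp_all)
  have main: "run (WHILE V NN DO collect_step ;; prepare k ;; ?classes ;;
    answer k) (\<rho>(NP := 0)) \<alpha> zs (?T1 + (?T2 + (?T3 + ?T4))) ?post"
  proof (rule run_Comp[OF run_collect[OF \<kappa> U n sm(1) inp(1)] _ order_refl])
    fix \<rho>' :: vars and \<alpha>' :: arrs and xs' :: "nat list"
    assume "\<rho>' NP = card {z\<in>set zs. z \<le> t} \<and> \<alpha>' Pres = ind {z\<in>set zs. z \<le> t} \<and> xs' = []"
      "same (wv (WHILE V NN DO collect_step)) (\<rho>(NP := 0)) \<rho>'" "same (wa (WHILE V NN DO collect_step)) \<alpha> \<alpha>'"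
    then show "run (prepare k ;; ?classes ;; answer k) \<rho>' \<alpha>' xs' (?T2 + (?T3 + ?T4)) ?post"
      using r2[of \<rho>' \<alpha>'] \<rho> by (simp add: same_def n'_def Zs_def)
  qed (use \<rho> in simp_all)
  show ?thesis
    unfolding solve_def
  proof (rule run_prefix[OF \<kappa>, where T' = "?T1 + (?T2 + (?T3 + ?T4))"])
    show "wpc \<kappa> (NP ::= C 0) \<rho> \<alpha> (\<lambda>\<rho> \<alpha>. run (WHILE V NN DO collect_step ;; prepare k ;; ?classes ;;
      answer k) \<rho> \<alpha> zs (?T1 + (?T2 + (?T3 + ?T4))) ?post)"
      using main by (simp add: sU)
    define w where "w = (k + 1) * \<kappa> ^ 3"
    define v where "v = l * W ^ k + length zs + 1"
    have k3: "\<kappa> ^ 3 = \<kappa> * \<kappa>\<^sup>2" by (simp add: power3_eq_cube power2_eq_square)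
    have w1: "1 * \<kappa> ^ 3 \<le> w" unfolding w_def by (intro mult_le_mono1) simp
    have w2: "(k + 1) * \<kappa>\<^sup>2 \<le> w" unfolding w_def k3 using \<kappa> by (intro mult_le_mono2) simp
    have w4: "(k + 1) * \<kappa> \<le> w" using mult_le_mono2[OF \<kappa>_sq(1), of "k + 1"] w2 by linarith
    have w5: "\<kappa> \<le> w" using w4 by simp
    have cost: "n' * H \<le> v" "l * L \<le> v" "length zs + 1 \<le> v" "1 \<le> v"
      using class_cost_le[of n'] big unfolding n'_def Zs_def v_def by linarith+
    have "l * 1 \<le> l * L" using L_pos by (intro mult_le_mono2) simp
    then have lv: "l \<le> v" using cost by linarith
    have "1 * L \<le> l * L" using pos by (intro mult_le_mono1) simp
    then have Lv: "L \<le> v" using cost by linarith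
    \<comment> \<open>The classes partition the items, so the charges of \<open>H\<close> per item
      add up to \<open>n' * H\<close>.\<close>
    have sum: "(\<Sum>r<l. card {z\<in>Zs. z mod l = r}) = n'"
    proof -
      have "(\<Sum>r<l. \<Sum>z\<in>{z\<in>Zs. z mod l = r}. 1 :: nat) = (\<Sum>z\<in>Zs. 1)"
        using Zs(2) pos by (intro sum.group) auto
      then show ?thesis by (simp add: n'_def)
    qed
    have "(\<Sum>r<l. ?t r) = 200000 * ((n' * H + l * L) * w)"
      by (simp add: sum[symmetric] w_def sum.distrib sum_distrib_left sum_distrib_right algebra_simps)
    also have "\<dots> \<le> 200000 * ((v + v) * w)" using cost by (intro mult_le_mono2 mult_le_mono1 add_mono)
    also have "\<dots> = 400000 * (v * w)" by (simp add: algebra_simps)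
    finally have A1: "(\<Sum>r<l. ?t r) \<le> 400000 * (v * w)" .
    have "(l + 1) * (9 * \<kappa>) \<le> (v + v) * (9 * w)" using lv cost w5 by (intro mult_le_mono add_mono) auto
    also have "\<dots> = 18 * (v * w)" by (simp add: algebra_simps)
    finally have A2: "(l + 1) * (9 * \<kappa>) \<le> 18 * (v * w)" .
    have "L * ((k + 1) * \<kappa>\<^sup>2) \<le> v * w" using Lv w2 by (rule mult_le_mono)
    then have A3: "?T4 \<le> 3000 * (v * w)" by (simp add: algebra_simps)
    have "l * \<kappa> \<le> v * w" using lv w5 by (rule mult_le_mono)
    moreover have "1 * ((k + 1) * \<kappa>) \<le> v * w" using cost(4) w4 by (rule mult_le_mono)
    moreover have "?T2 = 40 * (l * \<kappa>) + 100 * (1 * ((k + 1) * \<kappa>))" by (simp add: algebra_simps)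
    ultimately have A4: "?T2 \<le> 140 * (v * w)" by linarith
    have "(length zs + 1) * \<kappa> \<le> v * w" using cost(3) w5 by (rule mult_le_mono)
    then have "100 * ((length zs + 1) * \<kappa>) \<le> 100 * (v * w)" by (rule mult_le_mono2)
    then have A5: "100 * (length zs + 1) * \<kappa> \<le> 100 * (v * w)" by (simp only: mult.assoc)
    have "1 * \<kappa> \<le> v * w" using cost(4) w5 by (rule mult_le_mono)
    then have A6: "csize (NP ::= C 0) * \<kappa> \<le> 4 * (v * w)" by simp
    have e: "1000000 * (k + 1) * (l * W ^ k + length zs + 1) * \<kappa> ^ 3 = 1000000 * (v * w)"
      unfolding v_def[symmetric] w_def by (simp add: algebra_simps)
    show "csize (NP ::= C 0) * \<kappa> + (?T1 + (?T2 + (?T3 + ?T4))) \<le>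
        1000000 * (k + 1) * (l * W ^ k + length zs + 1) * \<kappa> ^ 3 + 100 * (\<Sum>z\<leftarrow>zs. bit_len z)"
      unfolding e using A1 A2 A3 A4 A5 A6 by linarith
  qed
qed

end

section \<open>Reading the targets and cardinalities\<close>

lemma run_read_numbers:
  assumes "6 \<le> \<kappa>" "short (\<kappa> - 5) k" "\<forall>y\<in>set ys. short \<kappa> y" and k: "length ys = k" and x: "x \<noteq> X" "x \<noteq> J"
  shows "run (read_numbers k a x) \<rho> \<alpha> (ys @ zs) (100 * (k + 1) * \<kappa>)
    (\<lambda>\<rho>' \<alpha>' xs'. \<rho>' x = Max (insert 0 (set ys)) \<and> (\<forall>i<k. \<alpha>' a i = ys ! i) \<and> xs' = zs)"
proof -
  \<comment> \<open>\<open>insert 0\<close> gives the empty prefix the maximum 0, matching the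
    initial register value; for a nonempty list of numbers it changes nothing.\<close>
  let ?m = "\<lambda>i. Max (insert 0 (set (take i ys)))"
  let ?Inv = "\<lambda>i \<rho>' \<alpha>' xs'. \<rho>' J = i \<and> \<rho>' x = ?m i \<and> (\<forall>j<i. \<alpha>' a j = ys ! j) \<and> xs' = drop i ys @ zs"
  have i5: "short (\<kappa> - 5) i" "short \<kappa> i" if "i \<le> k" for i
    using short_le[OF assms(2) that] short_mono[of "\<kappa> - 5" i \<kappa>] by auto
  have s1: "short \<kappa> v" if "v \<le> 1" for v
  proof -
    have "bit_len v \<le> bit_len 1" using that by (rule bit_len_mono)
    also have "\<dots> \<le> 1" using bit_len_le_iff[of 1 1] by simp
    finally show ?thesis using assms(1) by (simp add: short_def)
  qed
  have ms: "short \<kappa> (?m i)" for i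
  proof -
    have "?m i \<in> insert 0 (set (take i ys))" by (intro Max_in) auto
    then show ?thesis using assms(3) s1[of 0] by (auto dest: in_set_takeD)
  qed
  have loop: "run (WHILE C k \<ominus> V J DO read_step a x) (\<rho>(x := 0, J := 0)) \<alpha> (ys @ zs) (k * (70 * \<kappa>) + (k
    + 1) * (7 * \<kappa>)) (?Inv k)"
  proof (rule run_Loop[OF assms(1), where n = k and Inv = ?Inv and \<tau> = "\<lambda>_. 70 * \<kappa>"])
    show "?Inv 0 (\<rho>(x := 0, J := 0)) \<alpha> (ys @ zs)" using x by simp
  next
    fix i \<rho>' \<alpha>' xs'
    assume i: "i < k" and I: "?Inv i \<rho>' \<alpha>' xs'"
    define y where "y = ys ! i"
    have xs: "xs' = y # drop (Suc i) ys @ zs" using I i k by (simp add: y_def flip: Cons_nth_drop_Suc)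
    have sy: "short \<kappa> y" "short \<kappa> (y - ?m i)" using assms(3) i k short_le[of \<kappa> y "y - ?m i"]
      by (auto simp: y_def)
    have tk: "take (Suc i) ys = take i ys @ [y]" using i k by (simp add: take_Suc_conv_app_nth y_def)
    have m: "?m (Suc i) = max y (?m i)" by (simp add: tk insert_commute[of 0])
    have r: "\<rho>' J = i" "\<rho>' x = ?m i" using I by simp_all
    have si: "short (\<kappa> - 5) i" "short \<kappa> i" "short \<kappa> (Suc i)" "short \<kappa> (Suc 0)" "short \<kappa> 0" "short \<kappa> (?m i)"
      using i i5[of i] i5[of "Suc i"] s1 ms by simp_all
    let ?c = "a\<langle>V J\<rangle> ::= V X ;; IF V X \<ominus> V x THEN x ::= V X ELSE Nop ;; J ::= V J \<oplus> C 1"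
    have "run (?c) (\<rho>'(X := y)) \<alpha>' (drop (Suc i) ys @ zs) (60 * \<kappa>) (\<lambda>\<rho>'' \<alpha>'' xs''. \<rho>'' J = Suc i \<and>
      \<rho>'' x = max y (?m i) \<and>
       \<alpha>'' a = (\<alpha>' a)(i := y) \<and> xs'' = drop (Suc i) ys @ zs)"
    proof (rule run_flat[OF assms(1)])
      show "wpc \<kappa> (?c) (\<rho>'(X := y)) \<alpha>' (\<lambda>\<rho>'' \<alpha>''. \<rho>'' J = Suc i \<and> \<rho>'' x = max y (?m i) \<and>
         \<alpha>'' a = (\<alpha>' a)(i := y) \<and> drop (Suc i) ys @ zs = drop (Suc i) ys @ zs)"
        using r x si sy by (cases "y \<le> ?m i") (simp_all add: max_def del: Max_insert)
    qed simp
    then have "run (?c) (\<rho>'(X := y)) \<alpha>' (drop (Suc i) ys @ zs) (60 * \<kappa>) (?Inv (Suc i))"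
      by (rule run_conseq[OF _ order_refl]) (use I m in \<open>auto simp: y_def less_Suc_eq\<close>)
    then have "run (read_step a x) \<rho>' \<alpha>' xs' (70 * \<kappa>) (?Inv (Suc i))"
      unfolding read_step_def xs using sy(1)
      by (intro run_Comp[OF run_Inp[where post = "\<lambda>\<rho>'' \<alpha>'' xs''. \<rho>'' = \<rho>'(X := y) \<and> \<alpha>'' = \<alpha>' \<and>
        xs'' = drop (Suc i) ys @ zs" and T = \<kappa>]])
         (auto simp: short_def)
    moreover have "ebd \<kappa> (C k \<ominus> V J) \<rho>' \<alpha>'" "ev (C k \<ominus> V J) \<rho>' \<alpha>' \<noteq> 0"
      using r i i5[of k] i5[of i] i5[of "k - i"] by simp_all
    ultimately show "ebd \<kappa> (C k \<ominus> V J) \<rho>' \<alpha>' \<and> ev (C k \<ominus> V J) \<rho>' \<alpha>' \<noteq> 0 \<and>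
      run (read_step a x) \<rho>' \<alpha>' xs' (70 * \<kappa>) (?Inv (Suc i))" by blast
  next
    fix \<rho>' :: vars and \<alpha>' :: arrs and xs' :: "nat list"
    assume "?Inv k \<rho>' \<alpha>' xs'"
    then show "ebd \<kappa> (C k \<ominus> V J) \<rho>' \<alpha>' \<and> ev (C k \<ominus> V J) \<rho>' \<alpha>' = 0 \<and> ?Inv k \<rho>' \<alpha>' xs'"
      using i5[of k] s1[of 0] by simp
  qed simp
  show ?thesis
    unfolding read_numbers_def
  proof (rule run_prefix[OF assms(1), where T' = "k * (70 * \<kappa>) + (k + 1) * (7 * \<kappa>)"])
    have "run (WHILE C k \<ominus> V J DO read_step a x) (\<rho>(x := 0, J := 0)) \<alpha> (ys @ zs) (k * (70 * \<kappa>) + (k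
      + 1) * (7 * \<kappa>))
      (\<lambda>\<rho>' \<alpha>' xs'. \<rho>' x = Max (insert 0 (set ys)) \<and> (\<forall>i<k. \<alpha>' a i = ys ! i) \<and> xs' = zs)"
      by (rule run_conseq[OF loop order_refl]) (use k in simp)
    then show "wpc \<kappa> (x ::= C 0 ;; J ::= C 0) \<rho> \<alpha> (\<lambda>\<rho> \<alpha>. run (WHILE C k \<ominus> V J DO read_step a x) \<rho> \<alpha> (ys @ zs)
      (k * (70 * \<kappa>) + (k + 1) * (7 * \<kappa>)) (\<lambda>\<rho>' \<alpha>' xs'. \<rho>' x = Max (insert 0 (set ys)) \<and>
        (\<forall>i<k. \<alpha>' a i = ys ! i) \<and> xs' = zs))"
      using s1[of 0] by simp
  qed (simp add: algebra_simps)
qed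

section \<open>Running time\<close>

lemma member_le_size: "v \<in> set (kss_encode x) \<Longrightarrow> bit_len v \<le> kss_input_size x"
  unfolding kss_input_size_def by (rule member_le_sum_list) simp_all

lemma length_le_size: "length (kss_encode x) \<le> kss_input_size x"
proof -
  have "length ys \<le> sum_list (map bit_len ys)" for ys
  proof (induction ys)
    case (Cons y ys)
    then show ?case using bit_len_pos[of y] by (simp del: bit_len_pos)
  qed simp
  then show ?thesis by (simp add: kss_input_size_def)
qed

text \<open>Before the items only \<open>2 * k + 1\<close> numbers are read, so a crude scale,
  linear in the whole input size, already gives a cost of order \<open>k * s\<close>. What follows
  the reading is a hypothesis, to serve both the degenerate and the main case.\<close>

lemma run_kss_cmd:
  fixes zs ts cs :: "nat list"
  assumes k: "0 < k" and len: "length ts = k" "length cs = k"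
  defines "s \<equiv> kss_input_size (zs, ts, cs)"
  assumes tail: "\<And>\<rho> \<alpha>. \<rho> NN = length zs \<Longrightarrow> \<rho> TM = Max (set ts) \<Longrightarrow> \<rho> CM = Max (set cs) \<Longrightarrow>
      \<alpha> Pres = (\<lambda>_. 0) \<Longrightarrow> \<alpha> Out = (\<lambda>_. 0) \<Longrightarrow> \<forall>i<k. \<alpha> Tgt i = ts ! i \<Longrightarrow> \<forall>i<k. \<alpha> Crd i = cs ! i \<Longrightarrow>
      run (IF V TM \<otimes> V CM THEN solve k ELSE (IF V TM \<oplus> V CM THEN Ans ::= C 0 ELSE Ans ::= C 1)) \<rho> \<alpha> zs T post"
  shows "run (kss_cmd k) (\<lambda>_. 0) (\<lambda>_ _. 0) (kss_encode (zs, ts, cs)) (3000 * (k + 1) * s + T) post"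
proof -
  define \<kappa> where "\<kappa> = 2 * s + 12"
  have \<kappa>: "6 \<le> \<kappa>" by (simp add: \<kappa>_def)
  have sz: "length zs + 2 * k + 1 \<le> s"
    using length_le_size[of "(zs, ts, cs)"] len by (simp add: s_def kss_encode_def)
  have bl: "bit_len v \<le> s" if "v = length zs \<or> v \<in> set ts \<or> v \<in> set cs" for v
    using member_le_size[of v "(zs, ts, cs)"] that by (auto simp: s_def kss_encode_def)
  have bk: "short (\<kappa> - 5) k" using bit_len_le_self[OF k] sz by (simp add: short_def \<kappa>_def)
  have st: "\<forall>y\<in>set ts. short \<kappa> y" "\<forall>y\<in>set cs. short \<kappa> y"
    using bl unfolding short_def \<kappa>_def by (metis add.commute le_add2 le_trans mult_2)+
  have mx: "Max (insert 0 (set ts)) = Max (set ts)" "Max (insert 0 (set cs)) = Max (set cs)"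
    using k len by (subst Max_insert; auto)+
  let ?if = "IF V TM \<otimes> V CM THEN solve k ELSE (IF V TM \<oplus> V CM THEN Ans ::= C 0 ELSE Ans ::= C 1)"
  let ?R = "100 * (k + 1) * \<kappa>"
  have r2: "run (read_numbers k Crd CM ;; ?if) \<rho> \<alpha> xs (?R + T) post"
    if q: "\<rho> TM = Max (insert 0 (set ts)) \<and> (\<forall>i<k. \<alpha> Tgt i = ts ! i) \<and> xs = cs @ zs" "\<rho> NN = length zs"
      "\<alpha> Pres = (\<lambda>_. 0)" "\<alpha> Out = (\<lambda>_. 0)" for \<rho> \<alpha> xs
  proof -
    have "run (read_numbers k Crd CM ;; ?if) \<rho> \<alpha> (cs @ zs) (?R + T) post"
    proof (rule run_Comp[OF run_read_numbers[OF \<kappa> bk st(2) len(2)] _ order_refl])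
      fix \<rho>' :: vars and \<alpha>' :: arrs and xs' :: "nat list"
      assume a: "\<rho>' CM = Max (insert 0 (set cs)) \<and> (\<forall>i<k. \<alpha>' Crd i = cs ! i) \<and> xs' = zs"
        and s: "same (wv (read_numbers k Crd CM)) \<rho> \<rho>'" "same (wa (read_numbers k Crd CM)) \<alpha> \<alpha>'"
      have "\<rho>' NN = length zs" "\<rho>' TM = Max (set ts)" "\<rho>' CM = Max (set cs)" "\<alpha>' Pres = (\<lambda>_. 0)"
        "\<alpha>' Out = (\<lambda>_. 0)"
        "\<forall>i<k. \<alpha>' Tgt i = ts ! i" "\<forall>i<k. \<alpha>' Crd i = cs ! i"
        using a s q unfolding mx by (simp_all add: same_def)
      from tail[OF this] a show "run (?if) \<rho>' \<alpha>' xs' T post" by simp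
    qed simp_all
    then show ?thesis using q by simp
  qed
  have r1: "run (read_numbers k Tgt TM ;; read_numbers k Crd CM ;;
    ?if) \<rho> \<alpha> (ts @ cs @ zs) (?R + (?R + T)) post"
    if q: "\<rho> NN = length zs" "\<alpha> Pres = (\<lambda>_. 0)" "\<alpha> Out = (\<lambda>_. 0)" for \<rho> \<alpha>
  proof (rule run_Comp[OF run_read_numbers[OF \<kappa> bk st(1) len(1)] r2 order_refl])
  qed (use q in \<open>simp_all add: same_def\<close>)
  have "run (kss_cmd k) (\<lambda>_. 0) (\<lambda>_ _. 0) (length zs # ts @ cs @ zs) (s + (?R + (?R + T))) post"
    unfolding kss_cmd_def
  proof (rule run_Comp[OF run_Inp[where post = "\<lambda>\<rho> \<alpha> xs. \<rho> = (\<lambda>_. 0)(NN := length zs) \<and> \<alpha> = (\<lambda>_ _. 0) \<and>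
    xs = ts @ cs @ zs" and T = s] _ order_refl])
    show "bit_len (length zs) \<le> s" by (rule bl) simp
    fix \<rho> :: vars and \<alpha> :: arrs and xs :: "nat list"
    assume "\<rho> = (\<lambda>_. 0)(NN := length zs) \<and> \<alpha> = (\<lambda>_ _. 0) \<and> xs = ts @ cs @ zs"
    then show "run (read_numbers k Tgt TM ;; read_numbers k Crd CM ;; ?if) \<rho> \<alpha> xs (?R + (?R + T)) post"
      using r1[of \<rho> \<alpha>] by simp
  qed simp
  moreover have "s + (?R + (?R + T)) \<le> 3000 * (k + 1) * s + T"
  proof -
    have "\<kappa> \<le> 14 * s" using sz by (simp add: \<kappa>_def)
    then have "100 * (k + 1) * \<kappa> \<le> 100 * (k + 1) * (14 * s)" by (rule mult_le_mono2)
    then show ?thesis by (simp add: algebra_simps)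
  qed
  ultimately show ?thesis
    unfolding kss_encode_def prod.case by (rule run_conseq)
qed

text \<open>Items are positive, so a subset has sum 0 exactly if it is empty, that is, has
  cardinality 0. Hence targets and cardinalities of a solvable instance vanish at the same
  positions.\<close>

lemma k_subset_sum_card_trivial:
  assumes "0 < k" "\<forall>z\<in>set zs. 0 < z" "length ts = k" "length cs = k"
    and 0: "Max (set ts) = 0 \<or> Max (set cs) = 0"
  shows "k_subset_sum_card k (zs, ts, cs) \<longleftrightarrow> Max (set ts) = 0 \<and> Max (set cs) = 0"
proof
  assume "k_subset_sum_card k (zs, ts, cs)"
  then obtain F where F: "\<And>i. i < k \<Longrightarrow> F i \<subseteq> set zs \<and> \<Sum>(F i) = ts ! i \<and> card (F i) = cs ! i"
    unfolding k_subset_sum_card_def by auto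
  have iff: "ts ! i = 0 \<longleftrightarrow> cs ! i = 0" if "i < k" for i
  proof -
    have fin: "finite (F i)" using F[OF that] finite_subset by blast
    have "ts ! i = 0 \<longleftrightarrow> (\<forall>z\<in>F i. z = 0)" using F[OF that] fin by (metis (no_types, lifting) sum_eq_0_iff)
    also have "\<dots> \<longleftrightarrow> F i = {}" using F[OF that] assms(2) by fastforce
    also have "\<dots> \<longleftrightarrow> cs ! i = 0" using F[OF that] fin card_0_eq by metis
    finally show ?thesis .
  qed
  have mx: "Max (set ys) = 0 \<longleftrightarrow> (\<forall>i<k. ys ! i = 0)" if "length ys = k" for ys :: "nat list"
  proof -
    have "set ys \<noteq> {}" using that assms(1) by auto
    then have "Max (set ys) = 0 \<longleftrightarrow> (\<forall>y\<in>set ys. y \<le> 0)"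
      by (metis List.finite_set Max_le_iff bot_nat_0.extremum_uniqueI le_refl)
    also have "\<dots> \<longleftrightarrow> (\<forall>i<k. ys ! i = 0)" using that by (simp add: all_set_conv_all_nth)
    finally show ?thesis .
  qed
  show "Max (set ts) = 0 \<and> Max (set cs) = 0" using 0 iff mx[OF assms(3)] mx[OF assms(4)] by auto
next
  assume m: "Max (set ts) = 0 \<and> Max (set cs) = 0"
  have "ts ! i = 0 \<and> cs ! i = 0" if "i < k" for i
    using m that assms(3,4) Max_ge[OF finite_set, of "ts ! i" ts] Max_ge[OF finite_set, of "cs ! i" cs]
      by auto
  then show "k_subset_sum_card k (zs, ts, cs)"
    unfolding k_subset_sum_card_def prod.case by (intro exI[of _ "\<lambda>_. {}"]) (simp add: disjoint_family_on_def)
qed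

lemma class_number_le_root:
  assumes "0 < k" "0 < c" "c \<le> n" "l = 1 \<or> (l - 1) * (l - 1) * c < n"
  shows "real l * real c ^ k \<le> 2 * root (k + 1) (real n ^ k * real c ^ k\<^sup>2)"
proof -
  \<comment> \<open>The hypothesis is about \<open>l - 1\<close>; halving passes to
    \<open>l\<close>, because \<open>l / 2 \<le> l - 1\<close> as soon as
    \<open>2 \<le> l\<close>.\<close>
  define x where "x = real l / 2"
  define q where "q = real n / real c"
  have c: "0 < real c" using assms(2) by simp
  have q1: "1 \<le> q" using assms(2,3) by (simp add: q_def)
  have x0: "0 \<le> x" by (simp add: x_def)
  have "x\<^sup>2 * real c \<le> real n"
  proof (cases "l \<le> 1")
    case True
    then have "x\<^sup>2 \<le> 1" by (simp add: x_def power_le_one)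
    then have "x\<^sup>2 * real c \<le> 1 * real c" by (intro mult_right_mono) auto
    then show ?thesis using assms(3) by linarith
  next
    case False
    then have "real l / 2 \<le> real (l - 1)" by (simp add: of_nat_diff)
    then have "x\<^sup>2 \<le> (real (l - 1))\<^sup>2" unfolding x_def by (intro power_mono) auto
    then have "x\<^sup>2 * real c \<le> (real (l - 1))\<^sup>2 * real c" by (intro mult_right_mono) auto
    also have "\<dots> = real ((l - 1) * (l - 1) * c)" by (simp add: power2_eq_square)
    also have "\<dots> \<le> real n" using assms(4) False by (intro of_nat_mono) auto
    finally show ?thesis .
  qed
  then have xq: "x\<^sup>2 \<le> q" using c by (simp add: q_def pos_le_divide_eq)
  \<comment> \<open>Squaring avoids fractional exponents:
    \<open>q ^ (k + 1) \<le> q ^ (2 * k)\<close>, because \<open>1 \<le> k\<close> and because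
    \<open>c \<le> n\<close> gives \<open>1 \<le> q\<close>.\<close>
  have "(x ^ (k + 1))\<^sup>2 = (x\<^sup>2) ^ (k + 1)" by (metis power_mult mult.commute)
  also have "\<dots> \<le> q ^ (k + 1)" using xq by (intro power_mono) auto
  also have "\<dots> \<le> q ^ (k * 2)" using q1 assms(1) by (intro power_increasing) auto
  also have "\<dots> = (q ^ k)\<^sup>2" by (rule power_mult)
  finally have xk: "x ^ (k + 1) \<le> q ^ k" by (rule power2_le_imp_le) (use q1 in simp)
  have "(x * real c ^ k) ^ (k + 1) = x ^ (k + 1) * real c ^ (k * (k + 1))"
    by (simp only: power_mult_distrib power_mult)
  also have "\<dots> \<le> q ^ k * real c ^ (k * (k + 1))" using xk by (intro mult_right_mono) auto
  also have "\<dots> = (q * real c) ^ k * real c ^ k\<^sup>2"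
    by (simp add: power_mult_distrib power_add power2_eq_square algebra_simps)
  also have "q * real c = real n" using c by (simp add: q_def)
  finally have "root (k + 1) ((x * real c ^ k) ^ (k + 1)) \<le> root (k + 1) (real n ^ k * real c ^ k\<^sup>2)"
    by (intro real_root_le_mono) auto
  moreover have "root (k + 1) ((x * real c ^ k) ^ (k + 1)) = x * real c ^ k"
    using x0 by (intro real_root_power_cancel) auto
  ultimately have "x * real c ^ k \<le> root (k + 1) (real n ^ k * real c ^ k\<^sup>2)" by (simp only:)
  moreover have "real l * real c ^ k = 2 * (x * real c ^ k)" by (simp add: x_def)
  ultimately show ?thesis by linarith
qed

lemma bit_len_le_log:
  assumes "real v \<le> y ^ a" "2 \<le> y" "0 < v"
  shows "real (bit_len v) \<le> real a * log 2 y + 1"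
proof -
  have l0: "0 \<le> log 2 (real v)" using assms(3) by simp
  have "real (bit_len v) \<le> log 2 (real v) + 1" using assms(3) l0 by (simp add: bit_len_def)
  also have "log 2 (real v) \<le> log 2 (y ^ a)" using assms by simp
  also have "\<dots> = real a * log 2 y" using assms(2) by (simp add: log_nat_power)
  finally show ?thesis by simp
qed

text \<open>With \<open>y = 2 + x \<ge> 2\<close>, \<open>9 \<le> y ^ 4\<close> gives
  \<open>9 * t * c \<le> y ^ 6\<close>, and \<open>20 \<le> y ^ 5\<close>, so the first summand is
  at most \<open>y ^ (6 * k + 17)\<close>. Adding \<open>n\<close> costs one more factor
  \<open>y\<close>; the remaining 6 come from rounding the length and from the 5 bits for
  addresses.\<close>

lemma address_bound:
  fixes x :: real
  assumes "real t \<le> x" "real c \<le> x" "real n \<le> x" "0 < t" "0 < c"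
  shows "real (bit_len (20 * (9 * t * c) ^ (k + 2) + n) + 5) \<le> (6 * real k + 24) * log 2 (2 + x)"
proof -
  define y where "y = 2 + x"
  have x0: "0 \<le> x" using assms(1) by linarith
  have y: "2 \<le> y" "x \<le> y" using x0 by (simp_all add: y_def)
  have "9 * real t * real c \<le> 2 ^ 4 * y * y" using assms y by (intro mult_mono) auto
  also have "\<dots> \<le> y ^ 4 * y * y" using y by (intro mult_right_mono power_mono) auto
  also have "\<dots> = y ^ 6" by (simp add: eval_nat_numeral)
  finally have "(9 * real t * real c) ^ (k + 2) \<le> (y ^ 6) ^ (k + 2)" by (intro power_mono) auto
  then have "20 * (9 * real t * real c) ^ (k + 2) \<le> 2 ^ 5 * (y ^ 6) ^ (k + 2)" by (intro mult_mono) auto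
  also have "\<dots> \<le> y ^ 5 * (y ^ 6) ^ (k + 2)" using y by (intro mult_right_mono power_mono) auto
  also have "\<dots> = y ^ (6 * k + 17)" by (simp add: power_mult[symmetric] power_add[symmetric] algebra_simps)
  finally have 1: "20 * (9 * real t * real c) ^ (k + 2) \<le> y ^ (6 * k + 17)" .
  have "real n \<le> y ^ 1" using assms y by simp
  also have "\<dots> \<le> y ^ (6 * k + 17)" using y by (intro power_increasing) auto
  finally have 2: "real n \<le> y ^ (6 * k + 17)" .
  have "real (20 * (9 * t * c) ^ (k + 2) + n) \<le> 2 * y ^ (6 * k + 17)" using 1 2 by simp
  also have "\<dots> \<le> y * y ^ (6 * k + 17)" using y by (intro mult_right_mono) auto
  also have "\<dots> = y ^ (6 * k + 18)" by (simp add: add.commute flip: power_Suc)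
  finally have "real (bit_len (20 * (9 * t * c) ^ (k + 2) + n)) \<le> real (6 * k + 18) * log 2 y + 1"
    using y assms(4,5) by (intro bit_len_le_log) auto
  moreover have "1 \<le> log 2 y" using y by simp
  ultimately show ?thesis unfolding y_def[symmetric] by (simp add: algebra_simps)
qed

text \<open>In the constant, \<open>9 ^ k\<close> comes from \<open>W ^ k\<close>, the 2 from the
  estimate of the number of classes, the summand 1 from reading the input, and
  \<open>6 * k + 24\<close> from the estimate of \<open>\<kappa>\<close>.\<close>

lemma run_kss:
  assumes k: "0 < k" and inp: "(zs, ts, cs) \<in> kss_inputs k"
  defines "x \<equiv> kss_time k (zs, ts, cs)"
  defines "T \<equiv> 2000000 * (real k + 1) * (2 * 9 ^ k + 1) * (6 * real k + 24) ^ 3 * x * log 2 (2 + x) ^ 3"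
  shows "\<exists>\<tau>. real \<tau> \<le> T \<and> run (kss_cmd k) (\<lambda>_. 0) (\<lambda>_ _. 0) (kss_encode (zs, ts, cs)) \<tau>
    (\<lambda>\<rho>' \<alpha>' xs'. \<rho>' Ans = (if k_subset_sum_card k (zs, ts, cs) then 1 else 0))"
proof -
  define s where "s = kss_input_size (zs, ts, cs)"
  define n t c where ntc: "n = length zs" "t = Max (set ts)" "c = Max (set cs)"
  define y where "y = log 2 (2 + x)"
  have in': "distinct zs" "\<forall>z\<in>set zs. 0 < z" "length ts = k" "length cs = k" "sum_list cs \<le> n"
    using inp by (auto simp: kss_inputs_def ntc)
  let ?post = "\<lambda>\<rho>' \<alpha>' xs'. \<rho>' Ans = (if k_subset_sum_card k (zs, ts, cs) then 1 else (0::nat))"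
  let ?if = "IF V TM \<otimes> V CM THEN solve k ELSE (IF V TM \<oplus> V CM THEN Ans ::= C 0 ELSE Ans ::= C 1)"
  have sn: "n + 2 * k + 1 \<le> s"
    using length_le_size[of "(zs, ts, cs)"] in' by (simp add: s_def kss_encode_def ntc)
  have sx: "real s \<le> x" "kss_bound k (zs, ts, cs) \<le> x" by (simp_all add: x_def kss_time_def s_def)
  have x1: "1 \<le> x" using sx(1) sn by linarith
  have y1: "1 \<le> y" using x1 by (simp add: y_def)
  have ne: "set ts \<noteq> {}" "set cs \<noteq> {}" using in' k by auto
  have mem: "t \<in> set ts" "c \<in> set cs" using ne by (simp_all add: ntc)
  have cn: "c \<le> n" using member_le_sum_list[OF mem(2)] in'(5) by linarith
  have bl: "bit_len t \<le> s" "bit_len c \<le> s"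
    using member_le_size[of t "(zs, ts, cs)"] member_le_size[of c "(zs, ts, cs)"] mem
      by (simp_all add: s_def kss_encode_def)
  \<comment> \<open>The test for the degenerate case multiplies \<open>t\<close> and
    \<open>c\<close>, each of at most \<open>s\<close> bits, hence \<open>2 * s\<close>.\<close>
  define \<kappa>1 where "\<kappa>1 = 2 * s + 12"
  have k1: "6 \<le> \<kappa>1" "\<kappa>1 \<le> 14 * s" using sn by (simp_all add: \<kappa>1_def)
  have st: "short \<kappa>1 t" "short \<kappa>1 c" "short \<kappa>1 (t * c)" "short \<kappa>1 0" "short \<kappa>1 (Suc 0)"
    using bl bit_len_mult[of t c] bit_len_le_self[of "Suc 0"] by (simp_all add: short_def \<kappa>1_def)
  define K where "K = 2000000 * (real k + 1) * (2 * 9 ^ k + 1) * (6 * real k + 24) ^ 3"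
  have T: "T = K * x * y ^ 3" by (simp add: T_def K_def y_def)
  show ?thesis
  proof (cases "t = 0 \<or> c = 0")
    case True
    have kss: "k_subset_sum_card k (zs, ts, cs) \<longleftrightarrow> t = 0 \<and> c = 0"
      using k_subset_sum_card_trivial[OF k in'(2,3,4)] True by (simp add: ntc)
    have s2: "short \<kappa>1 (t + c)" using True st by auto
    have "run (?if) \<rho> \<alpha> zs (100 * \<kappa>1) ?post" if "\<rho> TM = Max (set ts)" "\<rho> CM = Max (set cs)" for \<rho> \<alpha>
    proof (rule run_If[OF k1(1), where ?T1.0 = "40 * \<kappa>1"])
      have r: "\<rho> TM = t" "\<rho> CM = c" using that by (simp_all add: ntc)
      show "ebd \<kappa>1 (V TM \<otimes> V CM) \<rho> \<alpha>" using r st by simp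
      show "run (solve k) \<rho> \<alpha> zs (40 * \<kappa>1) ?post" if "ev (V TM \<otimes> V CM) \<rho> \<alpha> \<noteq> 0"
        using that r True by auto
      show "run (IF V TM \<oplus> V CM THEN Ans ::= C 0 ELSE Ans ::= C 1) \<rho> \<alpha> zs (40 * \<kappa>1) ?post"
        using r st s2 kss by (intro run_flat[OF k1(1)]) simp_all
    qed simp
    then have "run (kss_cmd k) (\<lambda>_. 0) (\<lambda>_ _. 0) (kss_encode (zs, ts, cs)) (3000 * (k + 1) * s
      + 100 * \<kappa>1) ?post"
      unfolding s_def by (intro run_kss_cmd[OF k in'(3,4)])
    moreover have "real (3000 * (k + 1) * s + 100 * \<kappa>1) \<le> T"
    proof -
      have "3000 * (k + 1) * s + 100 * \<kappa>1 \<le> 3000 * (k + 1) * s + 1400 * s" using k1 by linarith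
      also have "\<dots> \<le> 5000 * (k + 1) * s" by (simp add: algebra_simps)
      finally have "real (3000 * (k + 1) * s + 100 * \<kappa>1) \<le> real (5000 * (k + 1) * s)" by (rule of_nat_mono)
      also have "\<dots> = 5000 * (real k + 1) * real s" by simp
      also have "\<dots> \<le> 5000 * (real k + 1) * x" using sx by (intro mult_left_mono) auto
      also have "\<dots> \<le> K * x"
      proof (rule mult_right_mono)
        have "5000 * (real k + 1) * 1 * 1 \<le> 2000000 * (real k + 1) * (2 * 9 ^ k + 1) * (6 * real k + 24) ^ 3"
          by (intro mult_mono one_le_power) (auto intro: add_increasing)
        then show "5000 * (real k + 1) \<le> K" by (simp add: K_def)
      qed (use x1 in simp)
      also have "\<dots> \<le> T"
      proof -
        have "0 \<le> K * x" using x1 by (simp add: K_def)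
        then have "K * x * 1 \<le> K * x * y ^ 3" using y1 by (intro mult_left_mono one_le_power) auto
        then show ?thesis by (simp add: T)
      qed
      finally show ?thesis .
    qed
    ultimately show ?thesis by blast
  next
    case False
    then have tc: "0 < t" "0 < c" by auto
    define m where "m = card {z\<in>set zs. z \<le> t}"
    have mt: "m \<le> t"
    proof -
      have "m \<le> card {1..t}" unfolding m_def using in'(2) by (intro card_mono) (auto simp: Suc_le_eq)
      then show ?thesis by simp
    qed
    have mn: "m \<le> n"
    proof -
      have "m \<le> card (set zs)" unfolding m_def by (intro card_mono) auto
      also have "\<dots> = n" using in'(1) by (simp add: ntc distinct_card)
      finally show ?thesis .
    qed
    \<comment> \<open>This is the value at which the search in \<open>prepare\<close> stops. It
      exists and is at most \<open>t\<close>, because \<open>m \<le> t\<close> makes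
      \<open>t\<close> itself admissible.\<close>
    define l where "l = (LEAST l. 0 < l \<and> m \<le> l * l * c)"
    have "m \<le> t * t * c"
    proof -
      have "t * 1 * 1 \<le> t * t * c" using tc by (intro mult_le_mono) auto
      then show ?thesis using mt unfolding mult_1_right by linarith
    qed
    with tc(1) have ex: "0 < t \<and> m \<le> t * t * c" by (rule conjI)
    have l: "0 < l \<and> m \<le> l * l * c" "l \<le> t"
      unfolding l_def
      by (rule LeastI[of "\<lambda>l. 0 < l \<and> m \<le> l * l * c", OF ex] Least_le[of "\<lambda>l. 0 < l \<and> m \<le> l * l * c", OF ex])+
    have small: "i * i * c < m" if "0 < i" "i < l" for i
      using not_less_Least[of i "\<lambda>l. 0 < l \<and> m \<le> l * l * c"] that by (auto simp: l_def)
    \<comment> \<open>The summand \<open>n\<close> is for the counter of unread items, which also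
      counts those above \<open>t\<close>.\<close>
    define U where "U = 20 * (9 * t * c) ^ (k + 2) + n"
    define \<kappa> where "\<kappa> = bit_len U + 5"
    interpret kss_params k t c l \<kappa> U
      by unfold_locales (use k tc l in \<open>simp_all add: \<kappa>_def short_def U_def Suc_le_eq\<close>)
    let ?S = "1000000 * (k + 1) * (l * W ^ k + n + 1) * \<kappa> ^ 3 + 100 * (\<Sum>z\<leftarrow>zs. bit_len z)"
    have "run (?if) \<rho> \<alpha> zs (10 * \<kappa>1 + ?S) ?post"
      if r: "\<rho> NN = length zs" "\<rho> TM = Max (set ts)" "\<rho> CM = Max (set cs)" "\<alpha> Pres = (\<lambda>_. 0)"
        "\<alpha> Out = (\<lambda>_. 0)"
        "\<forall>i<k. \<alpha> Tgt i = ts ! i" "\<forall>i<k. \<alpha> Crd i = cs ! i" for \<rho> \<alpha>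
    proof (rule run_If[OF k1(1), where ?T1.0 = ?S])
      have r': "\<rho> TM = t" "\<rho> CM = c" using r by (simp_all add: ntc)
      show "ebd \<kappa>1 (V TM \<otimes> V CM) \<rho> \<alpha>" using r' st by simp
      show "run (solve k) \<rho> \<alpha> zs ?S ?post"
        unfolding ntc(1)
      proof (rule run_solve[OF in'(1-4) _ _ _ _ _ r(1) r' r(4-7)])
        show "\<forall>x\<in>set ts. x \<le> t" "\<forall>x\<in>set cs. x \<le> c" by (simp_all add: ntc)
        show "length zs \<le> U" by (simp add: U_def ntc)
      qed (use small l in \<open>simp_all add: m_def\<close>)
      show "run (IF V TM \<oplus> V CM THEN Ans ::= C 0 ELSE Ans ::= C 1) \<rho> \<alpha> zs ?S ?post"
        if "ev (V TM \<otimes> V CM) \<rho> \<alpha> = 0"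
        using that r' tc by simp
    qed simp
    then have "run (kss_cmd k) (\<lambda>_. 0) (\<lambda>_ _. 0) (kss_encode (zs, ts, cs)) (3000 * (k + 1) * s + (10 * \<kappa>1
      + ?S)) ?post"
      unfolding s_def by (intro run_kss_cmd[OF k in'(3,4)])
    moreover have "real (3000 * (k + 1) * s + (10 * \<kappa>1 + ?S)) \<le> T"
    proof -
      define v where "v = l * W ^ k + s"
      define w where "w = (k + 1) * (v * \<kappa> ^ 3)"
      have "1 \<le> \<kappa> ^ 3" using \<kappa> by simp
      then have "s * 1 \<le> v * \<kappa> ^ 3" unfolding v_def by (intro mult_le_mono) auto
      then have sw: "(k + 1) * s \<le> w" unfolding w_def by (intro mult_le_mono2) simp
      then have sw': "s \<le> w" by simp
      have zs: "(\<Sum>z\<leftarrow>zs. bit_len z) \<le> s" by (simp add: s_def kss_input_size_def kss_encode_def)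
      have "1000000 * (k + 1) * (l * W ^ k + n + 1) * \<kappa> ^ 3 \<le> 1000000 * (k + 1) * v * \<kappa> ^ 3"
        using sn unfolding v_def by (intro mult_le_mono1 mult_le_mono2) simp
      also have "\<dots> = 1000000 * w" by (simp add: w_def algebra_simps)
      finally have S: "1000000 * (k + 1) * (l * W ^ k + n + 1) * \<kappa> ^ 3 \<le> 1000000 * w" .
      have "3000 * (k + 1) * s + (10 * \<kappa>1 + ?S) \<le> 2000000 * w"
      proof -
        have "3000 * (k + 1) * s = 3000 * ((k + 1) * s)" by (simp only: mult.assoc)
        with S show ?thesis using sw sw' zs k1(2) by linarith
      qed
      then have "real (3000 * (k + 1) * s + (10 * \<kappa>1 + ?S)) \<le> real (2000000 * w)" by (rule of_nat_mono)
      also have "\<dots> = 2000000 * (real k + 1) * (real v * real \<kappa> ^ 3)" by (simp add: w_def algebra_simps)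
      also have "\<dots> \<le> 2000000 * (real k + 1) * (((2 * 9 ^ k + 1) * x) * ((6 * real k + 24) * y) ^ 3)"
      proof (intro mult_left_mono mult_mono power_mono)
        have "real l * real c ^ k \<le> 2 * root (k + 1) (real n ^ k * real c ^ k\<^sup>2)"
        proof (rule class_number_le_root[OF k tc(2) cn])
          \<comment> \<open>Minimality of \<open>l\<close> gives the inequality with
            \<open>m\<close> on the right; \<open>m \<le> n\<close> passes to the \<open>n\<close>
            of the claimed bound.\<close>
          show "l = 1 \<or> (l - 1) * (l - 1) * c < n" using small[of "l - 1"] l(1) mn by (cases "l = 1") auto
        qed
        then have "real l * real c ^ k * real t ^ k \<le> 2 * root (k
          + 1) (real n ^ k * real c ^ k\<^sup>2) * real t ^ k"
          by (rule mult_right_mono) simp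
        then have "real l * real c ^ k * real t ^ k \<le> 2 * kss_bound k (zs, ts, cs)"
          by (simp add: kss_bound_def Let_def ntc)
        then have b: "real l * real c ^ k * real t ^ k \<le> 2 * x" using sx(2) by linarith
        have "real (l * W ^ k) = 9 ^ k * (real l * real c ^ k * real t ^ k)"
          by (simp add: W_def power_mult_distrib)
        also have "\<dots> \<le> 9 ^ k * (2 * x)" using b by (rule mult_left_mono) simp
        finally show "real v \<le> (2 * 9 ^ k + 1) * x" using sx(1) by (simp add: v_def algebra_simps)
        have "real t \<le> x"
        proof -
          have "1 * 1 \<le> real n ^ k * real c ^ k\<^sup>2" using tc cn by (intro mult_mono one_le_power) auto
          then have "1 \<le> root (k + 1) (real n ^ k * real c ^ k\<^sup>2)" by simp
          then have "1 * real t ^ k \<le> root (k + 1) (real n ^ k * real c ^ k\<^sup>2) * real t ^ k"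
            by (rule mult_right_mono) simp
          then have "real t ^ k \<le> x" using sx(2) by (simp add: kss_bound_def Let_def ntc)
          moreover have "real t \<le> real t ^ k" using tc k by (intro self_le_power) auto
          ultimately show ?thesis by linarith
        qed
        moreover have "real n \<le> x" "real c \<le> x" using sx(1) sn cn by linarith+
        ultimately show "real \<kappa> \<le> (6 * real k + 24) * y"
          unfolding \<kappa>_def U_def y_def using tc by (intro address_bound)
      qed (use x1 y1 in auto)
      also have "\<dots> = T" unfolding T K_def by (simp only: power_mult_distrib ac_simps)
      finally show ?thesis .
    qed
    ultimately show ?thesis by blast
  qed
qed

theorem theorem7:
  fixes k :: nat
  assumes "0 < k"
  shows "\<exists>P T. decides_in_time P (kss_inputs k) kss_encode (k_subset_sum_card k) T \<and>
           T \<in> soft_O (kss_inputs k) (kss_time k)"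
proof -
  define K where "K = 2000000 * (real k + 1) * (2 * 9 ^ k + 1) * (6 * real k + 24) ^ 3"
  define T where "T x = K * kss_time k x * log 2 (2 + kss_time k x) ^ 3" for x
  have "decides_in_time (comp (kss_cmd k)) (kss_inputs k) kss_encode (k_subset_sum_card k) T"
    unfolding decides_in_time_def
  proof
    fix x assume x: "x \<in> kss_inputs k"
    obtain zs ts cs where zs: "x = (zs, ts, cs)" by (cases x)
    from run_kss[OF assms x[unfolded zs]] obtain \<tau> where \<tau>: "real \<tau> \<le> T x"
      "run (kss_cmd k) (\<lambda>_. 0) (\<lambda>_ _. 0) (kss_encode x) \<tau> (\<lambda>\<rho>' \<alpha>' xs'. \<rho>' Ans
        = (if k_subset_sum_card k x then 1 else 0))"
      unfolding T_def K_def zs by blast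
    have "rep (\<lambda>_. 0) (\<lambda>_. 0) (\<lambda>_ _. 0)" by (simp add: rep_def)
    with \<tau>(2) obtain t m \<rho>' \<alpha>' xs' where e: "exec (comp (kss_cmd k)) (\<lambda>_. 0, kss_encode x) t (m, xs')"
      "rep m \<rho>' \<alpha>'"
      "t \<le> \<tau>" "\<rho>' Ans = (if k_subset_sum_card k x then 1 else 0)"
      unfolding run_def by blast
    \<comment> \<open>The register of \<open>Ans\<close> has address 0, where the machine model
      expects the answer.\<close>
    have "m 0 = \<rho>' Ans" using e(2) unfolding rep_def var_reg_def by (metis mult_0_right var_num.simps(1))
    with e \<tau>(1) show "\<exists>\<tau> m xs. exec (comp (kss_cmd k)) (\<lambda>_. 0, kss_encode x) \<tau> (m, xs) \<and> real \<tau> \<le> T x \<and>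
       m 0 = (if k_subset_sum_card k x then 1 else 0)"
      by (intro exI[of _ t] exI[of _ m] exI[of _ xs']) auto
  qed
  moreover have "T \<in> soft_O (kss_inputs k) (kss_time k)"
    unfolding soft_O_def
  proof (intro CollectI exI ballI)
    fix x
    have "0 \<le> kss_time k x" by (simp add: kss_time_def max.coboundedI1)
    then have "0 \<le> T x" by (simp add: T_def K_def)
    then show "\<bar>T x\<bar> \<le> K * kss_time k x * log 2 (2 + kss_time k x) ^ 3" by (simp add: T_def)
  qed
  ultimately show ?thesis by blast
qed

end
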